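(* Let $\Lambda\subseteq\mathbb R^d$ be a lattice and $\nu\in\mathbb C$. Set $\mathcal Z^{(0)}_{\Lambda^*,\nu}:\mathbb R^d\setminus\Lambda^*\to\mathbb C$, $$\mathcal Z^{(0)}_{\Lambda^*,\nu}(\boldsymbol y)=\lim_{\beta\to0}\mathrm{HSI}_{\boldsymbol z\in\mathbb R^d,\Lambda}\ \hat\chi_\beta(\boldsymbol z)\frac{e^{-2\pi i\langle\boldsymbol z,\boldsymbol y\rangle}}{|\boldsymbol z|^\nu},$$ where the function depends on the choice of the Hadamard regularisation in case that $\nu\in 2\mathbb N+d$. For all choices, $\mathcal Z^{(0)}_{\Lambda^*,\nu}$ can be extended to an analytic function on $(\mathbb R^d\setminus\Lambda^* )\cup\{\boldsymbol 0\}$, and the infinite order HSEM operator admits the representation $$\mathfrak D_{\Lambda,\nu}=\mathcal Z^{(0)}_{\Lambda^*,\nu}\Big(-\frac{\nabla}{2\pi i}\Big)$$ in the sense of a Taylor expansion of the function $\mathcal Z^{(0)}_{\Lambda^*,\nu}$ around zero. The finite order operators $\mathfrak D^{(\ell)}_{\Lambda,\nu}$ are found by truncating the Taylor expansion at the corresponding order.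
   Context: $d\ge1$, $\mathbb N=\{0,1,2,\dots\}$. A lattice is $\Lambda=M\mathbb Z^d$ with $M\in\mathbb R^{d\times d}$ invertible; $V_\Lambda=|\det M|$; the dual lattice is $\Lambda^*=M^{-\top}\mathbb Z^d$. $B_r$ is the open ball of radius $r$ about $\boldsymbol 0$. "Analytic" means real-analytic. Smooth cutoff functions: $\chi\in C_0^\infty(B_1)$, $\chi\ge0$, rotationally invariant, $\int\chi=1$, $\chi_\beta=\beta^{-d}\chi(\cdot/\beta)$ for $\beta>0$, $\hat\chi_\beta(\boldsymbol\xi)=\int e^{-2\pi i\langle\boldsymbol\xi,\boldsymbol x\rangle}\chi_\beta(\boldsymbol x)\,d\boldsymbol x$ (a Schwartz function). Hadamard integral: with $\ell_{\nu,d}=\lfloor\operatorname{Re}\nu-d\rfloor$ and $g\in C^\infty(\mathbb R^d)$ rapidly decaying, $$\mathrm{f.p.}\!\int_{\mathbb R^d}\frac{g(\boldsymbol z)}{|\boldsymbol z|^\nu}\,d\boldsymbol z=\lim_{\varepsilon\to0}\Big(\int_{\mathbb R^d\setminus B_\varepsilon}\frac{g(\boldsymbol z)}{|\boldsymbol z|^\nu}\,d\boldsymbol z-(\mathcal H_{\nu,\varepsilon}g)(\boldsymbol 0)\Big),$$ with, for $\nu\notin d+\mathbb N$, $\mathcal H_{\nu,\varepsilon}=\sum_{k=0}^{\ell_{\nu,d}}\frac1{k!}\int_{\mathbb R^d\setminus B_\varepsilon}\frac{\langle\boldsymbol y,\nabla\rangle^k}{|\boldsymbol y|^\nu}\,d\boldsymbol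 y$ (empty sum if $\ell_{\nu,d}<0$), and for $\nu\in d+\mathbb N$ the same expression except that in the term $k=\ell_{\nu,d}$ the integration region is $B_1\setminus B_\varepsilon$; for $\nu\in d+2\mathbb N$ other choices are obtained by replacing $B_1$ by another bounded open neighbourhood of the origin (one fixed choice is used throughout). If $\nu\notin\mathbb R$ and $\operatorname{Re}\nu-d\in\mathbb N$, the radial integral in the term $k=\ell_{\nu,d}$ is understood by analytic continuation in $\nu$, i.e. $\int_\varepsilon^\infty r^{k+d-1-\nu}\,dr:=\varepsilon^{k+d-\nu}/(\nu-k-d)$. Hadamard sum-integral: $$\mathrm{HSI}_{\boldsymbol z\in\mathbb R^d,\Lambda}\frac{g(\boldsymbol z)}{|\boldsymbol z|^\nu}=\sum_{\boldsymbol z\in\Lambda\setminus\{\boldsymbol0\}}\frac{g(\boldsymbol z)}{|\boldsymbol z|^\nu}-\frac1{V_\Lambda}\,\mathrm{f.p.}\!\int_{\mathbb R^d}\frac{g(\boldsymbol z)}{|\boldsymbol z|^\nu}\,d\boldsymbol z .$$ HSEM operator of order $\ell\in\mathbb N$: $$\mathfrak D^{(\ell)}_{\Lambda,\nu}=\sum_{k=0}^\ell\frac1{(2k)!}\lim_{\beta\to0}\mathrm{HSI}_{\boldsymbol z\in\mathbb R^d,\Lambda}\ \hat\chi_\beta(\boldsymbol z)\frac{\langle\boldsymbol z,\nabla\rangle^{2k}}{|\boldsymbol z|^\nu},$$ a constant-coefficient differential operator of order $2\ell$; the infinite order operator $\mathfrak D_{\Lambda,\nu}$ is obtained by setting $\ell=\infty$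 (a formal power series in $\nabla$). *)

theory Defs
  imports "HOL-Analysis.Analysis" "HOL-Library.Poly_Mapping"
begin

section \<open>Lattices\<close>

definition lattice_of :: "real ^ 'n ^ 'n \<Rightarrow> (real ^ 'n) set" where
  "lattice_of M = {M *v z | z. \<forall>i. z $ i \<in> \<int>}"

definition dual_lattice_of :: "real ^ 'n ^ 'n \<Rightarrow> (real ^ 'n) set" where
  "dual_lattice_of M = lattice_of (transpose (matrix_inv M))"


section \<open>Derivatives, smoothness and real analyticity\<close>

text \<open>\<open>dderiv v f\<close> is \<open>\<langle>v,\<nabla>\<rangle> f\<close>, so \<open>\<langle>v,\<nabla>\<rangle>\<close> to the power \<open>k\<close> is \<open>dderiv v ^^ k\<close>.\<close>

definition dderiv :: "'a::real_normed_vector \<Rightarrow> ('a \<Rightarrow> 'b::real_normed_vector) \<Rightarrow> 'a \<Rightarrow> 'b" where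
  "dderiv v f x = frechet_derivative f (at x) v"

definition smooth :: "('a::real_normed_vector \<Rightarrow> 'b::real_normed_vector) \<Rightarrow> bool" where
  "smooth f \<longleftrightarrow> (\<forall>vs x. foldr dderiv vs f differentiable (at x))"

type_synonym 'n mindex = "'n \<Rightarrow>\<^sub>0 nat"

definition mdeg :: "'n::finite mindex \<Rightarrow> nat" where
  "mdeg \<alpha> = (\<Sum>i\<in>UNIV. Poly_Mapping.lookup \<alpha> i)"

definition mfact :: "'n::finite mindex \<Rightarrow> nat" where
  "mfact \<alpha> = (\<Prod>i\<in>UNIV. fact (Poly_Mapping.lookup \<alpha> i))"

definition mpow :: "real ^ 'n \<Rightarrow> 'n::finite mindex \<Rightarrow> real" where
  "mpow y \<alpha> = (\<Prod>i\<in>UNIV. (y $ i) ^ Poly_Mapping.lookup \<alpha> i)"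

text \<open>
  The partial derivatives in \<open>mderiv\<close> are taken in the order of a fixed enumeration of the
  coordinates; the order is immaterial for smooth functions.
\<close>

definition coords :: "'n::finite list" where
  "coords = (SOME is. distinct is \<and> set is = UNIV)"

definition mderiv :: "'n::finite mindex \<Rightarrow> (real ^ 'n \<Rightarrow> complex) \<Rightarrow> real ^ 'n \<Rightarrow> complex" where
  "mderiv \<alpha> f = foldr (\<lambda>i. dderiv (axis i 1) ^^ Poly_Mapping.lookup \<alpha> i) coords f"

text \<open>Intended for open \<open>S\<close>: the power series represents \<open>f\<close> on a full ball around each point.\<close>

definition real_analytic_on :: "(real ^ 'n::finite \<Rightarrow> complex) \<Rightarrow> (real ^ 'n) set \<Rightarrow> bool" where
  "real_analytic_on f S \<longleftrightarrow>
     (\<forall>x\<in>S. \<exists>c. \<exists>r>0. \<forall>y\<in>ball x r.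
        ((\<lambda>\<alpha>. c \<alpha> * complex_of_real (mpow (y - x) \<alpha>)) has_sum f y) UNIV)"


section \<open>Smooth cutoff functions\<close>

text \<open>
  The cutoff is written \<open>\<phi>\<close>, since the letter chi is the binder for vectors. Rotational invariance
  means radial, also for \<open>d = 1\<close>, where it says that \<open>\<phi>\<close> is even.
\<close>

definition smooth_cutoff :: "(real ^ 'n::finite \<Rightarrow> real) \<Rightarrow> bool" where
  "smooth_cutoff \<phi> \<longleftrightarrow>
     smooth \<phi> \<and> closure {x. \<phi> x \<noteq> 0} \<subseteq> ball 0 1 \<and> (\<forall>x. 0 \<le> \<phi> x) \<and>
     (\<forall>T x. orthogonal_transformation T \<longrightarrow> \<phi> (T x) = \<phi> x) \<and>
     (LINT x|lborel. \<phi> x) = 1"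

definition rescaled :: "(real ^ 'n::finite \<Rightarrow> real) \<Rightarrow> real \<Rightarrow> real ^ 'n \<Rightarrow> real" where
  "rescaled \<phi> \<beta> x = \<phi> (x /\<^sub>R \<beta>) / \<beta> ^ CARD('n)"

definition fourier :: "(real ^ 'n::finite \<Rightarrow> real) \<Rightarrow> real ^ 'n \<Rightarrow> complex" where
  "fourier f \<xi> =
     (LINT x|lborel. exp (- 2 * of_real pi * \<i> * of_real (\<xi> \<bullet> x)) * of_real (f x))"


section \<open>Hadamard integral and sum-integral\<close>

definition npow :: "real ^ 'n::finite \<Rightarrow> complex \<Rightarrow> complex" where
  "npow z \<nu> = of_real (norm z) powr \<nu>"

text \<open>
  Integration over the unit sphere with respect to surface measure, realised as the cone measure
  \<open>\<sigma>(E) = d * vol {r *\<^sub>R \<theta> | r \<theta>. 0 < r < 1 \<and> \<theta> \<in> E}\<close>; note \<open>sgn y = y /\<^sub>R norm y\<close>.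
\<close>

definition sphere_integral :: "(real ^ 'n::finite \<Rightarrow> complex) \<Rightarrow> complex" where
  "sphere_integral F = of_nat CARD('n) * (LINT y:ball 0 1|lborel. F (sgn y))"

text \<open>
  The \<open>k\<close>-th summand of \<open>(\<H>\<^bsub>\<nu>,\<epsilon>\<^esub> g)(0)\<close>. The bounded open neighbourhood \<open>U\<close> of the origin is
  the choice of regularisation; it enters only if \<open>\<nu> \<in> d + 2\<nat>\<close>. Both exceptional
  cases, \<open>\<nu> = k + d\<close> and \<open>Re \<nu> = k + d\<close>, can occur only for the last summand
  \<open>k = \<lfloor>Re \<nu> - d\<rfloor>\<close>. In the second one the radial integral is the analytic continuation
  \<open>\<integral>\<^sub>\<epsilon>\<^sup>\<infinity> r powr (k + d - 1 - \<nu>) dr = \<epsilon> powr (k + d - \<nu>) / (\<nu> - k - d)\<close>.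
\<close>

definition hadamard_term ::
    "(real ^ 'n::finite) set \<Rightarrow> complex \<Rightarrow> real \<Rightarrow> (real ^ 'n \<Rightarrow> complex) \<Rightarrow> nat \<Rightarrow> complex" where
  "hadamard_term U \<nu> \<epsilon> g k =
     (if \<nu> = of_nat (k + CARD('n)) then
        (LINT y:(if even k then U else ball 0 1) - ball 0 \<epsilon>|lborel. (dderiv y ^^ k) g 0 / npow y \<nu>)
      else if Re \<nu> = of_nat (k + CARD('n)) then
        sphere_integral (\<lambda>\<theta>. (dderiv \<theta> ^^ k) g 0) *
          (of_real \<epsilon> powr (of_nat (k + CARD('n)) - \<nu>) / (\<nu> - of_nat (k + CARD('n))))
      else
        (LINT y:- ball 0 \<epsilon>|lborel. (dderiv y ^^ k) g 0 / npow y \<nu>))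
     / fact k"

definition hadamard_integral ::
    "(real ^ 'n::finite) set \<Rightarrow> complex \<Rightarrow> (real ^ 'n \<Rightarrow> complex) \<Rightarrow> complex" where
  "hadamard_integral U \<nu> g =
     Lim (at_right 0) (\<lambda>\<epsilon>.
       (LINT z:- ball 0 \<epsilon>|lborel. g z / npow z \<nu>) -
       (\<Sum>k | int k \<le> \<lfloor>Re \<nu> - real CARD('n)\<rfloor>. hadamard_term U \<nu> \<epsilon> g k))"

definition HSI ::
    "real ^ 'n ^ 'n \<Rightarrow> (real ^ 'n::finite) set \<Rightarrow> complex \<Rightarrow> (real ^ 'n \<Rightarrow> complex) \<Rightarrow> complex" where
  "HSI M U \<nu> g =
     (\<Sum>\<^sub>\<infinity>z\<in>lattice_of M - {0}. g z / npow z \<nu>) -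
     hadamard_integral U \<nu> g / of_real \<bar>det M\<bar>"

definition HSI_cutoff ::
    "(real ^ 'n::finite \<Rightarrow> real) \<Rightarrow> real ^ 'n ^ 'n \<Rightarrow> (real ^ 'n) set \<Rightarrow> complex \<Rightarrow>
     (real ^ 'n \<Rightarrow> complex) \<Rightarrow> real \<Rightarrow> complex" where
  "HSI_cutoff \<phi> M U \<nu> f \<beta> = HSI M U \<nu> (\<lambda>z. fourier (rescaled \<phi> \<beta>) z * f z)"


section \<open>The regularised zeta function and the HSEM operators\<close>

definition plane_wave :: "real ^ 'n::finite \<Rightarrow> real ^ 'n \<Rightarrow> complex" where
  "plane_wave y z = exp (- 2 * of_real pi * \<i> * of_real (z \<bullet> y))"

definition zeta0 ::
    "(real ^ 'n::finite \<Rightarrow> real) \<Rightarrow> real ^ 'n ^ 'n \<Rightarrow> (real ^ 'n) set \<Rightarrow> complex \<Rightarrow>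
     real ^ 'n \<Rightarrow> complex" where
  "zeta0 \<phi> M U \<nu> y = Lim (at_right 0) (HSI_cutoff \<phi> M U \<nu> (plane_wave y))"

text \<open>
  A constant-coefficient differential operator, of finite or infinite order, is the formal power
  series in \<open>\<nabla>\<close> given by its coefficients: the value at \<open>\<alpha>\<close> is the coefficient of the monomial
  \<open>\<nabla>\<^sup>\<alpha>\<close>.
\<close>

type_synonym 'n diffop = "'n mindex \<Rightarrow> complex"

text \<open>The linear form \<open>\<langle>z,\<nabla>\<rangle>\<close> as an element of the polynomial ring in \<open>\<nabla>\<close>.\<close>

definition nabla_form :: "real ^ 'n::finite \<Rightarrow> ('n mindex \<Rightarrow>\<^sub>0 real)" where
  "nabla_form z = (\<Sum>i\<in>UNIV. Poly_Mapping.single (Poly_Mapping.single i 1) (z $ i))"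

definition nabla_coeff :: "nat \<Rightarrow> 'n::finite mindex \<Rightarrow> real ^ 'n \<Rightarrow> complex" where
  "nabla_coeff m \<alpha> z = of_real (Poly_Mapping.lookup (nabla_form z ^ m) \<alpha>)"

definition hsem_term ::
    "(real ^ 'n::finite \<Rightarrow> real) \<Rightarrow> real ^ 'n ^ 'n \<Rightarrow> (real ^ 'n) set \<Rightarrow> complex \<Rightarrow>
     nat \<Rightarrow> 'n diffop" where
  "hsem_term \<phi> M U \<nu> k \<alpha> =
     Lim (at_right 0) (HSI_cutoff \<phi> M U \<nu> (nabla_coeff (2 * k) \<alpha>)) / fact (2 * k)"

definition hsem ::
    "(real ^ 'n::finite \<Rightarrow> real) \<Rightarrow> real ^ 'n ^ 'n \<Rightarrow> (real ^ 'n) set \<Rightarrow> complex \<Rightarrow>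
     nat \<Rightarrow> 'n diffop" where
  "hsem \<phi> M U \<nu> l \<alpha> = (\<Sum>k\<le>l. hsem_term \<phi> M U \<nu> k \<alpha>)"

text \<open>For each \<open>\<alpha>\<close> at most the summand with \<open>2 * k = mdeg \<alpha>\<close> is nonzero.\<close>

definition hsem_inf ::
    "(real ^ 'n::finite \<Rightarrow> real) \<Rightarrow> real ^ 'n ^ 'n \<Rightarrow> (real ^ 'n) set \<Rightarrow> complex \<Rightarrow>
     'n diffop" where
  "hsem_inf \<phi> M U \<nu> \<alpha> = suminf (\<lambda>k. hsem_term \<phi> M U \<nu> k \<alpha>)"

text \<open>\<open>F(c\<nabla>)\<close> in the sense of the Taylor expansion of \<open>F\<close> around zero.\<close>

definition taylor_op :: "(real ^ 'n::finite \<Rightarrow> complex) \<Rightarrow> complex \<Rightarrow> 'n diffop" where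
  "taylor_op F c \<alpha> = mderiv \<alpha> F 0 / of_nat (mfact \<alpha>) * c ^ mdeg \<alpha>"

definition truncate_op :: "nat \<Rightarrow> 'n::finite diffop \<Rightarrow> 'n diffop" where
  "truncate_op m D \<alpha> = (if mdeg \<alpha> \<le> m then D \<alpha> else 0)"

end

theory Submission
  imports Defs "HOL-Probability.Probability"
begin

text \<open>
  The product of the cutoff with a plane wave or a monomial is the Fourier transform of a bump
  function \<open>\<psi>\<close> near the point considered, so everything reduces to the linear functional that sends
  \<open>\<psi>\<close> to the regularised sum-integral of its transform divided by \<open>|z|\<close> to the power \<open>\<nu>\<close>. The claim
  is that this functional is integration against a function \<open>F\<close> that is analytic away from the
  nonzero dual lattice points: letting the bump shrink gives the value \<open>F y\<close>, and integration by
  parts gives the Taylor coefficients of \<open>F\<close> at the origin. Odd coefficients vanish as \<open>F\<close> is even.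

  For \<open>Re \<nu> \<ge> 2d\<close> Fubini's theorem yields \<open>F\<close> explicitly, as the absolutely convergent sum of plane
  waves minus an integral of plane waves with a Taylor polynomial subtracted inside the unit ball,
  up to a polynomial. Its analyticity is Riemann's argument: \<open>|z|\<close> to the power \<open>-\<nu>\<close> is a Mellin
  integral of Gaussians, which is split at \<open>t = 1\<close>; the part \<open>t > 1\<close> gives entire functions, and
  Poisson summation turns the part \<open>t \<le> 1\<close> into Gaussians centred at the dual lattice points, the one
  at the origin cancelling between the sum and the integral.

  Other exponents are reduced to this case by multiplying the transform by \<open>|z|\<^sup>2\<close>, which replaces
  \<open>\<psi>\<close> by a multiple of its Laplacian and moves the k-th Hadamard counterterm for \<open>\<nu>\<close> to the one with
  index k + 2 for \<open>\<nu> + 2\<close>. The Laplacians are finally moved to \<open>F\<close> by parts.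
\<close>

section \<open>Sums and integrals\<close>

text \<open>\<open>F\<close> does not depend on the width of the bump, so letting the bump shrink is
  an approximate-identity argument and no estimate uniform in the width arises. The delicate object
  is the Hadamard integral, whose counterterms come in three regimes of \<nu> and depend on
  \<epsilon>. Each of them is split into the integral of a Taylor term over the punctured unit ball,
  which cancels against the main integral, and a convergent weighted moment without \<epsilon>.
  These moments are the polynomial in the formula for \<open>F\<close>, and the freedom of
  regularisation is confined to them. The bound 2d is one of convenience: lattice sums are compared
  with products of d series of 1 / (1 + k^2), which costs the exponent 2 per coordinate, and raising
  the exponent is free. Analyticity is established without complexifying the variable. Expansions
  converge absolutely and come with majorants, and an integrable majorant allows expansion and
  integration to be exchanged; sums are treated as integrals over counting measure.\<close>

lemma has_sum_integral:
  fixes f :: "'i \<Rightarrow> 'a \<Rightarrow> complex"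
  assumes I: "countable I" and int: "\<And>i. i \<in> I \<Longrightarrow> integrable M (f i)"
    and F: "\<And>x. x \<in> space M \<Longrightarrow> ((\<lambda>i. f i x) has_sum F x) I"
    and nrm: "(\<lambda>i. \<integral>x. norm (f i x) \<partial>M) summable_on I"
  shows "integrable M F" "((\<lambda>i. \<integral>x. f i x \<partial>M) has_sum (\<integral>x. F x \<partial>M)) I"
proof -
  have "integrable M F \<and> ((\<lambda>i. \<integral>x. f i x \<partial>M) has_sum (\<integral>x. F x \<partial>M)) I"
  proof (cases "finite I")
    case True
    have eq: "F x = (\<Sum>i\<in>I. f i x)" if "x \<in> space M" for x
      using F[OF that] True has_sum_finite has_sum_unique by blast
    have "integrable M (\<lambda>x. \<Sum>i\<in>I. f i x)" using int by auto
    then have "integrable M F" using eq by (simp cong: Bochner_Integration.integrable_cong)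
    moreover have "(\<integral>x. F x \<partial>M) = (\<Sum>i\<in>I. \<integral>x. f i x \<partial>M)"
      using eq int by (simp cong: Bochner_Integration.integral_cong)
    ultimately show ?thesis using True by (simp add: has_sum_finiteI)
  next
    case False
    \<comment> \<open>An enumeration turns the family into a series, to which termwise integration
      applies; absolute convergence leads back to the unordered sum.\<close>
    define h where "h = from_nat_into I"
    have h: "bij_betw h UNIV I" unfolding h_def using I False by (rule bij_betw_from_nat_into)
    have hI: "h n \<in> I" for n using h by (auto simp: bij_betw_def)
    have s: "((\<lambda>n. f (h n) x) has_sum F x) UNIV" if "x \<in> space M" for x
      using F[OF that] has_sum_reindex_bij_betw[OF h, of "\<lambda>i. f i x"] by simp
    have sn: "summable (\<lambda>n. norm (f (h n) x))" if "x \<in> space M" for x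
    proof -
      have "(\<lambda>n. f (h n) x) summable_on UNIV" using s[OF that] by (rule has_sum_imp_summable)
      then show ?thesis
        by (simp add: summable_on_iff_abs_summable_on_complex summable_on_imp_summable)
    qed
    have ns: "summable (\<lambda>n. \<integral>x. norm (f (h n) x) \<partial>M)"
      using nrm summable_on_reindex_bij_betw[OF h, of "\<lambda>i. \<integral>x. norm (f i x) \<partial>M"]
      by (simp add: summable_on_imp_summable)
    have eq: "F x = (suminf (\<lambda>n. f (h n) x))" if "x \<in> space M" for x
      using has_sum_imp_sums[OF s[OF that]] by (simp add: sums_iff)
    have ae: "AE x in M. summable (\<lambda>n. norm (f (h n) x))" using sn by simp
    have ih: "\<And>n. integrable M (f (h n))" using int hI by blast
    have "integrable M (\<lambda>x. suminf (\<lambda>n. f (h n) x))"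
      by (rule integrable_suminf[OF ih ae ns])
    then have 1: "integrable M F" using eq by (simp cong: Bochner_Integration.integrable_cong)
    have "(\<lambda>n. \<integral>x. f (h n) x \<partial>M) sums (\<integral>x. (suminf (\<lambda>n. f (h n) x)) \<partial>M)"
      by (rule sums_integral[OF ih ae ns])
    then have "(\<lambda>n. \<integral>x. f (h n) x \<partial>M) sums (\<integral>x. F x \<partial>M)"
      using eq by (simp cong: Bochner_Integration.integral_cong)
    moreover have "summable (\<lambda>n. norm (\<integral>x. f (h n) x \<partial>M))"
      by (rule summable_comparison_test[OF _ ns]) (auto intro!: exI[of _ 0])
    ultimately have "((\<lambda>n. \<integral>x. f (h n) x \<partial>M) has_sum (\<integral>x. F x \<partial>M)) UNIV"
      by (intro norm_summable_imp_has_sum)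
    then show ?thesis using 1 has_sum_reindex_bij_betw[OF h, of "\<lambda>i. \<integral>x. f i x \<partial>M"] by simp
  qed
  then show "integrable M F" "((\<lambda>i. \<integral>x. f i x \<partial>M) has_sum (\<integral>x. F x \<partial>M)) I" by auto
qed

text \<open>One integrable bound for all finite partial sums of norms yields, after integration,
  summable L1 norms. Majorants of power series arrive in this form.\<close>

lemma has_sum_integral_dominated:
  fixes f :: "'i \<Rightarrow> 'a \<Rightarrow> complex"
  assumes I: "countable I" and meas: "\<And>i. i \<in> I \<Longrightarrow> f i \<in> borel_measurable M"
    and F: "\<And>x. x \<in> space M \<Longrightarrow> ((\<lambda>i. f i x) has_sum F x) I"
    and B: "integrable M B"
    and le: "\<And>x J. x \<in> space M \<Longrightarrow> finite J \<Longrightarrow> J \<subseteq> I \<Longrightarrow> (\<Sum>i\<in>J. norm (f i x)) \<le> B x"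
  shows "integrable M F" "((\<lambda>i. \<integral>x. f i x \<partial>M) has_sum (\<integral>x. F x \<partial>M)) I"
    and "\<And>i. i \<in> I \<Longrightarrow> integrable M (f i)"
proof -
  show int: "integrable M (f i)" if "i \<in> I" for i
  proof (rule Bochner_Integration.integrable_bound[OF B meas[OF that]])
    show "AE x in M. norm (f i x) \<le> norm (B x)"
      using le[of _ "{i}"] that by (auto intro!: AE_I2 order_trans[OF _ abs_ge_self])
  qed
  have nrm: "(\<lambda>i. \<integral>x. norm (f i x) \<partial>M) summable_on I"
  proof (rule nonneg_bdd_above_summable_on)
    show "bdd_above (sum (\<lambda>i. \<integral>x. norm (f i x) \<partial>M) ` {F. F \<subseteq> I \<and> finite F})"
    proof (rule bdd_aboveI2)
      fix J assume "J \<in> {F. F \<subseteq> I \<and> finite F}"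
      then have J: "J \<subseteq> I" "finite J" by auto
      have "(\<Sum>i\<in>J. \<integral>x. norm (f i x) \<partial>M) = (\<integral>x. (\<Sum>i\<in>J. norm (f i x)) \<partial>M)"
        using J int by (subst Bochner_Integration.integral_sum) (auto intro!: integrable_norm)
      also have "\<dots> \<le> (\<integral>x. B x \<partial>M)"
        using J by (intro integral_mono B le Bochner_Integration.integrable_sum integrable_norm int) auto
      finally show "(\<Sum>i\<in>J. \<integral>x. norm (f i x) \<partial>M) \<le> (\<integral>x. B x \<partial>M)" .
    qed
  qed simp
  show "integrable M F" "((\<lambda>i. \<integral>x. f i x \<partial>M) has_sum (\<integral>x. F x \<partial>M)) I"
    using has_sum_integral[OF I int F nrm] by auto
qed

text \<open>Dominated convergence for the remainder of the first-order expansion, taken along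
  sequences. The bound on the derivative over the whole ball controls difference quotients through
  the mean value inequality.\<close>

lemma has_derivative_integral:
  fixes K :: "'a::euclidean_space \<Rightarrow> 'w \<Rightarrow> complex"
  assumes r: "r > 0"
    and der: "\<And>y w. y \<in> ball x r \<Longrightarrow> w \<in> space M \<Longrightarrow> ((\<lambda>y. K y w) has_derivative K' y w) (at y)"
    and bd: "\<And>y w v. y \<in> ball x r \<Longrightarrow> w \<in> space M \<Longrightarrow> norm (K' y w v) \<le> B w * norm v"
    and B: "integrable M B"
    and int: "\<And>y. y \<in> ball x r \<Longrightarrow> integrable M (K y)"
    and meas: "\<And>v. (\<lambda>w. K' x w v) \<in> borel_measurable M"
  shows "((\<lambda>y. \<integral>w. K y w \<partial>M) has_derivative (\<lambda>v. \<integral>w. K' x w v \<partial>M)) (at x)"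
proof -
  have xb: "x \<in> ball x r" using r by simp
  have lin: "bounded_linear (K' x w)" if "w \<in> space M" for w
    using der[OF xb that] has_derivative_bounded_linear by blast
  have int': "integrable M (\<lambda>w. K' x w v)" for v
  proof (rule Bochner_Integration.integrable_bound[OF _ meas])
    show "integrable M (\<lambda>w. B w * norm v)" using B by simp
    show "AE w in M. norm (K' x w v) \<le> norm (B w * norm v)"
      using bd[OF xb, of _ v] by (auto intro!: AE_I2 order_trans[OF _ abs_ge_self])
  qed
  have Bn: "(\<integral>w. norm (K' x w v) \<partial>M) \<le> norm v * (\<integral>w. B w \<partial>M)" for v
  proof -
    have "(\<integral>w. norm (K' x w v) \<partial>M) \<le> (\<integral>w. B w * norm v \<partial>M)"
      using bd[OF xb, of _ v] B int'[of v] by (intro integral_mono) auto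
    then show ?thesis by (simp add: mult.commute)
  qed
  have bl: "bounded_linear (\<lambda>v. \<integral>w. K' x w v \<partial>M)"
  proof (rule bounded_linear_intro[where K = "\<integral>w. B w \<partial>M"])
    fix v1 v2 :: 'a
    have "(\<integral>w. K' x w (v1 + v2) \<partial>M) = (\<integral>w. K' x w v1 + K' x w v2 \<partial>M)"
      by (intro Bochner_Integration.integral_cong refl linear_add bounded_linear.linear lin)
    then show "(\<integral>w. K' x w (v1 + v2) \<partial>M) = (\<integral>w. K' x w v1 \<partial>M) + (\<integral>w. K' x w v2 \<partial>M)"
      using int' by simp
  next
    fix c :: real and v :: 'a
    have "(\<integral>w. K' x w (c *\<^sub>R v) \<partial>M) = (\<integral>w. c *\<^sub>R K' x w v \<partial>M)"
      by (intro Bochner_Integration.integral_cong refl linear_cmul bounded_linear.linear lin)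
    then show "(\<integral>w. K' x w (c *\<^sub>R v) \<partial>M) = c *\<^sub>R (\<integral>w. K' x w v \<partial>M)" by simp
  next
    fix v :: 'a
    have "norm (\<integral>w. K' x w v \<partial>M) \<le> (\<integral>w. norm (K' x w v) \<partial>M)" by simp
    then show "norm (\<integral>w. K' x w v \<partial>M) \<le> norm v * (\<integral>w. B w \<partial>M)" using Bn[of v] by linarith
  qed
  have lip: "norm (K y w - K x w) \<le> B w * norm (y - x)" if y: "y \<in> ball x r" and w: "w \<in> space M" for y w
  proof (rule differentiable_bound[OF convex_ball _ _ y xb])
    fix z assume z: "z \<in> ball x r"
    show "((\<lambda>y. K y w) has_derivative K' z w) (at z within ball x r)"
      using der[OF z w] by (rule has_derivative_at_withinI)
    show "onorm (K' z w) \<le> B w"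
    proof (rule onorm_bound)
      show "0 \<le> B w"
      proof -
        obtain b :: 'a where "b \<in> Basis" using nonempty_Basis by blast
        then show ?thesis using order_trans[OF norm_ge_zero bd[OF z w, of b]] by simp
      qed
    qed (use bd[OF z w] in auto)
  qed
  have "((\<lambda>y. norm ((\<integral>w. K y w \<partial>M) - (\<integral>w. K x w \<partial>M) - (\<integral>w. K' x w (y - x) \<partial>M)) / norm (y - x)) \<longlongrightarrow> 0) (at x)"
    unfolding tendsto_at_iff_sequentially comp_def
  proof (intro allI impI)
    fix X :: "nat \<Rightarrow> 'a" assume X: "\<forall>i. X i \<in> UNIV - {x}" "X \<longlonglongrightarrow> x"
    have "\<forall>\<^sub>F n in sequentially. X n \<in> ball x r"
      using X(2) r by (metis centre_in_ball open_ball tendsto_def)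
    then obtain N where N: "\<And>n. n \<ge> N \<Longrightarrow> X n \<in> ball x r" by (auto simp: eventually_sequentially)
    define Y where "Y n = X (n + N)" for n
    have Yb: "Y n \<in> ball x r" for n unfolding Y_def by (rule N) simp
    have Yx: "Y n \<noteq> x" for n using X(1) by (simp add: Y_def)
    have Yl: "Y \<longlonglongrightarrow> x" unfolding Y_def by (rule LIMSEQ_ignore_initial_segment[OF X(2)])
    define G where "G n w = (K (Y n) w - K x w - K' x w (Y n - x)) /\<^sub>R norm (Y n - x)" for n w
    have Gm: "G n \<in> borel_measurable M" for n
      unfolding G_def using int[OF Yb[of n]] int[OF xb] int'[of "Y n - x"] by measurable
    \<comment> \<open>\<open>G n\<close> is the normalised remainder. Its difference quotient is
      bounded by \<open>B\<close> through \<open>lip\<close> and its linear part by \<open>B\<close>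
      through \<open>bd\<close>, hence the dominating function \<open>2 * B\<close>.\<close>
    have "(\<lambda>n. \<integral>w. G n w \<partial>M) \<longlonglongrightarrow> (\<integral>w. 0 \<partial>M)"
    proof (rule integral_dominated_convergence[where w = "\<lambda>w. 2 * B w"])
      show "integrable M (\<lambda>w. 2 * B w)" using B by simp
      show "AE w in M. (\<lambda>n. G n w) \<longlonglongrightarrow> 0"
      proof (rule AE_I2)
        fix w assume w: "w \<in> space M"
        have "((\<lambda>y. norm (K y w - K x w - K' x w (y - x)) / norm (y - x)) \<longlongrightarrow> 0) (at x)"
          using der[OF xb w] by (simp add: has_derivative_iff_norm)
        then have "(\<lambda>n. norm (K (Y n) w - K x w - K' x w (Y n - x)) / norm (Y n - x)) \<longlonglongrightarrow> 0"
          using Yl Yx unfolding tendsto_at_iff_sequentially comp_def by auto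
        then have "(\<lambda>n. norm (G n w)) \<longlonglongrightarrow> 0" by (simp add: G_def divide_inverse mult.commute)
        then show "(\<lambda>n. G n w) \<longlonglongrightarrow> 0" by (rule tendsto_norm_zero_cancel)
      qed
      show "AE w in M. norm (G n w) \<le> 2 * B w" for n
      proof (rule AE_I2)
        fix w assume w: "w \<in> space M"
        have "norm (K (Y n) w - K x w - K' x w (Y n - x)) \<le> B w * norm (Y n - x) + B w * norm (Y n - x)"
          by (rule order_trans[OF norm_triangle_ineq4]) (intro add_mono lip bd Yb xb w)
        then show "norm (G n w) \<le> 2 * B w"
          using Yx[of n] unfolding G_def by (simp add: divide_simps del: scaleR_right_diff_distrib)
      qed
    qed (use Gm in auto)
    moreover have "(\<integral>w. G n w \<partial>M) = ((\<integral>w. K (Y n) w \<partial>M) - (\<integral>w. K x w \<partial>M) - (\<integral>w. K' x w (Y n - x) \<partial>M)) /\<^sub>R norm (Y n - x)" for n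
      unfolding G_def using int[OF Yb[of n]] int[OF xb] int'[of "Y n - x"] by simp
    ultimately have "(\<lambda>n. norm (((\<integral>w. K (Y n) w \<partial>M) - (\<integral>w. K x w \<partial>M) - (\<integral>w. K' x w (Y n - x) \<partial>M)) /\<^sub>R norm (Y n - x))) \<longlonglongrightarrow> 0"
      using tendsto_norm_zero by fastforce
    then have "(\<lambda>n. norm ((\<integral>w. K (Y n) w \<partial>M) - (\<integral>w. K x w \<partial>M) - (\<integral>w. K' x w (Y n - x) \<partial>M)) / norm (Y n - x)) \<longlonglongrightarrow> 0"
      by (simp add: divide_inverse mult.commute)
    then show "(\<lambda>n. norm ((\<integral>w. K (X n) w \<partial>M) - (\<integral>w. K x w \<partial>M) - (\<integral>w. K' x w (X n - x) \<partial>M)) / norm (X n - x)) \<longlonglongrightarrow> 0"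
      unfolding Y_def by (rule LIMSEQ_offset)
  qed
  then show ?thesis using bl by (simp add: has_derivative_iff_norm)
qed

text \<open>Absolute convergence allows a finite product of sums to be multiplied out over all
  choice functions. The second claim keeps the majorant, from which the dominating functions of the
  power series below are built.\<close>

lemma has_sum_prod_UNIV:
  fixes a :: "'n::finite \<Rightarrow> 'b \<Rightarrow> complex"
  assumes "\<And>i. (a i has_sum s i) UNIV"
  shows "((\<lambda>g. \<Prod>i\<in>UNIV. a i (g i)) has_sum (\<Prod>i\<in>UNIV. s i)) UNIV"
    and "\<And>J. finite J \<Longrightarrow> (\<Sum>g\<in>J. norm (\<Prod>i\<in>UNIV. a i (g i))) \<le> (\<Prod>i\<in>UNIV. \<Sum>\<^sub>\<infinity>b. norm (a i b))"
proof -
  have abs: "(\<lambda>b. norm (a i b)) summable_on UNIV" for i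
    using assms has_sum_imp_summable summable_on_iff_abs_summable_on_complex by blast
  show bd: "(\<Sum>g\<in>J. norm (\<Prod>i\<in>UNIV. a i (g i))) \<le> (\<Prod>i\<in>UNIV. \<Sum>\<^sub>\<infinity>b. norm (a i b))" if "finite J" for J
  proof -
    \<comment> \<open>A finite set of choice functions lies in the box of its coordinate
      projections, and over a box the sum of products factorises.\<close>
    define B where "B i = (\<lambda>g. g i) ` J" for i
    have "(\<Sum>g\<in>J. norm (\<Prod>i\<in>UNIV. a i (g i))) \<le> (\<Sum>g\<in>PiE UNIV B. norm (\<Prod>i\<in>UNIV. a i (g i)))"
      using that by (intro sum_mono2) (auto simp: B_def intro!: finite_PiE)
    also have "\<dots> = (\<Sum>g\<in>PiE UNIV B. \<Prod>i\<in>UNIV. norm (a i (g i)))" by (simp add: prod_norm)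
    also have "\<dots> = (\<Prod>i\<in>UNIV. \<Sum>b\<in>B i. norm (a i b))"
      using that by (subst prod_sum_PiE) (auto simp: B_def)
    also have "\<dots> \<le> (\<Prod>i\<in>UNIV. \<Sum>\<^sub>\<infinity>b. norm (a i b))"
      using that abs by (intro prod_mono conjI sum_nonneg finite_sum_le_infsum) (auto simp: B_def)
    finally show ?thesis .
  qed
  have "(\<lambda>g. norm (\<Prod>i\<in>UNIV. a i (g i))) summable_on UNIV"
    unfolding abs_summable_iff_bdd_above using bd by (intro bdd_aboveI2) auto
  then have "(\<lambda>g. \<Prod>i\<in>UNIV. a i (g i)) summable_on UNIV" by (rule abs_summable_summable)
  moreover have "infsum (\<lambda>g. \<Prod>i\<in>UNIV. a i (g i)) (PiE UNIV (\<lambda>_. UNIV)) = (\<Prod>i\<in>UNIV. infsum (a i) UNIV)"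
    by (rule infsum_prod_PiE_abs) (use abs in auto)
  ultimately show "((\<lambda>g. \<Prod>i\<in>UNIV. a i (g i)) has_sum (\<Prod>i\<in>UNIV. s i)) UNIV"
    using assms by (simp add: has_sum_iff)
qed

lemma bij_lookup: "bij (Poly_Mapping.lookup :: ('n::finite \<Rightarrow>\<^sub>0 nat) \<Rightarrow> _)"
proof (rule bij_betwI[where g = Abs_poly_mapping])
  show "Poly_Mapping.lookup (Abs_poly_mapping f) = f" for f :: "'n \<Rightarrow> nat"
    by (rule lookup_Abs_poly_mapping) simp
qed (auto simp: poly_mapping.lookup_inverse)

lemma has_sum_multiindex:
  fixes a :: "'n::finite \<Rightarrow> nat \<Rightarrow> complex"
  assumes "\<And>i. (a i has_sum s i) UNIV"
  shows "((\<lambda>\<alpha>::'n mindex. \<Prod>i\<in>UNIV. a i (Poly_Mapping.lookup \<alpha> i)) has_sum (\<Prod>i\<in>UNIV. s i)) UNIV"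
    and "\<And>J. finite J \<Longrightarrow> (\<Sum>\<alpha>\<in>J. norm (\<Prod>i\<in>UNIV. a i (Poly_Mapping.lookup (\<alpha>::'n mindex) i))) \<le> (\<Prod>i\<in>UNIV. \<Sum>\<^sub>\<infinity>b. norm (a i b))"
proof -
  show "((\<lambda>\<alpha>::'n mindex. \<Prod>i\<in>UNIV. a i (Poly_Mapping.lookup \<alpha> i)) has_sum (\<Prod>i\<in>UNIV. s i)) UNIV"
    using has_sum_prod_UNIV(1)[OF assms] has_sum_reindex_bij_betw[OF bij_lookup, of "\<lambda>g. \<Prod>i\<in>UNIV. a i (g i)"]
    by simp
  fix J :: "'n mindex set" assume "finite J"
  have "inj_on Poly_Mapping.lookup J" using bij_lookup by (meson bij_is_inj inj_on_subset subset_UNIV)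
  then show "(\<Sum>\<alpha>\<in>J. norm (\<Prod>i\<in>UNIV. a i (Poly_Mapping.lookup \<alpha> i))) \<le> (\<Prod>i\<in>UNIV. \<Sum>\<^sub>\<infinity>b. norm (a i b))"
    using has_sum_prod_UNIV(2)[OF assms, of "Poly_Mapping.lookup ` J"] \<open>finite J\<close> by (simp add: sum.reindex)
qed

lemma countable_mindex: "countable (UNIV :: 'n::finite mindex set)"
proof -
  have "countable (PiE (UNIV::'n set) (\<lambda>_. UNIV :: nat set))" by (rule countable_PiE) auto
  then show ?thesis using bij_lookup
    by (metis PiE_UNIV bij_betw_def countable_image_inj_on)
qed

section \<open>Power series in several variables\<close>

abbreviation lk :: "'n::finite mindex \<Rightarrow> 'n \<Rightarrow> nat" where "lk \<equiv> Poly_Mapping.lookup"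
abbreviation mindex_unit :: "'n \<Rightarrow> 'n mindex" where "mindex_unit i \<equiv> Poly_Mapping.single i 1"

text \<open>Unordered sums become integrals over counting measure, so the theorems on exchanging
  integrals with expansions, derivatives and limits serve for sums as well.\<close>

lemma integral_count_space_has_sum:
  fixes f :: "'a \<Rightarrow> complex"
  assumes "(f has_sum s) A"
  shows "integrable (count_space A) f" "(\<integral>x. f x \<partial>count_space A) = s"
proof -
  have "(\<lambda>x. norm (f x)) summable_on A"
    using assms has_sum_imp_summable summable_on_iff_abs_summable_on_complex by blast
  then have a: "Infinite_Set_Sum.abs_summable_on f A" by (simp add: abs_summable_equivalent)
  then show "integrable (count_space A) f" by (simp add: Infinite_Set_Sum.abs_summable_on_def)
  have "infsetsum f A = infsum f A"
    using a by (simp add: infsetsum_infsum)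
  then show "(\<integral>x. f x \<partial>count_space A) = s" using assms by (simp add: infsetsum_def infsumI)
qed

lemma has_sum_integral_count_space:
  fixes f :: "'a \<Rightarrow> complex"
  assumes "integrable (count_space A) f"
  shows "(f has_sum (\<integral>x. f x \<partial>count_space A)) A"
proof -
  have "(\<lambda>x. norm (f x)) summable_on A"
    using assms by (simp add: abs_summable_equivalent Infinite_Set_Sum.abs_summable_on_def)
  then have "(f has_sum infsum f A) A" by (simp add: abs_summable_summable)
  then show ?thesis using integral_count_space_has_sum(2) by metis
qed

text \<open>Keeps the coefficients and the radius visible, which \<open>real_analytic_on\<close>
  hides behind quantifiers; exchanging expansion and integral refers to both.\<close>

definition has_pser :: "(real ^ 'n::finite \<Rightarrow> complex) \<Rightarrow> real ^ 'n \<Rightarrow> ('n mindex \<Rightarrow> complex) \<Rightarrow> real \<Rightarrow> bool" where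
  "has_pser f x c r \<longleftrightarrow> (\<forall>y\<in>ball x r. ((\<lambda>\<alpha>. c \<alpha> * of_real (mpow (y - x) \<alpha>)) has_sum f y) UNIV)"

lemma real_analytic_on_alt:
  "real_analytic_on f S \<longleftrightarrow> (\<forall>x\<in>S. \<exists>c. \<exists>r>0. has_pser f x c r)"
  by (simp add: real_analytic_on_def has_pser_def)

text \<open>Only the expansion at the origin is asked for, with one family of coefficients for all
  radii; recentring is done once, in \<open>entire_pser_analytic\<close>.\<close>

definition entire_pser :: "(real ^ 'n::finite \<Rightarrow> complex) \<Rightarrow> bool" where
  "entire_pser f \<longleftrightarrow> (\<exists>a. \<forall>r. has_pser f 0 a r)"

lemma has_pser_mono: "has_pser f x c r \<Longrightarrow> r' \<le> r \<Longrightarrow> has_pser f x c r'"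
  by (auto simp: has_pser_def)

lemma has_pser_add:
  "has_pser f x c r \<Longrightarrow> has_pser g x d r \<Longrightarrow> has_pser (\<lambda>y. f y + g y) x (\<lambda>\<alpha>. c \<alpha> + d \<alpha>) r"
  by (auto simp: has_pser_def distrib_right intro!: has_sum_add)

lemma has_pser_cmult:
  "has_pser f x c r \<Longrightarrow> has_pser (\<lambda>y. b * f y) x (\<lambda>\<alpha>. b * c \<alpha>) r"
  by (auto simp: has_pser_def mult.assoc intro!: has_sum_cmult_right)

lemma has_pser_cong: "has_pser f x c r \<Longrightarrow> (\<And>y. y \<in> ball x r \<Longrightarrow> f y = g y) \<Longrightarrow> has_pser g x c r"
  by (auto simp: has_pser_def)

lemma real_analytic_on_add:
  assumes "real_analytic_on f S" "real_analytic_on g S"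
  shows "real_analytic_on (\<lambda>y. f y + g y) S"
  unfolding real_analytic_on_alt
proof
  fix x assume "x \<in> S"
  then obtain c r d s where "r > 0" "has_pser f x c r" "s > 0" "has_pser g x d s"
    using assms unfolding real_analytic_on_alt by meson
  then have "has_pser (\<lambda>y. f y + g y) x (\<lambda>\<alpha>. c \<alpha> + d \<alpha>) (min r s)" "min r s > 0"
    by (auto intro!: has_pser_add elim: has_pser_mono)
  then show "\<exists>c. \<exists>r>0. has_pser (\<lambda>y. f y + g y) x c r" by blast
qed

lemma real_analytic_on_cmult:
  assumes "real_analytic_on f S"
  shows "real_analytic_on (\<lambda>y. b * f y) S"
  unfolding real_analytic_on_alt
proof
  fix x assume "x \<in> S"
  then obtain c r where "r > 0" "has_pser f x c r"
    using assms unfolding real_analytic_on_alt by meson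
  then show "\<exists>c. \<exists>r>0. has_pser (\<lambda>y. b * f y) x c r" using has_pser_cmult by blast
qed

lemma real_analytic_on_sum:
  assumes "\<And>i. i \<in> I \<Longrightarrow> real_analytic_on (f i) S"
  shows "real_analytic_on (\<lambda>y. \<Sum>i\<in>I. f i y) S"
  using assms
proof (induction I rule: infinite_finite_induct)
  case (insert i I)
  then show ?case by (simp add: real_analytic_on_add)
qed (auto simp: real_analytic_on_def intro!: exI[of _ "\<lambda>_. 0"] exI[of _ 1])

text \<open>At each point \<open>y\<close> this is an exchange of sum and integral, so the majorant
  may depend on \<open>y\<close>; the coefficients, being integrals of the
  \<open>c w \<alpha>\<close>, do not.\<close>

lemma has_pser_integral:
  assumes ps: "\<And>w. w \<in> space M \<Longrightarrow> has_pser (K w) x (c w) r"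
    and meas: "\<And>\<alpha>. (\<lambda>w. c w \<alpha>) \<in> borel_measurable M"
    and B: "\<And>y. y \<in> ball x r \<Longrightarrow> integrable M (B y)"
    and le: "\<And>y w J. y \<in> ball x r \<Longrightarrow> w \<in> space M \<Longrightarrow> finite J \<Longrightarrow>
       (\<Sum>\<alpha>\<in>J. norm (c w \<alpha> * of_real (mpow (y - x) \<alpha>))) \<le> B y w"
  shows "has_pser (\<lambda>y. \<integral>w. K w y \<partial>M) x (\<lambda>\<alpha>. \<integral>w. c w \<alpha> \<partial>M) r"
  unfolding has_pser_def
proof
  fix y assume y: "y \<in> ball x r"
  have "((\<lambda>\<alpha>. \<integral>w. c w \<alpha> * of_real (mpow (y - x) \<alpha>) \<partial>M) has_sum (\<integral>w. K w y \<partial>M)) UNIV"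
  proof (rule has_sum_integral_dominated(2)[OF countable_mindex, where B = "B y"])
    show "((\<lambda>\<alpha>. c w \<alpha> * of_real (mpow (y - x) \<alpha>)) has_sum K w y) UNIV" if "w \<in> space M" for w
      using ps[OF that] y by (auto simp: has_pser_def)
    show "(\<lambda>w. c w i * complex_of_real (mpow (y - x) i)) \<in> borel_measurable M" for i
      by (intro borel_measurable_times borel_measurable_const meas)
  qed (use y le B in auto)
  then show "((\<lambda>\<alpha>. (\<integral>w. c w \<alpha> \<partial>M) * of_real (mpow (y - x) \<alpha>)) has_sum (\<integral>w. K w y \<partial>M)) UNIV"
    by simp
qed

lemma has_pser_prod:
  fixes a :: "'n::finite \<Rightarrow> nat \<Rightarrow> complex"
  assumes "\<And>y i. y \<in> ball x r \<Longrightarrow> ((\<lambda>j. a i j * of_real ((y $ i - x $ i) ^ j)) has_sum f i y) UNIV"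
  shows "has_pser (\<lambda>y. \<Prod>i\<in>UNIV. f i y) x (\<lambda>\<alpha>. \<Prod>i\<in>UNIV. a i (lk \<alpha> i)) r"
    and "\<And>y J. y \<in> ball x r \<Longrightarrow> finite J \<Longrightarrow>
       (\<Sum>\<alpha>\<in>J. norm ((\<Prod>i\<in>UNIV. a i (lk \<alpha> i)) * of_real (mpow (y - x) \<alpha>)))
        \<le> (\<Prod>i\<in>UNIV. \<Sum>\<^sub>\<infinity>j. norm (a i j * of_real ((y $ i - x $ i) ^ j)))"
proof -
  have eq: "(\<Prod>i\<in>UNIV. a i (lk \<alpha> i)) * of_real (mpow (y - x) \<alpha>) =
     (\<Prod>i\<in>UNIV. a i (lk \<alpha> i) * of_real ((y $ i - x $ i) ^ lk \<alpha> i))" for y \<alpha>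
    by (simp add: mpow_def prod.distrib)
  show "has_pser (\<lambda>y. \<Prod>i\<in>UNIV. f i y) x (\<lambda>\<alpha>. \<Prod>i\<in>UNIV. a i (lk \<alpha> i)) r"
    unfolding has_pser_def eq
  proof
    fix y assume "y \<in> ball x r"
    from has_sum_multiindex(1)[OF assms[OF this]]
    show "((\<lambda>\<alpha>. \<Prod>i\<in>UNIV. a i (lk \<alpha> i) * of_real ((y $ i - x $ i) ^ lk \<alpha> i)) has_sum (\<Prod>i\<in>UNIV. f i y)) UNIV" .
  qed
  fix y :: "real ^ 'n" and J :: "'n mindex set" assume "y \<in> ball x r" "finite J"
  from has_sum_multiindex(2)[OF assms[OF this(1)] this(2)]
  show "(\<Sum>\<alpha>\<in>J. norm ((\<Prod>i\<in>UNIV. a i (lk \<alpha> i)) * of_real (mpow (y - x) \<alpha>)))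
        \<le> (\<Prod>i\<in>UNIV. \<Sum>\<^sub>\<infinity>j. norm (a i j * of_real ((y $ i - x $ i) ^ j)))"
    unfolding eq .
qed

text \<open>A power expanded about another centre. The second claim is the majorant needed for
  recentring: taking norms of the terms turns y into |x| + |y - x|.\<close>

lemma has_sum_binomial_expansion:
  fixes x y :: real
  shows "((\<lambda>j. of_nat (n choose j) * of_real (x ^ (n - j)) * of_real ((y - x) ^ j)) has_sum complex_of_real (y ^ n)) UNIV"
    and "(\<Sum>\<^sub>\<infinity>j. norm (of_nat (n choose j) * of_real (x ^ (n - j)) * complex_of_real ((y - x) ^ j))) = (\<bar>x\<bar> + \<bar>y - x\<bar>) ^ n"
proof -
  have 1: "y ^ n = (\<Sum>j\<le>n. of_nat (n choose j) * x ^ (n - j) * (y - x) ^ j)"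
    using binomial_ring[of "y - x" x n] by (simp add: mult.commute mult.left_commute mult.assoc)
  have n: "norm (of_nat (n choose j) * of_real (x ^ (n - j)) * complex_of_real ((y - x) ^ j)) =
     real (n choose j) * \<bar>x\<bar> ^ (n - j) * \<bar>y - x\<bar> ^ j" for j
    by (simp only: norm_mult norm_of_real norm_of_nat power_abs)
  show "((\<lambda>j. of_nat (n choose j) * of_real (x ^ (n - j)) * of_real ((y - x) ^ j)) has_sum complex_of_real (y ^ n)) UNIV"
    by (rule has_sum_finite_neutralI[of "{..n}"]) (auto simp: 1)
  have "((\<lambda>j. norm (of_nat (n choose j) * of_real (x ^ (n - j)) * complex_of_real ((y - x) ^ j))) has_sum (\<bar>x\<bar> + \<bar>y - x\<bar>) ^ n) UNIV"
    by (subst n, rule has_sum_finite_neutralI[of "{..n}"])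
       (auto simp: binomial_ring[of "\<bar>y - x\<bar>" "\<bar>x\<bar>" n, unfolded add.commute[of "\<bar>y - x\<bar>"]] mult_ac intro!: sum.cong)
  then show "(\<Sum>\<^sub>\<infinity>j. norm (of_nat (n choose j) * of_real (x ^ (n - j)) * complex_of_real ((y - x) ^ j))) = (\<bar>x\<bar> + \<bar>y - x\<bar>) ^ n"
    by (rule infsumI)
qed

text \<open>Each monomial is expanded about \<open>x\<close> by the binomial theorem. The resulting
  double series is dominated by the original series of norms at the point with coordinates |x_i| +
  |y_i - x_i|, which converges however far out that point lies.\<close>

lemma entire_pser_analytic:
  fixes f :: "real ^ 'n::finite \<Rightarrow> complex"
  assumes "entire_pser f"
  shows "real_analytic_on f S"
  unfolding real_analytic_on_alt
proof
  fix x :: "real ^ 'n" assume "x \<in> S"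
  obtain a where a: "\<And>r. has_pser f 0 a r" using assms by (auto simp: entire_pser_def)
  have a': "((\<lambda>\<alpha>. a \<alpha> * of_real (mpow y \<alpha>)) has_sum f y) UNIV" for y
    using a[of "norm y + 1"] by (auto simp: has_pser_def)
  define K where "K \<alpha> y = a \<alpha> * complex_of_real (mpow y \<alpha>)" for \<alpha> y
  define c where "c \<alpha> \<gamma> = a \<alpha> * (\<Prod>i\<in>UNIV. of_nat (lk \<alpha> i choose lk \<gamma> i) * of_real (x $ i ^ (lk \<alpha> i - lk \<gamma> i)))" for \<alpha> \<gamma>
  define B where "B y \<alpha> = norm (a \<alpha>) * mpow (\<chi> i. \<bar>x $ i\<bar> + \<bar>y $ i - x $ i\<bar>) \<alpha>" for y \<alpha>
  have K: "has_pser (K \<alpha>) x (c \<alpha>) 1" for \<alpha>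
    unfolding K_def c_def mpow_def of_real_prod
    by (intro has_pser_cmult has_pser_prod(1)[where a = "\<lambda>i j. of_nat (lk \<alpha> i choose j) * of_real (x $ i ^ (lk \<alpha> i - j))"] has_sum_binomial_expansion)
  have "has_pser (\<lambda>y. \<integral>\<alpha>. K \<alpha> y \<partial>count_space UNIV) x (\<lambda>\<gamma>. \<integral>\<alpha>. c \<alpha> \<gamma> \<partial>count_space UNIV) 1"
  proof (rule has_pser_integral[OF K])
    show "(\<lambda>w. c w \<alpha>) \<in> borel_measurable (count_space UNIV)" for \<alpha> by simp
    show "integrable (count_space UNIV) (B y)" for y
    proof -
      have "integrable (count_space UNIV) (\<lambda>\<alpha>. norm (a \<alpha> * of_real (mpow (\<chi> i. \<bar>x $ i\<bar> + \<bar>y $ i - x $ i\<bar>) \<alpha>)))"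
        by (intro integrable_norm integral_count_space_has_sum(1)[OF a'])
      moreover have "mpow (\<chi> i. \<bar>x $ i\<bar> + \<bar>y $ i - x $ i\<bar>) \<alpha> \<ge> 0" for \<alpha>
        by (auto simp: mpow_def intro!: prod_nonneg)
      ultimately show ?thesis by (simp add: B_def[abs_def] norm_mult)
    qed
    fix y \<alpha> and J :: "'n mindex set" assume y: "y \<in> ball x 1" and J: "finite J"
    have "(\<Sum>\<gamma>\<in>J. norm (c \<alpha> \<gamma> * of_real (mpow (y - x) \<gamma>))) = norm (a \<alpha>) *
       (\<Sum>\<gamma>\<in>J. norm ((\<Prod>i\<in>UNIV. of_nat (lk \<alpha> i choose lk \<gamma> i) * of_real (x $ i ^ (lk \<alpha> i - lk \<gamma> i))) * complex_of_real (mpow (y - x) \<gamma>)))"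
      unfolding c_def by (simp add: norm_mult sum_distrib_left mult.assoc)
    also have "\<dots> \<le> norm (a \<alpha>) * (\<Prod>i\<in>UNIV. \<Sum>\<^sub>\<infinity>j. norm (of_nat (lk \<alpha> i choose j) * of_real (x $ i ^ (lk \<alpha> i - j)) * complex_of_real ((y $ i - x $ i) ^ j)))"
      by (intro mult_left_mono norm_ge_zero
        has_pser_prod(2)[where a = "\<lambda>i j. of_nat (lk \<alpha> i choose j) * of_real (x $ i ^ (lk \<alpha> i - j))" and r = 1 and
           f = "\<lambda>i y. complex_of_real (y $ i ^ lk \<alpha> i)"] has_sum_binomial_expansion y J)
    also have "\<dots> = B y \<alpha>" unfolding has_sum_binomial_expansion B_def mpow_def by simp
    finally show "(\<Sum>\<gamma>\<in>J. norm (c \<alpha> \<gamma> * of_real (mpow (y - x) \<gamma>))) \<le> B y \<alpha>" .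
  qed
  moreover have "(\<lambda>y. \<integral>\<alpha>. K \<alpha> y \<partial>count_space UNIV) = f"
    using integral_count_space_has_sum(2)[OF a'] by (auto simp: K_def)
  ultimately show "\<exists>c. \<exists>r>0. has_pser f x c r" by (intro exI[of _ "\<lambda>\<gamma>. \<integral>\<alpha>. c \<alpha> \<gamma> \<partial>count_space UNIV"] exI[of _ 1]) auto
qed

text \<open>A partial derivative of a monomial costs only a constant factor if the radius is halved:
  n (\<rho>/2)^(n-1) is at most 2^n (\<rho>/2)^(n-1), which equals (2/\<rho>) \<rho>^n.\<close>

lemma mpow_diff_bound:
  fixes h :: "real ^ 'n::finite"
  assumes "\<rho> > 0" "\<And>j. \<bar>h $ j\<bar> \<le> \<rho> / 2"
  shows "\<bar>real (lk \<alpha> i) * h $ i ^ (lk \<alpha> i - 1) * (\<Prod>j\<in>UNIV - {i}. h $ j ^ lk \<alpha> j)\<bar> \<le> 2 / \<rho> * \<rho> ^ mdeg \<alpha>"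
proof -
  have 1: "\<bar>real n * h $ i ^ (n - 1)\<bar> \<le> 2 / \<rho> * \<rho> ^ n" for n
  proof (cases n)
    case (Suc m)
    have "\<bar>real n * h $ i ^ (n - 1)\<bar> = real n * \<bar>h $ i\<bar> ^ m" by (simp add: Suc abs_mult power_abs)
    also have "\<dots> \<le> 2 ^ n * (\<rho> / 2) ^ m"
      using of_nat_less_two_power[of n, where 'a = real] assms(2)[of i] by (intro mult_mono power_mono) auto
    also have "\<dots> = 2 / \<rho> * \<rho> ^ n" using assms(1) by (simp add: Suc power_divide)
    finally show ?thesis .
  qed (use assms in auto)
  have 2: "(\<Prod>j\<in>UNIV - {i}. \<bar>h $ j\<bar> ^ lk \<alpha> j) \<le> (\<Prod>j\<in>UNIV - {i}. \<rho> ^ lk \<alpha> j)"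
    using assms by (intro prod_mono conjI power_mono) (auto intro: order_trans[OF assms(2)])
  have "\<bar>real (lk \<alpha> i) * h $ i ^ (lk \<alpha> i - 1) * (\<Prod>j\<in>UNIV - {i}. h $ j ^ lk \<alpha> j)\<bar> =
     \<bar>real (lk \<alpha> i) * h $ i ^ (lk \<alpha> i - 1)\<bar> * (\<Prod>j\<in>UNIV - {i}. \<bar>h $ j\<bar> ^ lk \<alpha> j)"
    by (simp add: abs_mult abs_prod power_abs)
  also have "\<dots> \<le> (2 / \<rho> * \<rho> ^ lk \<alpha> i) * (\<Prod>j\<in>UNIV - {i}. \<rho> ^ lk \<alpha> j)"
    using assms(1) by (intro mult_mono 1 2 prod_nonneg) auto
  also have "\<dots> = 2 / \<rho> * (\<Prod>j\<in>UNIV. \<rho> ^ lk \<alpha> j)"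
    by (simp add: prod.remove[of UNIV i "\<lambda>j. \<rho> ^ lk \<alpha> j"])
  also have "(\<Prod>j\<in>UNIV. \<rho> ^ lk \<alpha> j) = \<rho> ^ mdeg \<alpha>" by (simp add: mdeg_def power_sum)
  finally show ?thesis .
qed

text \<open>Termwise differentiation on a smaller ball. Differentiability near the centre and the
  expansion of the partial derivatives come out together, so analyticity can be iterated.\<close>

lemma has_pser_deriv:
  fixes f :: "real ^ 'n::finite \<Rightarrow> complex"
  assumes f: "has_pser f x c r" and r: "r > 0"
  obtains r' where "r' > 0" "\<And>y. y \<in> ball x r' \<Longrightarrow> f differentiable (at y)"
    "\<And>i. has_pser (dderiv (axis i 1) f) x (\<lambda>\<alpha>. of_nat (Suc (lk \<alpha> i)) * c (\<alpha> + mindex_unit i)) r'"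
proof -
  \<comment> \<open>With d the dimension, the diagonal vector with all coordinates \<rho> has norm
    at most d \<rho> < r. Absolute convergence at that point says that the series of |c_\<alpha>|
    \<rho>^deg(\<alpha>) converges, which dominates the differentiated series on the ball of radius
    \<rho>/2.\<close>
  define \<rho> where "\<rho> = r / (CARD('n) + 1)"
  have \<rho>: "\<rho> > 0" using r by (simp add: \<rho>_def)
  define p :: "real ^ 'n" where "p = (\<chi> i. \<rho>)"
  have "norm p \<le> (\<Sum>i\<in>UNIV. \<bar>p $ i\<bar>)" by (rule norm_le_l1_cart)
  also have "\<dots> = CARD('n) * \<rho>" using \<rho> by (simp add: p_def)
  also have "\<dots> < r" using r by (simp add: \<rho>_def field_simps)
  finally have "x + p \<in> ball x r" by (simp add: dist_norm)
  then have "((\<lambda>\<alpha>. c \<alpha> * of_real (mpow p \<alpha>)) has_sum f (x + p)) UNIV"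
    using f unfolding has_pser_def by (metis add_diff_cancel_left')
  then have "integrable (count_space UNIV) (\<lambda>\<alpha>. norm (c \<alpha> * of_real (mpow p \<alpha>)))"
    by (intro integrable_norm integral_count_space_has_sum(1))
  then have S: "integrable (count_space UNIV) (\<lambda>\<alpha>. norm (c \<alpha>) * \<rho> ^ mdeg \<alpha>)"
    using \<rho> by (simp only: norm_mult norm_of_real) (simp add: mpow_def p_def mdeg_def power_sum abs_prod power_abs)
  define D where "D i h \<alpha> = real (lk \<alpha> i) * h $ i ^ (lk \<alpha> i - 1) * (\<Prod>j\<in>UNIV - {i}. h $ j ^ lk \<alpha> j)" for i and h :: "real ^ 'n" and \<alpha>
  define K where "K y \<alpha> = c \<alpha> * of_real (mpow (y - x) \<alpha>)" for y \<alpha>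
  define K' where "K' y \<alpha> v = c \<alpha> * of_real (\<Sum>i\<in>UNIV. v $ i * D i (y - x) \<alpha>)" for y \<alpha> and v :: "real ^ 'n"
  have der: "((\<lambda>y. K y \<alpha>) has_derivative K' y \<alpha>) (at y)" for y \<alpha>
    unfolding K_def K'_def mpow_def D_def
    by (auto intro!: derivative_eq_intros bounded_linear_imp_has_derivative bounded_linear_vec_nth
        simp: fun_eq_iff sum_distrib_left algebra_simps intro!: sum.cong)
  have bD: "\<bar>D i (y - x) \<alpha>\<bar> \<le> 2 / \<rho> * \<rho> ^ mdeg \<alpha>" if "y \<in> ball x (\<rho>/2)" for i y \<alpha>
    unfolding D_def
  proof (rule mpow_diff_bound[OF \<rho>])
    fix j
    have "\<bar>(y - x) $ j\<bar> \<le> norm (y - x)" by (rule component_le_norm_cart)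
    then show "\<bar>(y - x) $ j\<bar> \<le> \<rho> / 2" using that by (simp add: dist_norm norm_minus_commute)
  qed
  define B where "B \<alpha> = (norm (c \<alpha>) * \<rho> ^ mdeg \<alpha>) * (2 * CARD('n) / \<rho>)" for \<alpha>
  have B: "integrable (count_space UNIV) B" unfolding B_def by (intro integrable_mult_left S)
  have bd: "norm (K' y \<alpha> v) \<le> B \<alpha> * norm v" if y: "y \<in> ball x (\<rho>/2)" for y \<alpha> v
  proof -
    have "\<bar>\<Sum>i\<in>UNIV. v $ i * D i (y - x) \<alpha>\<bar> \<le> (\<Sum>i\<in>(UNIV::'n set). \<bar>v $ i\<bar> * \<bar>D i (y - x) \<alpha>\<bar>)"
      by (rule order_trans[OF sum_abs]) (simp add: abs_mult)
    also have "\<dots> \<le> (\<Sum>i\<in>(UNIV::'n set). norm v * (2 / \<rho> * \<rho> ^ mdeg \<alpha>))"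
      by (intro sum_mono mult_mono component_le_norm_cart bD y) auto
    finally have "\<bar>\<Sum>i\<in>UNIV. v $ i * D i (y - x) \<alpha>\<bar> \<le> (\<Sum>i\<in>(UNIV::'n set). norm v * (2 / \<rho> * \<rho> ^ mdeg \<alpha>))" .
    then have "norm (c \<alpha>) * \<bar>\<Sum>i\<in>UNIV. v $ i * D i (y - x) \<alpha>\<bar> \<le> norm (c \<alpha>) * (CARD('n) * (norm v * (2 / \<rho> * \<rho> ^ mdeg \<alpha>)))"
      by (intro mult_left_mono) auto
    then show ?thesis by (simp add: K'_def B_def norm_mult algebra_simps del: of_real_sum)
  qed
  have le: "\<rho> / 2 \<le> r" using r \<rho> by (simp add: \<rho>_def field_simps)
  have fK: "((\<lambda>\<alpha>. K y \<alpha>) has_sum f y) UNIV" if "y \<in> ball x (\<rho>/2)" for y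
    using f that le unfolding has_pser_def K_def by auto
  have fd: "(f has_derivative (\<lambda>v. \<integral>\<alpha>. K' y \<alpha> v \<partial>count_space UNIV)) (at y)" if y: "y \<in> ball x (\<rho>/2)" for y
  proof -
    obtain s where s: "s > 0" "ball y s \<subseteq> ball x (\<rho>/2)" using y open_ball open_contains_ball by blast
    have "((\<lambda>y. \<integral>\<alpha>. K y \<alpha> \<partial>count_space UNIV) has_derivative (\<lambda>v. \<integral>\<alpha>. K' y \<alpha> v \<partial>count_space UNIV)) (at y)"
    proof (rule has_derivative_integral[OF s(1), where B = B])
      show "\<And>z. z \<in> ball y s \<Longrightarrow> integrable (count_space UNIV) (K z)"
        using s(2) fK integral_count_space_has_sum(1) by blast
    qed (use s(2) der bd B in auto)
    then show ?thesis
    proof (rule has_derivative_transform_within_open[OF _ open_ball y])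
      show "(\<integral>\<alpha>. K z \<alpha> \<partial>count_space UNIV) = f z" if "z \<in> ball x (\<rho>/2)" for z
        by (rule integral_count_space_has_sum(2)[OF fK[OF that]])
    qed
  qed
  show ?thesis
  proof
    show "\<rho>/2 > 0" using \<rho> by simp
    show "f differentiable (at y)" if "y \<in> ball x (\<rho>/2)" for y
      using fd[OF that] differentiableI by blast
    fix i
    show "has_pser (dderiv (axis i 1) f) x (\<lambda>\<alpha>. of_nat (Suc (lk \<alpha> i)) * c (\<alpha> + mindex_unit i)) (\<rho>/2)"
      unfolding has_pser_def
    proof
      fix y assume y: "y \<in> ball x (\<rho>/2)"
      have "dderiv (axis i 1) f y = (\<integral>\<alpha>. K' y \<alpha> (axis i 1) \<partial>count_space UNIV)"
        using frechet_derivative_at[OF fd[OF y]] by (simp add: dderiv_def fun_eq_iff)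
      moreover have "K' y \<alpha> (axis i 1) = c \<alpha> * of_real (D i (y - x) \<alpha>)" for \<alpha>
      proof -
        have "(\<Sum>j\<in>UNIV. axis i 1 $ j * D j (y - x) \<alpha>) = (\<Sum>j\<in>UNIV. if j = i then D j (y - x) \<alpha> else 0)"
          by (intro sum.cong) (auto simp: axis_def)
        then show ?thesis by (simp add: K'_def del: of_real_sum)
      qed
      moreover have "integrable (count_space UNIV) (\<lambda>\<alpha>. K' y \<alpha> (axis i 1))"
        by (rule Bochner_Integration.integrable_bound[OF B])
           (use bd[OF y, of _ "axis i 1"] in \<open>auto simp: intro!: AE_I2 order_trans[OF _ abs_ge_self]\<close>)
      ultimately have hs: "((\<lambda>\<alpha>. c \<alpha> * of_real (D i (y - x) \<alpha>)) has_sum dderiv (axis i 1) f y) UNIV"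
        using has_sum_integral_count_space[of UNIV "\<lambda>\<alpha>. K' y \<alpha> (axis i 1)"] by simp
      \<comment> \<open>The differentiated terms with exponent 0 in coordinate \<open>i\<close>
        vanish; all other multi-indices are of the form \<open>\<alpha> + mindex_unit i\<close>, and
        reindexing by \<alpha> gives the shifted coefficients.\<close>
      have inj: "inj (\<lambda>\<alpha>. \<alpha> + mindex_unit i)" by (auto simp: inj_def)
      have surj: "\<alpha> \<in> range (\<lambda>\<alpha>. \<alpha> + mindex_unit i)" if "lk \<alpha> i \<noteq> 0" for \<alpha> :: "'n mindex"
      proof -
        have "\<alpha> = (\<alpha> - mindex_unit i) + mindex_unit i"
          by (rule poly_mapping_eqI) (use that in \<open>auto simp: lookup_add lookup_minus lookup_single when_def\<close>)
        then show ?thesis by blast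
      qed
      have "((\<lambda>\<alpha>. c \<alpha> * of_real (D i (y - x) \<alpha>)) has_sum dderiv (axis i 1) f y) (range (\<lambda>\<alpha>. \<alpha> + mindex_unit i))"
        using hs by (rule has_sum_cong_neutral[THEN iffD1, rotated -1])
           (use surj in \<open>auto simp: D_def\<close>)
      then have "((\<lambda>\<alpha>. c (\<alpha> + mindex_unit i) * of_real (D i (y - x) (\<alpha> + mindex_unit i))) has_sum dderiv (axis i 1) f y) UNIV"
        by (subst (asm) has_sum_reindex[OF inj]) (simp add: o_def)
      moreover have "D i (y - x) (\<alpha> + mindex_unit i) = real (Suc (lk \<alpha> i)) * mpow (y - x) \<alpha>" for \<alpha>
      proof -
        have "(\<Prod>j\<in>UNIV - {i}. (y - x) $ j ^ lk (\<alpha> + mindex_unit i) j) = (\<Prod>j\<in>UNIV - {i}. (y - x) $ j ^ lk \<alpha> j)"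
          by (intro prod.cong) (auto simp: lookup_add lookup_single when_def)
        then show ?thesis
          by (simp add: D_def mpow_def prod.remove[of UNIV i] lookup_add)
      qed
      ultimately show "((\<lambda>\<alpha>. of_nat (Suc (lk \<alpha> i)) * c (\<alpha> + mindex_unit i) * of_real (mpow (y - x) \<alpha>)) has_sum dderiv (axis i 1) f y) UNIV"
        by (simp add: mult_ac)
    qed
  qed
qed

lemma real_analytic_on_differentiable:
  assumes "real_analytic_on f S" "x \<in> S"
  shows "f differentiable (at x)"
proof -
  obtain c r where r: "r > 0" and "has_pser f x c r" using assms unfolding real_analytic_on_alt by meson
  from has_pser_deriv[OF this(2,1)] obtain r' where "r' > 0" "\<And>y. y \<in> ball x r' \<Longrightarrow> f differentiable (at y)" by metis
  then show ?thesis by simp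
qed

lemma real_analytic_on_dderiv:
  assumes "real_analytic_on f S"
  shows "real_analytic_on (dderiv (axis i 1) f) S"
  unfolding real_analytic_on_alt
proof
  fix x assume "x \<in> S"
  then obtain c r where "r > 0" and "has_pser f x c r" using assms unfolding real_analytic_on_alt by meson
  from has_pser_deriv[OF this(2,1)] show "\<exists>c. \<exists>r>0. has_pser (dderiv (axis i 1) f) x c r" by metis
qed

lemma has_sum_exp:
  fixes w :: complex
  shows "((\<lambda>j. w ^ j / fact j) has_sum exp w) UNIV"
    and "(\<Sum>\<^sub>\<infinity>j. norm (w ^ j / fact j)) = exp (norm w)"
proof -
  have n: "norm (w ^ j / fact j) = norm w ^ j / fact j" for j by (simp add: norm_divide norm_power)
  have s: "(\<lambda>j. norm w ^ j / fact j) sums exp (norm w)"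
    using exp_converges[of "norm w"] by (simp add: divide_inverse mult.commute)
  have "(\<lambda>j. w ^ j / fact j) sums exp w"
    using exp_converges[of w] by (simp add: scaleR_conv_of_real divide_inverse mult.commute)
  then show "((\<lambda>j. w ^ j / fact j) has_sum exp w) UNIV"
    by (rule norm_summable_imp_has_sum[rotated]) (unfold n, rule sums_summable[OF s])
  have "((\<lambda>j. norm w ^ j / fact j) has_sum exp (norm w)) UNIV"
    by (rule norm_summable_imp_has_sum[OF _ s]) (use sums_summable[OF s] in simp)
  then show "(\<Sum>\<^sub>\<infinity>j. norm (w ^ j / fact j)) = exp (norm w)" unfolding n by (rule infsumI)
qed

definition exp_coeff :: "('n::finite \<Rightarrow> complex) \<Rightarrow> 'n mindex \<Rightarrow> complex" where
  "exp_coeff z \<alpha> = (\<Prod>i\<in>UNIV. z i ^ lk \<alpha> i / fact (lk \<alpha> i))"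

lemma has_pser_exp:
  fixes z :: "'n::finite \<Rightarrow> complex"
  shows "has_pser (\<lambda>x. exp (\<Sum>i\<in>UNIV. z i * of_real (x $ i))) 0 (exp_coeff z) r"
    and "finite J \<Longrightarrow> (\<Sum>\<alpha>\<in>J. norm (exp_coeff z \<alpha> * of_real (mpow x \<alpha>))) \<le> exp (\<Sum>i\<in>UNIV. norm (z i) * \<bar>x $ i\<bar>)"
proof -
  have eq: "z i ^ j / fact j * of_real ((y $ i - 0 $ i) ^ j) = (z i * of_real (y $ i)) ^ j / fact j" for i j and y :: "real ^ 'n"
    by (simp add: power_mult_distrib)
  have *: "((\<lambda>j. z i ^ j / fact j * of_real ((y $ i - 0 $ i) ^ j)) has_sum exp (z i * of_real (y $ i))) UNIV" for i and y :: "real ^ 'n"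
    unfolding eq by (rule has_sum_exp)
  have "has_pser (\<lambda>y. \<Prod>i\<in>UNIV. exp (z i * of_real (y $ i))) 0 (\<lambda>\<alpha>. \<Prod>i\<in>UNIV. z i ^ lk \<alpha> i / fact (lk \<alpha> i)) r"
    by (rule has_pser_prod(1)[where a = "\<lambda>i j. z i ^ j / fact j", OF *])
  then show "has_pser (\<lambda>x. exp (\<Sum>i\<in>UNIV. z i * of_real (x $ i))) 0 (exp_coeff z) r"
    by (simp add: exp_sum exp_coeff_def[abs_def])
  have "x \<in> ball 0 (norm x + 1)" by simp
  from has_pser_prod(2)[where a = "\<lambda>i j. z i ^ j / fact j", OF * this, of J]
  show "finite J \<Longrightarrow> (\<Sum>\<alpha>\<in>J. norm (exp_coeff z \<alpha> * of_real (mpow x \<alpha>))) \<le> exp (\<Sum>i\<in>UNIV. norm (z i) * \<bar>x $ i\<bar>)"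
    unfolding eq has_sum_exp by (simp add: exp_sum exp_coeff_def norm_mult)
qed

lemma sums_even:
  fixes f :: "nat \<Rightarrow> 'b::real_normed_vector"
  assumes "f sums s"
  shows "(\<lambda>n. if even n then f (n div 2) else 0) sums s"
proof -
  have "(\<lambda>n. if even (2 * n) then f (2 * n div 2) else 0) sums s" using assms by simp
  then show ?thesis
    by (subst (asm) sums_mono_reindex[of "\<lambda>n. 2 * n" "\<lambda>n. if even n then f (n div 2) else 0"])
       (auto simp: strict_mono_def elim!: evenE)
qed

text \<open>Taylor coefficients of h -> exp (q h + p h^2), written as a Cauchy product whose second
  factor has even powers only; up to scaling these are Hermite polynomials. They expand a Gaussian
  about a point other than its centre.\<close>

definition quad_exp_coeff :: "complex \<Rightarrow> complex \<Rightarrow> nat \<Rightarrow> complex" where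
  "quad_exp_coeff q p n = (\<Sum>i\<le>n. q ^ i / fact i * (if even (n - i) then p ^ ((n - i) div 2) / fact ((n - i) div 2) else 0))"

text \<open>Cauchy product of two exponential series. Taking norms in every term of the product
  gives the same expansion for |q| and |p|, hence the bound in the second claim.\<close>

lemma has_sum_quad_exp:
  fixes q p :: complex and h :: real
  shows "((\<lambda>n. quad_exp_coeff q p n * of_real (h ^ n)) has_sum exp (q * of_real h + p * of_real h ^ 2)) UNIV"
    and "(\<Sum>\<^sub>\<infinity>n. norm (quad_exp_coeff q p n * of_real (h ^ n))) \<le> exp (norm q * \<bar>h\<bar> + norm p * h ^ 2)"
proof -
  define a where "a j = (q * of_real h) ^ j / fact j" for j
  define b where "b j = (if even j then (p * of_real h ^ 2) ^ (j div 2) / fact (j div 2) else 0)" for j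
  have na: "norm (a j) = (norm q * \<bar>h\<bar>) ^ j / fact j" for j
    by (simp add: a_def norm_divide norm_power norm_mult)
  have nb: "norm (b j) = (if even j then (norm p * h ^ 2) ^ (j div 2) / fact (j div 2) else 0)" for j
    by (simp add: b_def norm_divide norm_power norm_mult)
  have e1: "(\<lambda>j. w ^ j / fact j) sums exp w" for w :: complex
    using exp_converges[of w] by (simp add: scaleR_conv_of_real divide_inverse mult.commute)
  have e2: "(\<lambda>j. w ^ j / fact j) sums exp w" for w :: real
    using exp_converges[of w] by (simp add: divide_inverse mult.commute)
  have a: "a sums exp (q * of_real h)" unfolding a_def by (rule e1)
  have an: "(\<lambda>j. norm (a j)) sums exp (norm q * \<bar>h\<bar>)" unfolding na by (rule e2)
  have b: "b sums exp (p * of_real h ^ 2)"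
    using sums_even[OF e1[of "p * of_real h ^ 2"]] by (simp add: b_def[abs_def])
  have bn: "(\<lambda>j. norm (b j)) sums exp (norm p * h ^ 2)"
    unfolding nb using sums_even[OF e2[of "norm p * h ^ 2"]] by simp
  have term_eq: "quad_exp_coeff q p n * of_real (h ^ n) = (\<Sum>i\<le>n. a i * b (n - i))" for n
    unfolding quad_exp_coeff_def sum_distrib_right
  proof (rule sum.cong)
    fix i assume "i \<in> {..n}"
    then have "i + (n - i) = n" by simp
    then have hn: "complex_of_real (h ^ n) = of_real h ^ i * of_real h ^ (n - i)" by (metis power_add of_real_power)
    have "even (n - i) \<Longrightarrow> complex_of_real h ^ (n - i) = (of_real h ^ 2) ^ ((n - i) div 2)"
      by (simp add: power_mult[symmetric])
    then show "q ^ i / fact i * (if even (n - i) then p ^ ((n - i) div 2) / fact ((n - i) div 2) else 0) * of_real (h ^ n) = a i * b (n - i)"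
      unfolding hn a_def b_def by (auto simp: power_mult_distrib)
  qed simp
  have sa: "summable (\<lambda>j. norm (a j))" and sb: "summable (\<lambda>j. norm (b j))"
    using an bn by (auto simp: sums_iff)
  have C: "(\<lambda>n. \<Sum>i\<le>n. a i * b (n - i)) sums (exp (q * of_real h) * exp (p * of_real h ^ 2))"
    using Cauchy_product_sums[OF sa sb] a b by (simp add: sums_iff)
  have Cn: "(\<lambda>n. \<Sum>i\<le>n. norm (a i) * norm (b (n - i))) sums (exp (norm q * \<bar>h\<bar>) * exp (norm p * h ^ 2))"
    using Cauchy_product_sums[of "\<lambda>j. norm (a j)" "\<lambda>j. norm (b j)"] sa sb an bn by (simp add: sums_iff)
  have le: "norm (\<Sum>i\<le>n. a i * b (n - i)) \<le> (\<Sum>i\<le>n. norm (a i) * norm (b (n - i)))" for n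
    by (rule order_trans[OF norm_sum]) (simp add: norm_mult)
  have sn: "summable (\<lambda>n. norm (\<Sum>i\<le>n. a i * b (n - i)))"
    by (rule summable_comparison_test[OF _ sums_summable[OF Cn]]) (use le in \<open>auto intro!: exI[of _ 0]\<close>)
  show "((\<lambda>n. quad_exp_coeff q p n * of_real (h ^ n)) has_sum exp (q * of_real h + p * of_real h ^ 2)) UNIV"
    unfolding term_eq exp_add by (rule norm_summable_imp_has_sum[OF sn C])
  have "((\<lambda>n. norm (\<Sum>i\<le>n. a i * b (n - i))) has_sum suminf (\<lambda>n. norm (\<Sum>i\<le>n. a i * b (n - i)))) UNIV"
    by (rule norm_summable_imp_has_sum) (use sn in \<open>auto intro: summable_sums\<close>)
  then have "(\<Sum>\<^sub>\<infinity>n. norm (\<Sum>i\<le>n. a i * b (n - i))) = suminf (\<lambda>n. norm (\<Sum>i\<le>n. a i * b (n - i)))"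
    by (rule infsumI)
  also have "\<dots> \<le> suminf (\<lambda>n. \<Sum>i\<le>n. norm (a i) * norm (b (n - i)))"
    using le sn Cn by (intro suminf_le) (auto simp: sums_iff)
  also have "\<dots> = exp (norm q * \<bar>h\<bar> + norm p * h ^ 2)" using Cn by (simp add: sums_iff exp_add)
  finally show "(\<Sum>\<^sub>\<infinity>n. norm (quad_exp_coeff q p n * of_real (h ^ n))) \<le> exp (norm q * \<bar>h\<bar> + norm p * h ^ 2)"
    unfolding term_eq .
qed

lemma has_pser_quad_exp:
  fixes q :: "'n::finite \<Rightarrow> complex" and p :: complex and x0 x :: "real ^ 'n"
  shows "has_pser (\<lambda>x. exp (\<Sum>i\<in>UNIV. q i * of_real (x $ i - x0 $ i) + p * of_real (x $ i - x0 $ i) ^ 2)) x0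
      (\<lambda>\<alpha>. \<Prod>i\<in>UNIV. quad_exp_coeff (q i) p (lk \<alpha> i)) r"
    and "finite J \<Longrightarrow> (\<Sum>\<alpha>\<in>J. norm ((\<Prod>i\<in>UNIV. quad_exp_coeff (q i) p (lk \<alpha> i)) * of_real (mpow (x - x0) \<alpha>)))
       \<le> exp (\<Sum>i\<in>UNIV. norm (q i) * \<bar>x $ i - x0 $ i\<bar> + norm p * (x $ i - x0 $ i) ^ 2)"
proof -
  have *: "((\<lambda>j. quad_exp_coeff (q i) p j * of_real ((y $ i - x0 $ i) ^ j)) has_sum
       exp (q i * of_real (y $ i - x0 $ i) + p * of_real (y $ i - x0 $ i) ^ 2)) UNIV" for i and y :: "real ^ 'n"
    by (rule has_sum_quad_exp)
  show "has_pser (\<lambda>x. exp (\<Sum>i\<in>UNIV. q i * of_real (x $ i - x0 $ i) + p * of_real (x $ i - x0 $ i) ^ 2)) x0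
      (\<lambda>\<alpha>. \<Prod>i\<in>UNIV. quad_exp_coeff (q i) p (lk \<alpha> i)) r"
    unfolding exp_sum[OF finite] by (rule has_pser_prod(1)[where a = "\<lambda>i j. quad_exp_coeff (q i) p j", OF *])
  assume J: "finite J"
  have "x \<in> ball x0 (dist x0 x + 1)" by simp
  from has_pser_prod(2)[where a = "\<lambda>i j. quad_exp_coeff (q i) p j", OF * this J]
  have "(\<Sum>\<alpha>\<in>J. norm ((\<Prod>i\<in>UNIV. quad_exp_coeff (q i) p (lk \<alpha> i)) * of_real (mpow (x - x0) \<alpha>)))
      \<le> (\<Prod>i\<in>UNIV. \<Sum>\<^sub>\<infinity>j. norm (quad_exp_coeff (q i) p j * of_real ((x $ i - x0 $ i) ^ j)))" .
  also have "\<dots> \<le> (\<Prod>i\<in>UNIV. exp (norm (q i) * \<bar>x $ i - x0 $ i\<bar> + norm p * (x $ i - x0 $ i) ^ 2))"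
    by (intro prod_mono conjI has_sum_quad_exp infsum_nonneg) auto
  finally show "(\<Sum>\<alpha>\<in>J. norm ((\<Prod>i\<in>UNIV. quad_exp_coeff (q i) p (lk \<alpha> i)) * of_real (mpow (x - x0) \<alpha>)))
       \<le> exp (\<Sum>i\<in>UNIV. norm (q i) * \<bar>x $ i - x0 $ i\<bar> + norm p * (x $ i - x0 $ i) ^ 2)"
    by (simp add: exp_sum)
qed

lemma finite_mdeg: "finite {\<alpha>::'n::finite mindex. mdeg \<alpha> = k}"
proof (rule finite_imageD[where f = Poly_Mapping.lookup])
  have "lk \<alpha> i \<le> mdeg \<alpha>" for \<alpha> :: "'n mindex" and i
    unfolding mdeg_def by (rule member_le_sum) auto
  then have "Poly_Mapping.lookup ` {\<alpha>::'n mindex. mdeg \<alpha> = k} \<subseteq> PiE UNIV (\<lambda>_. {..k})" by (auto simp: PiE_def Pi_def)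
  then show "finite (Poly_Mapping.lookup ` {\<alpha>::'n mindex. mdeg \<alpha> = k})"
    by (rule finite_subset) (auto intro: finite_PiE)
  show "inj_on Poly_Mapping.lookup {\<alpha>::'n mindex. mdeg \<alpha> = k}"
    using bij_lookup by (meson bij_is_inj inj_on_subset subset_UNIV)
qed

lemma mdeg_add: "mdeg (\<alpha> + \<beta>) = mdeg \<alpha> + mdeg \<beta>"
  by (simp add: mdeg_def lookup_add sum.distrib)

lemma mdeg_unit [simp]: "mdeg (Poly_Mapping.single i (Suc 0)) = Suc 0"
  by (simp add: mdeg_def lookup_single when_def)

text \<open>The substitution \<beta> = \<alpha> + e_i reaches exactly the multi-indices with
  \<beta>_i > 0; the others contribute nothing by assumption.\<close>

lemma sum_mdeg_Suc:
  fixes h :: "'n::finite mindex \<Rightarrow> 'b::comm_monoid_add"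
  assumes "\<And>\<beta>. lk \<beta> i = 0 \<Longrightarrow> h \<beta> = 0"
  shows "(\<Sum>\<beta> | mdeg \<beta> = Suc k. h \<beta>) = (\<Sum>\<alpha> | mdeg \<alpha> = k. h (\<alpha> + mindex_unit i))"
proof -
  have surj: "\<alpha> \<in> (\<lambda>\<alpha>. \<alpha> + mindex_unit i) ` {\<alpha>. mdeg \<alpha> = k}" if "lk \<alpha> i \<noteq> 0" "mdeg \<alpha> = Suc k" for \<alpha> :: "'n mindex"
  proof -
    have *: "\<alpha> = (\<alpha> - mindex_unit i) + mindex_unit i"
      by (rule poly_mapping_eqI) (use that in \<open>auto simp: lookup_add lookup_minus lookup_single when_def\<close>)
    then have "mdeg (\<alpha> - mindex_unit i) + 1 = Suc k" using that(2) by (metis mdeg_add mdeg_unit One_nat_def)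
    then show ?thesis using * by force
  qed
  have "(\<Sum>\<beta> | mdeg \<beta> = Suc k. h \<beta>) = (\<Sum>\<beta>\<in>(\<lambda>\<alpha>. \<alpha> + mindex_unit i) ` {\<alpha>. mdeg \<alpha> = k}. h \<beta>)"
    by (rule sum.mono_neutral_right) (use surj assms finite_mdeg in \<open>auto simp: mdeg_add\<close>)
  also have "\<dots> = (\<Sum>\<alpha> | mdeg \<alpha> = k. h (\<alpha> + mindex_unit i))"
    by (subst sum.reindex) (auto simp: inj_on_def)
  finally show ?thesis .
qed

lemma prod_power_fact_unit:
  fixes a :: "'n::finite \<Rightarrow> 'b::{field_char_0}"
  shows "of_nat (lk \<alpha> i + 1) * (\<Prod>j\<in>UNIV. a j ^ lk (\<alpha> + mindex_unit i) j / fact (lk (\<alpha> + mindex_unit i) j)) =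
     a i * (\<Prod>j\<in>UNIV. a j ^ lk \<alpha> j / fact (lk \<alpha> j))"
proof -
  have 1: "(\<Prod>j\<in>UNIV - {i}. a j ^ lk (\<alpha> + mindex_unit i) j / fact (lk (\<alpha> + mindex_unit i) j)) =
     (\<Prod>j\<in>UNIV - {i}. a j ^ lk \<alpha> j / fact (lk \<alpha> j))"
    by (intro prod.cong) (auto simp: lookup_add lookup_single when_def)
  have nz: "(of_nat (Suc (lk \<alpha> i)) :: 'b) \<noteq> 0" using of_nat_neq_0 by blast
  have 2: "of_nat (lk \<alpha> i + 1) * (a i ^ lk (\<alpha> + mindex_unit i) i / fact (lk (\<alpha> + mindex_unit i) i)) = a i * (a i ^ lk \<alpha> i / fact (lk \<alpha> i))"
    using nz by (simp add: lookup_add lookup_single field_simps del: of_nat_Suc)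
  show ?thesis
    by (simp only: prod.remove[of UNIV i, OF finite UNIV_I] 1 mult.assoc[symmetric] 2)
qed

text \<open>Induction on the degree with factorials divided out: multiplying by a_i and raising the
  i-th exponent differ by the factor \<beta>_i.\<close>

lemma multinomial:
  fixes a :: "'n::finite \<Rightarrow> 'b::{field_char_0}"
  shows "(\<Sum>i\<in>UNIV. a i) ^ k / fact k = (\<Sum>\<alpha> | mdeg \<alpha> = k. \<Prod>i\<in>UNIV. a i ^ lk \<alpha> i / fact (lk \<alpha> i))"
proof (induction k)
  case 0
  have "{\<alpha>::'n mindex. mdeg \<alpha> = 0} = {0}" by (auto simp: mdeg_def intro!: poly_mapping_eqI)
  then show ?case by simp
next
  case (Suc k)
  define g where "g \<alpha> = (\<Prod>i\<in>UNIV. a i ^ lk \<alpha> i / fact (lk \<alpha> i))" for \<alpha>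
  have "(\<Sum>i\<in>UNIV. a i) * (\<Sum>\<alpha> | mdeg \<alpha> = k. g \<alpha>) = (\<Sum>i\<in>UNIV. \<Sum>\<alpha> | mdeg \<alpha> = k. a i * g \<alpha>)"
    by (rule sum_product)
  also have "\<dots> = (\<Sum>i\<in>UNIV. \<Sum>\<alpha> | mdeg \<alpha> = k. of_nat (lk (\<alpha> + mindex_unit i) i) * g (\<alpha> + mindex_unit i))"
    unfolding g_def prod_power_fact_unit[symmetric] by (simp add: lookup_add)
  also have "\<dots> = (\<Sum>i\<in>UNIV. \<Sum>\<beta> | mdeg \<beta> = Suc k. of_nat (lk \<beta> i) * g \<beta>)"
    by (intro sum.cong refl sum_mdeg_Suc[symmetric]) auto
  \<comment> \<open>Euler's identity: the factors \<beta>_i add up to the degree.\<close>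
  also have "\<dots> = (\<Sum>\<beta> | mdeg \<beta> = Suc k. of_nat (mdeg \<beta>) * g \<beta>)"
    by (subst sum.swap, intro sum.cong refl) (simp only: mdeg_def sum_distrib_right of_nat_sum)
  also have "\<dots> = of_nat (Suc k) * (\<Sum>\<beta> | mdeg \<beta> = Suc k. g \<beta>)"
    by (simp add: sum_distrib_left)
  finally have e: "(\<Sum>i\<in>UNIV. a i) * (\<Sum>\<alpha> | mdeg \<alpha> = k. g \<alpha>) = of_nat (Suc k) * (\<Sum>\<beta> | mdeg \<beta> = Suc k. g \<beta>)" .
  have nz: "(of_nat (Suc k) :: 'b) \<noteq> 0" using of_nat_neq_0 by blast
  have "(\<Sum>i\<in>UNIV. a i) ^ Suc k / fact (Suc k) = (\<Sum>i\<in>UNIV. a i) * ((\<Sum>i\<in>UNIV. a i) ^ k / fact k) / of_nat (Suc k)"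
    by (simp add: field_simps del: of_nat_Suc)
  also have "\<dots> = (\<Sum>\<beta> | mdeg \<beta> = Suc k. g \<beta>)"
    using e nz unfolding Suc.IH g_def[symmetric] by (simp del: of_nat_Suc)
  finally show ?case by (simp add: g_def)
qed

lemma single_sum: "Poly_Mapping.single k (sum f A) = (\<Sum>a\<in>A. Poly_Mapping.single k (f a))"
  by (rule poly_mapping_eqI) (auto simp: lookup_sum lookup_single when_def)

text \<open>The induction of \<open>multinomial\<close> once more, now in the polynomial ring in
  \<nabla>, which is not a field; the divisions by factorials stay in the real coefficients.\<close>

lemma nabla_form_power:
  fixes z :: "real ^ 'n::finite"
  shows "nabla_form z ^ m = (\<Sum>\<alpha> | mdeg \<alpha> = m. Poly_Mapping.single \<alpha> (fact m * (\<Prod>i\<in>UNIV. z $ i ^ lk \<alpha> i / fact (lk \<alpha> i))))"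
proof (induction m)
  case 0
  have "{\<alpha>::'n mindex. mdeg \<alpha> = 0} = {0}" by (auto simp: mdeg_def intro!: poly_mapping_eqI)
  then show ?case by simp
next
  case (Suc m)
  define g where "g \<alpha> = (\<Prod>i\<in>UNIV. z $ i ^ lk \<alpha> i / fact (lk \<alpha> i))" for \<alpha>
  have "nabla_form z ^ Suc m = (\<Sum>i\<in>UNIV. \<Sum>\<alpha> | mdeg \<alpha> = m. Poly_Mapping.single (mindex_unit i) (z $ i) * Poly_Mapping.single \<alpha> (fact m * g \<alpha>))"
    unfolding power_Suc Suc.IH g_def[symmetric] by (simp only: nabla_form_def sum_product)
  also have "\<dots> = (\<Sum>i\<in>UNIV. \<Sum>\<alpha> | mdeg \<alpha> = m. Poly_Mapping.single (\<alpha> + mindex_unit i) (real (lk (\<alpha> + mindex_unit i) i) * fact m * g (\<alpha> + mindex_unit i)))"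
  proof (intro sum.cong refl)
    fix i :: 'n and \<alpha> :: "'n mindex"
    show "Poly_Mapping.single (mindex_unit i) (z $ i) * Poly_Mapping.single \<alpha> (fact m * g \<alpha>) =
      Poly_Mapping.single (\<alpha> + mindex_unit i) (real (lk (\<alpha> + mindex_unit i) i) * fact m * g (\<alpha> + mindex_unit i))"
    proof -
      have "z $ i * (fact m * g \<alpha>) = real (lk (\<alpha> + mindex_unit i) i) * fact m * g (\<alpha> + mindex_unit i)"
        using prod_power_fact_unit[of \<alpha> i "\<lambda>i. z $ i"] unfolding g_def[symmetric]
        by (simp add: lookup_add)
      then show ?thesis by (simp only: mult_single add.commute)
    qed
  qed
  also have "\<dots> = (\<Sum>i\<in>UNIV. \<Sum>\<beta> | mdeg \<beta> = Suc m. Poly_Mapping.single \<beta> (real (lk \<beta> i) * fact m * g \<beta>))"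
    by (intro sum.cong refl sum_mdeg_Suc[symmetric]) auto
  also have "\<dots> = (\<Sum>\<beta> | mdeg \<beta> = Suc m. Poly_Mapping.single \<beta> (\<Sum>i\<in>UNIV. real (lk \<beta> i) * fact m * g \<beta>))"
    by (subst sum.swap) (simp add: single_sum)
  also have "\<dots> = (\<Sum>\<beta> | mdeg \<beta> = Suc m. Poly_Mapping.single \<beta> (fact (Suc m) * g \<beta>))"
  proof (intro sum.cong refl)
    fix \<beta> :: "'n mindex" assume "\<beta> \<in> {\<beta>. mdeg \<beta> = Suc m}"
    then have "(\<Sum>i\<in>UNIV. real (lk \<beta> i)) = real (Suc m)"
      unfolding of_nat_sum[symmetric] mdeg_def[symmetric] by simp
    then have "(\<Sum>i\<in>UNIV. real (lk \<beta> i) * fact m * g \<beta>) = real (Suc m) * fact m * g \<beta>"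
      by (simp only: sum_distrib_right[symmetric])
    then show "Poly_Mapping.single \<beta> (\<Sum>i\<in>UNIV. real (lk \<beta> i) * fact m * g \<beta>) = Poly_Mapping.single \<beta> (fact (Suc m) * g \<beta>)"
      by simp
  qed
  finally show ?case by (simp add: g_def)
qed

text \<open>Translates the formal powers of the linear form into monomials in \<open>z\<close>, the
  form in which a Fourier transform of derivatives can match them.\<close>

lemma nabla_coeff_eq:
  "nabla_coeff m \<alpha> z = (if mdeg \<alpha> = m then fact m / of_nat (mfact \<alpha>) * of_real (mpow z \<alpha>) else 0)"
proof -
  have "Poly_Mapping.lookup (nabla_form z ^ m) \<alpha> = (\<Sum>\<beta> | mdeg \<beta> = m. if \<beta> = \<alpha> then fact m * (\<Prod>i\<in>UNIV. z $ i ^ lk \<beta> i / fact (lk \<beta> i)) else 0)"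
    unfolding nabla_form_power lookup_sum by (intro sum.cong) (auto simp: lookup_single when_def)
  also have "\<dots> = (if mdeg \<alpha> = m then fact m * (\<Prod>i\<in>UNIV. z $ i ^ lk \<alpha> i / fact (lk \<alpha> i)) else 0)"
    using finite_mdeg[of m] by (subst sum.delta) auto
  finally show ?thesis by (simp add: nabla_coeff_def mpow_def mfact_def prod_dividef)
qed

section \<open>Gaussians and lattices\<close>

lemma norm_plane_wave [simp]: "norm (plane_wave y z) = 1"
proof -
  have "plane_wave y z = exp (\<i> * of_real (- 2 * pi * (z \<bullet> y)))" by (simp add: plane_wave_def mult_ac)
  then show ?thesis by (simp only: norm_exp_i_times)
qed

lemma plane_wave_sym: "plane_wave y z = plane_wave z y"
  by (simp add: plane_wave_def inner_commute)

lemma plane_wave_add: "plane_wave (x + y) z = plane_wave x z * plane_wave y z"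
  by (simp add: plane_wave_def inner_add_right distrib_left distrib_right exp_add[symmetric])

lemma continuous_on_plane_wave [continuous_intros]:
  "continuous_on S f \<Longrightarrow> continuous_on S g \<Longrightarrow> continuous_on S (\<lambda>x. plane_wave (f x) (g x))"
  unfolding plane_wave_def by (intro continuous_intros)

lemma borel_measurable_plane_wave [measurable]:
  "f \<in> borel_measurable M \<Longrightarrow> g \<in> borel_measurable M \<Longrightarrow> (\<lambda>x. plane_wave (f x) (g x)) \<in> borel_measurable M"
  unfolding plane_wave_def by measurable

text \<open>After rescaling, the integral is the characteristic function of the standard normal
  distribution.\<close>

lemma gaussian_fourier_real:
  fixes a t :: real
  assumes t: "t > 0"
  shows "integrable lborel (\<lambda>x. exp (\<i> * of_real (a * x)) * of_real (exp (- pi * t * x\<^sup>2)))"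
    and "(\<integral>x. exp (\<i> * of_real (a * x)) * of_real (exp (- pi * t * x\<^sup>2)) \<partial>lborel) =
       of_real (exp (- a\<^sup>2 / (4 * pi * t)) / sqrt t)"
proof -
  define f where "f x = exp (\<i> * of_real (a * x)) * complex_of_real (exp (- pi * t * x\<^sup>2))" for x :: real
  \<comment> \<open>Chosen so that pi t (c x)^2 = x^2 / 2.\<close>
  define c where "c = 1 / sqrt (2 * pi * t)"
  have c: "c > 0" using t by (simp add: c_def)
  have c2: "c\<^sup>2 = 1 / (2 * pi * t)" using t by (simp add: c_def power_divide)
  have fc: "f (0 + c * x) = sqrt (2 * pi) * (std_normal_density x *\<^sub>R iexp (a * c * x))" for x
  proof -
    have "pi * t * (c * x)\<^sup>2 = x\<^sup>2 / 2" using t by (simp add: power_mult_distrib c2)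
    then show ?thesis by (simp add: f_def std_normal_density_def scaleR_conv_of_real mult_ac)
  qed
  have int0: "integrable lborel (\<lambda>x. std_normal_density x *\<^sub>R iexp (a * c * x))"
  proof (rule Bochner_Integration.integrable_bound)
    show "integrable lborel (\<lambda>x. std_normal_density x * \<bar>x\<bar> ^ 0)" by (rule integrable_std_normal_moment_abs)
  qed auto
  then have "integrable lborel (\<lambda>x. f (0 + c * x))" unfolding fc by (rule integrable_mult_right)
  then show "integrable lborel (\<lambda>x. exp (\<i> * of_real (a * x)) * of_real (exp (- pi * t * x\<^sup>2)))"
    using c lborel_integrable_real_affine_iff[of c f 0] by (simp add: f_def[abs_def])
  have "(\<integral>x. std_normal_density x *\<^sub>R iexp (a * c * x) \<partial>lborel) = char std_normal_distribution (a * c)"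
    unfolding char_def by (subst integral_density) (auto simp: )
  also have "\<dots> = of_real (exp (- (a * c)\<^sup>2 / 2))" by (simp add: char_std_normal_distribution)
  also have "- (a * c)\<^sup>2 / 2 = - a\<^sup>2 / (4 * pi * t)" by (simp add: power_mult_distrib c2)
  finally have ch: "(\<integral>x. std_normal_density x *\<^sub>R iexp (a * c * x) \<partial>lborel) = of_real (exp (- a\<^sup>2 / (4 * pi * t)))" .
  have "(\<integral>x. f x \<partial>lborel) = \<bar>c\<bar> *\<^sub>R (\<integral>x. f (0 + c * x) \<partial>lborel)"
    by (rule lborel_integral_real_affine) (use c in auto)
  also have "\<dots> = of_real (c * sqrt (2 * pi) * exp (- a\<^sup>2 / (4 * pi * t)))"
    unfolding fc integral_mult_right_zero ch using c by (simp add: scaleR_conv_of_real)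
  also have "c * sqrt (2 * pi) = 1 / sqrt t" using t by (simp add: c_def real_sqrt_mult)
  finally show "(\<integral>x. exp (\<i> * of_real (a * x)) * of_real (exp (- pi * t * x\<^sup>2)) \<partial>lborel) =
       of_real (exp (- a\<^sup>2 / (4 * pi * t)) / sqrt t)"
    by (simp add: f_def)
qed

text \<open>Lebesgue measure is the image of a product of one-dimensional ones indexed by
  \<open>Basis\<close>; the work lies in passing between basis vectors \<open>axis i 1\<close> and
  indices \<open>i\<close>.\<close>

lemma lborel_prod_vec:
  fixes f :: "'n::finite \<Rightarrow> real \<Rightarrow> complex"
  assumes f: "\<And>i. integrable lborel (f i)"
  shows "integrable lborel (\<lambda>x::real^'n. \<Prod>i\<in>UNIV. f i (x $ i))"
    and "(\<integral>x. (\<Prod>i\<in>UNIV. f i (x $ i)) \<partial>(lborel :: (real^'n) measure)) = (\<Prod>i\<in>UNIV. \<integral>x. f i x \<partial>lborel)"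
proof -
  have [measurable]: "f i \<in> borel_measurable borel" for i using f[of i] borel_measurable_integrable by fastforce
  interpret P: product_sigma_finite "\<lambda>_::real^'n. lborel :: real measure" ..
  define ix where "ix = inv (\<lambda>i::'n. axis i (1::real))"
  have inj: "inj (\<lambda>i::'n. axis i (1::real))" by (auto simp: inj_def axis_eq_axis)
  have ix: "ix (axis i 1) = i" for i unfolding ix_def using inj by (rule inv_f_f)
  have B: "(Basis :: (real^'n) set) = range (\<lambda>i. axis i 1)" by (auto simp: Basis_vec_def)
  have prodB: "(\<Prod>b\<in>Basis. g b) = (\<Prod>i\<in>UNIV. g (axis i 1))" for g :: "real^'n \<Rightarrow> complex"
    unfolding B by (subst prod.reindex[OF inj]) simp
  define T where "T g = (\<Sum>b\<in>Basis. g b *\<^sub>R b)" for g :: "real^'n \<Rightarrow> real"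
  have Tm: "T \<in> (\<Pi>\<^sub>M b\<in>Basis. lborel) \<rightarrow>\<^sub>M borel" unfolding T_def by measurable
  have eq: "(\<Prod>i\<in>UNIV. f i (T g $ i)) = (\<Prod>b\<in>Basis. f (ix b) (g b))" for g
  proof -
    have "T g $ i = g (axis i 1)" for i
    proof -
      have "T g $ i = T g \<bullet> axis i 1" by (simp add: inner_axis)
      also have "\<dots> = g (axis i 1)" unfolding T_def by (rule inner_sum_left_Basis) (simp add: B)
      finally show ?thesis .
    qed
    then show ?thesis by (simp add: prodB ix)
  qed
  have m: "(\<lambda>x::real^'n. \<Prod>i\<in>UNIV. f i (x $ i)) \<in> borel_measurable borel" by measurable
  have lb: "lborel = distr (\<Pi>\<^sub>M b\<in>Basis. lborel) borel T" unfolding T_def[abs_def] by (rule lborel_eq)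
  show "integrable lborel (\<lambda>x::real^'n. \<Prod>i\<in>UNIV. f i (x $ i))"
    unfolding lb by (subst integrable_distr_eq[OF Tm m], unfold eq) (intro P.product_integrable_prod f finite_Basis)
  show "(\<integral>x. (\<Prod>i\<in>UNIV. f i (x $ i)) \<partial>(lborel :: (real^'n) measure)) = (\<Prod>i\<in>UNIV. \<integral>x. f i x \<partial>lborel)"
    unfolding lb by (subst integral_distr[OF Tm m], unfold eq, subst P.product_integral_prod)
      (auto simp: f prodB ix)
qed

lemma norm_vec_sum_squares: "norm x ^ 2 = (\<Sum>i\<in>UNIV. (x $ i)\<^sup>2)" for x :: "real ^ 'n::finite"
  unfolding power2_norm_eq_inner inner_vec_def by (simp add: power2_eq_square)

lemma gaussian_fourier:
  fixes x :: "real ^ 'n::finite"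
  assumes t: "t > 0"
  shows "integrable lborel (\<lambda>z. plane_wave x z * of_real (exp (- pi * t * norm z ^ 2)))"
    and "(\<integral>z. plane_wave x z * of_real (exp (- pi * t * norm z ^ 2)) \<partial>lborel) =
       of_real (exp (- pi * norm x ^ 2 / t) / sqrt t ^ CARD('n))"
proof -
  define f where "f i u = exp (\<i> * of_real (- 2 * pi * x $ i * u)) * complex_of_real (exp (- pi * t * u\<^sup>2))" for i u
  have eq: "plane_wave x z * of_real (exp (- pi * t * norm z ^ 2)) = (\<Prod>i\<in>UNIV. f i (z $ i))" for z
  proof -
    have "plane_wave x z = exp (\<Sum>i\<in>UNIV. \<i> * of_real (- 2 * pi * x $ i * z $ i))"
      by (simp add: plane_wave_def inner_vec_def sum_distrib_left mult_ac)
    moreover have "exp (- pi * t * norm z ^ 2) = exp (\<Sum>i\<in>UNIV. - pi * t * (z $ i)\<^sup>2)"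
      unfolding norm_vec_sum_squares by (simp add: sum_distrib_left)
    ultimately show ?thesis unfolding f_def prod.distrib by (simp only: exp_sum finite of_real_prod)
  qed
  have fi: "integrable lborel (f i)" for i unfolding f_def by (rule gaussian_fourier_real(1)[OF t])
  have int_f: "(\<integral>u. f i u \<partial>lborel) = of_real (exp (- (- 2 * pi * x $ i)\<^sup>2 / (4 * pi * t)) / sqrt t)" for i
    unfolding f_def by (rule gaussian_fourier_real(2)[OF t])
  show "integrable lborel (\<lambda>z. plane_wave x z * of_real (exp (- pi * t * norm z ^ 2)))"
    unfolding eq by (rule lborel_prod_vec(1)[OF fi])
  have "(\<Prod>i\<in>UNIV. exp (- (- 2 * pi * x $ i)\<^sup>2 / (4 * pi * t)) / sqrt t) = exp (- pi * norm x ^ 2 / t) / sqrt t ^ CARD('n)"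
  proof -
    have "- (- 2 * pi * x $ i)\<^sup>2 / (4 * pi * t) = - pi * (x $ i)\<^sup>2 / t" for i
      using t by (simp add: power2_eq_square field_simps)
    then have "(\<Prod>i\<in>UNIV. exp (- (- 2 * pi * x $ i)\<^sup>2 / (4 * pi * t)) / sqrt t) = exp (\<Sum>i\<in>UNIV. - pi * (x $ i)\<^sup>2 / t) / sqrt t ^ CARD('n)"
      by (simp add: prod_dividef exp_sum)
    then show ?thesis unfolding norm_vec_sum_squares by (simp add: sum_distrib_left sum_divide_distrib)
  qed
  then show "(\<integral>z. plane_wave x z * of_real (exp (- pi * t * norm z ^ 2)) \<partial>lborel) =
       of_real (exp (- pi * norm x ^ 2 / t) / sqrt t ^ CARD('n))"
    unfolding eq lborel_prod_vec(2)[OF fi] int_f of_real_prod[symmetric] by simp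
qed

section \<open>Integer vectors, summability over lattices and bounds for Gaussians\<close>

definition int_vec :: "('n::finite \<Rightarrow> int) \<Rightarrow> real ^ 'n" where
  "int_vec n = (\<chi> i. of_int (n i))"

lemma int_vec_nth [simp]: "int_vec n $ i = of_int (n i)" by (simp add: int_vec_def)

lemma inj_int_vec: "inj int_vec"
  by (auto simp: inj_def int_vec_def vec_eq_iff fun_eq_iff)

lemma lattice_of_eq: "lattice_of M = range (\<lambda>n. M *v int_vec n)"
proof -
  have "\<exists>n. z = int_vec n" if "\<forall>i. z $ i \<in> \<int>" for z :: "real ^ 'a"
  proof -
    have "\<forall>i. \<exists>k::int. z $ i = of_int k" using \<open>\<forall>i. z $ i \<in> \<int>\<close> by (auto elim: Ints_cases)
    from choice[OF this] obtain n where "\<And>i. z $ i = of_int (n i)" by blast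
    then show ?thesis by (intro exI[of _ n]) (simp add: vec_eq_iff)
  qed
  then have "{z :: real ^ 'a. \<forall>i. z $ i \<in> \<int>} = range int_vec" by (auto simp: image_iff)
  moreover have "lattice_of M = (*v) M ` {z. \<forall>i. z $ i \<in> \<int>}" unfolding lattice_of_def by blast
  ultimately show ?thesis by (simp add: image_image)
qed

lemma countable_int_vec: "countable (UNIV :: ('n::finite \<Rightarrow> int) set)"
proof -
  have "countable (PiE (UNIV::'n set) (\<lambda>_. UNIV :: int set))" by (rule countable_PiE) auto
  then show ?thesis by simp
qed

lemma summable_on_int_square: "(\<lambda>k::int. 1 / (1 + (of_int k)\<^sup>2) :: real) summable_on UNIV"
proof -
  have "summable (\<lambda>n. 1 / (1 + (real n)\<^sup>2))"
  proof (rule summable_comparison_test)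
    show "summable (\<lambda>n. inverse ((real n)\<^sup>2))" by (rule inverse_power_summable) simp
    show "\<exists>N. \<forall>n\<ge>N. norm (1 / (1 + (real n)\<^sup>2)) \<le> inverse ((real n)\<^sup>2)"
      using frac_le[of 1 1 "(real n)\<^sup>2" "1 + (real n)\<^sup>2" for n] by (intro exI[of _ 1]) (auto simp: inverse_eq_divide)
  qed
  then have s: "(\<lambda>n::nat. 1 / (1 + (real n)\<^sup>2)) summable_on UNIV"
    by (intro summable_nonneg_imp_summable_on) auto
  have 1: "(\<lambda>k::int. 1 / (1 + (of_int k)\<^sup>2) :: real) summable_on (range int)"
    by (subst summable_on_reindex) (use s in \<open>auto simp: o_def\<close>)
  have 2: "(\<lambda>k::int. 1 / (1 + (of_int k)\<^sup>2) :: real) summable_on (range (\<lambda>n. - int n))"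
    by (subst summable_on_reindex) (use s in \<open>auto simp: o_def inj_def\<close>)
  have "UNIV = range int \<union> range (\<lambda>n. - int n)"
    by (metis (no_types, lifting) UNIV_eq_I UnCI int_cases2 rangeI)
  then show ?thesis using summable_on_union[OF 1 2] by simp
qed

text \<open>The exponent 2d comes from bounding the product of the d factors 1 + n_i^2 by (1 +
  |n|)^(2d): the product of d convergent one-dimensional series is then a majorant.\<close>

lemma summable_on_int_vec:
  "(\<lambda>n::'n::finite\<Rightarrow>int. 1 / (1 + norm (int_vec n)) ^ (2 * CARD('n))) summable_on UNIV"
proof -
  define s where "s = (\<Sum>\<^sub>\<infinity>k::int. complex_of_real (1 / (1 + (of_int k)\<^sup>2)))"
  have "((\<lambda>k::int. complex_of_real (1 / (1 + (of_int k)\<^sup>2))) has_sum s) UNIV"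
    unfolding s_def using summable_on_int_square by (intro has_sum_infsum summable_on_of_real)
  from has_sum_prod_UNIV(1)[OF this, where 'n = 'n]
  have "(\<lambda>n::'n\<Rightarrow>int. complex_of_real (\<Prod>i\<in>UNIV. 1 / (1 + (of_int (n i))\<^sup>2))) summable_on UNIV"
    by (simp add: has_sum_imp_summable)
  then have "(\<lambda>n::'n\<Rightarrow>int. norm (complex_of_real (\<Prod>i\<in>UNIV. 1 / (1 + (of_int (n i))\<^sup>2)))) summable_on UNIV"
    by (simp only: summable_on_iff_abs_summable_on_complex)
  then have sm: "(\<lambda>n::'n\<Rightarrow>int. (\<Prod>i\<in>UNIV. 1 / (1 + (of_int (n i))\<^sup>2)) :: real) summable_on UNIV"
    by (simp only: norm_of_real abs_prod) simp
  show ?thesis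
  proof (rule summable_on_comparison_test[OF sm])
    fix n :: "'n \<Rightarrow> int"
    have "(\<Prod>i\<in>UNIV. 1 + (of_int (n i) :: real)\<^sup>2) \<le> (\<Prod>i\<in>(UNIV::'n set). (1 + norm (int_vec n))\<^sup>2)"
    proof (intro prod_mono conjI)
      fix i
      have "(of_int (n i) :: real)\<^sup>2 \<le> norm (int_vec n) ^ 2"
        using component_le_norm_cart[of "int_vec n" i] by (simp add: abs_le_square_iff[symmetric])
      then show "1 + (of_int (n i) :: real)\<^sup>2 \<le> (1 + norm (int_vec n))\<^sup>2"
        by (simp add: power2_sum add_increasing2)
    qed simp
    also have "\<dots> = (1 + norm (int_vec n)) ^ (2 * CARD('n))" by (simp add: power_mult)
    finally have "1 / (1 + norm (int_vec n)) ^ (2 * CARD('n)) \<le> 1 / (\<Prod>i\<in>UNIV. 1 + (of_int (n i) :: real)\<^sup>2)"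
      by (intro divide_left_mono mult_pos_pos prod_pos zero_less_power) (auto intro!: add_pos_nonneg)
    then show "1 / (1 + norm (int_vec n)) ^ (2 * CARD('n)) \<le> (\<Prod>i\<in>UNIV. 1 / (1 + (of_int (n i))\<^sup>2) :: real)"
      by (simp add: prod_dividef)
  qed auto
qed

lemma invertible_bounded_below:
  fixes M :: "real ^ 'n ^ 'n"
  assumes "invertible M"
  obtains c where "c > 0" "c \<le> 1" "\<And>x. c * norm x \<le> norm (M *v x)"
proof -
  obtain B where B: "B > 0" "\<And>x. B * norm x \<le> norm (M *v x)"
    using linear_inj_bounded_below_pos[OF matrix_vector_mul_linear inj_matrix_vector_mult[OF assms]] by metis
  show ?thesis
  proof
    show "min B 1 * norm x \<le> norm (M *v x)" for x
      by (rule order_trans[OF mult_right_mono B(2)]) auto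
  qed (use B in auto)
qed

lemma summable_on_lattice:
  fixes f :: "real ^ 'n::finite \<Rightarrow> real" and M :: "real ^ 'n ^ 'n"
  assumes "invertible M" and "\<And>z. 0 \<le> f z" and "\<And>z. f z \<le> C / (1 + norm z) ^ (2 * CARD('n))"
  shows "(\<lambda>n. f (M *v int_vec n)) summable_on UNIV"
proof -
  obtain c where c: "c > 0" "c \<le> 1" "\<And>x. c * norm x \<le> norm (M *v x)"
    using invertible_bounded_below[OF assms(1)] by metis
  have C: "C \<ge> 0" using order_trans[OF assms(2,3), of 0] by simp
  show ?thesis
  proof (rule summable_on_comparison_test)
    show "(\<lambda>n::'n\<Rightarrow>int. C / c ^ (2 * CARD('n)) * (1 / (1 + norm (int_vec n)) ^ (2 * CARD('n)))) summable_on UNIV"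
      by (intro summable_on_cmult_right summable_on_int_vec)
    fix n :: "'n \<Rightarrow> int"
    have "c * (1 + norm (int_vec n)) \<le> 1 + norm (M *v int_vec n)"
      using c(2) c(3)[of "int_vec n"] by (simp add: distrib_left)
    then have "(c * (1 + norm (int_vec n))) ^ (2 * CARD('n)) \<le> (1 + norm (M *v int_vec n)) ^ (2 * CARD('n))"
      using c(1) by (intro power_mono) auto
    then have "C / (1 + norm (M *v int_vec n)) ^ (2 * CARD('n)) \<le> C / (c * (1 + norm (int_vec n))) ^ (2 * CARD('n))"
      using C c(1) by (intro divide_left_mono mult_pos_pos zero_less_power) (auto intro!: add_pos_nonneg)
    also have "\<dots> = C / c ^ (2 * CARD('n)) * (1 / (1 + norm (int_vec n)) ^ (2 * CARD('n)))"
      by (simp add: power_mult_distrib)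
    finally show "f (M *v int_vec n) \<le> C / c ^ (2 * CARD('n)) * (1 / (1 + norm (int_vec n)) ^ (2 * CARD('n)))"
      using assms(3)[of "M *v int_vec n"] by linarith
  qed (use assms(2) in auto)
qed

lemma exp_square_bound:
  assumes "a > 0" "d > 0"
  obtains C where "C > 0" "\<And>r::real. r \<ge> 0 \<Longrightarrow> exp (- a * r\<^sup>2) \<le> C / (1 + r) ^ (2 * d)"
proof
  \<comment> \<open>Makes 1 + r^2 \<le> K (1 + a r^2 / d) \<le> K exp (a r^2 / d); raising this to
    the power d produces exp (a r^2).\<close>
  define K where "K = max 1 (real d / a)"
  have K: "K \<ge> 1" "K * a \<ge> d" using assms by (auto simp: K_def max_def field_simps)
  show "(2 * K) ^ d > 0" using K by simp
  fix r :: real assume r: "r \<ge> 0"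
  have "1 + r\<^sup>2 \<le> K + K * a * r\<^sup>2 / d"
  proof -
    have "real d * r\<^sup>2 \<le> (K * a) * r\<^sup>2" using K by (intro mult_right_mono) auto
    then have "r\<^sup>2 \<le> K * a * r\<^sup>2 / d" using assms by (simp add: field_simps)
    then show ?thesis using K by simp
  qed
  also have "\<dots> = K * (1 + a * r\<^sup>2 / d)" by (simp add: algebra_simps)
  also have "\<dots> \<le> K * exp (a * r\<^sup>2 / d)" using K by (intro mult_left_mono exp_ge_add_one_self) auto
  finally have 1: "1 + r\<^sup>2 \<le> K * exp (a * r\<^sup>2 / d)" .
  have "(1 + r) ^ (2 * d) = ((1 + r)\<^sup>2) ^ d" by (simp add: power_mult)
  also have "\<dots> \<le> (2 * (1 + r\<^sup>2)) ^ d"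
  proof (rule power_mono)
    show "(1 + r)\<^sup>2 \<le> 2 * (1 + r\<^sup>2)" using sum_squares_bound[of 1 r] by (simp add: power2_sum)
  qed simp
  also have "\<dots> \<le> (2 * (K * exp (a * r\<^sup>2 / d))) ^ d" using 1 by (intro power_mono) auto
  also have "\<dots> = (2 * K) ^ d * exp (a * r\<^sup>2)"
    using assms by (simp add: power_mult_distrib exp_of_nat_mult[symmetric])
  finally show "exp (- a * r\<^sup>2) \<le> (2 * K) ^ d / (1 + r) ^ (2 * d)"
    using r by (simp add: exp_minus field_simps)
qed

lemma summable_on_lattice_gaussian:
  fixes M :: "real ^ 'n ^ 'n"
  assumes "invertible M" "a > 0"
  shows "(\<lambda>n. exp (- a * norm (M *v int_vec n) ^ 2)) summable_on UNIV"
proof -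
  obtain C where C: "C > 0" "\<And>r::real. r \<ge> 0 \<Longrightarrow> exp (- a * r\<^sup>2) \<le> C / (1 + r) ^ (2 * CARD('n))"
    using exp_square_bound[OF assms(2), of "CARD('n)"] by auto
  show ?thesis by (rule summable_on_lattice[OF assms(1), where C = C]) (use C in auto)
qed

lemma norm_shift_bound: "norm (x + w) ^ 2 \<ge> norm w ^ 2 / 2 - norm x ^ 2" for x w :: "'a::real_normed_vector"
proof -
  have "norm w \<le> norm (x + w) + norm x" using norm_triangle_ineq4[of "x + w" x] by simp
  then have "norm w ^ 2 \<le> (norm (x + w) + norm x) ^ 2" by (intro power_mono) auto
  also have "\<dots> \<le> 2 * norm (x + w) ^ 2 + 2 * norm x ^ 2"
    using sum_squares_bound[of "norm (x + w)" "norm x"] by (simp add: power2_sum)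
  finally show ?thesis by simp
qed

text \<open>Half of the exponent pays for the shift, up to a factor depending on \<open>x\<close>
  only. Sums of Gaussians centred at an arbitrary point are thereby reduced to centred lattice
  sums.\<close>

lemma gaussian_shift_bound:
  fixes x w :: "'a::real_normed_vector"
  assumes "a \<ge> 0"
  shows "exp (- a * norm (x + w) ^ 2) \<le> exp (a * norm x ^ 2) * exp (- (a / 2) * norm w ^ 2)"
proof -
  have "a * (norm w ^ 2 / 2 - norm x ^ 2) \<le> a * norm (x + w) ^ 2"
    using assms norm_shift_bound by (intro mult_left_mono)
  then show ?thesis by (simp add: exp_add[symmetric] algebra_simps)
qed

section \<open>Linear change of variables for Lebesgue measure\<close>

lemma matrix_inv:
  assumes "invertible M"
  shows "M ** matrix_inv M = mat 1" "matrix_inv M ** M = mat 1"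
  using someI_ex[OF assms[unfolded invertible_def]] unfolding matrix_inv_def by auto

text \<open>Induction over products of elementary matrices. \<open>P\<close> is conditional on a
  nonzero determinant, so factors with a zero row are vacuous. Transpositions and shears have
  determinant of modulus 1 and preserve the volume of boxes, which \<open>unit\<close> extends to
  all measurable sets.\<close>

lemma measure_matrix_image:
  fixes A :: "real ^ 'n ^ 'n"
  assumes "det A \<noteq> 0" "S \<in> lmeasurable"
  shows "(*v) A ` S \<in> lmeasurable \<and> measure lebesgue ((*v) A ` S) = \<bar>det A\<bar> * measure lebesgue S"
proof -
  define P where "P A \<longleftrightarrow> (det A \<noteq> 0 \<longrightarrow> (\<forall>S\<in>lmeasurable. (*v) A ` S \<in> lmeasurable \<and>
     measure lebesgue ((*v) A ` S) = \<bar>det A\<bar> * measure lebesgue S))" for A :: "real ^ 'n ^ 'n"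
  have unit: "P A" if "\<bar>det A\<bar> = 1" "\<And>a b. measure lebesgue ((*v) A ` cbox a b) = measure lebesgue (cbox a b)" for A
  proof -
    have "(*v) A ` S \<in> lmeasurable \<and> measure lebesgue ((*v) A ` S) = measure lebesgue S" if "S \<in> lmeasurable" for S
      using measure_linear_sufficient[OF matrix_vector_mul_linear[of A] that, of 1] \<open>\<And>a b. measure lebesgue ((*v) A ` cbox a b) = _\<close>
      by (metis mult_1)
    then show ?thesis using that(1) by (simp add: P_def)
  qed
  have "P A"
  proof (rule induct_matrix_elementary_alt)
    fix A B assume A: "P A" and B: "P B"
    show "P (A ** B)"
    proof -
      have "(*v) (A ** B) ` S = (*v) A ` ((*v) B ` S)" for S
        by (simp add: image_image matrix_vector_mul_assoc)
      then show ?thesis using A B unfolding P_def by (auto simp: det_mul abs_mult)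
    qed
  next
    fix A :: "real ^ 'n ^ 'n" and i assume "row i A = 0"
    then have "det A = 0" by (rule det_zero_row(1))
    then show "P A" by (simp add: P_def)
  next
    fix A :: "real ^ 'n ^ 'n" assume d: "\<And>i j. i \<noteq> j \<Longrightarrow> A $ i $ j = 0"
    have "(\<Sum>j\<in>UNIV. A $ i $ j * x $ j) = A $ i $ i * x $ i" for i x
      using d by (subst sum.remove[of _ i]) auto
    then have "(*v) A = (\<lambda>x. \<chi> k. A $ k $ k * x $ k)" by (auto simp: vec_eq_iff matrix_vector_mult_def)
    then show "P A" by (simp add: P_def measurable_stretch measure_stretch det_diagonal[OF d])
  next
    fix m n :: 'n
    let ?\<sigma> = "Transposition.transpose m n"
    define A :: "real ^ 'n ^ 'n" where "A = (\<chi> i j. mat 1 $ i $ ?\<sigma> j)"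
    have "(\<Sum>j\<in>UNIV. (mat 1 :: real ^ 'n ^ 'n) $ i $ ?\<sigma> j * x $ j) = x $ ?\<sigma> i" for i and x :: "real ^ 'n"
    proof -
      have "i = ?\<sigma> j \<longleftrightarrow> j = ?\<sigma> i" for j by (metis transpose_involutory)
      then have "(mat 1 :: real ^ 'n ^ 'n) $ i $ ?\<sigma> j * x $ j = (if j = ?\<sigma> i then x $ j else 0)" for j
        by (simp add: mat_def)
      then show ?thesis by simp
    qed
    then have Av: "A *v x = (\<chi> i. x $ ?\<sigma> i)" for x by (auto simp: vec_eq_iff matrix_vector_mult_def A_def)
    have img: "(*v) A ` cbox a b = cbox (A *v a) (A *v b)" for a b
    proof (intro set_eqI iffI)
      fix x assume x: "x \<in> cbox (A *v a) (A *v b)"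
      have "A *v x \<in> cbox a b"
        unfolding mem_box_cart
      proof
        fix i
        have "(A *v a) $ ?\<sigma> i \<le> x $ ?\<sigma> i \<and> x $ ?\<sigma> i \<le> (A *v b) $ ?\<sigma> i" using x by (simp add: mem_box_cart)
        then show "a $ i \<le> (A *v x) $ i \<and> (A *v x) $ i \<le> b $ i" by (simp add: Av)
      qed
      moreover have "x = A *v (A *v x)" by (simp add: Av vec_eq_iff)
      ultimately show "x \<in> (*v) A ` cbox a b" by blast
    qed (auto simp: mem_box_cart Av)
    have "measure lebesgue ((*v) A ` cbox a b) = measure lebesgue (cbox a b)" for a b
    proof -
      have e: "cbox (A *v a) (A *v b) = {} \<longleftrightarrow> cbox a b = {}" using img by blast
      have "(\<Prod>i\<in>UNIV. (A *v b) $ i - (A *v a) $ i) = (\<Prod>i\<in>UNIV. b $ i - a $ i)"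
        unfolding Av using prod.reindex_bij_betw[of ?\<sigma> UNIV UNIV "\<lambda>i. b $ i - a $ i"] by simp
      then show ?thesis using e unfolding img by (simp add: content_cbox_if_cart)
    qed
    moreover have "\<bar>det A\<bar> = 1"
      unfolding A_def by (subst det_permute_columns) (auto simp: permutes_swap_id sign_swap_id abs_mult)
    ultimately show "P (\<chi> i j. mat 1 $ i $ ?\<sigma> j)" unfolding A_def by (intro unit) auto
  next
    fix m n :: 'n assume mn: "m \<noteq> n"
    define A :: "real ^ 'n ^ 'n" where "A = (\<chi> i j. of_bool (i = m \<and> j = n \<or> i = j))"
    have "A = (\<chi> k. if k = m then row m (mat 1) + 1 *s row n (mat 1) else row k (mat 1))"
      using mn by (auto simp: A_def vec_eq_iff row_def mat_def)
    then have det: "det A = 1" using det_row_operation[OF mn, of "mat 1 :: real ^ 'n ^ 'n" 1] by simp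
    have "(\<Sum>j\<in>UNIV. of_bool (i = m \<and> j = n \<or> i = j) * x $ j) = (if i = m then x $ m + x $ n else x $ i)" for i and x :: "real ^ 'n"
    proof -
      have "(\<Sum>j\<in>UNIV. of_bool (i = m \<and> j = n \<or> i = j) * x $ j) =
          (\<Sum>j\<in>UNIV. (if j = i then x $ j else 0) + (if j = n \<and> i = m then x $ j else 0))"
        using mn by (intro sum.cong) auto
      also have "\<dots> = (if i = m then x $ m + x $ n else x $ i)"
        by (cases "i = m") (simp_all add: sum.distrib)
      finally show ?thesis .
    qed
    then have Av: "(*v) A = (\<lambda>x. \<chi> i. if i = m then x $ m + x $ n else x $ i)"
      by (auto simp: vec_eq_iff matrix_vector_mult_def A_def)
    have "measure lebesgue ((*v) A ` cbox a b) = measure lebesgue (cbox a b)" for a b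
    proof (cases "cbox a b = {}")
      case False
      \<comment> \<open>The volume formula for a sheared box wants the n-th coordinate of the lower
        corner to be nonnegative; translation by \<open>s\<close> makes it 0.\<close>
      define s :: "real ^ 'n" where "s = (\<chi> i. if i = n then - a $ n else 0)"
      have e: "A *v x = - (A *v s) + A *v (s + x)" for x
        by (simp add: matrix_vector_right_distrib)
      have "(*v) A ` cbox a b = (+) (- (A *v s)) ` (*v) A ` (+) s ` cbox a b"
        unfolding image_image by (intro image_cong refl e)
      then have "measure lebesgue ((*v) A ` cbox a b) = measure lebesgue ((*v) A ` cbox (s + a) (s + b))"
        by (simp only: measure_translation cbox_translation)
      also have "\<dots> = measure lebesgue (cbox (s + a) (s + b))"
        unfolding Av
      proof (rule measure_shear_interval[OF mn])
        show "cbox (s + a) (s + b) \<noteq> {}" unfolding cbox_translation using False by blast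
      qed (simp add: s_def)
      also have "\<dots> = measure lebesgue ((+) s ` cbox a b)" by (simp only: cbox_translation)
      also have "\<dots> = measure lebesgue (cbox a b)" by (rule measure_translation)
      finally show ?thesis .
    qed simp
    then show "P (\<chi> i j. of_bool (i = m \<and> j = n \<or> i = j))" using det unfolding A_def by (intro unit) auto
  qed
  then show ?thesis using assms by (simp add: P_def)
qed

lemma lborel_linear:
  fixes M :: "real ^ 'n ^ 'n"
  assumes "invertible M"
  shows "lborel = density (distr lborel borel ((*v) M)) (\<lambda>_. ennreal \<bar>det M\<bar>)"
proof (rule lborel_eqI)
  have d: "det M \<noteq> 0" using assms by (simp add: invertible_det_nz)
  have [measurable]: "(*v) M \<in> borel_measurable borel"
    by (intro borel_measurable_continuous_onI linear_continuous_on matrix_vector_mul_bounded_linear)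
  fix l u :: "real ^ 'n" assume lu: "\<And>b. b \<in> Basis \<Longrightarrow> l \<bullet> b \<le> u \<bullet> b"
  have v: "M *v (matrix_inv M *v x) = x" "matrix_inv M *v (M *v x) = x" for x
    by (simp_all add: matrix_vector_mul_assoc matrix_inv[OF assms])
  have pre: "(*v) M -` box l u = (*v) (matrix_inv M) ` box l u"
    by (auto simp: v image_iff) (metis v)
  have di: "det (matrix_inv M) = inverse (det M)"
    using matrix_inv[OF assms] by (metis d det_I det_mul inverse_unique)
  have m: "measure lebesgue ((*v) (matrix_inv M) ` box l u) = \<bar>inverse (det M)\<bar> * measure lebesgue (box l u)"
    and lm: "(*v) (matrix_inv M) ` box l u \<in> lmeasurable"
    using measure_matrix_image[of "matrix_inv M" "box l u"] d by (auto simp: di)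
  have bs: "(*v) M -` box l u \<in> sets borel" using measurable_sets[of "(*v) M" borel borel "box l u"] by simp
  have "emeasure (density (distr lborel borel ((*v) M)) (\<lambda>_. ennreal \<bar>det M\<bar>)) (box l u) =
      ennreal \<bar>det M\<bar> * emeasure lborel ((*v) M -` box l u)"
    by (simp add: emeasure_density nn_integral_cmult_indicator emeasure_distr)
  also have "emeasure lborel ((*v) M -` box l u) = emeasure lebesgue ((*v) M -` box l u)"
    using bs by simp
  also have "\<dots> = ennreal (measure lebesgue ((*v) M -` box l u))"
    using lm unfolding pre by (simp add: emeasure_eq_measure2 fmeasurableD2)
  also have "ennreal \<bar>det M\<bar> * \<dots> = ennreal (measure lebesgue (box l u))"
    unfolding pre m using d by (simp add: ennreal_mult'[symmetric] abs_inverse)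
  also have "\<dots> = (\<Prod>b\<in>Basis. (u - l) \<bullet> b)"
    using lu by simp
  finally show "emeasure (density (distr lborel borel ((*v) M)) (\<lambda>_. ennreal \<bar>det M\<bar>)) (box l u) = (\<Prod>b\<in>Basis. (u - l) \<bullet> b)" .
qed simp

lemma integral_lborel_linear:
  fixes M :: "real ^ 'n ^ 'n" and f :: "real ^ 'n \<Rightarrow> complex"
  assumes "invertible M" "integrable lborel f"
  shows "integrable lborel (\<lambda>x. f (M *v x))"
    and "(\<integral>x. f x \<partial>lborel) = of_real \<bar>det M\<bar> * (\<integral>x. f (M *v x) \<partial>lborel)"
proof -
  have d: "det M \<noteq> 0" using assms(1) by (simp add: invertible_det_nz)
  have [measurable]: "(*v) M \<in> borel_measurable borel"
    by (intro borel_measurable_continuous_onI linear_continuous_on matrix_vector_mul_bounded_linear)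
  have [measurable]: "f \<in> borel_measurable borel" using assms(2) by auto
  have "integrable (density (distr lborel borel ((*v) M)) (\<lambda>_. ennreal \<bar>det M\<bar>)) f"
    using assms by (simp add: lborel_linear[symmetric])
  then have "integrable lborel (\<lambda>x. \<bar>det M\<bar> *\<^sub>R f (M *v x))"
    by (simp add: integrable_density integrable_distr_eq)
  then show "integrable lborel (\<lambda>x. f (M *v x))"
    using integrable_scaleR_right[of "inverse \<bar>det M\<bar>" lborel "\<lambda>x. \<bar>det M\<bar> *\<^sub>R f (M *v x)"] d by simp
  have "(\<integral>x. f x \<partial>lborel) = (\<integral>x. f x \<partial>density (distr lborel borel ((*v) M)) (\<lambda>_. ennreal \<bar>det M\<bar>))"
    using assms by (simp add: lborel_linear[symmetric])
  also have "\<dots> = \<bar>det M\<bar> *\<^sub>R (\<integral>x. f (M *v x) \<partial>lborel)"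
    by (subst integral_density) (auto simp: integral_distr)
  finally show "(\<integral>x. f x \<partial>lborel) = of_real \<bar>det M\<bar> * (\<integral>x. f (M *v x) \<partial>lborel)"
    by (simp add: scaleR_conv_of_real)
qed

section \<open>Poisson summation\<close>

lemma isCont_integral:
  fixes K :: "'a::metric_space \<Rightarrow> 'w \<Rightarrow> complex"
  assumes r: "r > 0" and cont: "\<And>w. w \<in> space M \<Longrightarrow> isCont (\<lambda>y. K y w) x"
    and bd: "\<And>y w. y \<in> ball x r \<Longrightarrow> w \<in> space M \<Longrightarrow> norm (K y w) \<le> B w"
    and B: "integrable M B" and meas: "\<And>y. y \<in> ball x r \<Longrightarrow> K y \<in> borel_measurable M"
  shows "isCont (\<lambda>y. \<integral>w. K y w \<partial>M) x"
  unfolding continuous_at_sequentially comp_def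
proof (intro allI impI)
  fix X :: "nat \<Rightarrow> 'a" assume X: "X \<longlonglongrightarrow> x"
  have "\<forall>\<^sub>F n in sequentially. X n \<in> ball x r"
    using X r by (metis centre_in_ball open_ball tendsto_def)
  then obtain N where N: "\<And>n. n \<ge> N \<Longrightarrow> X n \<in> ball x r" by (auto simp: eventually_sequentially)
  define Y where "Y n = X (n + N)" for n
  have Yb: "Y n \<in> ball x r" for n unfolding Y_def by (rule N) simp
  have Yl: "Y \<longlonglongrightarrow> x" unfolding Y_def by (rule LIMSEQ_ignore_initial_segment[OF X])
  have "(\<lambda>n. \<integral>w. K (Y n) w \<partial>M) \<longlonglongrightarrow> (\<integral>w. K x w \<partial>M)"
  proof (rule integral_dominated_convergence[OF _ _ B])
    show "AE w in M. (\<lambda>n. K (Y n) w) \<longlonglongrightarrow> K x w"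
      by (intro AE_I2 isCont_tendsto_compose[OF cont Yl])
    show "K x \<in> borel_measurable M" by (rule meas) (use r in simp)
    show "AE w in M. norm (K (Y n) w) \<le> B w" for n
      using bd[OF Yb] by (auto intro!: AE_I2)
  qed (use meas Yb in auto)
  then show "(\<lambda>n. \<integral>w. K (X n) w \<partial>M) \<longlonglongrightarrow> (\<integral>w. K x w \<partial>M)"
    unfolding Y_def by (rule LIMSEQ_offset)
qed

lemma integral_lborel_translation:
  fixes f :: "'a::euclidean_space \<Rightarrow> 'b::{banach, second_countable_topology}"
  assumes "f \<in> borel_measurable borel"
  shows "(\<integral>x. f (x + c) \<partial>lborel) = (\<integral>x. f x \<partial>lborel)"
proof -
  have "(\<integral>x. f x \<partial>lborel) = (\<integral>x. f x \<partial>distr lborel borel ((+) c))" by (simp add: lborel_distr_plus)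
  also have "\<dots> = (\<integral>x. f (c + x) \<partial>lborel)" by (rule integral_distr) (use assms in auto)
  finally show ?thesis by (simp add: add.commute)
qed

text \<open>Half-open, so that its integer translates tile the space without overlap, see
  \<open>unit_cube_floor\<close>.\<close>

definition unit_cube :: "(real ^ 'n::finite) set" where
  "unit_cube = {u. \<forall>i. 0 \<le> u $ i \<and> u $ i < 1}"

abbreviation wave :: "('n::finite \<Rightarrow> int) \<Rightarrow> real ^ 'n \<Rightarrow> complex" where
  "wave m \<equiv> plane_wave (int_vec m)"

lemma unit_cube_measurable [measurable]: "unit_cube \<in> sets borel"
  unfolding unit_cube_def by measurable

lemma int_vec_add: "int_vec (\<lambda>i. m i + n i) = int_vec m + int_vec n"
  by (simp add: int_vec_def vec_eq_iff)

lemma wave_add: "wave (\<lambda>i. m i + n i) u = wave m u * wave n u"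
  by (simp add: int_vec_add plane_wave_add)

lemma wave_int_vec [simp]: "wave m (int_vec n) = 1"
proof -
  define k where "k = (\<Sum>i\<in>UNIV. n i * m i)"
  have "int_vec n \<bullet> int_vec m = of_int k" by (simp add: inner_vec_def k_def)
  then have "wave m (int_vec n) = exp ((2 * of_int (- k) * of_real pi) * \<i>)"
    by (simp add: plane_wave_def mult_ac)
  also have "\<dots> = 1" using exp_integer_2pi[OF Ints_of_int[of "- k"]] by simp
  finally show ?thesis .
qed

lemma wave_periodic: "wave m (u + int_vec n) = wave m u"
proof -
  have "wave m (u + int_vec n) = wave m u * wave m (int_vec n)"
    by (metis plane_wave_sym plane_wave_add)
  then show ?thesis by simp
qed

lemma unit_cube_floor: "v - int_vec n \<in> unit_cube \<longleftrightarrow> n = (\<lambda>i. \<lfloor>v $ i\<rfloor>)"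
  unfolding unit_cube_def fun_eq_iff by (auto simp: floor_eq_iff eq_commute[of "n _"] algebra_simps)

text \<open>Unfolding of a periodised function. \<open>g n\<close> is \<open>h\<close> restricted to
  one tile: summing the tiles gives the integral over the whole space, while translating each tile
  back to the cube gives the integral of the periodisation \<open>P\<close>.\<close>

lemma integral_unit_cube_unfold:
  fixes h :: "real ^ 'n::finite \<Rightarrow> complex"
  assumes h: "integrable lborel h" and P: "\<And>u. ((\<lambda>n. h (u + int_vec n)) has_sum P u) UNIV"
  shows "(\<integral>u. indicator unit_cube u * P u \<partial>lborel) = (\<integral>u. h u \<partial>lborel)"
proof -
  have [measurable]: "h \<in> borel_measurable borel" using h by auto
  define g where "g n v = indicator unit_cube (v - int_vec n) * h v" for n and v :: "real ^ 'n"
  have gm [measurable]: "g n \<in> borel_measurable borel" for n unfolding g_def by measurable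
  have g: "((\<lambda>n. g n v) has_sum h v) UNIV" for v
    by (rule has_sum_finite_neutralI[of "{\<lambda>i. \<lfloor>v $ i\<rfloor>}"]) (auto simp: g_def indicator_def unit_cube_floor)
  have gb: "(\<Sum>n\<in>J. norm (g n v)) \<le> norm (h v)" if "finite J" for J v
  proof -
    have "(\<Sum>n\<in>J. norm (g n v)) = (\<Sum>n\<in>J. if n = (\<lambda>i. \<lfloor>v $ i\<rfloor>) then norm (h v) else 0)"
      by (intro sum.cong) (auto simp: g_def indicator_def unit_cube_floor)
    then show ?thesis using that by simp
  qed
  have gi: "integrable lborel (g n)" for n
    by (rule Bochner_Integration.integrable_bound[OF h]) (auto simp: g_def norm_mult indicator_def)
  have tr: "(\<integral>v. F (g n v) \<partial>lborel) = (\<integral>u. F (indicator unit_cube u * h (u + int_vec n)) \<partial>lborel)"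
    if [measurable]: "F \<in> borel_measurable borel" for F :: "complex \<Rightarrow> 'b::{banach, second_countable_topology}" and n
    using integral_lborel_translation[of "\<lambda>v. F (g n v)" "int_vec n"] by (simp add: g_def)
  have s1: "((\<lambda>n. \<integral>v. g n v \<partial>lborel) has_sum (\<integral>v. h v \<partial>lborel)) UNIV"
    by (rule has_sum_integral_dominated(2)[OF countable_int_vec, where B = "\<lambda>v. norm (h v)"])
       (use g gb h in auto)
  have s2: "((\<lambda>n. \<integral>u. indicator unit_cube u * h (u + int_vec n) \<partial>lborel) has_sum (\<integral>u. indicator unit_cube u * P u \<partial>lborel)) UNIV"
  proof (rule has_sum_integral(2)[OF countable_int_vec])
    show "integrable lborel (\<lambda>u. indicator unit_cube u * h (u + int_vec i))" for i
    proof -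
      have "integrable (distr lborel borel ((+) (int_vec i))) (g i)" using gi by (simp add: lborel_distr_plus)
      then have "integrable lborel (\<lambda>u. g i (int_vec i + u))"
        by (subst (asm) integrable_distr_eq) auto
      then show ?thesis by (simp add: g_def add.commute)
    qed
    show "(\<lambda>n. \<integral>u. norm (indicator unit_cube u * h (u + int_vec n)) \<partial>lborel) summable_on UNIV"
      unfolding tr[of norm, simplified, symmetric]
    proof (rule nonneg_bdd_above_summable_on)
      show "bdd_above (sum (\<lambda>n. \<integral>v. norm (g n v) \<partial>lborel) ` {F. F \<subseteq> UNIV \<and> finite F})"
      proof (rule bdd_aboveI2)
        fix J :: "('n \<Rightarrow> int) set" assume "J \<in> {F. F \<subseteq> UNIV \<and> finite F}"
        then have J: "finite J" by auto
        have "(\<Sum>n\<in>J. \<integral>v. norm (g n v) \<partial>lborel) = (\<integral>v. (\<Sum>n\<in>J. norm (g n v)) \<partial>lborel)"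
          by (rule Bochner_Integration.integral_sum[symmetric]) (intro integrable_norm gi)
        also have "\<dots> \<le> (\<integral>v. norm (h v) \<partial>lborel)"
          by (intro integral_mono Bochner_Integration.integrable_sum integrable_norm gi h gb J)
        finally show "(\<Sum>n\<in>J. \<integral>v. norm (g n v) \<partial>lborel) \<le> (\<integral>v. norm (h v) \<partial>lborel)" .
      qed
    qed simp
    show "((\<lambda>n. indicator unit_cube u * h (u + int_vec n)) has_sum indicator unit_cube u * P u) UNIV" for u
      by (intro has_sum_cmult_right P)
  qed
  have "(\<integral>v. g n v \<partial>lborel) = (\<integral>u. indicator unit_cube u * h (u + int_vec n) \<partial>lborel)" for n
    using tr[of "\<lambda>x. x" n] by simp
  then show ?thesis using has_sum_unique[OF s1] s2 by simp
qed

lemma integral_wave: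
  fixes m :: "'n::finite \<Rightarrow> int"
  shows "integrable lborel (\<lambda>u. indicator unit_cube u * wave m u)"
    and "(\<integral>u. indicator unit_cube u * wave m u \<partial>lborel) = (if m = (\<lambda>_. 0) then 1 else 0)"
proof -
  define f where "f i x = indicator {0..<1} x * exp (- 2 * of_real pi * \<i> * of_int (m i) * complex_of_real x)" for i x
  have eq: "indicator unit_cube u * wave m u = (\<Prod>i\<in>UNIV. f i (u $ i))" for u
  proof -
    have 1: "(indicator unit_cube u :: complex) = (\<Prod>i\<in>UNIV. indicator {0..<1} (u $ i))"
      by (auto simp: indicator_def unit_cube_def)
    have 2: "wave m u = (\<Prod>i\<in>UNIV. exp (- 2 * of_real pi * \<i> * of_int (m i) * complex_of_real (u $ i)))"
      by (subst exp_sum[symmetric]) (simp_all add: plane_wave_def inner_vec_def sum_distrib_left mult_ac)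
    show ?thesis unfolding 1 2 f_def by (simp add: prod.distrib)
  qed
  have fm: "f i \<in> borel_measurable borel" for i unfolding f_def by measurable
  have fi: "integrable lborel (f i)" for i
  proof (rule Bochner_Integration.integrable_bound)
    show "integrable lborel (indicator {0..<1} :: real \<Rightarrow> real)" by (rule integrable_real_indicator) auto
    have "norm (exp (- 2 * of_real pi * \<i> * of_int (m i) * complex_of_real x)) = 1" for x
    proof -
      have "- 2 * of_real pi * \<i> * of_int (m i) * complex_of_real x = \<i> * of_real (- 2 * pi * of_int (m i) * x)" by simp
      then show ?thesis by (simp only: norm_exp_i_times)
    qed
    then show "AE x in lborel. norm (f i x) \<le> norm (indicator {0..<1} x :: real)"
      by (auto intro!: AE_I2 simp: f_def norm_mult indicator_def)
  qed (use fm in simp)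
  have fint: "(\<integral>x. f i x \<partial>lborel) = (if m i = 0 then 1 else 0)" for i
  proof -
    define c where "c = - 2 * of_real pi * \<i> * of_int (m i)"
    have "(\<integral>x. f i x \<partial>lborel) = (LINT x:{0..1}|lborel. exp (c * of_real x))"
      unfolding set_lebesgue_integral_def f_def c_def
    proof (rule integral_cong_AE)
      have "AE x in lborel. x \<noteq> (1::real)" by (rule AE_lborel_singleton)
      then show "AE x in lborel. indicator {0..<1} x * exp (- 2 * of_real pi * \<i> * of_int (m i) * complex_of_real x) =
         indicator {0..1} x *\<^sub>R exp (- 2 * of_real pi * \<i> * of_int (m i) * complex_of_real x)"
        by eventually_elim (auto simp: indicator_def)
    qed (auto intro!: borel_measurable_continuous_onI continuous_intros)
    also have "\<dots> = (if m i = 0 then 1 else 0)"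
    proof (cases "m i = 0")
      case True
      then show ?thesis by (simp add: c_def set_lebesgue_integral_def)
    next
      case False
      then have c: "c \<noteq> 0" by (simp add: c_def)
      have "(LINT x:{0..1}|lborel. exp (c * of_real x)) = exp (c * of_real 1) / c - exp (c * of_real 0) / c"
        unfolding set_lebesgue_integral_def
      proof (rule integral_FTC_Icc[where F = "\<lambda>x. exp (c * of_real x) / c"])
        fix x :: real
        show "((\<lambda>x. exp (c * of_real x) / c) has_vector_derivative exp (c * of_real x)) (at x within {0..1})"
          by (rule has_vector_derivative_real_field) (use c in \<open>auto intro!: derivative_eq_intros\<close>)
      qed (auto intro!: continuous_intros)
      moreover have "exp c = 1"
        using exp_integer_2pi[OF Ints_of_int[of "- m i"]] by (simp add: c_def mult_ac)
      ultimately show ?thesis using False by simp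
    qed
    finally show ?thesis .
  qed
  show "integrable lborel (\<lambda>u. indicator unit_cube u * wave m u)" unfolding eq by (rule lborel_prod_vec(1)[OF fi])
  show "(\<integral>u. indicator unit_cube u * wave m u \<partial>lborel) = (if m = (\<lambda>_. 0) then 1 else 0)"
    unfolding eq lborel_prod_vec(2)[OF fi] fint by (auto simp: fun_eq_iff)
qed

section \<open>Trigonometric polynomials and uniqueness of Fourier coefficients on the torus\<close>

definition trig_poly :: "(complex \<times> ('n::finite \<Rightarrow> int)) list \<Rightarrow> real ^ 'n \<Rightarrow> complex" where
  "trig_poly l u = (\<Sum>(c, m)\<leftarrow>l. c * wave m u)"

lemma trig_poly_append: "trig_poly (k @ l) u = trig_poly k u + trig_poly l u"
  by (simp add: trig_poly_def)

lemma trig_poly_single: "c * wave m u * trig_poly l u = trig_poly (map (\<lambda>(d, n). (c * d, \<lambda>i. m i + n i)) l) u"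
  by (induction l) (auto simp: trig_poly_def wave_add algebra_simps)

text \<open>Frequencies may repeat in the list, so sums are concatenations and products require no
  collecting of equal frequencies.\<close>

lemma trig_poly_mult: "\<exists>j. \<forall>u. trig_poly k u * trig_poly l u = trig_poly j u"
proof (induction k)
  case Nil
  then show ?case by (intro exI[of _ "[]"]) (simp add: trig_poly_def)
next
  case (Cons a k)
  then obtain j where j: "\<And>u. trig_poly k u * trig_poly l u = trig_poly j u" by blast
  obtain c m where a: "a = (c, m)" by force
  have "trig_poly (a # k) u * trig_poly l u = c * wave m u * trig_poly l u + trig_poly k u * trig_poly l u" for u
    by (simp add: trig_poly_def a algebra_simps)
  then have "trig_poly (a # k) u * trig_poly l u = trig_poly (map (\<lambda>(d, n). (c * d, \<lambda>i. m i + n i)) l @ j) u" for u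
    by (simp add: j trig_poly_single trig_poly_append)
  then show ?case by blast
qed

lemma trig_poly_scale: "c * trig_poly l u = trig_poly (map (\<lambda>(d, n). (c * d, n)) l) u"
  by (induction l) (auto simp: trig_poly_def algebra_simps)

text \<open>Realises the torus as a compact subset of complex space, on which polynomial
  approximation in the sense of Stone and Weierstrass is available.\<close>

definition torus_map :: "real ^ 'n \<Rightarrow> complex ^ 'n" where
  "torus_map u = (\<chi> i. cis (2 * pi * u $ i))"

text \<open>Waves carry a minus sign in the exponent, hence frequency -1 for the coordinate itself
  and +1 for its conjugate.\<close>

lemma cis_eq_wave:
  fixes u :: "real ^ 'n::finite"
  shows "cis (2 * pi * u $ i) = wave (\<lambda>j. if j = i then -1 else 0) u"
    and "cnj (cis (2 * pi * u $ i)) = wave (\<lambda>j. if j = i then 1 else 0) u"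
proof -
  have *: "u \<bullet> int_vec (\<lambda>j. if j = i then k else 0) = of_int k * u $ i" for k
  proof -
    have "u \<bullet> int_vec (\<lambda>j. if j = i then k else 0) = (\<Sum>j\<in>UNIV. if j = i then of_int k * u $ j else 0)"
      unfolding inner_vec_def by (intro sum.cong) auto
    then show ?thesis by simp
  qed
  show "cis (2 * pi * u $ i) = wave (\<lambda>j. if j = i then -1 else 0) u"
    "cnj (cis (2 * pi * u $ i)) = wave (\<lambda>j. if j = i then 1 else 0) u"
    by (simp_all only: plane_wave_def *) (simp_all add: cis_conv_exp exp_cnj mult_ac)
qed

text \<open>Induction over the generation of real polynomials. A linear functional is a combination
  of the real and imaginary parts of the coordinates, and on the torus these are combinations of the
  waves of frequency +1 and -1 in one coordinate.\<close>

lemma trig_poly_real_polynomial_function: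
  fixes r :: "complex ^ 'n::finite \<Rightarrow> real"
  assumes "real_polynomial_function r"
  shows "\<exists>l. \<forall>u. of_real (r (torus_map u)) = trig_poly l u"
  using assms
proof induction
  case (linear f)
  interpret f: bounded_linear f by fact
  have expand: "(v::complex ^ 'n) = (\<Sum>i\<in>UNIV. Re (v $ i) *\<^sub>R axis i 1 + Im (v $ i) *\<^sub>R axis i \<i>)" for v
  proof (simp add: vec_eq_iff, intro allI)
    fix j
    have "(\<Sum>i\<in>UNIV. Re (v $ i) *\<^sub>R axis i 1 $ j + Im (v $ i) *\<^sub>R axis i \<i> $ j) = (\<Sum>i\<in>UNIV. if i = j then v $ i else 0)"
      by (intro sum.cong) (auto simp: axis_def complex_eq_iff)
    then show "v $ j = (\<Sum>i\<in>UNIV. Re (v $ i) *\<^sub>R axis i 1 $ j + Im (v $ i) *\<^sub>R axis i \<i> $ j)" by simp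
  qed
  have f: "f v = (\<Sum>i\<in>UNIV. Re (v $ i) * f (axis i 1) + Im (v $ i) * f (axis i \<i>))" for v
    by (subst expand) (simp add: f.sum f.add f.scaleR)
  define t where "t i = [((f (axis i 1) - \<i> * f (axis i \<i>)) / 2, \<lambda>j. if j = i then -1 else 0 :: int),
     ((f (axis i 1) + \<i> * f (axis i \<i>)) / 2, \<lambda>j. if j = i then 1 else 0)]" for i
  have t: "of_real (Re (torus_map u $ i) * f (axis i 1) + Im (torus_map u $ i) * f (axis i \<i>)) = trig_poly (t i) u" for u i
    by (simp add: t_def trig_poly_def cis_eq_wave[symmetric] torus_map_def complex_eq_iff field_simps)
  have "\<exists>l. \<forall>u. (\<Sum>i\<in>I. trig_poly (t i) u) = trig_poly l u" for I
  proof (induction I rule: infinite_finite_induct)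
    case (insert i I)
    then obtain l where "\<And>u. (\<Sum>i\<in>I. trig_poly (t i) u) = trig_poly l u" by blast
    then show ?case using insert by (intro exI[of _ "t i @ l"]) (simp add: trig_poly_append)
  qed (auto intro!: exI[of _ "[]"] simp: trig_poly_def)
  moreover have "of_real (f (torus_map u)) = (\<Sum>i\<in>UNIV. trig_poly (t i) u)" for u
    by (subst f) (simp only: of_real_sum t)
  ultimately show ?case by metis
next
  case (const c)
  have "(int_vec (\<lambda>_. 0) :: real ^ 'n) = 0" by (simp add: int_vec_def vec_eq_iff)
  then show ?case
    by (intro exI[of _ "[(of_real c, \<lambda>_. 0)]"]) (simp add: trig_poly_def plane_wave_def)
next
  case (add f g)
  then obtain k l where "\<And>u. of_real (f (torus_map u)) = trig_poly k u" "\<And>u. of_real (g (torus_map u)) = trig_poly l u" by blast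
  then show ?case by (intro exI[of _ "k @ l"]) (simp add: trig_poly_append)
next
  case (mult f g)
  then obtain k l where "\<And>u. of_real (f (torus_map u)) = trig_poly k u" "\<And>u. of_real (g (torus_map u)) = trig_poly l u" by blast
  then show ?case using trig_poly_mult[of k l] by simp
qed

lemma trig_poly_polynomial_function:
  fixes p :: "complex ^ 'n::finite \<Rightarrow> complex"
  assumes "polynomial_function p"
  shows "\<exists>l. \<forall>u. p (torus_map u) = trig_poly l u"
proof -
  have "real_polynomial_function (Re \<circ> p)" "real_polynomial_function (Im \<circ> p)"
    using assms bounded_linear_Re bounded_linear_Im unfolding polynomial_function_def by auto
  then obtain k l where k: "\<And>u. of_real ((Re \<circ> p) (torus_map u)) = trig_poly k u"
    and l: "\<And>u. of_real ((Im \<circ> p) (torus_map u)) = trig_poly l u"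
    using trig_poly_real_polynomial_function by meson
  have "p (torus_map u) = trig_poly k u + \<i> * trig_poly l u" for u
    using complex_eq[of "p (torus_map u)"] by (simp flip: k l)
  then show ?thesis by (metis trig_poly_append trig_poly_scale)
qed

text \<open>\<open>D\<close> is orthogonal to every trigonometric polynomial, and its conjugate is a
  uniform limit of such. Hence the integral of |D|^2 is at most e times the integral of |D| for
  every e > 0, so it vanishes, and continuity gives D = 0.\<close>

lemma periodic_fourier_unique:
  fixes D :: "real ^ 'n::finite \<Rightarrow> complex"
  assumes cont: "continuous_on UNIV D" and per: "\<And>u n. D (u + int_vec n) = D u"
    and zero: "\<And>m. (\<integral>u. indicator unit_cube u * (D u * wave m u) \<partial>lborel) = 0"
  shows "D u = 0"
proof -
  define C :: "(real ^ 'n) set" where "C = cbox 0 (\<chi> i. 1)"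
  have C: "u \<in> C \<longleftrightarrow> (\<forall>i. 0 \<le> u $ i \<and> u $ i \<le> 1)" for u by (simp add: C_def mem_box_cart)
  have sub: "unit_cube \<subseteq> C" by (auto simp: unit_cube_def C less_imp_le)
  have eqD: "D u = D v" if "torus_map u = torus_map v" for u v
  proof -
    have "\<exists>k::int. u $ i = v $ i + of_int k" for i
    proof -
      have "cis (2 * pi * u $ i) = cis (2 * pi * v $ i)" using that by (simp add: torus_map_def vec_eq_iff)
      then obtain k :: int where "\<i> * of_real (2 * pi * u $ i) = \<i> * of_real (2 * pi * v $ i) + of_real (of_int (2 * k) * pi) * \<i>"
        unfolding cis_conv_exp exp_eq by blast
      then have "Im (\<i> * of_real (2 * pi * u $ i)) = Im (\<i> * of_real (2 * pi * v $ i) + of_real (of_int (2 * k) * pi) * \<i>)" by simp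
      then have "2 * pi * u $ i = 2 * pi * v $ i + 2 * pi * of_int k" by simp
      then have "2 * pi * u $ i = 2 * pi * (v $ i + of_int k)" by (simp add: distrib_left)
      then show ?thesis by auto
    qed
    then have "\<forall>i. \<exists>k::int. u $ i = v $ i + of_int k" by blast
    from choice[OF this] obtain n where "\<And>i. u $ i = v $ i + of_int (n i)" by blast
    then have "u = v + int_vec n" by (simp add: vec_eq_iff)
    then show ?thesis using per by simp
  qed
  \<comment> \<open>The conjugate of \<open>D\<close> viewed as a function on the torus; by
    \<open>eqD\<close> the preimage picked by \<open>inv_into\<close> does not matter.\<close>
  define g where "g v = cnj (D (inv_into C torus_map v))" for v
  have g: "g (torus_map u) = cnj (D u)" if "u \<in> C" for u
  proof -
    have "torus_map (inv_into C torus_map (torus_map u)) = torus_map u" using that by (intro f_inv_into_f) auto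
    then show ?thesis unfolding g_def using eqD by metis
  qed
  have ctm: "continuous_on S torus_map" for S :: "(real ^ 'n) set"
    unfolding torus_map_def cis_conv_exp by (intro continuous_intros continuous_on_vec_lambda)
  have compC: "compact C" by (simp add: C_def)
  have compT: "compact (torus_map ` C)" by (intro compact_continuous_image ctm compC)
  \<comment> \<open>A preimage of a closed set under \<open>g\<close> is the image under
    \<open>torus_map\<close> of a closed part of the compact cube, so it is compact and therefore
    closed.\<close>
  have cg: "continuous_on (torus_map ` C) g"
    unfolding continuous_on_closed_vimage[OF compact_imp_closed[OF compT]]
  proof (intro allI impI)
    fix B :: "complex set" assume B: "closed B"
    have "g -` B \<inter> torus_map ` C = torus_map ` (C \<inter> (\<lambda>u. cnj (D u)) -` B)" using g by auto
    moreover have "closed ((\<lambda>u. cnj (D u)) -` B)"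
      using B by (intro closed_vimage continuous_intros cont)
    ultimately show "closed (g -` B \<inter> torus_map ` C)"
      using compC by (metis compact_Int_closed compact_continuous_image compact_imp_closed ctm)
  qed
  have bC: "C \<in> sets borel" unfolding C_def by simp
  have [measurable]: "D \<in> borel_measurable borel" using cont by (rule borel_measurable_continuous_onI)
  have intC: "integrable lborel (\<lambda>u. indicator C u * F u)" if "continuous_on UNIV F" for F :: "real ^ 'n \<Rightarrow> complex"
  proof -
    have "(\<lambda>u. indicator C u * F u) = (\<lambda>u. indicator C u *\<^sub>R F u)" by (auto simp: indicator_def)
    then show ?thesis using borel_integrable_compact[OF compC continuous_on_subset[OF that]] by simp
  qed
  have intU: "integrable lborel (\<lambda>u. indicator unit_cube u * F u)" if "continuous_on UNIV F" for F :: "real ^ 'n \<Rightarrow> complex"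
  proof (rule Bochner_Integration.integrable_bound[OF intC[OF that]])
    show "AE u in lborel. norm (indicator unit_cube u * F u) \<le> norm (indicator C u * F u)"
      using sub by (auto simp: indicator_def intro!: AE_I2)
    have [measurable]: "F \<in> borel_measurable borel" using that by (rule borel_measurable_continuous_onI)
    show "(\<lambda>u. indicator unit_cube u * F u) \<in> borel_measurable lborel" by measurable
  qed
  define I where "I = (\<integral>u. indicator unit_cube u * (D u * cnj (D u)) \<partial>lborel)"
  define A where "A = (\<integral>u. norm (indicator unit_cube u * D u) \<partial>lborel)"
  have "norm I \<le> e * A" if e: "e > 0" for e
  proof -
    obtain p where p: "polynomial_function p" "\<And>v. v \<in> torus_map ` C \<Longrightarrow> norm (g v - p v) < e"
      using Stone_Weierstrass_polynomial_function[OF compT cg e] by blast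
    obtain l where l: "\<And>u. p (torus_map u) = trig_poly l u" using trig_poly_polynomial_function[OF p(1)] by blast
    have ctp: "continuous_on UNIV (\<lambda>u. trig_poly l u)" for l :: "(complex \<times> ('n \<Rightarrow> int)) list"
      by (induction l) (auto simp: trig_poly_def intro!: continuous_intros)
    have "(\<integral>u. indicator unit_cube u * (D u * trig_poly l u) \<partial>lborel) = 0" for l
    proof (induction l)
      case (Cons a l)
      obtain c m where a: "a = (c, m)" by force
      have "(\<integral>u. indicator unit_cube u * (D u * trig_poly (a # l) u) \<partial>lborel) =
         (\<integral>u. c * (indicator unit_cube u * (D u * wave m u)) + indicator unit_cube u * (D u * trig_poly l u) \<partial>lborel)"
        by (simp add: a trig_poly_def algebra_simps)
      also have "\<dots> = c * (\<integral>u. indicator unit_cube u * (D u * wave m u) \<partial>lborel) + (\<integral>u. indicator unit_cube u * (D u * trig_poly l u) \<partial>lborel)"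
        by (subst Bochner_Integration.integral_add) (auto intro!: integrable_mult_right intU continuous_intros cont ctp)
      finally show ?case using Cons zero by simp
    qed (simp add: trig_poly_def)
    then have "I = (\<integral>u. indicator unit_cube u * (D u * cnj (D u)) \<partial>lborel) - (\<integral>u. indicator unit_cube u * (D u * trig_poly l u) \<partial>lborel)"
      by (simp add: I_def)
    also have "\<dots> = (\<integral>u. indicator unit_cube u * (D u * cnj (D u)) - indicator unit_cube u * (D u * trig_poly l u) \<partial>lborel)"
      by (rule Bochner_Integration.integral_diff[symmetric]) (auto intro!: intU continuous_intros cont ctp)
    finally have "norm I \<le> (\<integral>u. norm (indicator unit_cube u * (D u * cnj (D u)) - indicator unit_cube u * (D u * trig_poly l u)) \<partial>lborel)"
      by simp
    also have "\<dots> \<le> (\<integral>u. e * norm (indicator unit_cube u * D u) \<partial>lborel)"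
    proof (rule integral_mono)
      fix u
      show "norm (indicator unit_cube u * (D u * cnj (D u)) - indicator unit_cube u * (D u * trig_poly l u)) \<le> e * norm (indicator unit_cube u * D u)"
      proof (cases "u \<in> unit_cube")
        case True
        then have "norm (cnj (D u) - trig_poly l u) < e" using p(2)[of "torus_map u"] sub g l by auto
        then have "norm (D u) * norm (cnj (D u) - trig_poly l u) \<le> norm (D u) * e" by (intro mult_left_mono) auto
        then show ?thesis using True by (simp add: norm_mult[symmetric] right_diff_distrib mult.commute)
      qed simp
    qed (auto intro!: integrable_norm integrable_mult_right Bochner_Integration.integrable_diff intU continuous_intros cont ctp)
    finally show ?thesis by (simp add: A_def)
  qed
  then have "norm I \<le> 0"
  proof -
    have A: "A \<ge> 0" by (simp add: A_def)
    have "norm I \<le> 0 + e" if "e > 0" for e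
    proof -
      have "norm I \<le> e / (A + 1) * A" by (rule \<open>\<And>e. e > 0 \<Longrightarrow> norm I \<le> e * A\<close>) (use that A in auto)
      also have "\<dots> \<le> e" using that A by (simp add: field_simps)
      finally show ?thesis by simp
    qed
    then show ?thesis by (rule field_le_epsilon)
  qed
  moreover have "I = of_real (\<integral>u. indicator unit_cube u * (norm (D u))\<^sup>2 \<partial>lborel)"
    unfolding I_def integral_complex_of_real[symmetric]
    by (intro Bochner_Integration.integral_cong) (auto simp: complex_norm_square[symmetric] indicator_def)
  ultimately have "complex_of_real (\<integral>u. indicator unit_cube u * (norm (D u))\<^sup>2 \<partial>lborel) = 0"
    by (metis norm_le_zero_iff)
  then have "(\<integral>u. indicator unit_cube u * (norm (D u))\<^sup>2 \<partial>lborel) = 0" by (simp only: of_real_eq_0_iff)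
  \<comment> \<open>The half-open and the closed cube differ by part of the boundary, a null set.
    The closed cube is needed to infer vanishing of a continuous nonnegative integrand.\<close>
  moreover have "(\<integral>u. indicator unit_cube u * (norm (D u))\<^sup>2 \<partial>lborel) = (LINT u:C|lborel. (norm (D u))\<^sup>2)"
    unfolding set_lebesgue_integral_def
  proof (rule integral_cong_AE)
    have "negligible (cbox 0 (\<chi> i. 1) - box 0 (\<chi> i. 1) :: (real ^ 'n) set)" by (rule negligible_frontier_interval)
    then have "cbox 0 (\<chi> i. 1) - box 0 (\<chi> i. 1) \<in> null_sets (lborel :: (real ^ 'n) measure)"
      by (simp add: negligible_iff_null_sets null_sets_completion_iff)
    then have "AE u in lborel. u \<notin> (cbox 0 (\<chi> i. 1) - box 0 (\<chi> i. 1) :: (real ^ 'n) set)"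
      by (rule AE_not_in)
    then show "AE u in lborel. indicator unit_cube u * (norm (D u))\<^sup>2 = indicator C u *\<^sub>R (norm (D u))\<^sup>2"
    proof eventually_elim
      case (elim u)
      then have "u \<in> unit_cube \<longleftrightarrow> u \<in> C" using sub
        by (auto simp: C_def unit_cube_def mem_box_cart less_imp_le)
      then show ?case by (simp add: indicator_def)
    qed
  qed (use bC in measurable)
  ultimately have i0: "(LINT u:C|lborel. (norm (D u))\<^sup>2) = 0" by simp
  have si: "set_integrable lborel C (\<lambda>u. (norm (D u))\<^sup>2)"
    unfolding set_integrable_def
    by (rule borel_integrable_compact[OF compC]) (intro continuous_intros continuous_on_subset[OF cont] subset_UNIV)
  have DC: "D u = 0" if "u \<in> C" for u
  proof -
    have "((\<lambda>u. (norm (D u))\<^sup>2) has_integral 0) (cbox 0 (\<chi> i. 1))"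
      using set_borel_integral_eq_integral[OF si] i0 by (metis C_def integrable_integral)
    moreover have "(\<chi> i. 1 / 2) \<in> (box 0 (\<chi> i. 1) :: (real ^ 'n) set)" by (simp add: mem_box_cart)
    moreover have "continuous_on (cbox 0 (\<chi> i. 1)) (\<lambda>u. (norm (D u))\<^sup>2)"
      by (intro continuous_intros continuous_on_subset[OF cont] subset_UNIV)
    ultimately have "(norm (D u))\<^sup>2 = 0"
      using that by (intro has_integral_0_cbox_imp_0[of 0 "\<chi> i. 1" "\<lambda>u. (norm (D u))\<^sup>2"]) (auto simp: C_def)
    then show ?thesis by simp
  qed
  define n where "n = (\<lambda>i. \<lfloor>u $ i\<rfloor>)"
  have "u - int_vec n \<in> C" using sub unit_cube_floor[of u n] by (auto simp: n_def)
  then have "D (u - int_vec n) = 0" by (rule DC)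
  then show ?thesis using per[of "u - int_vec n" n] by simp
qed

lemma summable_on_bounded:
  fixes f :: "'i \<Rightarrow> complex"
  assumes "B summable_on I" "\<And>i. i \<in> I \<Longrightarrow> norm (f i) \<le> B i"
  shows "f summable_on I"
  by (rule abs_summable_summable, rule summable_on_comparison_test[OF assms(1)]) (use assms(2) in auto)

lemma integrable_count_space_summable:
  fixes B :: "'i \<Rightarrow> real"
  assumes "B summable_on I"
  shows "integrable (count_space I) B"
proof -
  have "(\<lambda>x. norm (B x)) summable_on I" using assms summable_on_iff_abs_summable_on_real by blast
  then show ?thesis by (simp only: abs_summable_equivalent Infinite_Set_Sum.abs_summable_on_def)
qed

lemma continuous_on_infsum:
  fixes K :: "'i \<Rightarrow> real ^ 'n::finite \<Rightarrow> complex"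
  assumes cont: "\<And>i. continuous_on UNIV (K i)"
    and B: "\<And>x. B x summable_on UNIV" and le: "\<And>x y i. y \<in> ball x 1 \<Longrightarrow> norm (K i y) \<le> B x i"
  shows "continuous_on UNIV (\<lambda>y. \<Sum>\<^sub>\<infinity>i. K i y)"
  unfolding continuous_on_eq_continuous_at[OF open_UNIV]
proof
  fix x :: "real ^ 'n"
  have eq: "(\<Sum>\<^sub>\<infinity>i. K i y) = (\<integral>i. K i y \<partial>count_space UNIV)" for y
  proof -
    have "(\<lambda>i. K i y) summable_on UNIV" by (rule summable_on_bounded[OF B[of y]]) (use le in simp)
    then show ?thesis by (intro integral_count_space_has_sum(2)[symmetric] has_sum_infsum)
  qed
  show "isCont (\<lambda>y. \<Sum>\<^sub>\<infinity>i. K i y) x"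
    unfolding eq
  proof (rule isCont_integral[where r = 1 and B = "B x"])
    show "isCont (\<lambda>y. K w y) x" for w using cont[of w] by (simp add: continuous_on_eq_continuous_at)
  qed (use le B in \<open>auto intro: integrable_count_space_summable\<close>)
qed

section \<open>The dual lattice and Poisson summation for Gaussians\<close>

abbreviation dual_matrix :: "real ^ 'n ^ 'n \<Rightarrow> real ^ 'n ^ 'n" where
  "dual_matrix M \<equiv> transpose (matrix_inv M)"

lemma dual_matrix_inner:
  assumes "invertible M"
  shows "(M *v x) \<bullet> (dual_matrix M *v y) = x \<bullet> y"
proof -
  have "(M *v x) \<bullet> (dual_matrix M *v y) = (y v* matrix_inv M) \<bullet> (M *v x)"
    by (simp add: transpose_matrix_vector inner_commute)
  also have "\<dots> = y \<bullet> ((matrix_inv M ** M) *v x)" by (simp add: dot_lmul_matrix matrix_vector_mul_assoc)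
  finally show ?thesis by (simp add: matrix_inv[OF assms] inner_commute)
qed

lemma dual_matrix_surj:
  assumes "invertible M"
  shows "dual_matrix M *v (transpose M *v x) = x" "transpose M *v (dual_matrix M *v x) = x"
  by (simp_all only: matrix_vector_mul_assoc matrix_transpose_mul[symmetric] matrix_inv[OF assms] transpose_mat matrix_vector_mul_lid)

lemma det_dual_matrix:
  assumes "invertible M"
  shows "det (dual_matrix M) = inverse (det M)"
  using matrix_inv[OF assms] by (metis det_I det_mul det_transpose inverse_unique mult.commute)

lemma invertible_dual_matrix: "invertible M \<Longrightarrow> invertible (dual_matrix M)"
  using det_dual_matrix by (metis invertible_det_nz nonzero_imp_inverse_nonzero)

text \<open>In coordinates u with x = A u, where A is the dual matrix, both sides are continuous and
  periodic under integer translations. Their Fourier coefficients agree: those of the periodised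
  Gaussian \<open>P\<close> by unfolding, those of the wave series \<open>Q\<close> by
  orthogonality.\<close>

theorem gaussian_poisson:
  fixes M :: "real ^ 'n ^ 'n"
  assumes M: "invertible M" and t: "t > 0"
  shows "((\<lambda>m. of_real (exp (- pi * t * norm (M *v int_vec m) ^ 2)) * plane_wave x (M *v int_vec m)) has_sum
    of_real (1 / (\<bar>det M\<bar> * sqrt t ^ CARD('n))) *
      (\<Sum>\<^sub>\<infinity>n. of_real (exp (- pi * norm (x + dual_matrix M *v int_vec n) ^ 2 / t)))) UNIV"
proof -
  define A where "A = dual_matrix M"
  note A = invertible_dual_matrix[OF M, folded A_def]
  have d: "det M \<noteq> 0" using M by (simp add: invertible_det_nz)
  define q where "q m = complex_of_real (exp (- (pi * t) * norm (M *v int_vec m) ^ 2))" for m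
  define h where "h u = complex_of_real (exp (- (pi / t) * norm (A *v u) ^ 2))" for u
  define P where "P u = (\<Sum>\<^sub>\<infinity>n. h (u + int_vec n))" for u
  define Q where "Q u = (\<Sum>\<^sub>\<infinity>m. q m * wave m u)" for u
  have bl: "bounded_linear ((*v) A)" by (rule matrix_vector_mul_bounded_linear)
  have hb: "norm (h (u + int_vec n)) \<le> exp (pi / t * norm (A *v u) ^ 2) * exp (- (pi / t / 2) * norm (A *v int_vec n) ^ 2)" for u n
    unfolding h_def matrix_vector_right_distrib using gaussian_shift_bound[of "pi / t" "A *v u" "A *v int_vec n"] t by simp
  have sA: "(\<lambda>n. c * exp (- (pi / t / 2) * norm (A *v int_vec n) ^ 2)) summable_on UNIV" for c
    by (intro summable_on_cmult_right summable_on_lattice_gaussian A) (use t in simp)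
  have hP: "((\<lambda>n. h (u + int_vec n)) has_sum P u) UNIV" for u
    unfolding P_def by (intro has_sum_infsum summable_on_bounded[OF sA hb])
  have sM: "(\<lambda>m. exp (- (pi * t) * norm (M *v int_vec m) ^ 2)) summable_on UNIV"
    by (intro summable_on_lattice_gaussian M) (use t in simp)
  have hQ: "((\<lambda>m. q m * wave m u) has_sum Q u) UNIV" for u
    unfolding Q_def by (intro has_sum_infsum summable_on_bounded[OF sM]) (simp add: q_def norm_mult)
  have ch: "continuous_on UNIV h" unfolding h_def
    by (intro continuous_intros linear_continuous_on[OF bl])
  obtain K where K: "K > 0" "\<And>u. norm (A *v u) \<le> norm u * K" using bounded_linear.pos_bounded[OF bl] by blast
  have cP: "continuous_on UNIV P" unfolding P_def
  proof (rule continuous_on_infsum)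
    show "(\<lambda>n. exp (pi / t * ((norm x + 1) * K) ^ 2) * exp (- (pi / t / 2) * norm (A *v int_vec n) ^ 2)) summable_on UNIV" for x :: "real ^ 'n"
      by (rule sA)
    fix x y :: "real ^ 'n" and n assume y: "y \<in> ball x 1"
    have "norm y \<le> norm x + 1" using y norm_triangle_ineq2[of y x] by (simp add: dist_norm norm_minus_commute)
    then have "norm (A *v y) \<le> (norm x + 1) * K" using K by (meson mult_right_mono order_trans less_imp_le)
    then have "pi / t * norm (A *v y) ^ 2 \<le> pi / t * ((norm x + 1) * K) ^ 2" using t by (intro mult_left_mono power_mono) auto
    then show "norm (h (y + int_vec n)) \<le> exp (pi / t * ((norm x + 1) * K) ^ 2) * exp (- (pi / t / 2) * norm (A *v int_vec n) ^ 2)"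
      by (intro order_trans[OF hb] mult_right_mono) auto
  next
    show "continuous_on UNIV (\<lambda>u. h (u + int_vec i))" for i
      by (rule continuous_on_compose2[OF ch]) (auto intro!: continuous_intros)
  qed
  have cQ: "continuous_on UNIV Q" unfolding Q_def
    by (rule continuous_on_infsum[OF _ sM]) (auto simp: q_def norm_mult intro!: continuous_intros)
  have per_h: "P (u + int_vec n) = P u" for u n
  proof -
    have "bij (\<lambda>m i. m i + n i)" for n :: "'n \<Rightarrow> int"
      by (rule bij_betw_byWitness[where f' = "\<lambda>m i. m i - n i"]) auto
    from infsum_reindex_bij_betw[OF this, of "\<lambda>m. h (u + int_vec m)" n]
    show ?thesis by (simp add: P_def int_vec_add add_ac)
  qed
  define c where "c = \<bar>det M\<bar> * sqrt t ^ CARD('n)"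
  have c: "c > 0" using d t by (simp add: c_def)
  have hint: "integrable lborel (\<lambda>u. h u * wave m u)"
    and hfour: "(\<integral>u. h u * wave m u \<partial>lborel) = of_real (c * exp (- (pi * t) * norm (M *v int_vec m) ^ 2))" for m
  proof -
    define f where "f x = plane_wave (M *v int_vec m) x * complex_of_real (exp (- pi * (1 / t) * norm x ^ 2))" for x
    have ti: "1 / t > 0" using t by simp
    note gf = gaussian_fourier[OF ti, of "M *v int_vec m", folded f_def]
    have "plane_wave (M *v int_vec m) (A *v u) = wave m u" for u
      using dual_matrix_inner[OF M, of "int_vec m" u] by (simp add: plane_wave_def A_def inner_commute)
    then have fA: "f (A *v u) = h u * wave m u" for u by (simp add: f_def h_def)
    show "integrable lborel (\<lambda>u. h u * wave m u)" using integral_lborel_linear(1)[OF A gf(1)] by (simp add: fA)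
    have "(\<integral>x. f x \<partial>lborel) = of_real \<bar>det A\<bar> * (\<integral>u. h u * wave m u \<partial>lborel)"
      using integral_lborel_linear(2)[OF A gf(1)] by (simp add: fA)
    then have "(\<integral>x. f x \<partial>lborel) = of_real \<bar>inverse (det M)\<bar> * (\<integral>u. h u * wave m u \<partial>lborel)"
      by (simp only: A_def det_dual_matrix[OF M])
    then have "(\<integral>u. h u * wave m u \<partial>lborel) = of_real \<bar>det M\<bar> * (\<integral>x. f x \<partial>lborel)"
      using d by (simp add: abs_inverse)
    then show "(\<integral>u. h u * wave m u \<partial>lborel) = of_real (c * exp (- (pi * t) * norm (M *v int_vec m) ^ 2))"
      using t unfolding gf(2) by (simp add: c_def real_sqrt_divide power_divide)
  qed
  define D where "D u = P u - of_real c * Q u" for u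
  have D0: "D u = 0" for u
  proof (rule periodic_fourier_unique)
    show "continuous_on UNIV D" unfolding D_def by (intro continuous_intros cP cQ)
    show "D (u + int_vec n) = D u" for u n by (simp add: D_def per_h Q_def wave_periodic)
    fix k :: "'n \<Rightarrow> int"
    have unf: "((\<lambda>n. h (u + int_vec n) * wave k (u + int_vec n)) has_sum P u * wave k u) UNIV" for u
      unfolding wave_periodic by (intro has_sum_cmult_left hP)
    have 1: "(\<integral>u. indicator unit_cube u * (P u * wave k u) \<partial>lborel) = of_real (c * exp (- (pi * t) * norm (M *v int_vec k) ^ 2))"
      using integral_unit_cube_unfold[OF hint unf] hfour by simp
    define K where "K m u = q m * (indicator unit_cube u * wave (\<lambda>i. m i + k i) u)" for m and u :: "real ^ 'n"
    have "((\<lambda>m. \<integral>u. K m u \<partial>lborel) has_sum (\<integral>u. indicator unit_cube u * (Q u * wave k u) \<partial>lborel)) UNIV"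
    proof (rule has_sum_integral(2)[OF countable_int_vec])
      show "integrable lborel (K m)" for m unfolding K_def by (intro integrable_mult_right integral_wave(1))
      show "((\<lambda>m. K m u) has_sum indicator unit_cube u * (Q u * wave k u)) UNIV" for u
        using has_sum_cmult_right[OF has_sum_cmult_left[OF hQ[of u], of "wave k u"], of "indicator unit_cube u"]
        by (simp add: K_def wave_add mult_ac)
      show "(\<lambda>m. \<integral>u. norm (K m u) \<partial>lborel) summable_on UNIV"
      proof (rule summable_on_comparison_test)
        show "(\<lambda>m. exp (- (pi * t) * norm (M *v int_vec m) ^ 2) * (\<integral>u. norm (indicator unit_cube u * wave (\<lambda>i. 0) (u :: real ^ 'n)) \<partial>lborel)) summable_on UNIV"
          by (intro summable_on_cmult_left sM)
        show "(\<integral>u. norm (K m u) \<partial>lborel) \<le> exp (- (pi * t) * norm (M *v int_vec m) ^ 2) * (\<integral>u. norm (indicator unit_cube u * wave (\<lambda>i. 0) (u :: real ^ 'n)) \<partial>lborel)" for m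
          by (simp add: K_def norm_mult q_def)
      qed auto
    qed
    \<comment> \<open>The coefficient is tested with the wave itself rather than its conjugate, so
      orthogonality singles out frequency -k; \<open>q\<close> is even.\<close>
    moreover have "(\<integral>u. K m u \<partial>lborel) = (if m = (\<lambda>i. - k i) then q m else 0)" for m
      by (auto simp: K_def integral_wave(2) fun_eq_iff add_eq_0_iff2)
    moreover have "((\<lambda>m. if m = (\<lambda>i. - k i) then q m else 0) has_sum q (\<lambda>i. - k i)) UNIV"
      by (rule has_sum_finite_neutralI[of "{\<lambda>i. - k i}"]) auto
    ultimately have 2: "(\<integral>u. indicator unit_cube u * (Q u * wave k u) \<partial>lborel) = q (\<lambda>i. - k i)"
      using has_sum_unique by fastforce
    have "int_vec (\<lambda>i. - k i) = - int_vec k" by (simp add: int_vec_def vec_eq_iff)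
    then have q: "q (\<lambda>i. - k i) = of_real (exp (- (pi * t) * norm (M *v int_vec k) ^ 2))"
      by (simp add: q_def linear_neg[OF matrix_vector_mul_linear])
    have int: "integrable lborel (\<lambda>u. indicator unit_cube u * (F u * wave k u))" if F: "continuous_on UNIV F" for F
    proof -
      have cpt: "compact (cbox 0 (\<chi> i. 1) :: (real ^ 'n) set)" by simp
      have "integrable lborel (\<lambda>u. indicator (cbox 0 (\<chi> i. 1)) u *\<^sub>R (F u * wave k u))"
        by (rule borel_integrable_compact[OF cpt]) (auto intro!: continuous_intros continuous_on_subset[OF F])
      then show ?thesis
      proof (rule Bochner_Integration.integrable_bound)
        have [measurable]: "F \<in> borel_measurable borel" using F by (rule borel_measurable_continuous_onI)
        show "(\<lambda>u. indicator unit_cube u * (F u * wave k u)) \<in> borel_measurable lborel" by measurable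
      qed (auto simp: indicator_def unit_cube_def mem_box_cart less_imp_le intro!: AE_I2)
    qed
    have "(\<integral>u. indicator unit_cube u * (D u * wave k u) \<partial>lborel) =
        (\<integral>u. indicator unit_cube u * (P u * wave k u) - of_real c * (indicator unit_cube u * (Q u * wave k u)) \<partial>lborel)"
      by (intro Bochner_Integration.integral_cong) (auto simp: D_def algebra_simps)
    also have "\<dots> = (\<integral>u. indicator unit_cube u * (P u * wave k u) \<partial>lborel) - of_real c * (\<integral>u. indicator unit_cube u * (Q u * wave k u) \<partial>lborel)"
      by (subst Bochner_Integration.integral_diff) (auto intro!: integrable_mult_right int cP cQ)
    finally show "(\<integral>u. indicator unit_cube u * (D u * wave k u) \<partial>lborel) = 0" by (simp add: 1 2 q)
  qed
  \<comment> \<open>The coordinates of \<open>x\<close> with respect to the dual basis.\<close>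
  define u where "u = transpose M *v x"
  have x: "x = A *v u" unfolding u_def A_def by (rule dual_matrix_surj(1)[OF M, symmetric])
  have "plane_wave x (M *v int_vec m) = wave m u" for m
    unfolding x using dual_matrix_inner[OF M, of "int_vec m" u] by (simp add: plane_wave_def A_def inner_commute)
  then have "((\<lambda>m. of_real (exp (- pi * t * norm (M *v int_vec m) ^ 2)) * plane_wave x (M *v int_vec m)) has_sum Q u) UNIV"
    using hQ[of u] by (simp add: q_def mult.assoc)
  moreover have "Q u = of_real (1 / c) * P u" using D0[of u] c by (simp add: D_def field_simps)
  moreover have "P u = (\<Sum>\<^sub>\<infinity>n. of_real (exp (- pi * norm (x + A *v int_vec n) ^ 2 / t)))"
    by (simp add: P_def h_def x matrix_vector_right_distrib)
  ultimately show ?thesis by (simp add: c_def A_def)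
qed

section \<open>Polar coordinates and the Mellin integral of the Gaussian\<close>

lemma powr_of_real_pos: "r > 0 \<Longrightarrow> complex_of_real r powr a = exp (a * of_real (ln r))"
  by (simp add: powr_def Ln_of_real)

lemma norm_powr_of_real: "r \<ge> 0 \<Longrightarrow> norm (complex_of_real r powr a) = r powr Re a"
  by (simp add: norm_powr_real_powr)

lemma borel_measurable_powr_of_real [measurable]:
  assumes [measurable]: "f \<in> borel_measurable M"
  shows "(\<lambda>x. complex_of_real (f x) powr a) \<in> borel_measurable M"
proof -
  have "complex_of_real r powr a = (if r = 0 then 0 else if r > 0 then exp (a * of_real (ln r))
      else exp (a * (of_real (ln (- r)) + \<i> * of_real pi)))" for r
    using Ln_minus[of "of_real (- r)"] Ln_of_real[of "- r"] by (auto simp: powr_def Ln_of_real not_less)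
  then show ?thesis by simp
qed

lemma powr_mult_of_real:
  "r \<ge> 0 \<Longrightarrow> s \<ge> 0 \<Longrightarrow> complex_of_real (r * s) powr a = of_real r powr a * of_real s powr a"
  by (simp add: powr_times_real)

lemma has_vector_derivative_powr_of_real:
  assumes "r > 0"
  shows "((\<lambda>r. complex_of_real r powr a) has_vector_derivative a * of_real r powr (a - 1)) (at r within S)"
proof (rule has_vector_derivative_real_field)
  show "((\<lambda>z. z powr a) has_field_derivative a * complex_of_real r powr (a - 1)) (at (of_real r))"
    by (rule has_field_derivative_powr) (use assms in \<open>auto simp: complex_nonpos_Reals_iff\<close>)
qed

lemma continuous_on_powr_of_real: "S \<subseteq> {0<..} \<Longrightarrow> continuous_on S (\<lambda>r. complex_of_real r powr a)"
  by (intro continuous_at_imp_continuous_on ballI has_vector_derivative_continuous[OF has_vector_derivative_powr_of_real]) auto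

lemma integral_powr_Icc:
  fixes a :: complex
  assumes "0 < e" "e \<le> R" "a + 1 \<noteq> 0"
  shows "(\<integral>r. indicator {e..R} r *\<^sub>R of_real r powr a \<partial>lborel) = (of_real R powr (a + 1) - of_real e powr (a + 1)) / (a + 1)"
proof -
  have "(\<integral>r. indicator {e..R} r *\<^sub>R of_real r powr a \<partial>lborel) = of_real R powr (a + 1) / (a + 1) - of_real e powr (a + 1) / (a + 1)"
  proof (rule integral_FTC_Icc[OF assms(2)])
    fix r assume "e \<le> r" "r \<le> R"
    then have "((\<lambda>r. complex_of_real r powr (a + 1)) has_vector_derivative (a + 1) * of_real r powr (a + 1 - 1)) (at r within {e..R})"
      using assms(1) by (intro has_vector_derivative_powr_of_real) simp
    from has_vector_derivative_divide[OF this, of "a + 1"] assms(3)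
    show "((\<lambda>r. complex_of_real r powr (a + 1) / (a + 1)) has_vector_derivative of_real r powr a) (at r within {e..R})"
      by simp
  qed (use assms in \<open>auto intro!: continuous_on_powr_of_real\<close>)
  then show ?thesis by (simp add: diff_divide_distrib)
qed

lemma integral_lborel_scale:
  fixes f :: "'a::euclidean_space \<Rightarrow> complex"
  assumes c: "c > 0" and [measurable]: "f \<in> borel_measurable borel"
  shows "(\<integral>x. f x \<partial>lborel) = of_real (c ^ DIM('a)) * (\<integral>x. f (c *\<^sub>R x) \<partial>lborel)"
proof -
  have "(\<integral>x. f x \<partial>lborel) = (\<integral>x. f x \<partial>density (distr lborel borel (\<lambda>x. 0 + c *\<^sub>R x)) (\<lambda>_. \<bar>c\<bar> ^ DIM('a)))"
    using c by (subst lborel_affine[of c 0]) auto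
  also have "\<dots> = of_real (c ^ DIM('a)) * (\<integral>x. f (c *\<^sub>R x) \<partial>lborel)"
    using c by (subst integral_density) (auto simp: integral_distr scaleR_conv_of_real)
  finally show ?thesis .
qed

lemma ball_measurable [measurable]: "ball c r \<in> sets borel"
  by simp

lemma sgn_vec_measurable [measurable (raw)]:
  fixes f :: "'a \<Rightarrow> real ^ 'n::finite"
  assumes [measurable]: "f \<in> borel_measurable M"
  shows "(\<lambda>x. sgn (f x)) \<in> borel_measurable M"
  unfolding sgn_div_norm by measurable

lemma finite_measure_ball_integrable:
  fixes G :: "real ^ 'n::finite \<Rightarrow> complex"
  assumes [measurable]: "G \<in> borel_measurable borel" and K: "\<And>y. y \<in> ball 0 r \<Longrightarrow> norm (G y) \<le> K"
  shows "integrable lborel (\<lambda>y. indicator (ball 0 r) y * G y)"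
proof (rule Bochner_Integration.integrable_bound)
  show "integrable lborel (\<lambda>y. K * indicator (ball 0 r) y)"
    using emeasure_lborel_ball_finite[of 0 r] by (intro integrable_mult_right integrable_real_indicator) auto
  show "AE y in lborel. norm (indicator (ball 0 r) y * G y) \<le> norm (K * indicator (ball 0 r) y)"
    using K by (auto simp: indicator_def intro!: AE_I2 order_trans[OF _ abs_ge_self])
qed auto

lemma indicator_scaleR_mult: "indicator A x *\<^sub>R z = indicator A x * (z :: complex)"
  by (simp add: indicator_def)

text \<open>Only the scaling law of balls is used, not a disintegration into spheres. The power
  |y|^a is written as R^a minus the integral of a r^(a-1) over r from |y| to R; exchanging the
  integrals leaves \<open>S r - S e\<close>, where \<open>S\<close> is the integral of G (sgn y)
  over a ball and \<open>S r\<close> is r^d times \<open>S 1\<close>.\<close>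

lemma polar_shell:
  fixes G :: "real ^ 'n::finite \<Rightarrow> complex"
  assumes [measurable]: "G \<in> borel_measurable borel" and K: "\<And>y. norm (G y) \<le> K"
    and e: "0 < e" "e \<le> R" and a: "a \<noteq> 0" "a + of_nat CARD('n) \<noteq> 0"
  shows "(\<integral>y. indicator (ball 0 R - ball 0 e) y * (G (sgn y) * of_real (norm y) powr a) \<partial>lborel) =
    sphere_integral G * (of_real R powr (a + of_nat CARD('n)) - of_real e powr (a + of_nat CARD('n))) / (a + of_nat CARD('n))"
proof -
  let ?d = "of_nat CARD('n) :: complex"
  define S where "S r = (\<integral>y. indicator (ball 0 r) y * G (sgn y) \<partial>lborel)" for r
  have iS: "integrable lborel (\<lambda>y. indicator (ball 0 r) y * G (sgn y))" for r
    by (rule finite_measure_ball_integrable) (auto intro: K)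
  have S: "S r = of_real r powr ?d * S 1" if r: "r > 0" for r
  proof -
    have "S r = of_real (r ^ DIM(real ^ 'n)) * (\<integral>y. indicator (ball 0 r) (r *\<^sub>R y) * G (sgn (r *\<^sub>R y)) \<partial>lborel)"
      unfolding S_def by (rule integral_lborel_scale[OF r]) measurable
    also have "(\<lambda>y::real ^ 'n. indicator (ball 0 r) (r *\<^sub>R y) * G (sgn (r *\<^sub>R y))) = (\<lambda>y. indicator (ball 0 1) y * G (sgn y))"
      using r by (auto simp: indicator_def sgn_scaleR fun_eq_iff)
    finally show ?thesis using r by (simp add: S_def)
  qed
  have sph: "sphere_integral G = ?d * S 1"
    by (simp add: sphere_integral_def S_def set_lebesgue_integral_def indicator_scaleR_mult)
  define k where "k y r = indicator (ball 0 R - ball 0 e) y * (indicator {norm y<..R} r * (G (sgn y) * (a * of_real r powr (a - 1))))" for y and r :: real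
  have kint: "(\<integral>r. k y r \<partial>lborel) = indicator (ball 0 R - ball 0 e) y * (G (sgn y) * (of_real R powr a - of_real (norm y) powr a))" for y
  proof (cases "y \<in> ball 0 R - ball 0 e")
    case True
    then have ny: "0 < norm y" "norm y \<le> R" using e by (auto simp: dist_norm)
    have "(\<integral>r. k y r \<partial>lborel) = (\<integral>r. G (sgn y) * a * (indicator {norm y..R} r *\<^sub>R of_real r powr (a - 1)) \<partial>lborel)"
    proof (rule integral_cong_AE)
      have "AE r in lborel. r \<noteq> norm y" by (rule AE_lborel_singleton)
      then show "AE r in lborel. k y r = G (sgn y) * a * (indicator {norm y..R} r *\<^sub>R of_real r powr (a - 1))"
        by eventually_elim (use True in \<open>auto simp: k_def indicator_def\<close>)
    qed (auto simp: k_def)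
    also have "\<dots> = G (sgn y) * a * ((of_real R powr (a - 1 + 1) - of_real (norm y) powr (a - 1 + 1)) / (a - 1 + 1))"
      unfolding integral_mult_right_zero by (subst integral_powr_Icc) (use ny a in auto)
    finally show ?thesis using True a by simp
  qed (simp add: k_def)
  have kint2: "(\<integral>y. k y r \<partial>lborel) = indicator {e..R} r *\<^sub>R ((S r - S e) * (a * of_real r powr (a - 1)))" for r
  proof (cases "r \<in> {e..R}")
    case True
    have "k y r = (indicator (ball 0 r) y * G (sgn y) - indicator (ball 0 e) y * G (sgn y)) * (a * of_real r powr (a - 1))" for y
      using True by (auto simp: k_def indicator_def)
    then have "(\<integral>y. k y r \<partial>lborel) = (S r - S e) * (a * of_real r powr (a - 1))"
      using iS by (simp add: S_def)
    then show ?thesis using True by simp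
  next
    case False
    then have "k y r = 0" for y by (auto simp: k_def indicator_def)
    then show ?thesis using False by simp
  qed
  have km: "case_prod k \<in> borel_measurable (lborel \<Otimes>\<^sub>M lborel)"
  proof -
    have "k = (\<lambda>y r. indicator (ball 0 R - ball 0 e) y * ((if norm y < r \<and> r \<le> R then 1 else 0) * (G (sgn y) * (a * of_real r powr (a - 1)))))"
      by (auto simp: k_def indicator_def fun_eq_iff)
    then show ?thesis by simp
  qed
  obtain L where L: "\<And>r. r \<in> {e..R} \<Longrightarrow> norm (a * complex_of_real r powr (a - 1)) \<le> L"
  proof -
    have "compact ((\<lambda>r. a * complex_of_real r powr (a - 1)) ` {e..R})"
      by (intro compact_continuous_image continuous_intros continuous_on_powr_of_real) (use e in auto)
    then show ?thesis using that by (force dest!: compact_imp_bounded simp: bounded_iff)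
  qed
  have K0: "K \<ge> 0" using order_trans[OF norm_ge_zero K] .
  have kI: "integrable (lborel \<Otimes>\<^sub>M lborel) (case_prod k)"
  proof (rule Bochner_Integration.integrable_bound)
    have fin: "emeasure (lborel \<Otimes>\<^sub>M lborel) (ball 0 R \<times> {e..R} :: ((real ^ 'n) \<times> real) set) < \<infinity>"
      by (subst lborel.emeasure_pair_measure_Times)
         (use emeasure_lborel_ball_finite[of "0 :: real ^ 'n" R] e in \<open>auto simp: ennreal_mult_less_top\<close>)
    show "integrable (lborel \<Otimes>\<^sub>M lborel) (\<lambda>p. (K * L) * indicator (ball 0 R \<times> {e..R} :: ((real ^ 'n) \<times> real) set) p)"
      using fin by (intro integrable_mult_right integrable_real_indicator) auto
    show "AE p in lborel \<Otimes>\<^sub>M lborel. norm (case_prod k p) \<le> norm (K * L * indicator (ball 0 R \<times> {e..R}) p)"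
    proof (rule AE_I2)
      fix p :: "(real ^ 'n) \<times> real"
      obtain y r where p: "p = (y, r)" by force
      show "norm (case_prod k p) \<le> norm (K * L * indicator (ball 0 R \<times> {e..R}) p)"
      proof (cases "y \<in> ball 0 R - ball 0 e \<and> norm y < r \<and> r \<le> R")
        case True
        then have r: "r \<in> {e..R}" by auto
        have "norm (k y r) = norm (G (sgn y)) * norm (a * of_real r powr (a - 1))"
          using True by (simp add: k_def norm_mult)
        also have "\<dots> \<le> K * L" by (intro mult_mono K L r K0) auto
        also have "\<dots> = norm (K * L * indicator (ball 0 R \<times> {e..R}) p)"
          using True r K0 order_trans[OF norm_ge_zero L[OF r]] by (simp add: p abs_mult)
        finally show ?thesis by (simp add: p)
      qed (auto simp: p k_def indicator_def)
    qed
  qed (rule km)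
  have F: "(\<integral>y. (\<integral>r. k y r \<partial>lborel) \<partial>lborel) = (\<integral>r. (\<integral>y. k y r \<partial>lborel) \<partial>lborel)"
    by (rule lborel_pair.Fubini_integral[OF kI, symmetric])
  have shell: "indicator (ball 0 R - ball 0 e) y * z = indicator (ball 0 R) y * z - indicator (ball 0 e) y * z" for y :: "real ^ 'n" and z :: complex
    using e by (auto simp: indicator_def)
  have i1: "integrable lborel (\<lambda>y. indicator (ball 0 R - ball 0 e) y * (G (sgn y) * of_real R powr a))"
    unfolding shell mult.assoc[symmetric] by (intro Bochner_Integration.integrable_diff integrable_mult_left iS)
  have i2: "integrable lborel (\<lambda>y. indicator (ball 0 R - ball 0 e) y * (G (sgn y) * (of_real R powr a - of_real (norm y) powr a)))"
    using lborel_pair.integrable_fst'[OF kI] by (simp add: kint)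
  have "(\<integral>y. indicator (ball 0 R - ball 0 e) y * (G (sgn y) * of_real (norm y) powr a) \<partial>lborel) =
    (\<integral>y. indicator (ball 0 R - ball 0 e) y * (G (sgn y) * of_real R powr a) -
      indicator (ball 0 R - ball 0 e) y * (G (sgn y) * (of_real R powr a - of_real (norm y) powr a)) \<partial>lborel)"
    by (intro Bochner_Integration.integral_cong) (auto simp: algebra_simps)
  also have "\<dots> = (S R - S e) * of_real R powr a - (\<integral>r. (\<integral>y. k y r \<partial>lborel) \<partial>lborel)"
  proof -
    have "(\<integral>y. indicator (ball 0 R - ball 0 e) y * (G (sgn y) * of_real R powr a) \<partial>lborel) = (S R - S e) * of_real R powr a"
      unfolding shell mult.assoc[symmetric] S_def left_diff_distrib using iS by simp
    then show ?thesis using i1 i2 F by (simp add: kint)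
  qed
  also have "(\<integral>r. (\<integral>y. k y r \<partial>lborel) \<partial>lborel) =
     (\<integral>r. S 1 * a * (indicator {e..R} r *\<^sub>R of_real r powr (a + ?d - 1)) - S e * a * (indicator {e..R} r *\<^sub>R of_real r powr (a - 1)) \<partial>lborel)"
  proof (intro Bochner_Integration.integral_cong refl)
    fix r :: real
    show "(\<integral>y. k y r \<partial>lborel) = S 1 * a * (indicator {e..R} r *\<^sub>R of_real r powr (a + ?d - 1)) - S e * a * (indicator {e..R} r *\<^sub>R of_real r powr (a - 1))"
    proof (cases "r \<in> {e..R}")
      case True
      then have r: "r > 0" using e by auto
      have "a + ?d - 1 = ?d + (a - 1)" by simp
      then have q: "complex_of_real r powr (a + ?d - 1) = of_real r powr ?d * of_real r powr (a - 1)"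
        by (simp only: powr_add)
      have "indicator {e..R} r = (1 :: real)" using True by simp
      then show ?thesis unfolding kint2 S[OF r] q by (simp only: scaleR_one left_diff_distrib right_diff_distrib mult_ac)
    qed (simp add: kint2)
  qed
  also have "\<dots> = S 1 * a * (\<integral>r. indicator {e..R} r *\<^sub>R of_real r powr (a + ?d - 1) \<partial>lborel) - S e * a * (\<integral>r. indicator {e..R} r *\<^sub>R of_real r powr (a - 1) \<partial>lborel)"
  proof -
    have ip: "integrable lborel (\<lambda>r. indicator {e..R} r *\<^sub>R complex_of_real r powr b)" for b
      by (intro borel_integrable_compact continuous_on_powr_of_real) (use e in auto)
    show ?thesis unfolding integral_mult_right_zero[symmetric]
      by (rule Bochner_Integration.integral_diff) (intro integrable_mult_right ip)+
  qed
  also have "\<dots> = S 1 * a * ((of_real R powr (a + ?d) - of_real e powr (a + ?d)) / (a + ?d)) - S e * (of_real R powr a - of_real e powr a)"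
    using integral_powr_Icc[of e R "a + ?d - 1"] integral_powr_Icc[of e R "a - 1"] e a by simp
  finally have "(\<integral>y. indicator (ball 0 R - ball 0 e) y * (G (sgn y) * of_real (norm y) powr a) \<partial>lborel) =
     (S R - S e) * of_real R powr a - (S 1 * a * ((of_real R powr (a + ?d) - of_real e powr (a + ?d)) / (a + ?d)) - S e * (of_real R powr a - of_real e powr a))" .
  also have "\<dots> = S 1 * (of_real R powr ?d * of_real R powr a - of_real e powr ?d * of_real e powr a - a * ((of_real R powr (a + ?d) - of_real e powr (a + ?d)) / (a + ?d)))"
  proof -
    have "R > 0" using e by simp
    then show ?thesis unfolding S[OF \<open>R > 0\<close>] S[OF e(1)] by (simp only: algebra_simps)
  qed
  also have "of_real R powr ?d * of_real R powr a = of_real R powr (a + ?d)" by (simp only: powr_add mult.commute)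
  also have "of_real e powr ?d * of_real e powr a = of_real e powr (a + ?d)" by (simp only: powr_add mult.commute)
  also have "S 1 * (of_real R powr (a + ?d) - of_real e powr (a + ?d) - a * ((of_real R powr (a + ?d) - of_real e powr (a + ?d)) / (a + ?d)))
     = sphere_integral G * (of_real R powr (a + ?d) - of_real e powr (a + ?d)) / (a + ?d)"
  proof -
    have aux: "s * (x - a * (x / p)) = d * s * x / p" if "p \<noteq> 0" "p = a + d" for s x p d :: complex
    proof -
      have "x - a * (x / p) = d * x / p" using that by (simp add: field_simps)
      then show ?thesis by simp
    qed
    show ?thesis unfolding sph by (rule aux) (use a in auto)
  qed
  finally show ?thesis .
qed

lemma real_shell:
  fixes a :: real
  assumes e: "0 < e" "e \<le> R" and a: "a \<noteq> 0" "a + CARD('n) \<noteq> 0"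
  shows "integrable lborel (\<lambda>y::real ^ 'n::finite. indicator (ball 0 R - ball 0 e) y * norm y powr a)"
    and "(\<integral>y. indicator (ball 0 R - ball 0 e) y * norm (y :: real ^ 'n) powr a \<partial>lborel) =
      Re (sphere_integral (\<lambda>_::real ^ 'n. 1)) * (R powr (a + CARD('n)) - e powr (a + CARD('n))) / (a + CARD('n))"
proof -
  have cp: "compact (cball 0 R - ball 0 e :: (real ^ 'n) set)" by (intro compact_diff) auto
  have "integrable lborel (\<lambda>y::real ^ 'n. indicator (cball 0 R - ball 0 e) y *\<^sub>R norm y powr a)"
    by (intro borel_integrable_compact cp continuous_intros) (use e in auto)
  then show "integrable lborel (\<lambda>y::real ^ 'n. indicator (ball 0 R - ball 0 e) y * norm y powr a)"
    by (rule Bochner_Integration.integrable_bound) (auto simp: indicator_def)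
  define C where "C = sphere_integral (\<lambda>_::real ^ 'n. 1)"
  define D where "D = (R powr (a + CARD('n)) - e powr (a + CARD('n))) / (a + CARD('n))"
  have "complex_of_real (\<integral>y. indicator (ball 0 R - ball 0 e) y * norm (y :: real ^ 'n) powr a \<partial>lborel) =
     (\<integral>y. indicator (ball 0 R - ball 0 e) y * (1 * of_real (norm (y :: real ^ 'n)) powr of_real a) \<partial>lborel)"
    unfolding integral_complex_of_real[symmetric]
    by (intro Bochner_Integration.integral_cong) (auto simp: indicator_def powr_of_real)
  also have "\<dots> = C * (of_real R powr (of_real a + of_nat CARD('n)) - of_real e powr (of_real a + of_nat CARD('n))) / (of_real a + of_nat CARD('n))"
    unfolding C_def
  proof (rule polar_shell)
    show "complex_of_real a + of_nat CARD('n) \<noteq> 0"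
      using a(2) by (metis of_real_add of_real_eq_0_iff of_real_of_nat_eq)
  qed (use e a in auto)
  also have "\<dots> = C * of_real D"
  proof -
    have "complex_of_real a + of_nat CARD('n) = of_real (a + CARD('n))" by simp
    moreover have "0 \<le> R" "0 \<le> e" using e by auto
    ultimately show ?thesis unfolding D_def
      by (simp only: powr_of_real of_real_diff[symmetric] of_real_divide times_divide_eq_right)
  qed
  finally have eq: "complex_of_real (\<integral>y. indicator (ball 0 R - ball 0 e) y * norm (y :: real ^ 'n) powr a \<partial>lborel) = C * of_real D" .
  have "Re (complex_of_real (\<integral>y. indicator (ball 0 R - ball 0 e) y * norm (y :: real ^ 'n) powr a \<partial>lborel)) = Re C * D"
    unfolding eq by simp
  then show "(\<integral>y. indicator (ball 0 R - ball 0 e) y * norm (y :: real ^ 'n) powr a \<partial>lborel) =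
      Re (sphere_integral (\<lambda>_::real ^ 'n. 1)) * (R powr (a + CARD('n)) - e powr (a + CARD('n))) / (a + CARD('n))"
    by (simp add: C_def D_def)
qed

text \<open>For a negative exponent the ball is exhausted by shells of inner radius 1/(n+1), whose
  integrals converge because a + d > 0; monotone convergence does the rest. For a nonnegative
  exponent the integrand is bounded.\<close>

lemma integrable_norm_powr_ball:
  fixes a :: real
  assumes a: "a + CARD('n) > 0"
  shows "integrable lborel (\<lambda>y::real ^ 'n::finite. indicator (ball 0 1) y * norm y powr a)"
proof (cases "a \<ge> 0")
  case True
  have "integrable lborel (\<lambda>y::real ^ 'n. indicator (ball 0 1) y *\<^sub>R (1::real))"
    using emeasure_lborel_ball_finite[of "0 :: real ^ 'n" 1] by (simp add: integrable_real_indicator)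
  then show ?thesis
    by (rule Bochner_Integration.integrable_bound) (use True in \<open>auto simp: indicator_def intro!: AE_I2 powr_le1\<close>)
next
  case False
  define f where "f n y = indicator (ball 0 1 - ball 0 (1 / Suc n)) y * norm y powr a" for n and y :: "real ^ 'n"
  have e: "0 < 1 / real (Suc n)" "1 / real (Suc n) \<le> 1" for n by auto
  show ?thesis
  proof (rule integral_monotone_convergence_nonneg(1)[where f = f])
    show "integrable lborel (f n)" for n unfolding f_def by (rule real_shell(1)[OF e]) (use False a in auto)
    show "AE y in lborel. mono (\<lambda>n. f n y)"
    proof (intro AE_I2 monoI)
      fix y :: "real ^ 'n" and m n :: nat assume "m \<le> n"
      then have "1 / real (Suc n) \<le> 1 / real (Suc m)" by (intro divide_left_mono) auto
      then show "f m y \<le> f n y" by (auto simp: f_def indicator_def)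
    qed
    show "AE y in lborel. (\<lambda>n. f n y) \<longlonglongrightarrow> indicator (ball 0 1) y * norm y powr a"
    proof (rule AE_I2)
      fix y :: "real ^ 'n"
      show "(\<lambda>n. f n y) \<longlonglongrightarrow> indicator (ball 0 1) y * norm y powr a"
      proof (cases "y = 0")
        case False
        then obtain m where m: "1 / real (Suc m) < norm y" using nat_approx_posE[of "norm y"] by auto
        have "f n y = indicator (ball 0 1) y * norm y powr a" if "n \<ge> m" for n
        proof -
          have "1 / real (Suc n) \<le> 1 / real (Suc m)" using that by (intro divide_left_mono) auto
          then show ?thesis using m by (auto simp: f_def indicator_def)
        qed
        then show ?thesis by (intro tendsto_eventually) (auto simp: eventually_sequentially)
      qed (simp add: f_def)
    qed
    define c where "c = Re (sphere_integral (\<lambda>_::real ^ 'n. 1))"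
    have "(\<integral>y. f n y \<partial>lborel) = c * (1 - (1 / Suc n) powr (a + CARD('n))) / (a + CARD('n))" for n
      unfolding f_def c_def by (subst real_shell(2)[OF e]) (use False a in auto)
    moreover have "(\<lambda>n. c * (1 - (1 / Suc n) powr (a + CARD('n))) / (a + CARD('n))) \<longlonglongrightarrow> c * (1 - 0) / (a + CARD('n))"
    proof (intro tendsto_intros)
      have "(\<lambda>n. (1 / Suc n) powr (a + CARD('n))) \<longlonglongrightarrow> 0 powr (a + CARD('n))"
        by (rule tendsto_powr') (use a LIMSEQ_Suc[OF lim_1_over_n] in auto)
      then show "(\<lambda>n. (1 / Suc n) powr (a + CARD('n))) \<longlonglongrightarrow> 0" by simp
    qed (use a in auto)
    ultimately show "(\<lambda>n. \<integral>y. f n y \<partial>lborel) \<longlonglongrightarrow> c * (1 - 0) / (a + CARD('n))" by simp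
  qed (auto simp: f_def)
qed

lemma integrable_norm_powr_outside:
  fixes a :: real
  assumes a: "a + CARD('n) < 0"
  shows "integrable lborel (\<lambda>y::real ^ 'n::finite. indicator (- ball 0 1) y * norm y powr a)"
proof -
  define f where "f n y = indicator (ball 0 (Suc n) - ball 0 1) y * norm y powr a" for n and y :: "real ^ 'n"
  have a0: "a \<noteq> 0" using a by auto
  show ?thesis
  proof (rule integral_monotone_convergence_nonneg(1)[where f = f])
    show "integrable lborel (f n)" for n unfolding f_def by (rule real_shell(1)) (use a a0 in auto)
    show "AE y in lborel. mono (\<lambda>n. f n y)"
      by (intro AE_I2 monoI) (auto simp: f_def indicator_def)
    show "AE y in lborel. (\<lambda>n. f n y) \<longlonglongrightarrow> indicator (- ball 0 1) y * norm y powr a"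
    proof (rule AE_I2)
      fix y :: "real ^ 'n"
      obtain m where m: "norm y < real m" using reals_Archimedean2 by blast
      then have "f n y = indicator (- ball 0 1) y * norm y powr a" if "n \<ge> m" for n
        using that by (auto simp: f_def indicator_def)
      then show "(\<lambda>n. f n y) \<longlonglongrightarrow> indicator (- ball 0 1) y * norm y powr a"
        by (intro tendsto_eventually) (auto simp: eventually_sequentially)
    qed
    define c where "c = Re (sphere_integral (\<lambda>_::real ^ 'n. 1))"
    have "(\<integral>y. f n y \<partial>lborel) = c * (Suc n powr (a + CARD('n)) - 1) / (a + CARD('n))" for n
      unfolding f_def c_def by (subst real_shell(2)) (use a a0 in auto)
    moreover have "(\<lambda>n. c * (Suc n powr (a + CARD('n)) - 1) / (a + CARD('n))) \<longlonglongrightarrow> c * (0 - 1) / (a + CARD('n))"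
    proof (intro tendsto_intros)
      show "(\<lambda>n. real (Suc n) powr (a + CARD('n))) \<longlonglongrightarrow> 0"
        by (rule tendsto_neg_powr[OF a]) (rule filterlim_compose[OF filterlim_real_sequentially filterlim_Suc])
    qed (use a in auto)
    ultimately show "(\<lambda>n. \<integral>y. f n y \<partial>lborel) \<longlonglongrightarrow> c * (0 - 1) / (a + CARD('n))" by simp
  qed (auto simp: f_def)
qed

section \<open>The Gamma integral and the splitting of the Mellin integral of a Gaussian\<close>

lemma gamma_integral_scaled:
  assumes s: "Re s > 0" and a: "a > 0"
  shows "integrable lborel (\<lambda>t. indicator {0<..} t * (complex_of_real t powr (s - 1) * of_real (exp (- (a * t)))))"
    and "(\<integral>t. indicator {0<..} t * (complex_of_real t powr (s - 1) * of_real (exp (- (a * t)))) \<partial>lborel) = Gamma s * of_real a powr (- s)"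
proof -
  define f where "f b t = indicator {0<..} t * (complex_of_real t powr (s - 1) * of_real (exp (- (b * t))))" for b t :: real
  have fm: "f b \<in> borel_measurable borel" for b unfolding f_def by measurable
  have f1: "f 1 t = indicator {0<..} t *\<^sub>R (complex_of_real t powr (s - 1) / of_real (exp t))" for t
    by (simp add: f_def indicator_def exp_minus field_simps)
  have ac: "(\<lambda>t. complex_of_real t powr (s - 1) / of_real (exp t)) absolutely_integrable_on {0<..}"
    using absolutely_integrable_Gamma_integral'[OF s] .
  then have "integrable lebesgue (f 1)" unfolding set_integrable_def f1[abs_def] .
  then have i1: "integrable lborel (f 1)" using fm by (simp add: integrable_completion)
  have "(\<integral>t. f 1 t \<partial>lebesgue) = integral {0<..} (\<lambda>t. complex_of_real t powr (s - 1) / of_real (exp t))"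
    using set_lebesgue_integral_eq_integral(2)[OF ac] unfolding set_lebesgue_integral_def f1 .
  also have "\<dots> = Gamma s" using Gamma_integral_complex'[OF s] by (rule integral_unique)
  finally have g1: "(\<integral>t. f 1 t \<partial>lborel) = Gamma s" using fm by (simp add: integral_completion)
  have sc: "f 1 (0 + a * t) = of_real a powr (s - 1) * f a t" for t
    using a by (simp add: f_def indicator_def powr_mult_of_real zero_less_mult_iff del: of_real_mult)
  have az: "complex_of_real a powr (s - 1) \<noteq> 0" using a by simp
  have "integrable lborel (\<lambda>t. f 1 (0 + a * t))" by (rule lborel_integrable_real_affine[OF i1]) (use a in simp)
  then have "integrable lborel (\<lambda>t. of_real a powr (s - 1) * f a t)" unfolding sc .
  from integrable_mult_right[OF this, of "inverse (of_real a powr (s - 1))"] az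
  have "integrable lborel (f a)" by (simp add: mult.assoc[symmetric])
  then show "integrable lborel (\<lambda>t. indicator {0<..} t * (complex_of_real t powr (s - 1) * of_real (exp (- (a * t)))))"
    by (simp add: f_def[abs_def])
  have "Gamma s = \<bar>a\<bar> *\<^sub>R (\<integral>t. f 1 (0 + a * t) \<partial>lborel)"
    unfolding g1[symmetric] by (rule lborel_integral_real_affine) (use a in simp)
  also have "\<dots> = of_real a * of_real a powr (s - 1) * (\<integral>t. f a t \<partial>lborel)"
    unfolding sc using a by (simp add: scaleR_conv_of_real mult.assoc)
  also have "of_real a * of_real a powr (s - 1) = complex_of_real a powr s"
    using a powr_add[of "complex_of_real a" 1 "s - 1"] by simp
  finally have "Gamma s = complex_of_real a powr s * (\<integral>t. f a t \<partial>lborel)" .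
  then have "(\<integral>t. f a t \<partial>lborel) = Gamma s * of_real a powr (- s)"
    using a by (simp add: powr_minus field_simps)
  then show "(\<integral>t. indicator {0<..} t * (complex_of_real t powr (s - 1) * of_real (exp (- (a * t)))) \<partial>lborel) = Gamma s * of_real a powr (- s)"
    by (simp add: f_def)
qed

definition theta_kernel :: "complex \<Rightarrow> real \<Rightarrow> real ^ 'n::finite \<Rightarrow> complex" where
  "theta_kernel s t z = of_real t powr (s - 1) * of_real (exp (- pi * t * norm z ^ 2))"

text \<open>The two parts have complementary defects. The upper one decays like a Gaussian but blows
  up at the origin; the lower one is bounded but decays only like a power. Accordingly the upper
  part is treated directly and the lower one through its Fourier transform.\<close>

definition upper_part :: "complex \<Rightarrow> real ^ 'n::finite \<Rightarrow> complex" where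
  "upper_part s z = (\<integral>t. indicator {1<..} t * theta_kernel s t z \<partial>lborel)"

definition lower_part :: "complex \<Rightarrow> real ^ 'n::finite \<Rightarrow> complex" where
  "lower_part s z = (\<integral>t. indicator {0<..1} t * theta_kernel s t z \<partial>lborel)"

lemma theta_kernel_measurable [measurable]:
  assumes [measurable]: "f \<in> borel_measurable M" "g \<in> borel_measurable M"
  shows "(\<lambda>x. theta_kernel s (f x) (g x)) \<in> borel_measurable M"
  unfolding theta_kernel_def by measurable

lemma upper_part_measurable [measurable]: "upper_part s \<in> borel_measurable borel"
proof -
  have "(\<lambda>z::real ^ 'a. \<integral>t. (case (z, t) of (z, t) \<Rightarrow> indicator {1<..} t * theta_kernel s t z) \<partial>lborel) \<in> borel_measurable lborel"
    by (intro lborel.borel_measurable_lebesgue_integral) measurable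
  then show ?thesis unfolding upper_part_def[abs_def] by simp
qed

lemma lower_part_measurable [measurable]: "lower_part s \<in> borel_measurable borel"
proof -
  have "(\<lambda>z::real ^ 'a. \<integral>t. (case (z, t) of (z, t) \<Rightarrow> indicator {0<..1} t * theta_kernel s t z) \<partial>lborel) \<in> borel_measurable lborel"
    by (intro lborel.borel_measurable_lebesgue_integral) measurable
  then show ?thesis unfolding lower_part_def[abs_def] by simp
qed

lemma theta_kernel_integrable:
  fixes z :: "real ^ 'n::finite"
  assumes s: "Re s > 0" and z: "z \<noteq> 0"
  shows "integrable lborel (\<lambda>t. indicator {0<..} t * theta_kernel s t z)"
    and "integrable lborel (\<lambda>t. indicator {1<..} t * theta_kernel s t z)"
    and "integrable lborel (\<lambda>t. indicator {0<..1} t * theta_kernel s t z)"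
proof -
  have a: "pi * norm z ^ 2 > 0" using z by simp
  show i: "integrable lborel (\<lambda>t. indicator {0<..} t * theta_kernel s t z)"
    using gamma_integral_scaled(1)[OF s a] by (simp add: theta_kernel_def mult_ac)
  show "integrable lborel (\<lambda>t. indicator {1<..} t * theta_kernel s t z)"
    "integrable lborel (\<lambda>t. indicator {0<..1} t * theta_kernel s t z)"
    by (rule Bochner_Integration.integrable_bound[OF i]; simp add: indicator_def)+
qed

definition gamma_factor :: "complex \<Rightarrow> complex" where
  "gamma_factor s = of_real pi powr s / Gamma s"

text \<open>Euler's integral at the rate pi |z|^2 equals Gamma s times pi^(-s) |z|^(-2s), which is
  where \<open>gamma_factor\<close> comes from; Gamma s is nonzero since Re s > 0.\<close>

lemma npow_eq_parts:
  fixes z :: "real ^ 'n::finite"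
  assumes s: "Re s > 0" and z: "z \<noteq> 0"
  shows "1 / npow z (2 * s) = gamma_factor s * (upper_part s z + lower_part s z)"
proof -
  have a: "pi * norm z ^ 2 > 0" using z by simp
  have G: "Gamma s \<noteq> 0" using s by (auto simp: Gamma_eq_zero_iff elim!: nonpos_Ints_cases')
  have "upper_part s z + lower_part s z = (\<integral>t. indicator {1<..} t * theta_kernel s t z + indicator {0<..1} t * theta_kernel s t z \<partial>lborel)"
    unfolding upper_part_def lower_part_def using theta_kernel_integrable[OF s z] by simp
  also have "\<dots> = (\<integral>t. indicator {0<..} t * (complex_of_real t powr (s - 1) * of_real (exp (- (pi * norm z ^ 2 * t)))) \<partial>lborel)"
    by (intro Bochner_Integration.integral_cong) (auto simp: indicator_def theta_kernel_def mult_ac)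
  also have "\<dots> = Gamma s * of_real (pi * norm z ^ 2) powr (- s)" by (rule gamma_integral_scaled(2)[OF s a])
  also have "complex_of_real (pi * norm z ^ 2) powr (- s) = of_real pi powr (- s) * of_real (norm z ^ 2) powr (- s)"
    by (rule powr_mult_of_real) auto
  also have "complex_of_real (norm z ^ 2) powr (- s) = 1 / npow z (2 * s)"
    using z unfolding npow_def by (simp add: powr_of_real_pos ln_realpow exp_minus divide_inverse mult_ac del: of_real_power)
  finally show ?thesis using G by (simp add: gamma_factor_def powr_minus field_simps)
qed

lemma norm_theta_kernel: "t \<ge> 0 \<Longrightarrow> norm (theta_kernel s t z) = t powr (Re s - 1) * exp (- pi * t * norm z ^ 2)"
  by (simp add: theta_kernel_def norm_mult norm_powr_of_real)

lemma gamma_integral_real: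
  fixes \<sigma> a :: real
  assumes "\<sigma> > 0" "a > 0"
  shows "integrable lborel (\<lambda>t. indicator {0<..} t * (t powr (\<sigma> - 1) * exp (- (a * t))))"
    and "(\<integral>t. indicator {0<..} t * (t powr (\<sigma> - 1) * exp (- (a * t))) \<partial>lborel) = Gamma \<sigma> * a powr (- \<sigma>)"
proof -
  have eq: "indicator {0<..} t * (complex_of_real t powr (of_real \<sigma> - 1) * of_real (exp (- (a * t)))) =
     complex_of_real (indicator {0<..} t * (t powr (\<sigma> - 1) * exp (- (a * t))))" for t
    using powr_of_real[of t "\<sigma> - 1"] by (simp add: indicator_def)
  note g = gamma_integral_scaled[of "of_real \<sigma>" a, unfolded eq]
  show "integrable lborel (\<lambda>t. indicator {0<..} t * (t powr (\<sigma> - 1) * exp (- (a * t))))"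
    using g(1) assms by (simp only: complex_of_real_integrable_eq Re_complex_of_real)
  have "complex_of_real (\<integral>t. indicator {0<..} t * (t powr (\<sigma> - 1) * exp (- (a * t))) \<partial>lborel) = Gamma (of_real \<sigma>) * of_real a powr (- of_real \<sigma>)"
    using g(2) assms by (simp only: integral_complex_of_real Re_complex_of_real)
  also have "\<dots> = of_real (Gamma \<sigma> * a powr (- \<sigma>))"
    using assms powr_of_real[of a "- \<sigma>"] by (simp add: Gamma_complex_of_real)
  finally show "(\<integral>t. indicator {0<..} t * (t powr (\<sigma> - 1) * exp (- (a * t))) \<partial>lborel) = Gamma \<sigma> * a powr (- \<sigma>)"
    by (simp only: of_real_eq_iff)
qed

lemma powr_minus_square_norm:
  fixes c r \<sigma> :: real
  assumes "r > 0" "c > 0"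
  shows "(c * r ^ 2) powr (- \<sigma>) = c powr (- \<sigma>) * r powr (- 2 * \<sigma>)"
  using assms by (simp add: powr_def ln_realpow ln_mult exp_add[symmetric] algebra_simps)

lemma upper_part_bound:
  assumes s: "Re s > 0"
  obtains C where "C > 0" "\<And>z::real ^ 'n::finite. z \<noteq> 0 \<Longrightarrow> norm (upper_part s z) \<le> C * exp (- (pi / 2) * norm z ^ 2) * norm z powr (- 2 * Re s)"
proof
  define C where "C = Gamma (Re s) * (pi / 2) powr (- Re s)"
  show "C > 0" using s by (simp add: C_def Gamma_real_pos)
  fix z :: "real ^ 'n" assume z: "z \<noteq> 0"
  \<comment> \<open>Half of the rate: for t > 1, exp (-2 a t) is at most exp (-a) exp (-a t). The
    first factor is the Gaussian decay in \<open>z\<close>, the second keeps the Gamma integral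
    convergent near t = 0.\<close>
  define a where "a = pi / 2 * norm z ^ 2"
  have a: "a > 0" using z by (simp add: a_def)
  have "norm (upper_part s z) \<le> (\<integral>t. norm (indicator {1<..} t * theta_kernel s t z) \<partial>lborel)"
    unfolding upper_part_def by simp
  also have "\<dots> \<le> (\<integral>t. exp (- a) * (indicator {0<..} t * (t powr (Re s - 1) * exp (- (a * t)))) \<partial>lborel)"
  proof (rule integral_mono)
    fix t :: real
    show "norm (indicator {1<..} t * theta_kernel s t z) \<le> exp (- a) * (indicator {0<..} t * (t powr (Re s - 1) * exp (- (a * t))))"
    proof (cases "t > 1")
      case True
      have "a \<le> a * t" using True a by simp
      moreover have "- pi * t * norm z ^ 2 = - (2 * (a * t))" by (simp add: a_def)
      ultimately have "- pi * t * norm z ^ 2 \<le> - a + - (a * t)" by linarith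
      then have "exp (- pi * t * norm z ^ 2) \<le> exp (- a) * exp (- (a * t))" by (simp add: exp_add[symmetric])
      then have "t powr (Re s - 1) * exp (- pi * t * norm z ^ 2) \<le> t powr (Re s - 1) * (exp (- a) * exp (- (a * t)))"
        by (intro mult_left_mono) auto
      then show ?thesis using True by (simp add: norm_mult norm_theta_kernel mult_ac)
    qed (simp add: indicator_def)
  qed (intro integrable_norm theta_kernel_integrable s z integrable_mult_right gamma_integral_real a)+
  also have "\<dots> = exp (- a) * (Gamma (Re s) * a powr (- Re s))"
    by (simp only: integral_mult_right_zero gamma_integral_real(2)[OF s a])
  also have "\<dots> = C * exp (- (pi / 2) * norm z ^ 2) * norm z powr (- 2 * Re s)"
    using z powr_minus_square_norm[of "norm z" "pi / 2" "Re s"] by (simp add: C_def a_def)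
  finally show "norm (upper_part s z) \<le> C * exp (- (pi / 2) * norm z ^ 2) * norm z powr (- 2 * Re s)" .
qed

lemma lower_part_norm_bound:
  assumes s: "Re s > 0"
  obtains C where "C > 0" "\<And>z::real ^ 'n::finite. z \<noteq> 0 \<Longrightarrow>
    (\<integral>t. norm (indicator {0<..1} t * theta_kernel s t z) \<partial>lborel) \<le> C * norm z powr (- 2 * Re s)"
proof
  define C where "C = Gamma (Re s) * pi powr (- Re s)"
  show "C > 0" using s by (simp add: C_def Gamma_real_pos)
  fix z :: "real ^ 'n" assume z: "z \<noteq> 0"
  define a where "a = pi * norm z ^ 2"
  have a: "a > 0" using z by (simp add: a_def)
  have "(\<integral>t. norm (indicator {0<..1} t * theta_kernel s t z) \<partial>lborel) \<le> (\<integral>t. indicator {0<..} t * (t powr (Re s - 1) * exp (- (a * t))) \<partial>lborel)"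
  proof (rule integral_mono)
    fix t :: real
    show "norm (indicator {0<..1} t * theta_kernel s t z) \<le> indicator {0<..} t * (t powr (Re s - 1) * exp (- (a * t)))"
      by (auto simp: indicator_def norm_mult norm_theta_kernel a_def mult_ac)
  qed (intro integrable_norm theta_kernel_integrable s z gamma_integral_real a)+
  also have "\<dots> = Gamma (Re s) * a powr (- Re s)" by (rule gamma_integral_real(2)[OF s a])
  also have "\<dots> = C * norm z powr (- 2 * Re s)"
    using z powr_minus_square_norm[of "norm z" pi "Re s"] by (simp add: C_def a_def)
  finally show "(\<integral>t. norm (indicator {0<..1} t * theta_kernel s t z) \<partial>lborel) \<le> C * norm z powr (- 2 * Re s)" .
qed

lemma integrable_powr_unit:
  assumes "a > (-1::real)"
  shows "integrable lborel (\<lambda>t. indicator {0<..1} t * t powr a)"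
proof -
  have "(\<lambda>t. t powr a) absolutely_integrable_on {0<..1}"
    by (rule nonnegative_absolutely_integrable_1) (use integrable_on_powr_from_0'[OF assms, of 1] in auto)
  then have "integrable lebesgue (\<lambda>t. indicator {0<..1} t * t powr a)" by (simp add: set_integrable_def)
  then show ?thesis by (subst (asm) integrable_completion) auto
qed

lemma lower_part_bounded:
  assumes s: "Re s > 0"
  obtains C where "\<And>z::real ^ 'n::finite. norm (lower_part s z) \<le> C"
proof
  fix z :: "real ^ 'n"
  have i: "integrable lborel (\<lambda>t. indicator {0<..1} t * t powr (Re s - 1))" by (rule integrable_powr_unit) (use s in simp)
  have le: "norm (indicator {0<..1} t * theta_kernel s t z) \<le> indicator {0<..1} t * t powr (Re s - 1)" for t
    by (auto simp: indicator_def norm_mult norm_theta_kernel intro!: mult_left_le)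
  have i': "integrable lborel (\<lambda>t. indicator {0<..1} t * theta_kernel s t z)"
    by (rule Bochner_Integration.integrable_bound[OF i]) (use le in \<open>auto intro!: AE_I2 order_trans[OF le abs_ge_self]\<close>)
  have "norm (lower_part s z) \<le> (\<integral>t. norm (indicator {0<..1} t * theta_kernel s t z) \<partial>lborel)"
    unfolding lower_part_def by simp
  also have "\<dots> \<le> (\<integral>t. indicator {0<..1} t * t powr (Re s - 1) \<partial>lborel)"
    by (intro integral_mono integrable_norm i i' le)
  finally show "norm (lower_part s z) \<le> (\<integral>t. indicator {0<..1} t * t powr (Re s - 1) \<partial>lborel)" .
qed

section \<open>Entire functions from integrals of plane waves\<close>

definition phase :: "real ^ 'n::finite \<Rightarrow> real ^ 'n \<Rightarrow> complex" where
  "phase z x = - 2 * of_real pi * \<i> * of_real (z \<bullet> x)"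

definition phase_coeff :: "real ^ 'n::finite \<Rightarrow> 'n \<Rightarrow> complex" where
  "phase_coeff z i = - 2 * of_real pi * \<i> * of_real (z $ i)"

definition phase_taylor :: "nat \<Rightarrow> real ^ 'n::finite \<Rightarrow> real ^ 'n \<Rightarrow> complex" where
  "phase_taylor l z x = (\<Sum>k\<le>l. phase z x ^ k / fact k)"

lemma plane_wave_phase: "plane_wave x z = exp (phase z x)"
  by (simp add: plane_wave_def phase_def)

lemma phase_eq_sum: "phase z x = (\<Sum>i\<in>UNIV. phase_coeff z i * of_real (x $ i))"
  by (simp add: phase_def phase_coeff_def inner_vec_def sum_distrib_left mult.assoc)

lemma phase_commute: "phase z x = phase x z"
  by (simp add: phase_def inner_commute)

lemma norm_phase: "norm (phase z x) \<le> 2 * pi * (norm z * norm x)"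
  using Cauchy_Schwarz_ineq2[of z x] by (simp add: phase_def norm_mult mult.assoc)

lemma phase_coeff_sum_bound: "(\<Sum>i\<in>UNIV. norm (phase_coeff z i) * \<bar>x $ i\<bar>) \<le> 2 * pi * CARD('n) * norm z * norm x"
  for z x :: "real ^ 'n::finite"
proof -
  have "(\<Sum>i\<in>UNIV. norm (phase_coeff z i) * \<bar>x $ i\<bar>) \<le> (\<Sum>i\<in>(UNIV::'n set). 2 * pi * norm z * norm x)"
    by (intro sum_mono mult_mono) (auto simp: phase_coeff_def norm_mult component_le_norm_cart)
  then show ?thesis by (simp add: mult_ac)
qed

lemma phase_measurable [measurable]:
  "f \<in> borel_measurable M \<Longrightarrow> g \<in> borel_measurable M \<Longrightarrow> (\<lambda>x. phase (f x) (g x)) \<in> borel_measurable M"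
  unfolding phase_def by measurable

lemma phase_taylor_measurable [measurable]:
  "f \<in> borel_measurable M \<Longrightarrow> g \<in> borel_measurable M \<Longrightarrow> (\<lambda>x. phase_taylor l (f x) (g x)) \<in> borel_measurable M"
  unfolding phase_taylor_def
  by (intro borel_measurable_sum borel_measurable_divide borel_measurable_power borel_measurable_const phase_measurable)

lemma exp_coeff_measurable [measurable]: "(\<lambda>z. exp_coeff (phase_coeff z) \<alpha>) \<in> borel_measurable borel"
  unfolding exp_coeff_def phase_coeff_def divide_inverse by measurable

lemma npow_measurable [measurable]:
  "f \<in> borel_measurable M \<Longrightarrow> (\<lambda>x. npow (f x) \<nu>) \<in> borel_measurable M"
  unfolding npow_def by measurable

lemma phase_power_eq:
  "phase z x ^ k / fact k = (\<Sum>\<alpha> | mdeg \<alpha> = k. exp_coeff (phase_coeff z) \<alpha> * of_real (mpow x \<alpha>))"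
  unfolding phase_eq_sum multinomial exp_coeff_def mpow_def of_real_prod prod.distrib[symmetric]
  by (intro sum.cong prod.cong refl) (simp add: power_mult_distrib)

lemma has_pser_finite:
  assumes "finite A"
  shows "has_pser (\<lambda>x. \<Sum>\<alpha>\<in>A. c \<alpha> * of_real (mpow x \<alpha>)) 0 (\<lambda>\<alpha>. if \<alpha> \<in> A then c \<alpha> else 0) r"
  unfolding has_pser_def
  by (intro ballI has_sum_finite_neutralI[of A]) (use assms in auto)

lemma has_pser_phase_power:
  "has_pser (\<lambda>x. phase z x ^ k / fact k) 0 (\<lambda>\<alpha>. if mdeg \<alpha> = k then exp_coeff (phase_coeff z) \<alpha> else 0) r"
  using has_pser_finite[OF finite_mdeg[of k], of "exp_coeff (phase_coeff z)" r] by (simp add: phase_power_eq)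

lemma has_pser_phase_taylor:
  "has_pser (phase_taylor l z) 0 (\<lambda>\<alpha>. if mdeg \<alpha> \<le> l then exp_coeff (phase_coeff z) \<alpha> else 0) r"
proof -
  have eq: "{\<alpha>::'a mindex. mdeg \<alpha> \<le> l} = (\<Union>k\<in>{..l}. {\<alpha>. mdeg \<alpha> = k})" by auto
  have fin: "finite {\<alpha>::'a mindex. mdeg \<alpha> \<le> l}" unfolding eq using finite_mdeg by auto
  have "phase_taylor l z = (\<lambda>x. \<Sum>\<alpha> | mdeg \<alpha> \<le> l. exp_coeff (phase_coeff z) \<alpha> * of_real (mpow x \<alpha>))"
    unfolding phase_taylor_def[abs_def] phase_power_eq eq
    by (subst sum.UNION_disjoint) (auto simp: finite_mdeg)
  then show ?thesis using has_pser_finite[OF fin, of "exp_coeff (phase_coeff z)" r] by simp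
qed

lemma has_pser_plane_wave: "has_pser (\<lambda>x. plane_wave x z) 0 (exp_coeff (phase_coeff z)) r"
  unfolding plane_wave_phase phase_eq_sum by (rule has_pser_exp(1))

lemma plane_wave_coeff_sum:
  fixes z y :: "real ^ 'n::finite"
  assumes "finite J"
  shows "(\<Sum>\<alpha>\<in>J. norm (exp_coeff (phase_coeff z) \<alpha> * of_real (mpow y \<alpha>))) \<le> exp (2 * pi * CARD('n) * norm z * norm y)"
  by (rule order_trans[OF has_pser_exp(2)[OF assms]]) (simp add: phase_coeff_sum_bound)

lemma entire_pser_integral:
  assumes "\<And>w r. w \<in> space M \<Longrightarrow> has_pser (K w) 0 (c w) r"
    and "\<And>\<alpha>. (\<lambda>w. c w \<alpha>) \<in> borel_measurable M" and "\<And>y. integrable M (B y)"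
    and "\<And>y w J. w \<in> space M \<Longrightarrow> finite J \<Longrightarrow> (\<Sum>\<alpha>\<in>J. norm (c w \<alpha> * of_real (mpow y \<alpha>))) \<le> B y w"
  shows "entire_pser (\<lambda>y. \<integral>w. K w y \<partial>M)"
  unfolding entire_pser_def
  by (intro exI[of _ "\<lambda>\<alpha>. \<integral>w. c w \<alpha> \<partial>M"] allI has_pser_integral[where B = B]) (use assms in auto)

lemma entire_pser_add: "entire_pser f \<Longrightarrow> entire_pser g \<Longrightarrow> entire_pser (\<lambda>x. f x + g x)"
  unfolding entire_pser_def by (elim exE) (rule exI, rule allI, rule has_pser_add, auto)

lemma entire_pser_cmult: "entire_pser f \<Longrightarrow> entire_pser (\<lambda>x. c * f x)"
  unfolding entire_pser_def using has_pser_cmult by metis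

lemma entire_pser_diff: "entire_pser f \<Longrightarrow> entire_pser g \<Longrightarrow> entire_pser (\<lambda>x. f x - g x)"
  using entire_pser_add[of f "\<lambda>x. (-1) * g x"] entire_pser_cmult[of g "-1"] by simp

lemma entire_pser_const: "entire_pser (\<lambda>_. c)"
  using has_pser_finite[of "{0}" "\<lambda>_. c"] unfolding entire_pser_def by (auto simp: mpow_def)

lemma entire_pser_sum: "(\<And>i. i \<in> I \<Longrightarrow> entire_pser (f i)) \<Longrightarrow> entire_pser (\<lambda>x. \<Sum>i\<in>I. f i x)"
  by (induction I rule: infinite_finite_induct) (auto intro: entire_pser_add entire_pser_const)

text \<open>For fixed \<open>k\<close> the integral is a homogeneous polynomial in \<open>x\<close>
  whose coefficients are moments of \<mu>. The multinomial formula turns the sum of norms over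
  degree \<open>k\<close> into the single power |z|^k.\<close>

lemma entire_pser_moment:
  fixes \<mu> :: "real ^ 'n::finite \<Rightarrow> complex"
  assumes [measurable]: "\<mu> \<in> borel_measurable borel" and int: "integrable lborel (\<lambda>z. norm z ^ k * norm (\<mu> z))"
  shows "entire_pser (\<lambda>x. \<integral>z. phase z x ^ k / fact k * \<mu> z \<partial>lborel)"
proof (rule entire_pser_integral)
  show "has_pser (\<lambda>x. phase z x ^ k / fact k * \<mu> z) 0 (\<lambda>\<alpha>. \<mu> z * (if mdeg \<alpha> = k then exp_coeff (phase_coeff z) \<alpha> else 0)) r" for z :: "real ^ 'n" and r
    using has_pser_cmult[OF has_pser_phase_power[of z k r], of "\<mu> z"] by (simp add: mult.commute)
  show "(\<lambda>z. \<mu> z * (if mdeg \<alpha> = k then exp_coeff (phase_coeff z) \<alpha> else 0)) \<in> borel_measurable lborel" for \<alpha> by measurable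
  show "integrable lborel (\<lambda>z::real ^ 'n. (2 * pi * CARD('n) * norm y) ^ k / fact k * (norm z ^ k * norm (\<mu> z)))" for y :: "real ^ 'n"
    by (intro integrable_mult_right int)
  fix y z :: "real ^ 'n" and J :: "'n mindex set" assume J: "finite J"
  define n where "n i = norm (phase_coeff z i) * \<bar>y $ i\<bar>" for i
  have term_eq: "norm (exp_coeff (phase_coeff z) \<alpha> * of_real (mpow y \<alpha>)) = (\<Prod>i\<in>UNIV. n i ^ lk \<alpha> i / fact (lk \<alpha> i))" for \<alpha>
    unfolding exp_coeff_def mpow_def norm_mult norm_of_real abs_prod prod_norm[symmetric] prod.distrib[symmetric] n_def
    by (intro prod.cong refl) (simp add: norm_divide norm_power power_mult_distrib power_abs)
  have "(\<Sum>\<alpha>\<in>J. norm (\<mu> z * (if mdeg \<alpha> = k then exp_coeff (phase_coeff z) \<alpha> else 0) * of_real (mpow y \<alpha>))) =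
     norm (\<mu> z) * (\<Sum>\<alpha>\<in>J. if mdeg \<alpha> = k then norm (exp_coeff (phase_coeff z) \<alpha> * of_real (mpow y \<alpha>)) else 0)"
    unfolding sum_distrib_left by (intro sum.cong refl) (simp add: norm_mult)
  also have "\<dots> = norm (\<mu> z) * (\<Sum>\<alpha> | \<alpha> \<in> J \<and> mdeg \<alpha> = k. norm (exp_coeff (phase_coeff z) \<alpha> * of_real (mpow y \<alpha>)))"
    using J by (simp add: sum.inter_filter[symmetric] Collect_conj_eq)
  also have "\<dots> \<le> norm (\<mu> z) * (\<Sum>\<alpha> | mdeg \<alpha> = k. norm (exp_coeff (phase_coeff z) \<alpha> * of_real (mpow y \<alpha>)))"
    by (intro mult_left_mono sum_mono2 finite_mdeg) auto
  also have "\<dots> = norm (\<mu> z) * ((\<Sum>i\<in>UNIV. n i) ^ k / fact k)"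
    unfolding term_eq multinomial ..
  also have "\<dots> \<le> norm (\<mu> z) * ((2 * pi * CARD('n) * norm z * norm y) ^ k / fact k)"
    unfolding n_def by (intro mult_left_mono divide_right_mono power_mono phase_coeff_sum_bound sum_nonneg) auto
  also have "\<dots> = (2 * pi * CARD('n) * norm y) ^ k / fact k * (norm z ^ k * norm (\<mu> z))"
    by (simp add: power_mult_distrib)
  finally show "(\<Sum>\<alpha>\<in>J. norm (\<mu> z * (if mdeg \<alpha> = k then exp_coeff (phase_coeff z) \<alpha> else 0) * of_real (mpow y \<alpha>)))
     \<le> (2 * pi * CARD('n) * norm y) ^ k / fact k * (norm z ^ k * norm (\<mu> z))" .
qed

lemma gaussian_integrable:
  assumes "t > 0"
  shows "integrable lborel (\<lambda>z::real ^ 'n::finite. exp (- (pi * t) * norm z ^ 2))"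
  using integrable_norm[OF gaussian_fourier(1)[OF assms, of 0]] by (simp add: norm_mult)

text \<open>Completing the square. The majorant of the expansion of a plane wave grows exponentially
  in |z|; half of the Gaussian decay absorbs this growth.\<close>

lemma exp_linear_gaussian_bound:
  fixes a r :: real
  shows "exp (a * r) * exp (- (pi / 2) * r ^ 2) \<le> exp (a ^ 2 / pi) * exp (- (pi / 4) * r ^ 2)"
proof -
  have "0 \<le> (a - pi / 2 * r) ^ 2" by simp
  also have "\<dots> = a ^ 2 - pi * (a * r) + pi ^ 2 / 4 * r ^ 2" by (simp add: power2_eq_square algebra_simps)
  finally have "pi * (a * r) \<le> pi * (a ^ 2 / pi + pi / 4 * r ^ 2)" by (simp add: power2_eq_square algebra_simps)
  then have "a * r \<le> a ^ 2 / pi + pi / 4 * r ^ 2" by simp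
  then show ?thesis by (simp add: exp_add[symmetric] algebra_simps)
qed

text \<open>Inside the unit ball, removing the degrees up to \<open>l\<close> leaves a factor
  |z|^(l+1), which by the assumption on \<open>l\<close> makes the singularity integrable. Outside,
  the Gaussian decay of \<mu> dominates all plane-wave coefficients together.\<close>

lemma entire_pser_upper_integral:
  fixes \<mu> :: "real ^ 'n::finite \<Rightarrow> complex"
  assumes [measurable]: "\<mu> \<in> borel_measurable borel"
    and \<mu>: "\<And>z. norm (\<mu> z) \<le> C * exp (- (pi / 2) * norm z ^ 2) * norm z powr (- 2 * \<sigma>)"
    and C: "C > 0" and \<sigma>: "\<sigma> > 0" and l: "real l + 1 - 2 * \<sigma> + CARD('n) > 0"
  shows "entire_pser (\<lambda>x. \<integral>z. (plane_wave x z - indicator (ball 0 1) z * phase_taylor l z x) * \<mu> z \<partial>lborel)"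
    and "\<And>x. integrable lborel (\<lambda>z. (plane_wave x z - indicator (ball 0 1) z * phase_taylor l z x) * \<mu> z)"
proof -
  define c where "c z \<alpha> = \<mu> z * (exp_coeff (phase_coeff z) \<alpha> + (- indicator (ball 0 1) z) * (if mdeg \<alpha> \<le> l then exp_coeff (phase_coeff z) \<alpha> else 0))" for z \<alpha>
  define B where "B y z = C * exp (\<Sum>i\<in>UNIV. 2 * pi * \<bar>y $ i\<bar>) * (indicator (ball 0 1) z * norm z powr (real l + 1 - 2 * \<sigma>)) +
     C * exp ((2 * pi * CARD('n) * norm y) ^ 2 / pi) * exp (- (pi * (1 / 4)) * norm z ^ 2)" for y z :: "real ^ 'n"
  have ps: "has_pser (\<lambda>x. (plane_wave x z - indicator (ball 0 1) z * phase_taylor l z x) * \<mu> z) 0 (c z) r" for z r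
  proof -
    have "has_pser (\<lambda>x. \<mu> z * (plane_wave x z + (- indicator (ball 0 1) z) * phase_taylor l z x)) 0 (c z) r"
      unfolding c_def by (intro has_pser_cmult has_pser_add has_pser_plane_wave has_pser_phase_taylor)
    then show ?thesis by (simp add: mult.commute)
  qed
  have Bi: "integrable lborel (B y)" for y
    unfolding B_def using l
    by (intro Bochner_Integration.integrable_add integrable_mult_right integrable_norm_powr_ball gaussian_integrable) auto
  have le: "(\<Sum>\<alpha>\<in>J. norm (c z \<alpha> * of_real (mpow y \<alpha>))) \<le> B y z" if J: "finite J" for y z :: "real ^ 'n" and J
  proof (cases "z \<in> ball 0 1")
    case True
    \<comment> \<open>Degrees up to \<open>l\<close> cancel in \<open>c\<close>. For a higher
      degree, |z| < 1 permits lowering |z|^deg to |z|^(l+1); what remains are the coefficients of an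
      exponential that does not involve \<open>z\<close>.\<close>
    have t: "norm (c z \<alpha> * of_real (mpow y \<alpha>)) \<le> norm (\<mu> z) * (norm z ^ (l + 1) * norm (exp_coeff (\<lambda>_. 2 * of_real pi) \<alpha> * of_real (mpow y \<alpha>)))" for \<alpha>
    proof (cases "mdeg \<alpha> \<le> l")
      case False
      have "norm (exp_coeff (phase_coeff z) \<alpha>) = (\<Prod>i\<in>UNIV. \<bar>z $ i\<bar> ^ lk \<alpha> i * ((2 * pi) ^ lk \<alpha> i / fact (lk \<alpha> i)))"
        unfolding exp_coeff_def prod_norm[symmetric]
        by (intro prod.cong refl) (simp add: phase_coeff_def norm_divide norm_power norm_mult power_mult_distrib)
      also have "\<dots> \<le> (\<Prod>i\<in>UNIV. norm z ^ lk \<alpha> i * ((2 * pi) ^ lk \<alpha> i / fact (lk \<alpha> i)))"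
        by (intro prod_mono conjI mult_right_mono power_mono component_le_norm_cart) auto
      also have "\<dots> = norm z ^ mdeg \<alpha> * norm (exp_coeff (\<lambda>_. 2 * of_real pi) \<alpha>)"
      proof -
        have "norm (exp_coeff (\<lambda>_. 2 * of_real pi) \<alpha>) = (\<Prod>i\<in>UNIV. (2 * pi) ^ lk \<alpha> i / fact (lk \<alpha> i))"
          unfolding exp_coeff_def prod_norm[symmetric] by (intro prod.cong refl) (simp add: norm_divide norm_power norm_mult)
        then show ?thesis by (simp only: prod.distrib power_sum mdeg_def)
      qed
      also have "\<dots> \<le> norm z ^ (l + 1) * norm (exp_coeff (\<lambda>_. 2 * of_real pi) \<alpha>)"
        using False True by (intro mult_right_mono power_decreasing) auto
      finally have "norm (exp_coeff (phase_coeff z) \<alpha>) \<le> norm z ^ (l + 1) * norm (exp_coeff (\<lambda>_. 2 * of_real pi) \<alpha>)" .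
      then have "norm (\<mu> z) * (norm (exp_coeff (phase_coeff z) \<alpha>) * \<bar>mpow y \<alpha>\<bar>) \<le>
          norm (\<mu> z) * ((norm z ^ (l + 1) * norm (exp_coeff (\<lambda>_. 2 * of_real pi) \<alpha>)) * \<bar>mpow y \<alpha>\<bar>)"
        by (intro mult_left_mono mult_right_mono) auto
      then show ?thesis using False by (simp add: c_def norm_mult mult.assoc)
    qed (use True in \<open>simp add: c_def\<close>)
    have "(\<Sum>\<alpha>\<in>J. norm (c z \<alpha> * of_real (mpow y \<alpha>))) \<le> (\<Sum>\<alpha>\<in>J. norm (\<mu> z) * (norm z ^ (l + 1) * norm (exp_coeff (\<lambda>_. 2 * of_real pi) \<alpha> * of_real (mpow y \<alpha>))))"
      by (intro sum_mono t)
    also have "\<dots> = norm (\<mu> z) * norm z ^ (l + 1) * (\<Sum>\<alpha>\<in>J. norm (exp_coeff (\<lambda>_. 2 * of_real pi) \<alpha> * of_real (mpow y \<alpha>)))"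
      by (simp add: sum_distrib_left mult.assoc)
    also have "\<dots> \<le> norm (\<mu> z) * norm z ^ (l + 1) * exp (\<Sum>i\<in>UNIV. 2 * pi * \<bar>y $ i\<bar>)"
      using has_pser_exp(2)[OF J, of "\<lambda>_. 2 * of_real pi" y] by (intro mult_left_mono) (auto simp: norm_mult)
    also have "\<dots> \<le> (C * norm z powr (- 2 * \<sigma>)) * norm z ^ (l + 1) * exp (\<Sum>i\<in>UNIV. 2 * pi * \<bar>y $ i\<bar>)"
    proof (intro mult_right_mono)
      have "C * exp (- (pi / 2) * norm z ^ 2) * norm z powr (- 2 * \<sigma>) \<le> C * 1 * norm z powr (- 2 * \<sigma>)"
        using C by (intro mult_right_mono mult_left_mono) auto
      then show "norm (\<mu> z) \<le> C * norm z powr (- 2 * \<sigma>)" using \<mu>[of z] by simp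
    qed auto
    also have "(C * norm z powr (- 2 * \<sigma>)) * norm z ^ (l + 1) * exp (\<Sum>i\<in>UNIV. 2 * pi * \<bar>y $ i\<bar>)
      = C * exp (\<Sum>i\<in>UNIV. 2 * pi * \<bar>y $ i\<bar>) * (indicator (ball 0 1) z * norm z powr (real l + 1 - 2 * \<sigma>))"
    proof -
      have "norm z powr (- 2 * \<sigma>) * norm z ^ (l + 1) = norm z powr (real l + 1 - 2 * \<sigma>)"
        by (cases "z = 0") (simp_all add: powr_realpow[symmetric] powr_add[symmetric] algebra_simps del: power_Suc)
      then show ?thesis using True by (simp add: mult_ac)
    qed
    also have "\<dots> \<le> B y z" using C by (simp add: B_def)
    finally show ?thesis .
  next
    case False
    then have z1: "norm z \<ge> 1" by auto
    have "c z \<alpha> = \<mu> z * exp_coeff (phase_coeff z) \<alpha>" for \<alpha> using False by (simp add: c_def)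
    then have "(\<Sum>\<alpha>\<in>J. norm (c z \<alpha> * of_real (mpow y \<alpha>))) = norm (\<mu> z) * (\<Sum>\<alpha>\<in>J. norm (exp_coeff (phase_coeff z) \<alpha> * of_real (mpow y \<alpha>)))"
      by (simp add: norm_mult sum_distrib_left mult.assoc)
    also have "\<dots> \<le> (C * exp (- (pi / 2) * norm z ^ 2)) * exp (2 * pi * CARD('n) * norm z * norm y)"
    proof (intro mult_mono plane_wave_coeff_sum J)
      have "norm z powr (- 2 * \<sigma>) \<le> norm z powr 0" using z1 \<sigma> by (intro powr_mono) auto
      then have "norm z powr (- 2 * \<sigma>) \<le> 1" using z1 by (auto split: if_splits)
      then have "C * exp (- (pi / 2) * norm z ^ 2) * norm z powr (- 2 * \<sigma>) \<le> C * exp (- (pi / 2) * norm z ^ 2) * 1"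
        using z1 C by (intro mult_left_mono) auto
      then show "norm (\<mu> z) \<le> C * exp (- (pi / 2) * norm z ^ 2)" using \<mu>[of z] by simp
    qed (use C in \<open>auto intro!: sum_nonneg\<close>)
    also have "\<dots> = C * (exp ((2 * pi * CARD('n) * norm y) * norm z) * exp (- (pi / 2) * norm z ^ 2))"
      by (simp add: mult_ac)
    also have "\<dots> \<le> C * (exp ((2 * pi * CARD('n) * norm y) ^ 2 / pi) * exp (- (pi / 4) * norm z ^ 2))"
      using C by (intro mult_left_mono exp_linear_gaussian_bound) auto
    also have "\<dots> \<le> B y z" using False by (simp add: B_def)
    finally show ?thesis .
  qed
  have cm: "(\<lambda>z. c z \<alpha>) \<in> borel_measurable lborel" for \<alpha> unfolding c_def by measurable
  show "entire_pser (\<lambda>x. \<integral>z. (plane_wave x z - indicator (ball 0 1) z * phase_taylor l z x) * \<mu> z \<partial>lborel)"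
    by (rule entire_pser_integral[OF ps cm Bi le]) auto
  show "integrable lborel (\<lambda>z. (plane_wave x z - indicator (ball 0 1) z * phase_taylor l z x) * \<mu> z)" for x
  proof (rule has_sum_integral_dominated(1)[OF countable_mindex, where B = "B x"])
    show "((\<lambda>\<alpha>. c z \<alpha> * of_real (mpow x \<alpha>)) has_sum (plane_wave x z - indicator (ball 0 1) z * phase_taylor l z x) * \<mu> z) UNIV" for z
      using ps[of z "norm x + 1"] unfolding has_pser_def by auto
    show "(\<lambda>z. c z \<alpha> * of_real (mpow x \<alpha>)) \<in> borel_measurable lborel" for \<alpha>
      by (intro borel_measurable_times borel_measurable_const cm)
  qed (use Bi le in auto)
qed

section \<open>Enumerated lattice points and the set where the density is analytic\<close>

abbreviation lattice_point :: "real ^ 'n ^ 'n \<Rightarrow> ('n::finite \<Rightarrow> int) \<Rightarrow> real ^ 'n" where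
  "lattice_point M n \<equiv> M *v int_vec n"

lemma int_vec_eq_0_iff: "int_vec n = 0 \<longleftrightarrow> n = (\<lambda>_. 0)"
  by (auto simp: int_vec_def vec_eq_iff fun_eq_iff)

lemma int_vec_zero [simp]: "int_vec (\<lambda>_. 0) = 0"
  by (simp add: int_vec_eq_0_iff)

lemma int_vec_minus: "int_vec (\<lambda>i. - n i) = - int_vec n"
  by (simp add: int_vec_def vec_eq_iff)

lemma norm_int_vec_ge_1:
  assumes "n \<noteq> (\<lambda>_. 0)"
  shows "norm (int_vec n) \<ge> 1"
proof -
  obtain i where "n i \<noteq> 0" using assms by auto
  then have "1 \<le> \<bar>int_vec n $ i\<bar>" by simp
  then show ?thesis using component_le_norm_cart[of "int_vec n" i] by linarith
qed

lemma lattice_point_lower: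
  fixes M :: "real ^ 'n ^ 'n"
  assumes "invertible M"
  obtains c where "c > 0" "\<And>n. n \<noteq> (\<lambda>_. 0) \<Longrightarrow> c \<le> norm (lattice_point M n)"
    "\<And>n. c * norm (int_vec n) \<le> norm (lattice_point M n)"
proof -
  obtain c where c: "c > 0" "\<And>x. c * norm x \<le> norm (M *v x)" using invertible_bounded_below[OF assms] by metis
  show ?thesis
  proof
    fix n :: "'n \<Rightarrow> int" assume "n \<noteq> (\<lambda>_. 0)"
    then have "c * 1 \<le> c * norm (int_vec n)" using c(1) norm_int_vec_ge_1 by (intro mult_left_mono) auto
    then show "c \<le> norm (lattice_point M n)" using c(2)[of "int_vec n"] by simp
  qed (use c in auto)
qed

lemma finite_int_vec_bounded: "finite {n::'n::finite \<Rightarrow> int. norm (int_vec n) \<le> R}"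
proof (rule finite_subset)
  show "{n::'n \<Rightarrow> int. norm (int_vec n) \<le> R} \<subseteq> PiE UNIV (\<lambda>_. {- \<lceil>R\<rceil>..\<lceil>R\<rceil>})"
  proof
    fix n :: "'n \<Rightarrow> int" assume "n \<in> {n. norm (int_vec n) \<le> R}"
    then have "\<bar>of_int (n i)\<bar> \<le> R" for i using component_le_norm_cart[of "int_vec n" i] by simp
    then have "of_int \<bar>n i\<bar> \<le> R" for i by simp
    then have "\<bar>n i\<bar> \<le> \<lceil>R\<rceil>" for i by (metis ceiling_mono ceiling_of_int)
    then show "n \<in> PiE UNIV (\<lambda>_. {- \<lceil>R\<rceil>..\<lceil>R\<rceil>})" by (auto simp: abs_le_iff minus_le_iff)
  qed
qed (auto intro: finite_PiE)

definition regular_set :: "real ^ 'n ^ 'n \<Rightarrow> (real ^ 'n) set" where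
  "regular_set M = - dual_lattice_of M \<union> {0}"

lemma dual_lattice_of_eq: "dual_lattice_of M = range (lattice_point (dual_matrix M))"
  by (simp add: dual_lattice_of_def lattice_of_eq)

text \<open>Only finitely many dual lattice points are near \<open>x\<close>, and none of the
  nonzero ones hits -x. The index 0 is excluded, which is what admits x = 0.\<close>

lemma regular_set_distance:
  fixes M :: "real ^ 'n ^ 'n"
  assumes M: "invertible M" and x: "x \<in> regular_set M"
  obtains \<delta> where "\<delta> > 0" "\<And>n. n \<noteq> (\<lambda>_. 0) \<Longrightarrow> \<delta> \<le> norm (x + lattice_point (dual_matrix M) n)"
proof -
  define A where "A = dual_matrix M"
  have A: "invertible A" unfolding A_def by (rule invertible_dual_matrix[OF M])
  obtain c where c: "c > 0" "\<And>n. c * norm (int_vec n) \<le> norm (lattice_point A n)"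
    "\<And>n. n \<noteq> (\<lambda>_. 0) \<Longrightarrow> c \<le> norm (lattice_point A n)"
    using lattice_point_lower[OF A] by metis
  \<comment> \<open>For a nonzero index outside \<open>S\<close> the lattice point is longer than
    |x| + 1, so its distance exceeds 1; this is why 1 is inserted into the minimum below.\<close>
  define S where "S = {n::'n \<Rightarrow> int. norm (int_vec n) \<le> (norm x + 1) / c} - {\<lambda>_. 0}"
  have S: "finite S" unfolding S_def using finite_int_vec_bounded by blast
  have pos: "norm (x + lattice_point A n) > 0" if "n \<noteq> (\<lambda>_. 0)" for n
  proof (rule ccontr)
    assume "\<not> ?thesis"
    then have 0: "x = - lattice_point A n" by (simp add: eq_neg_iff_add_eq_0)
    then have "x = lattice_point A (\<lambda>i. - n i)" by (simp add: int_vec_minus linear_neg[OF matrix_vector_mul_linear])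
    then have "x = 0" using x unfolding regular_set_def dual_lattice_of_eq A_def by auto
    then show False using 0 c(1) c(3)[OF that] by auto
  qed
  define \<delta> where "\<delta> = Min (insert 1 ((\<lambda>n. norm (x + lattice_point A n)) ` S))"
  have "\<delta> > 0" unfolding \<delta>_def using S pos by (subst Min_gr_iff) (auto simp: S_def)
  moreover have "\<delta> \<le> norm (x + lattice_point A n)" if n: "n \<noteq> (\<lambda>_. 0)" for n
  proof (cases "n \<in> S")
    case True
    then show ?thesis unfolding \<delta>_def using S by (intro Min_le) auto
  next
    case False
    then have "norm x + 1 < c * norm (int_vec n)" using n c(1) by (auto simp: S_def field_simps)
    then have "norm x + 1 < norm (lattice_point A n)" using c(2)[of n] by linarith
    then have "1 \<le> norm (x + lattice_point A n)" using norm_diff_ineq[of "lattice_point A n" x] by (simp add: add.commute)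
    moreover have "\<delta> \<le> 1" unfolding \<delta>_def using S by (intro Min_le) auto
    ultimately show ?thesis by linarith
  qed
  ultimately show ?thesis using that unfolding A_def by blast
qed

lemma open_regular_set:
  fixes M :: "real ^ 'n ^ 'n"
  assumes M: "invertible M"
  shows "open (regular_set M)"
  unfolding open_contains_ball
proof
  fix x assume "x \<in> regular_set M"
  then obtain \<delta> where \<delta>: "\<delta> > 0" "\<And>n. n \<noteq> (\<lambda>_. 0) \<Longrightarrow> \<delta> \<le> norm (x + lattice_point (dual_matrix M) n)"
    using regular_set_distance[OF M] by metis
  have "y \<in> regular_set M" if y: "y \<in> ball x \<delta>" for y
  proof (rule ccontr)
    assume "y \<notin> regular_set M"
    then obtain m where m: "y = lattice_point (dual_matrix M) m" "y \<noteq> 0"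
      unfolding regular_set_def dual_lattice_of_eq by auto
    then have "m \<noteq> (\<lambda>_. 0)" by (metis int_vec_zero matrix_vector_mult_0_right)
    then have "(\<lambda>i. - m i) \<noteq> (\<lambda>_. 0)" by (auto simp: fun_eq_iff)
    from \<delta>(2)[OF this] have "\<delta> \<le> norm (x - y)"
      by (simp add: m int_vec_minus linear_neg[OF matrix_vector_mul_linear])
    then show False using y by (simp add: dist_norm)
  qed
  then show "\<exists>e>0. ball x e \<subseteq> regular_set M" using \<delta>(1) by blast
qed

abbreviation nonzero :: "('n \<Rightarrow> int) set" where "nonzero \<equiv> - {\<lambda>_. 0}"

lemma infsum_eq_integral:
  fixes f :: "'a \<Rightarrow> complex"
  assumes "f summable_on A"
  shows "infsum f A = (\<integral>x. f x \<partial>count_space A)"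
  by (rule integral_count_space_has_sum(2)[OF has_sum_infsum[OF assms], symmetric])

text \<open>The discrete analogue of \<open>entire_pser_upper_integral\<close>. Nonzero lattice
  points stay away from the origin, so the singular factor is bounded and no Taylor polynomial is
  subtracted.\<close>

lemma lattice_upper_entire:
  fixes M :: "real ^ 'n ^ 'n" and \<mu> :: "real ^ 'n \<Rightarrow> complex"
  assumes M: "invertible M" and \<sigma>: "\<sigma> > 0" and C: "C > 0"
    and \<mu>: "\<And>z. norm (\<mu> z) \<le> C * exp (- (pi / 2) * norm z ^ 2) * norm z powr (- 2 * \<sigma>)"
  shows "entire_pser (\<lambda>x. \<Sum>\<^sub>\<infinity>n\<in>nonzero. plane_wave x (lattice_point M n) * \<mu> (lattice_point M n))"
    and "\<And>x. (\<lambda>n. plane_wave x (lattice_point M n) * \<mu> (lattice_point M n)) summable_on nonzero"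
proof -
  let ?z = "lattice_point M"
  obtain c where c: "c > 0" "\<And>n. n \<noteq> (\<lambda>_. 0) \<Longrightarrow> c \<le> norm (?z n)" using lattice_point_lower[OF M] by metis
  define B where "B y n = C * c powr (- 2 * \<sigma>) * exp ((2 * pi * CARD('n) * norm y) ^ 2 / pi) * exp (- (pi / 4) * norm (?z n) ^ 2)" for y :: "real ^ 'n" and n
  have Bs: "B y summable_on nonzero" for y
    unfolding B_def
  proof (rule summable_on_cmult_right, rule summable_on_subset_banach)
    show "(\<lambda>n. exp (- (pi / 4) * norm (?z n) ^ 2)) summable_on UNIV"
      by (rule summable_on_lattice_gaussian[OF M]) simp
  qed simp
  have le: "norm (\<mu> (?z n)) * exp (2 * pi * CARD('n) * norm (?z n) * norm y) \<le> B y n" if "n \<noteq> (\<lambda>_. 0)" for n and y :: "real ^ 'n"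
  proof -
    have "norm (?z n) powr (- 2 * \<sigma>) \<le> c powr (- 2 * \<sigma>)"
      using c that \<sigma> by (intro powr_mono2') auto
    then have "C * exp (- (pi / 2) * norm (?z n) ^ 2) * norm (?z n) powr (- 2 * \<sigma>) \<le> C * exp (- (pi / 2) * norm (?z n) ^ 2) * c powr (- 2 * \<sigma>)"
      using C by (intro mult_left_mono) auto
    then have "norm (\<mu> (?z n)) \<le> C * exp (- (pi / 2) * norm (?z n) ^ 2) * c powr (- 2 * \<sigma>)" using \<mu>[of "?z n"] by linarith
    then have "norm (\<mu> (?z n)) * exp (2 * pi * CARD('n) * norm (?z n) * norm y) \<le>
        C * exp (- (pi / 2) * norm (?z n) ^ 2) * c powr (- 2 * \<sigma>) * exp (2 * pi * CARD('n) * norm (?z n) * norm y)"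
      by (intro mult_right_mono) auto
    also have "\<dots> = C * c powr (- 2 * \<sigma>) * (exp ((2 * pi * CARD('n) * norm y) * norm (?z n)) * exp (- (pi / 2) * norm (?z n) ^ 2))"
      by (simp add: mult_ac)
    also have "\<dots> \<le> C * c powr (- 2 * \<sigma>) * (exp ((2 * pi * CARD('n) * norm y) ^ 2 / pi) * exp (- (pi / 4) * norm (?z n) ^ 2))"
      using C by (intro mult_left_mono exp_linear_gaussian_bound) auto
    finally show ?thesis by (simp add: B_def mult_ac)
  qed
  show sm: "(\<lambda>n. plane_wave x (?z n) * \<mu> (?z n)) summable_on nonzero" for x
    by (rule summable_on_bounded[OF Bs[of 0]]) (use le[of _ 0] in \<open>auto simp: norm_mult\<close>)
  have "entire_pser (\<lambda>x. \<integral>n. plane_wave x (?z n) * \<mu> (?z n) \<partial>count_space nonzero)"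
  proof (rule entire_pser_integral)
    show "has_pser (\<lambda>x. plane_wave x (?z n) * \<mu> (?z n)) 0 (\<lambda>\<alpha>. \<mu> (?z n) * exp_coeff (phase_coeff (?z n)) \<alpha>) r" for n r
      using has_pser_cmult[OF has_pser_plane_wave, of "\<mu> (?z n)" "?z n" r] by (simp add: mult.commute)
    show "integrable (count_space nonzero) (B y)" for y by (rule integrable_count_space_summable[OF Bs])
    fix y and n :: "'n \<Rightarrow> int" and J :: "'n mindex set" assume n: "n \<in> space (count_space nonzero)" and J: "finite J"
    have "(\<Sum>\<alpha>\<in>J. norm (\<mu> (?z n) * exp_coeff (phase_coeff (?z n)) \<alpha> * of_real (mpow y \<alpha>))) =
       norm (\<mu> (?z n)) * (\<Sum>\<alpha>\<in>J. norm (exp_coeff (phase_coeff (?z n)) \<alpha> * of_real (mpow y \<alpha>)))"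
      by (simp add: norm_mult sum_distrib_left mult.assoc)
    also have "\<dots> \<le> norm (\<mu> (?z n)) * exp (2 * pi * CARD('n) * norm (?z n) * norm y)"
      by (intro mult_left_mono plane_wave_coeff_sum J) auto
    also have "\<dots> \<le> B y n" using n by (intro le) auto
    finally show "(\<Sum>\<alpha>\<in>J. norm (\<mu> (?z n) * exp_coeff (phase_coeff (?z n)) \<alpha> * of_real (mpow y \<alpha>))) \<le> B y n" .
  qed simp
  then show "entire_pser (\<lambda>x. \<Sum>\<^sub>\<infinity>n\<in>nonzero. plane_wave x (?z n) * \<mu> (?z n))"
    by (simp add: infsum_eq_integral[OF sm])
qed

text \<open>The Fourier transform of \<open>lower_part s\<close>, see
  \<open>lower_part_wave_integral\<close>; the power of sqrt t comes from transforming a Gaussian.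
  Substituting 1/t turns it into an incomplete Gamma integral in |x|^2.\<close>

definition dual_gaussian :: "complex \<Rightarrow> real ^ 'n::finite \<Rightarrow> complex" where
  "dual_gaussian s x = (\<integral>t. indicator {0<..1} t * (of_real t powr (s - 1) / of_real (sqrt t ^ CARD('n)) *
     of_real (exp (- pi * norm x ^ 2 / t))) \<partial>lborel)"

definition dual_weight :: "nat \<Rightarrow> real \<Rightarrow> real \<Rightarrow> real" where
  "dual_weight d \<sigma> t = indicator {0<..1} t * (t powr (\<sigma> - 1) / sqrt t ^ d)"

lemma dual_weight_integrable:
  assumes "\<sigma> > d / 2"
  shows "integrable lborel (dual_weight d \<sigma>)"
proof -
  have "dual_weight d \<sigma> t = indicator {0<..1} t * t powr (\<sigma> - 1 - d / 2)" for t
  proof (cases "t \<in> {0<..1}")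
    case True
    then have "sqrt t ^ d = t powr (d / 2)" by (simp add: powr_half_sqrt[symmetric] powr_powr powr_realpow[symmetric])
    then show ?thesis using True by (simp add: dual_weight_def powr_diff)
  qed (simp add: dual_weight_def)
  then have "dual_weight d \<sigma> = (\<lambda>t. indicator {0<..1} t * t powr (\<sigma> - 1 - d / 2))" by auto
  then show ?thesis using integrable_powr_unit[of "\<sigma> - 1 - d / 2"] assms by simp
qed

lemma norm_dual_weight: "norm (indicator {0<..1} t * (complex_of_real t powr (s - 1) / of_real (sqrt t ^ d))) = dual_weight d (Re s) t"
  by (cases "t \<in> {0<..1}") (simp_all add: dual_weight_def norm_divide norm_power norm_powr_of_real)

text \<open>Brings a Gaussian that is not centred at \<open>x0\<close> into the form of
  \<open>has_pser_quad_exp\<close>, with linear coefficients -2 pi a_i / t and quadratic coefficient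
  -pi / t.\<close>

lemma dual_gaussian_expansion:
  fixes x0 y a :: "real ^ 'n::finite"
  assumes t: "t > 0"
  shows "complex_of_real (exp (- pi * norm (y - x0 + a) ^ 2 / t)) = of_real (exp (- pi * norm a ^ 2 / t)) *
     exp (\<Sum>i\<in>UNIV. of_real (- 2 * pi * a $ i / t) * of_real (y $ i - x0 $ i) + of_real (- pi / t) * of_real (y $ i - x0 $ i) ^ 2)"
proof -
  have "norm (y - x0 + a) ^ 2 = norm a ^ 2 + (\<Sum>i\<in>UNIV. 2 * a $ i * (y $ i - x0 $ i) + (y $ i - x0 $ i) ^ 2)"
    unfolding norm_vec_sum_squares sum.distrib[symmetric]
    by (intro sum.cong refl) (simp add: power2_eq_square algebra_simps)
  then have "- pi * norm (y - x0 + a) ^ 2 / t = - pi * norm a ^ 2 / t + (- pi / t) * (\<Sum>i\<in>UNIV. 2 * a $ i * (y $ i - x0 $ i) + (y $ i - x0 $ i) ^ 2)"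
    using t by (simp add: field_simps)
  also have "(- pi / t) * (\<Sum>i\<in>UNIV. 2 * a $ i * (y $ i - x0 $ i) + (y $ i - x0 $ i) ^ 2) =
      (\<Sum>i\<in>UNIV. - 2 * pi * a $ i / t * (y $ i - x0 $ i) + - pi / t * (y $ i - x0 $ i) ^ 2)"
    unfolding sum_distrib_left by (intro sum.cong refl) (use t in \<open>simp add: field_simps\<close>)
  finally have "- pi * norm (y - x0 + a) ^ 2 / t = - pi * norm a ^ 2 / t + (\<Sum>i\<in>UNIV. - 2 * pi * a $ i / t * (y $ i - x0 $ i) + - pi / t * (y $ i - x0 $ i) ^ 2)" .
  then have "exp (- pi * norm (y - x0 + a) ^ 2 / t) = exp (- pi * norm a ^ 2 / t) *
     exp (\<Sum>i\<in>UNIV. - 2 * pi * a $ i / t * (y $ i - x0 $ i) + - pi / t * (y $ i - x0 $ i) ^ 2)"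
    by (simp only: exp_add)
  then show ?thesis
    by (simp only: of_real_mult exp_of_real[symmetric] of_real_sum of_real_add of_real_power)
qed

section \<open>Dual Gaussians and the analytic density\<close>

lemma dual_weight_nonneg: "0 \<le> dual_weight d \<sigma> t"
  by (cases "t \<in> {0<..1}") (auto simp: dual_weight_def)

lemma quad_exp_coeff_measurable [measurable]:
  "f \<in> borel_measurable M \<Longrightarrow> g \<in> borel_measurable M \<Longrightarrow> (\<lambda>x. quad_exp_coeff (f x) (g x) n) \<in> borel_measurable M"
  unfolding quad_exp_coeff_def
  by (intro borel_measurable_sum borel_measurable_times borel_measurable_divide borel_measurable_power borel_measurable_const borel_measurable_if) auto

text \<open>The majorant survives the integration. This lets \<open>has_pser_integral\<close> be
  applied twice: over \<open>t\<close> for one dual lattice point, then over the dual lattice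
  points.\<close>

lemma has_pser_integral_bound:
  assumes ps: "\<And>w. w \<in> space M \<Longrightarrow> has_pser (K w) x (c w) r"
    and meas: "\<And>\<alpha>. (\<lambda>w. c w \<alpha>) \<in> borel_measurable M"
    and B: "integrable M B" and J: "finite J"
    and le: "\<And>w J. w \<in> space M \<Longrightarrow> finite J \<Longrightarrow> (\<Sum>\<alpha>\<in>J. norm (c w \<alpha> * of_real (mpow h \<alpha>))) \<le> B w"
  shows "(\<Sum>\<alpha>\<in>J. norm ((\<integral>w. c w \<alpha> \<partial>M) * of_real (mpow h \<alpha>))) \<le> (\<integral>w. B w \<partial>M)"
proof -
  have int: "integrable M (\<lambda>w. c w \<alpha> * of_real (mpow h \<alpha>))" for \<alpha>
  proof (rule Bochner_Integration.integrable_bound[OF B])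
    show "(\<lambda>w. c w \<alpha> * of_real (mpow h \<alpha>)) \<in> borel_measurable M"
      by (intro borel_measurable_times borel_measurable_const meas)
    show "AE w in M. norm (c w \<alpha> * of_real (mpow h \<alpha>)) \<le> norm (B w)"
      using le[of _ "{\<alpha>}"] by (auto intro!: AE_I2 order_trans[OF _ abs_ge_self])
  qed
  have "(\<Sum>\<alpha>\<in>J. norm ((\<integral>w. c w \<alpha> \<partial>M) * of_real (mpow h \<alpha>))) = (\<Sum>\<alpha>\<in>J. norm (\<integral>w. c w \<alpha> * of_real (mpow h \<alpha>) \<partial>M))"
    by simp
  also have "\<dots> \<le> (\<Sum>\<alpha>\<in>J. \<integral>w. norm (c w \<alpha> * of_real (mpow h \<alpha>)) \<partial>M)"
    by (intro sum_mono integral_norm_bound)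
  also have "\<dots> = (\<integral>w. (\<Sum>\<alpha>\<in>J. norm (c w \<alpha> * of_real (mpow h \<alpha>))) \<partial>M)"
    by (rule Bochner_Integration.integral_sum[symmetric]) (intro integrable_norm int)
  also have "\<dots> \<le> (\<integral>w. B w \<partial>M)"
    by (intro integral_mono Bochner_Integration.integrable_sum integrable_norm int B le J)
  finally show ?thesis .
qed

text \<open>On the ball of radius |a| / (8d) the majorant loses at most half of the exponent: the
  cross term, d times 2 |a| |h|, and the square |h|^2 are each at most |a|^2 / 4. Finally 1/t is at
  least 1, which removes the dependence on \<open>t\<close>.\<close>

lemma quad_exp_decay:
  fixes a h :: "real ^ 'n::finite"
  assumes t: "0 < t" "t \<le> 1" and h: "norm h \<le> norm a / (8 * CARD('n))"
  shows "exp (- pi * norm a ^ 2 / t) * exp (\<Sum>i\<in>UNIV. (2 * pi * \<bar>a $ i\<bar> / t) * \<bar>h $ i\<bar> + (pi / t) * (h $ i) ^ 2) \<le> exp (- (pi / 2) * norm a ^ 2)"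
proof -
  have d: "real CARD('n) \<ge> 1" by (simp add: Suc_leI)
  have 1: "(\<Sum>i\<in>UNIV. \<bar>a $ i\<bar> * \<bar>h $ i\<bar>) \<le> CARD('n) * (norm a * norm h)"
    using sum_bounded_above[of "UNIV :: 'n set" "\<lambda>i. \<bar>a $ i\<bar> * \<bar>h $ i\<bar>" "norm a * norm h"]
    by (simp add: mult_mono component_le_norm_cart)
  have "CARD('n) * (norm a * norm h) \<le> CARD('n) * (norm a * (norm a / (8 * CARD('n))))"
    using h by (intro mult_left_mono) auto
  also have "\<dots> = norm a ^ 2 / 8" using d by (simp add: power2_eq_square)
  finally have 2: "2 * (\<Sum>i\<in>UNIV. \<bar>a $ i\<bar> * \<bar>h $ i\<bar>) \<le> norm a ^ 2 / 4" using 1 by linarith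
  have "norm a / (8 * CARD('n)) \<le> norm a / 8" using d by (intro divide_left_mono) auto
  then have "norm h ^ 2 \<le> (norm a / 8) ^ 2" using h by (intro power_mono) auto
  also have "\<dots> \<le> norm a ^ 2 / 4" by (simp add: power_divide)
  finally have 3: "norm h ^ 2 \<le> norm a ^ 2 / 4" .
  have "(\<Sum>i\<in>UNIV. (2 * pi * \<bar>a $ i\<bar> / t) * \<bar>h $ i\<bar> + (pi / t) * (h $ i) ^ 2) = pi / t * (2 * (\<Sum>i\<in>UNIV. \<bar>a $ i\<bar> * \<bar>h $ i\<bar>) + norm h ^ 2)"
    unfolding norm_vec_sum_squares by (simp add: sum.distrib sum_distrib_left distrib_left mult_ac)
  also have "\<dots> \<le> pi / t * (norm a ^ 2 / 2)"
    using t 2 3 by (intro mult_left_mono) auto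
  finally have "- pi * norm a ^ 2 / t + (\<Sum>i\<in>UNIV. (2 * pi * \<bar>a $ i\<bar> / t) * \<bar>h $ i\<bar> + (pi / t) * (h $ i) ^ 2) \<le> - (1 / t) * (pi / 2 * norm a ^ 2)"
    by (simp add: field_simps)
  also have "\<dots> \<le> - 1 * (pi / 2 * norm a ^ 2)" using t by (intro mult_right_mono) auto
  finally show ?thesis by (simp add: exp_add[symmetric])
qed

text \<open>All summands are expanded on one common ball around \<open>x0\<close>, with majorants
  that decay like Gaussians in the dual lattice point. As t tends to 0 a Gaussian centred away from
  \<open>x0\<close> is flat there, while the power of \<open>t\<close> is integrable for Re s >
  d/2.\<close>

lemma dual_gaussian_sum_analytic:
  fixes M :: "real ^ 'n ^ 'n"
  assumes M: "invertible M" and s: "Re s > CARD('n) / 2"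
  shows "real_analytic_on (\<lambda>x. \<Sum>\<^sub>\<infinity>n\<in>nonzero. dual_gaussian s (x + lattice_point (dual_matrix M) n)) (regular_set M)"
  unfolding real_analytic_on_alt
proof
  fix x0 :: "real ^ 'n" assume x0: "x0 \<in> regular_set M"
  define d where "d = CARD('n)"
  define A where "A = dual_matrix M"
  have A: "invertible A" unfolding A_def by (rule invertible_dual_matrix[OF M])
  obtain \<delta> where \<delta>: "\<delta> > 0" "\<And>n. n \<noteq> (\<lambda>_. 0) \<Longrightarrow> \<delta> \<le> norm (x0 + lattice_point A n)"
    using regular_set_distance[OF M x0] unfolding A_def by metis
  \<comment> \<open>One radius for all indices: |a n| is at least \<delta>, so the ball lies within
    the range |a n| / (8d) of \<open>quad_exp_decay\<close>.\<close>
  define \<rho> where "\<rho> = \<delta> / (8 * d)"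
  have \<rho>: "\<rho> > 0" using \<delta>(1) by (simp add: \<rho>_def d_def)
  define a where "a n = x0 + lattice_point A n" for n
  define W where "W t = indicator {0<..1} t * (complex_of_real t powr (s - 1) / of_real (sqrt t ^ d))" for t :: real
  have nW: "norm (W t) = dual_weight d (Re s) t" for t unfolding W_def by (rule norm_dual_weight)
  have Wm [measurable]: "W \<in> borel_measurable borel" unfolding W_def by measurable
  have dwi: "integrable lborel (dual_weight d (Re s))" by (rule dual_weight_integrable) (use s in \<open>simp add: d_def\<close>)
  define c where "c n t \<alpha> = W t * (of_real (exp (- pi * norm (a n) ^ 2 / t)) *
     (\<Prod>i\<in>UNIV. quad_exp_coeff (of_real (- 2 * pi * a n $ i / t)) (of_real (- pi / t)) (lk \<alpha> i)))" for n t \<alpha>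
  define B where "B n t = dual_weight d (Re s) t * exp (- (pi / 2) * norm (a n) ^ 2)" for n t
  have Bi: "integrable lborel (B n)" for n unfolding B_def by (intro integrable_mult_left dwi)
  have cm: "(\<lambda>t. c n t \<alpha>) \<in> borel_measurable lborel" for n \<alpha> unfolding c_def by measurable
  have ps: "has_pser (\<lambda>y. W t * of_real (exp (- pi * norm (y + lattice_point A n) ^ 2 / t))) x0 (c n t) r" for t n r
  proof (cases "t \<in> {0<..1}")
    case True
    have eq: "complex_of_real (exp (- pi * norm (y + lattice_point A n) ^ 2 / t)) = of_real (exp (- pi * norm (a n) ^ 2 / t)) *
       exp (\<Sum>i\<in>UNIV. of_real (- 2 * pi * a n $ i / t) * of_real (y $ i - x0 $ i) + of_real (- pi / t) * of_real (y $ i - x0 $ i) ^ 2)" for y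
      using dual_gaussian_expansion[of t y x0 "a n"] True by (simp add: a_def)
    show ?thesis unfolding c_def eq by (intro has_pser_cmult has_pser_quad_exp(1))
  next
    case False
    then have "W t = 0" by (simp add: W_def)
    then show ?thesis by (simp add: has_pser_def c_def)
  qed
  have le: "(\<Sum>\<alpha>\<in>J. norm (c n t \<alpha> * of_real (mpow (y - x0) \<alpha>))) \<le> B n t"
    if n: "n \<noteq> (\<lambda>_. 0)" and y: "y \<in> ball x0 \<rho>" and J: "finite J" for n t y J
  proof (cases "t \<in> {0<..1}")
    case True
    let ?q = "\<lambda>i. complex_of_real (- 2 * pi * a n $ i / t)" and ?p = "complex_of_real (- pi / t)"
    have "(\<Sum>\<alpha>\<in>J. norm (c n t \<alpha> * of_real (mpow (y - x0) \<alpha>))) = norm (W t) * (exp (- pi * norm (a n) ^ 2 / t) *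
       (\<Sum>\<alpha>\<in>J. norm ((\<Prod>i\<in>UNIV. quad_exp_coeff (?q i) ?p (lk \<alpha> i)) * of_real (mpow (y - x0) \<alpha>))))"
      unfolding c_def sum_distrib_left by (intro sum.cong refl) (simp only: norm_mult norm_of_real abs_exp_cancel mult.assoc)
    also have "\<dots> \<le> norm (W t) * (exp (- pi * norm (a n) ^ 2 / t) *
       exp (\<Sum>i\<in>UNIV. norm (?q i) * \<bar>y $ i - x0 $ i\<bar> + norm ?p * (y $ i - x0 $ i) ^ 2))"
      by (intro mult_left_mono has_pser_quad_exp(2) J) auto
    also have "\<dots> = norm (W t) * (exp (- pi * norm (a n) ^ 2 / t) *
       exp (\<Sum>i\<in>UNIV. (2 * pi * \<bar>a n $ i\<bar> / t) * \<bar>(y - x0) $ i\<bar> + (pi / t) * ((y - x0) $ i) ^ 2))"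
      using True by (simp only: norm_of_real abs_mult abs_divide) simp
    also have "\<dots> \<le> norm (W t) * exp (- (pi / 2) * norm (a n) ^ 2)"
    proof (intro mult_left_mono quad_exp_decay)
      have "norm (y - x0) \<le> \<rho>" using y by (simp add: dist_norm norm_minus_commute)
      also have "\<dots> \<le> norm (a n) / (8 * d)" using \<delta>(2)[OF n] unfolding \<rho>_def a_def by (intro divide_right_mono) auto
      finally show "norm (y - x0) \<le> norm (a n) / (8 * CARD('n))" by (simp add: d_def)
    qed (use True in auto)
    finally show ?thesis by (simp add: B_def nW)
  next
    case False
    then have "W t = 0" "dual_weight d (Re s) t = 0" by (simp_all add: W_def dual_weight_def)
    then show ?thesis by (simp add: c_def B_def)
  qed
  have dg: "dual_gaussian s (y + lattice_point A n) = (\<integral>t. W t * of_real (exp (- pi * norm (y + lattice_point A n) ^ 2 / t)) \<partial>lborel)" for y n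
    by (simp add: dual_gaussian_def W_def d_def mult.assoc)
  have ps1: "has_pser (\<lambda>y. dual_gaussian s (y + lattice_point A n)) x0 (\<lambda>\<alpha>. \<integral>t. c n t \<alpha> \<partial>lborel) \<rho>" if n: "n \<noteq> (\<lambda>_. 0)" for n
    unfolding dg by (rule has_pser_integral[where B = "\<lambda>_. B n"]) (use ps cm Bi le[OF n] in auto)
  define Kw where "Kw = (\<integral>t. dual_weight d (Re s) t \<partial>lborel)"
  define B2 where "B2 n = Kw * exp (- (pi / 2) * norm (a n) ^ 2)" for n
  have Kw0: "Kw \<ge> 0" unfolding Kw_def by (intro Bochner_Integration.integral_nonneg dual_weight_nonneg)
  have B2: "(\<integral>t. B n t \<partial>lborel) = B2 n" for n by (simp add: B_def B2_def Kw_def)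
  have sB2: "B2 summable_on UNIV"
  proof (rule summable_on_comparison_test)
    show "(\<lambda>n. Kw * (exp (pi / 2 * norm x0 ^ 2) * exp (- (pi / 2 / 2) * norm (lattice_point A n) ^ 2))) summable_on UNIV"
      by (intro summable_on_cmult_right summable_on_lattice_gaussian A) simp
    show "B2 n \<le> Kw * (exp (pi / 2 * norm x0 ^ 2) * exp (- (pi / 2 / 2) * norm (lattice_point A n) ^ 2))" for n
      unfolding B2_def a_def by (intro mult_left_mono gaussian_shift_bound Kw0) auto
  qed (use Kw0 in \<open>auto simp: B2_def\<close>)
  have le2: "(\<Sum>\<alpha>\<in>J. norm ((\<integral>t. c n t \<alpha> \<partial>lborel) * of_real (mpow (y - x0) \<alpha>))) \<le> B2 n"
    if n: "n \<noteq> (\<lambda>_. 0)" and y: "y \<in> ball x0 \<rho>" and J: "finite J" for n y J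
    unfolding B2[symmetric] by (rule has_pser_integral_bound[OF ps cm Bi J le[OF n y]])
  have "has_pser (\<lambda>y. \<integral>n. dual_gaussian s (y + lattice_point A n) \<partial>count_space nonzero) x0 (\<lambda>\<alpha>. \<integral>n. (\<integral>t. c n t \<alpha> \<partial>lborel) \<partial>count_space nonzero) \<rho>"
  proof (rule has_pser_integral[where B = "\<lambda>_. B2"])
    show "integrable (count_space nonzero) B2"
      by (intro integrable_count_space_summable summable_on_subset_banach[OF sB2]) simp
  qed (use ps1 le2 in auto)
  then have "has_pser (\<lambda>y. \<Sum>\<^sub>\<infinity>n\<in>nonzero. dual_gaussian s (y + lattice_point A n)) x0 (\<lambda>\<alpha>. \<integral>n. (\<integral>t. c n t \<alpha> \<partial>lborel) \<partial>count_space nonzero) \<rho>"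
  proof (rule has_pser_cong)
    fix y assume y: "y \<in> ball x0 \<rho>"
    \<comment> \<open>Returning from the counting-measure integral to \<open>infsum\<close> requires
      summability; the value at \<open>y\<close> is bounded by its absolute power series and thus by
      \<open>B2 n\<close>.\<close>
    have "norm (dual_gaussian s (y + lattice_point A n)) \<le> B2 n" if n: "n \<in> nonzero" for n
    proof -
      have n0: "n \<noteq> (\<lambda>_. 0)" using n by simp
      have hs: "((\<lambda>\<alpha>. (\<integral>t. c n t \<alpha> \<partial>lborel) * of_real (mpow (y - x0) \<alpha>)) has_sum dual_gaussian s (y + lattice_point A n)) UNIV"
        using ps1[OF n0] y by (auto simp: has_pser_def)
      have nb: "((\<lambda>\<alpha>. norm ((\<integral>t. c n t \<alpha> \<partial>lborel) * of_real (mpow (y - x0) \<alpha>))) has_sum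
         (\<Sum>\<^sub>\<infinity>\<alpha>. norm ((\<integral>t. c n t \<alpha> \<partial>lborel) * of_real (mpow (y - x0) \<alpha>)))) UNIV"
        using hs by (intro has_sum_infsum) (metis has_sum_imp_summable summable_on_iff_abs_summable_on_complex)
      have "norm (dual_gaussian s (y + lattice_point A n)) \<le> (\<Sum>\<^sub>\<infinity>\<alpha>. norm ((\<integral>t. c n t \<alpha> \<partial>lborel) * of_real (mpow (y - x0) \<alpha>)))"
        by (rule norm_has_sum_bound[OF nb hs])
      also have "\<dots> \<le> B2 n" by (rule has_sum_le_finite_sums[OF nb]) (use le2[OF n0 y] in auto)
      finally show ?thesis .
    qed
    then have "(\<lambda>n. dual_gaussian s (y + lattice_point A n)) summable_on nonzero"
      by (intro summable_on_bounded[of B2] summable_on_subset_banach[OF sB2]) auto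
    then show "(\<integral>n. dual_gaussian s (y + lattice_point A n) \<partial>count_space nonzero) = (\<Sum>\<^sub>\<infinity>n\<in>nonzero. dual_gaussian s (y + lattice_point A n))"
      by (rule infsum_eq_integral[symmetric])
  qed
  then show "\<exists>c. \<exists>r>0. has_pser (\<lambda>x. \<Sum>\<^sub>\<infinity>n\<in>nonzero. dual_gaussian s (x + lattice_point (dual_matrix M) n)) x0 c r"
    using \<rho> unfolding A_def by blast
qed

lemma dual_gaussian_kernel_bound:
  fixes x :: "real ^ 'n::finite"
  assumes s: "Re s > CARD('n) / 2"
  defines "f \<equiv> \<lambda>t. indicator {0<..1} t * (complex_of_real t powr (s - 1) / of_real (sqrt t ^ CARD('n)) * of_real (exp (- pi * norm x ^ 2 / t)))"
  shows "integrable lborel f"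
    and "(\<integral>t. norm (f t) \<partial>lborel) \<le> (\<integral>t. dual_weight CARD('n) (Re s) t \<partial>lborel) * exp (- pi * norm x ^ 2)"
proof -
  have dwi: "integrable lborel (dual_weight CARD('n) (Re s))" by (rule dual_weight_integrable[OF s])
  have le: "norm (f t) \<le> dual_weight CARD('n) (Re s) t * exp (- pi * norm x ^ 2)" for t
  proof (cases "t \<in> {0<..1}")
    case True
    have "norm (f t) = dual_weight CARD('n) (Re s) t * exp (- pi * norm x ^ 2 / t)"
      unfolding f_def mult.assoc[symmetric] norm_mult[of _ "of_real _"] norm_dual_weight by simp
    moreover have "- pi * norm x ^ 2 / t \<le> - pi * norm x ^ 2"
    proof -
      have "pi * norm x ^ 2 * t \<le> pi * norm x ^ 2 * 1" using True by (intro mult_left_mono) auto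
      then show ?thesis using True by (simp add: field_simps)
    qed
    ultimately show ?thesis by (simp only:) (intro mult_left_mono dual_weight_nonneg, simp)
  qed (simp add: f_def dual_weight_def)
  show fi: "integrable lborel f"
  proof (rule Bochner_Integration.integrable_bound)
    show "integrable lborel (\<lambda>t. dual_weight CARD('n) (Re s) t * exp (- pi * norm x ^ 2))" by (intro integrable_mult_left dwi)
    show "f \<in> borel_measurable lborel" unfolding f_def by measurable
    show "AE t in lborel. norm (f t) \<le> norm (dual_weight CARD('n) (Re s) t * exp (- pi * norm x ^ 2))"
      unfolding real_norm_def by (intro AE_I2 order_trans[OF le abs_ge_self])
  qed
  have "(\<integral>t. norm (f t) \<partial>lborel) \<le> (\<integral>t. dual_weight CARD('n) (Re s) t * exp (- pi * norm x ^ 2) \<partial>lborel)"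
    by (intro integral_mono integrable_norm fi integrable_mult_left dwi le)
  then show "(\<integral>t. norm (f t) \<partial>lborel) \<le> (\<integral>t. dual_weight CARD('n) (Re s) t \<partial>lborel) * exp (- pi * norm x ^ 2)" by simp
qed

text \<open>For r \<ge> c one has 1/r \<le> ((1 + c)/c) / (1 + r). Away from the origin a pure power
  is thereby compared with the weight used for lattice summability.\<close>

lemma powr_decay_bound:
  fixes r c p :: real
  assumes c: "0 < c" and r: "c \<le> r" and p: "real m \<le> p"
  shows "r powr - p \<le> ((1 + c) / c) ^ m * c powr (real m - p) / (1 + r) ^ m"
proof -
  have r0: "r > 0" using c r by simp
  have "r powr - p = r powr (real m - p) * r powr - real m"
    by (simp add: powr_add[symmetric])
  also have "\<dots> = r powr (real m - p) * (1 / r) ^ m"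
    unfolding powr_minus powr_realpow[OF r0] by (simp add: power_divide inverse_eq_divide)
  also have "\<dots> \<le> c powr (real m - p) * (((1 + c) / c) / (1 + r)) ^ m"
  proof (intro mult_mono power_mono powr_mono2')
    have "c * (1 + r) \<le> (1 + c) * r" using r by (simp add: algebra_simps)
    then have "c * (1 + r) / (r * (c * (1 + r))) \<le> (1 + c) * r / (r * (c * (1 + r)))"
      using c r0 by (intro divide_right_mono) auto
    moreover have "c * (1 + r) / (r * (c * (1 + r))) = 1 / r" "(1 + c) * r / (r * (c * (1 + r))) = (1 + c) / c / (1 + r)"
      using c r0 by auto
    ultimately show "1 / r \<le> (1 + c) / c / (1 + r)" by simp
  qed (use c r r0 p in auto)
  finally show ?thesis by (simp add: power_divide power_mult_distrib mult_ac)
qed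

text \<open>Poisson summation under the integral over \<open>t\<close>. Removing the zero lattice
  vector, whose Gaussian equals 1, produces the subtracted integral of t^(s-1); on the dual side the
  zero frequency is split off as \<open>dual_gaussian s x\<close>. The condition on Re s makes the
  lattice sum absolutely convergent.\<close>

lemma lower_part_lattice_sum:
  fixes M :: "real ^ 'n ^ 'n"
  assumes M: "invertible M" and s: "Re s \<ge> CARD('n)"
  shows "((\<lambda>n. plane_wave x (lattice_point M n) * lower_part s (lattice_point M n)) has_sum
     ((1 / of_real \<bar>det M\<bar>) * (dual_gaussian s x + (\<Sum>\<^sub>\<infinity>n\<in>nonzero. dual_gaussian s (x + lattice_point (dual_matrix M) n)))
       - (\<integral>t. indicator {0<..1} t * of_real t powr (s - 1) \<partial>lborel))) nonzero"
proof -
  define V where "V = \<bar>det M\<bar>"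
  define A where "A = dual_matrix M"
  let ?z = "lattice_point M"
  have A: "invertible A" unfolding A_def by (rule invertible_dual_matrix[OF M])
  have d1: "real CARD('n) \<ge> 1" by (simp add: Suc_leI)
  have s0: "Re s > 0" and s2: "Re s > CARD('n) / 2" using s d1 by linarith+
  obtain c where c: "c > 0" "\<And>n. n \<noteq> (\<lambda>_. 0) \<Longrightarrow> c \<le> norm (?z n)" using lattice_point_lower[OF M] by metis
  have z0: "?z n \<noteq> 0" if "n \<in> nonzero" for n using c(1) c(2)[of n] that by auto
  obtain C where C: "C > 0" "\<And>z::real ^ 'n. z \<noteq> 0 \<Longrightarrow> (\<integral>t. norm (indicator {0<..1} t * theta_kernel s t z) \<partial>lborel) \<le> C * norm z powr (- 2 * Re s)"
    using lower_part_norm_bound[OF s0, where 'n = 'n] by metis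
  define E where "E m t = complex_of_real (exp (- pi * norm (x + lattice_point A m) ^ 2 / t))" for m t
  define W where "W t = indicator {0<..1} t * (complex_of_real t powr (s - 1) / of_real (sqrt t ^ CARD('n)))" for t :: real
  define pw where "pw t = indicator {0<..1} t * complex_of_real t powr (s - 1)" for t :: real
  define S where "S t = (\<Sum>\<^sub>\<infinity>m. E m t)" for t
  have dg: "dual_gaussian s (x + lattice_point A m) = (\<integral>t. W t * E m t \<partial>lborel)" for m
    by (simp add: dual_gaussian_def W_def E_def mult.assoc)
  define Kw where "Kw = (\<integral>t. dual_weight CARD('n) (Re s) t \<partial>lborel)"
  have Kw0: "Kw \<ge> 0" unfolding Kw_def by (intro Bochner_Integration.integral_nonneg dual_weight_nonneg)
  have sumE: "(\<lambda>m. E m t) summable_on UNIV" if "t > 0" for t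
  proof (rule summable_on_bounded)
    show "(\<lambda>m. exp (pi / t * norm x ^ 2) * exp (- (pi / t / 2) * norm (lattice_point A m) ^ 2)) summable_on UNIV"
      by (intro summable_on_cmult_right summable_on_lattice_gaussian A) (use that in simp)
    show "norm (E m t) \<le> exp (pi / t * norm x ^ 2) * exp (- (pi / t / 2) * norm (lattice_point A m) ^ 2)" for m
      using gaussian_shift_bound[of "pi / t" x "lattice_point A m"] that by (simp add: E_def)
  qed
  have WE: "((\<lambda>m. W t * E m t) has_sum W t * S t) UNIV" for t
  proof (cases "t \<in> {0<..1}")
    case True
    then show ?thesis unfolding S_def by (intro has_sum_cmult_right has_sum_infsum sumE) auto
  qed (simp add: W_def)
  have sKw: "(\<lambda>m. Kw * exp (- pi * norm (x + lattice_point A m) ^ 2)) summable_on UNIV"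
  proof (rule summable_on_comparison_test)
    show "(\<lambda>n. Kw * (exp (pi * norm x ^ 2) * exp (- (pi / 2) * norm (lattice_point A n) ^ 2))) summable_on UNIV"
      by (intro summable_on_cmult_right summable_on_lattice_gaussian A) simp
    show "Kw * exp (- pi * norm (x + lattice_point A n) ^ 2) \<le> Kw * (exp (pi * norm x ^ 2) * exp (- (pi / 2) * norm (lattice_point A n) ^ 2))" for n
      by (intro mult_left_mono gaussian_shift_bound Kw0) auto
  qed (use Kw0 in auto)
  have WEi: "integrable lborel (\<lambda>t. W t * E m t)" for m
    using dual_gaussian_kernel_bound(1)[OF s2, of "x + lattice_point A m"] by (simp add: W_def E_def mult.assoc)
  have WEn: "(\<integral>t. norm (W t * E m t) \<partial>lborel) \<le> Kw * exp (- pi * norm (x + lattice_point A m) ^ 2)" for m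
    using dual_gaussian_kernel_bound(2)[OF s2, of "x + lattice_point A m"] by (simp add: W_def E_def mult.assoc Kw_def)
  have sW: "(\<lambda>m. \<integral>t. norm (W t * E m t) \<partial>lborel) summable_on UNIV"
    by (rule summable_on_comparison_test[OF sKw]) (use WEn in auto)
  note swapW = has_sum_integral[OF countable_int_vec WEi WE sW, folded dg]
  have "((\<lambda>m. dual_gaussian s (x + lattice_point A m)) has_sum dual_gaussian s (x + lattice_point A (\<lambda>_. 0))) {\<lambda>_. 0}"
    by (simp add: has_sum_finiteI)
  from has_sum_Diff[OF swapW(2) this] have "((\<lambda>m. dual_gaussian s (x + lattice_point A m)) has_sum ((\<integral>t. W t * S t \<partial>lborel) - dual_gaussian s x)) nonzero"
    by (simp add: Compl_eq_Diff_UNIV)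
  then have WS: "(\<integral>t. W t * S t \<partial>lborel) = dual_gaussian s x + (\<Sum>\<^sub>\<infinity>n\<in>nonzero. dual_gaussian s (x + lattice_point A n))"
    by (simp add: infsumI)
  have pwi: "integrable lborel pw"
  proof (rule Bochner_Integration.integrable_bound)
    show "integrable lborel (\<lambda>t. indicator {0<..1} t * t powr (Re s - 1))" by (rule integrable_powr_unit) (use s0 in simp)
    show "AE t in lborel. norm (pw t) \<le> norm (indicator {0<..1} t * t powr (Re s - 1))"
      by (auto intro!: AE_I2 simp: pw_def norm_mult norm_powr_of_real indicator_def)
    show "pw \<in> borel_measurable lborel" unfolding pw_def by measurable
  qed
  \<comment> \<open>The sum over nonzero lattice points for fixed \<open>t\<close>: the dual side of
    Poisson's formula minus the term of the zero vector.\<close>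
  define F where "F t = (1 / of_real V) * (W t * S t) - pw t" for t
  define f where "f n t = plane_wave x (?z n) * (indicator {0<..1} t * theta_kernel s t (?z n))" for n t
  have fint: "(\<integral>t. f n t \<partial>lborel) = plane_wave x (?z n) * lower_part s (?z n)" for n
    by (simp add: f_def lower_part_def)
  have "((\<lambda>n. \<integral>t. f n t \<partial>lborel) has_sum (\<integral>t. F t \<partial>lborel)) nonzero"
  proof (rule has_sum_integral(2))
    show "countable (nonzero :: ('n \<Rightarrow> int) set)" by (rule countable_subset[OF _ countable_int_vec]) simp
    show "integrable lborel (f n)" if "n \<in> nonzero" for n
      unfolding f_def by (intro integrable_mult_right theta_kernel_integrable(3)[OF s0] z0 that)
    show "((\<lambda>n. f n t) has_sum F t) nonzero" for t
    proof (cases "t \<in> {0<..1}")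
      case True
      then have t: "t > 0" by simp
      let ?h = "\<lambda>n. complex_of_real (exp (- pi * t * norm (?z n) ^ 2)) * plane_wave x (?z n)"
      have p: "(?h has_sum of_real (1 / (V * sqrt t ^ CARD('n))) * S t) UNIV"
        using gaussian_poisson[OF M t, of x] by (simp add: V_def S_def E_def A_def)
      have "(?h has_sum 1) {\<lambda>_. 0}" by (rule has_sum_finiteI) (simp_all add: plane_wave_def)
      from has_sum_Diff[OF p this] have "(?h has_sum (of_real (1 / (V * sqrt t ^ CARD('n))) * S t - 1)) nonzero"
        by (simp add: Compl_eq_Diff_UNIV)
      from has_sum_cmult_right[OF this, of "complex_of_real t powr (s - 1)"]
      have "((\<lambda>n. f n t) has_sum of_real t powr (s - 1) * (of_real (1 / (V * sqrt t ^ CARD('n))) * S t - 1)) nonzero"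
        using True by (simp add: f_def theta_kernel_def mult_ac)
      also have "of_real t powr (s - 1) * (of_real (1 / (V * sqrt t ^ CARD('n))) * S t - 1) = F t"
        using True by (simp add: F_def W_def pw_def right_diff_distrib mult_ac)
      finally show ?thesis .
    qed (simp add: f_def F_def W_def pw_def)
    show "(\<lambda>n. \<integral>t. norm (f n t) \<partial>lborel) summable_on nonzero"
    proof (rule summable_on_comparison_test)
      define K where "K = ((1 + c) / c) ^ (2 * CARD('n)) * c powr (real (2 * CARD('n)) - 2 * Re s)"
      have K: "K > 0" using c(1) by (auto simp: K_def intro!: mult_pos_pos)
      show "(\<lambda>n. C * (K / (1 + norm (?z n)) ^ (2 * CARD('n)))) summable_on nonzero"
      proof (rule summable_on_subset_banach)
        show "(\<lambda>n. C * (K / (1 + norm (?z n)) ^ (2 * CARD('n)))) summable_on UNIV"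
          by (intro summable_on_cmult_right summable_on_lattice[OF M, where C = K]) (use K in auto)
      qed simp
      show "(\<integral>t. norm (f n t) \<partial>lborel) \<le> C * (K / (1 + norm (?z n)) ^ (2 * CARD('n)))" if n: "n \<in> nonzero" for n
      proof -
        have "(\<integral>t. norm (f n t) \<partial>lborel) = (\<integral>t. norm (indicator {0<..1} t * theta_kernel s t (?z n)) \<partial>lborel)"
          by (simp add: f_def norm_mult)
        also have "\<dots> \<le> C * norm (?z n) powr (- 2 * Re s)" by (rule C(2)[OF z0[OF n]])
        also have "\<dots> \<le> C * (K / (1 + norm (?z n)) ^ (2 * CARD('n)))"
          using powr_decay_bound[OF c(1) c(2), of n "2 * CARD('n)" "2 * Re s"] n s C(1)
          by (intro mult_left_mono) (auto simp: K_def)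
        finally show ?thesis .
      qed
    qed auto
  qed
  moreover have "(\<integral>t. F t \<partial>lborel) = (1 / of_real V) * (\<integral>t. W t * S t \<partial>lborel) - (\<integral>t. pw t \<partial>lborel)"
    unfolding F_def using swapW(1) pwi by (subst Bochner_Integration.integral_diff) auto
  ultimately show ?thesis unfolding fint WS by (simp add: V_def A_def pw_def)
qed

text \<open>Fubini with the Gaussian transform inside. The L1 norm over \<open>z\<close> of the
  integrand at \<open>t\<close> is exactly \<open>dual_weight\<close>, whose integrability needs Re
  s > d/2.\<close>

lemma lower_part_wave_integral:
  fixes x :: "real ^ 'n::finite"
  assumes s: "Re s > CARD('n) / 2"
  shows "integrable lborel (\<lambda>z. plane_wave x z * lower_part s z)"
    and "(\<integral>z. plane_wave x z * lower_part s z \<partial>lborel) = dual_gaussian s x"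
proof -
  define f where "f t z = indicator {0<..1} t * theta_kernel s t z * plane_wave x z" for t :: real and z :: "real ^ 'n"
  have [measurable]: "(\<lambda>z::real ^ 'n. plane_wave x z) \<in> borel_measurable borel"
    unfolding plane_wave_phase by measurable
  have eq: "f t z = (indicator {0<..1} t * of_real t powr (s - 1)) * (plane_wave x z * of_real (exp (- pi * t * norm z ^ 2)))" for t z
    by (simp add: f_def theta_kernel_def mult_ac)
  have fi: "integrable lborel (f t)" for t
  proof (cases "t \<in> {0<..1}")
    case True
    then show ?thesis unfolding eq[abs_def] by (intro integrable_mult_right gaussian_fourier) auto
  qed (simp add: f_def[abs_def])
  have fz: "(\<integral>z. f t z \<partial>lborel) = indicator {0<..1} t * (of_real t powr (s - 1) / of_real (sqrt t ^ CARD('n)) *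
     of_real (exp (- pi * norm x ^ 2 / t)))" for t
  proof (cases "t \<in> {0<..1}")
    case True
    then have t: "t > 0" by simp
    show ?thesis unfolding eq integral_mult_right_zero gaussian_fourier(2)[OF t] using True by (simp add: indicator_def)
  qed (simp add: f_def)
  have fn: "(\<integral>z. norm (f t z) \<partial>lborel) = dual_weight CARD('n) (Re s) t" for t
  proof (cases "t \<in> {0<..1}")
    case True
    then have t: "t > 0" by simp
    have "(\<integral>z. norm (f t z) \<partial>lborel) = (\<integral>z. t powr (Re s - 1) * exp (- pi * t * norm (z :: real ^ 'n) ^ 2) \<partial>lborel)"
      using True by (intro Bochner_Integration.integral_cong) (simp_all add: f_def norm_mult norm_theta_kernel norm_plane_wave)
    also have "\<dots> = t powr (Re s - 1) * (\<integral>z. exp (- pi * t * norm (z :: real ^ 'n) ^ 2) \<partial>lborel)" by simp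
    also have "complex_of_real (\<integral>z. exp (- pi * t * norm (z :: real ^ 'n) ^ 2) \<partial>lborel) = of_real (1 / sqrt t ^ CARD('n))"
      using gaussian_fourier(2)[OF t, of "0 :: real ^ 'n"] by (simp add: plane_wave_def flip: integral_complex_of_real)
    then have "(\<integral>z. exp (- pi * t * norm (z :: real ^ 'n) ^ 2) \<partial>lborel) = 1 / sqrt t ^ CARD('n)"
      by (simp only: of_real_eq_iff)
    finally show ?thesis using True by (simp add: dual_weight_def)
  qed (simp add: f_def dual_weight_def)
  have int: "integrable (lborel \<Otimes>\<^sub>M lborel) (case_prod f)"
  proof (rule lborel_pair.Fubini_integrable)
    show "case_prod f \<in> borel_measurable (lborel \<Otimes>\<^sub>M lborel)" unfolding f_def by measurable
    show "integrable lborel (\<lambda>t. \<integral>z. norm (case (t, z) of (t, z) \<Rightarrow> f t z) \<partial>lborel)"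
      using dual_weight_integrable[OF s] by (simp add: fn)
  qed (simp add: fi)
  have inner: "(\<integral>t. f t z \<partial>lborel) = plane_wave x z * lower_part s z" for z
    by (simp add: f_def lower_part_def mult.commute)
  show "integrable lborel (\<lambda>z. plane_wave x z * lower_part s z)"
    using lborel_pair.integrable_snd[OF int] by (simp add: inner)
  show "(\<integral>z. plane_wave x z * lower_part s z \<partial>lborel) = dual_gaussian s x"
    using lborel_pair.Fubini_integral[OF int] by (simp add: inner fz dual_gaussian_def)
qed

lemma moment_integrable:
  fixes \<mu> :: "real ^ 'n::finite \<Rightarrow> complex"
  assumes [measurable]: "\<mu> \<in> borel_measurable borel" and int: "integrable lborel (\<lambda>z. norm z ^ k * norm (\<mu> z))"
  shows "integrable lborel (\<lambda>z. phase z x ^ k / fact k * \<mu> z)"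
proof (rule Bochner_Integration.integrable_bound)
  show "integrable lborel (\<lambda>z. (2 * pi * norm x) ^ k / fact k * (norm z ^ k * norm (\<mu> z)))"
    by (intro integrable_mult_right int)
  show "AE z in lborel. norm (phase z x ^ k / fact k * \<mu> z) \<le> norm ((2 * pi * norm x) ^ k / fact k * (norm z ^ k * norm (\<mu> z)))"
  proof (rule AE_I2)
    fix z :: "real ^ 'n"
    have "norm (phase z x) ^ k \<le> (2 * pi * (norm z * norm x)) ^ k" by (intro power_mono norm_phase) auto
    then have "norm (phase z x) ^ k / fact k * norm (\<mu> z) \<le> (2 * pi * (norm z * norm x)) ^ k / fact k * norm (\<mu> z)"
      by (intro mult_right_mono divide_right_mono) auto
    then show "norm (phase z x ^ k / fact k * \<mu> z) \<le> norm ((2 * pi * norm x) ^ k / fact k * (norm z ^ k * norm (\<mu> z)))"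
      by (simp add: norm_mult norm_divide norm_power power_mult_distrib abs_mult mult_ac)
  qed
qed measurable

abbreviation wave_remainder :: "nat \<Rightarrow> real ^ 'n::finite \<Rightarrow> real ^ 'n \<Rightarrow> complex" where
  "wave_remainder l x z \<equiv> plane_wave x z - indicator (ball 0 1) z * phase_taylor l z x"

text \<open>The Taylor polynomial has to stay attached only to the singular upper part. For the
  bounded lower part the plane wave is transformed separately, giving \<open>dual_gaussian\<close>,
  and the subtracted terms integrate to a polynomial.\<close>

lemma wave_remainder_integral:
  fixes s :: complex
  assumes s: "Re s > CARD('n) / 2" and l: "real l + 1 - 2 * Re s + CARD('n) > 0"
  obtains E :: "real ^ 'n::finite \<Rightarrow> complex" where "entire_pser E"
    and "\<And>x::real ^ 'n. integrable lborel (\<lambda>z. wave_remainder l x z / npow z (2 * s))"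
    and "\<And>x::real ^ 'n. (\<integral>z. wave_remainder l x z / npow z (2 * s) \<partial>lborel) = E x + gamma_factor s * dual_gaussian s x"
proof -
  have s0: "Re s > 0" using s by (meson divide_nonneg_nonneg le_less_trans of_nat_0_le_iff zero_le_numeral)
  \<comment> \<open>The decay bound is known for nonzero arguments only; the value 0 at the origin
    makes it hold everywhere and changes no integral.\<close>
  define \<mu> where "\<mu> z = (if z = 0 then 0 else upper_part s z)" for z :: "real ^ 'n"
  define B where "B x = (\<integral>z. wave_remainder l x z * \<mu> z \<partial>lborel)" for x
  define \<kappa> where "\<kappa> z = indicator (ball 0 1) z * lower_part s z" for z :: "real ^ 'n"
  define P where "P x = (\<Sum>k\<le>l. \<integral>z. phase z x ^ k / fact k * \<kappa> z \<partial>lborel)" for x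
  obtain C where C: "C > 0" "\<And>z::real ^ 'n. z \<noteq> 0 \<Longrightarrow> norm (upper_part s z) \<le> C * exp (- (pi / 2) * norm z ^ 2) * norm z powr (- 2 * Re s)"
    using upper_part_bound[OF s0, where 'n = 'n] by metis
  obtain D where D: "\<And>z::real ^ 'n. norm (lower_part s z) \<le> D" using lower_part_bounded[OF s0, where 'n = 'n] by metis
  have [measurable]: "\<mu> \<in> borel_measurable borel" unfolding \<mu>_def by measurable
  have [measurable]: "\<kappa> \<in> borel_measurable borel" unfolding \<kappa>_def by measurable
  have \<mu>: "norm (\<mu> z) \<le> C * exp (- (pi / 2) * norm z ^ 2) * norm z powr (- 2 * Re s)" for z
    using C by (simp add: \<mu>_def)
  note up = entire_pser_upper_integral[OF _ \<mu> C(1) s0 l]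
  have mom: "integrable lborel (\<lambda>z. norm z ^ k * norm (\<kappa> z))" for k
  proof (rule Bochner_Integration.integrable_bound)
    show "integrable lborel (\<lambda>z. D * indicator (ball (0 :: real ^ 'n) 1) z)"
      using emeasure_lborel_ball_finite[of "0 :: real ^ 'n" 1] by (intro integrable_mult_right integrable_real_indicator) auto
    show "AE z in lborel. norm (norm z ^ k * norm (\<kappa> z)) \<le> norm (D * indicator (ball (0 :: real ^ 'n) 1) z)"
    proof (rule AE_I2)
      fix z :: "real ^ 'n"
      show "norm (norm z ^ k * norm (\<kappa> z)) \<le> norm (D * indicator (ball (0 :: real ^ 'n) 1) z)"
      proof (cases "z \<in> ball 0 1")
        case True
        then have "norm z ^ k * norm (lower_part s z) \<le> 1 * D" by (intro mult_mono D power_le_one) auto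
        then show ?thesis using True by (simp add: \<kappa>_def)
      qed (simp add: \<kappa>_def)
    qed
  qed measurable
  have Pi: "integrable lborel (\<lambda>z. \<Sum>k\<le>l. phase z x ^ k / fact k * \<kappa> z)" for x
    by (intro Bochner_Integration.integrable_sum moment_integrable mom) measurable
  have PI: "(\<integral>z. (\<Sum>k\<le>l. phase z x ^ k / fact k * \<kappa> z) \<partial>lborel) = P x" for x
    unfolding P_def by (intro Bochner_Integration.integral_sum moment_integrable mom) measurable
  note lw = lower_part_wave_integral[OF s]
  define R where "R x z = gamma_factor s * (wave_remainder l x z * \<mu> z + plane_wave x z * lower_part s z - (\<Sum>k\<le>l. phase z x ^ k / fact k * \<kappa> z))" for x z
  have Bi: "integrable lborel (\<lambda>z. wave_remainder l x z * \<mu> z)" for x by (rule up(2)) measurable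
  have Ri: "integrable lborel (R x)" for x
    unfolding R_def by (intro integrable_mult_right Bochner_Integration.integrable_diff Bochner_Integration.integrable_add Bi lw Pi)
  have RI: "(\<integral>z. R x z \<partial>lborel) = gamma_factor s * (B x + dual_gaussian s x - P x)" for x
    unfolding R_def integral_mult_right_zero
      Bochner_Integration.integral_diff[OF Bochner_Integration.integrable_add[OF Bi lw(1)] Pi]
      Bochner_Integration.integral_add[OF Bi lw(1)] lw(2) PI B_def ..
  have eq: "R x z = wave_remainder l x z / npow z (2 * s)" if "z \<noteq> 0" for x z
  proof -
    have T: "(\<Sum>k\<le>l. phase z x ^ k / fact k * \<kappa> z) = indicator (ball 0 1) z * phase_taylor l z x * lower_part s z"
      unfolding \<kappa>_def phase_taylor_def sum_distrib_left sum_distrib_right by (intro sum.cong refl) simp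
    have "wave_remainder l x z / npow z (2 * s) = wave_remainder l x z * (1 / npow z (2 * s))" by simp
    also have "\<dots> = R x z" unfolding npow_eq_parts[OF s0 that] R_def T using that by (simp add: \<mu>_def algebra_simps)
    finally show ?thesis by simp
  qed
  have ae: "AE z in lborel. R x z = wave_remainder l x z / npow z (2 * s)" for x
    using AE_lborel_singleton[of "0 :: real ^ 'n"] by eventually_elim (rule eq)
  have [measurable]: "(\<lambda>z. wave_remainder l x z / npow z (2 * s)) \<in> borel_measurable lborel" for x :: "real ^ 'n"
    unfolding plane_wave_phase by measurable
  have [measurable]: "R x \<in> borel_measurable lborel" for x using Ri by auto
  show ?thesis
  proof
    show "entire_pser (\<lambda>x. gamma_factor s * (B x - P x))"
      unfolding P_def B_def
      by (intro entire_pser_cmult entire_pser_diff entire_pser_sum entire_pser_moment mom up(1)) measurable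
    show "integrable lborel (\<lambda>z. wave_remainder l x z / npow z (2 * s))" for x :: "real ^ 'n"
      by (rule integrable_cong_AE_imp[OF Ri]) (use ae[of x] in \<open>auto elim: eventually_mono\<close>)
    have "(\<integral>z. wave_remainder l x z / npow z (2 * s) \<partial>lborel) = (\<integral>z. R x z \<partial>lborel)" for x :: "real ^ 'n"
      by (rule integral_cong_AE) (use ae[of x] in \<open>auto elim: eventually_mono\<close>)
    then show "(\<integral>z. wave_remainder l x z / npow z (2 * s) \<partial>lborel) = gamma_factor s * (B x - P x) + gamma_factor s * dual_gaussian s x" for x :: "real ^ 'n"
      by (simp add: RI algebra_simps)
  qed
qed

text \<open>The upper parts sum to an entire function and Poisson's formula handles the lower parts;
  the constant \<open>k\<close> stems from the missing zero lattice vector. The term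
  \<open>dual_gaussian s x\<close> appears with the factor it has in
  \<open>wave_remainder_integral\<close>, divided by |det M|.\<close>

lemma lattice_wave_sum:
  fixes M :: "real ^ 'n ^ 'n"
  assumes M: "invertible M" and s: "Re s \<ge> CARD('n)"
  obtains E where "entire_pser E"
    and "\<And>x. ((\<lambda>n. plane_wave x (lattice_point M n) / npow (lattice_point M n) (2 * s)) has_sum
       (E x + gamma_factor s / of_real \<bar>det M\<bar> *
         (dual_gaussian s x + (\<Sum>\<^sub>\<infinity>n\<in>nonzero. dual_gaussian s (x + lattice_point (dual_matrix M) n))))) nonzero"
proof -
  let ?z = "lattice_point M"
  have d1: "real CARD('n) \<ge> 1" by (simp add: Suc_leI)
  have s0: "Re s > 0" using s d1 by linarith
  define \<mu> where "\<mu> z = (if z = 0 then 0 else upper_part s z)" for z :: "real ^ 'n"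
  obtain C where C: "C > 0" "\<And>z::real ^ 'n. z \<noteq> 0 \<Longrightarrow> norm (upper_part s z) \<le> C * exp (- (pi / 2) * norm z ^ 2) * norm z powr (- 2 * Re s)"
    using upper_part_bound[OF s0, where 'n = 'n] by metis
  have \<mu>: "norm (\<mu> z) \<le> C * exp (- (pi / 2) * norm z ^ 2) * norm z powr (- 2 * Re s)" for z
    using C by (simp add: \<mu>_def)
  note up = lattice_upper_entire[OF M s0 C(1) \<mu>]
  define k where "k = (\<integral>t. indicator {0<..1} t * complex_of_real t powr (s - 1) \<partial>lborel)"
  define E where "E x = gamma_factor s * ((\<Sum>\<^sub>\<infinity>n\<in>nonzero. plane_wave x (?z n) * \<mu> (?z n)) - k)" for x
  obtain c where c: "c > 0" "\<And>n. n \<noteq> (\<lambda>_. 0) \<Longrightarrow> c \<le> norm (?z n)" using lattice_point_lower[OF M] by metis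
  have z0: "?z n \<noteq> 0" if "n \<in> nonzero" for n using c(1) c(2)[of n] that by auto
  show ?thesis
  proof
    show "entire_pser E" unfolding E_def by (intro entire_pser_cmult entire_pser_diff up(1) entire_pser_const)
    fix x :: "real ^ 'n"
    have "((\<lambda>n. gamma_factor s * (plane_wave x (?z n) * \<mu> (?z n) + plane_wave x (?z n) * lower_part s (?z n))) has_sum
       gamma_factor s * ((\<Sum>\<^sub>\<infinity>n\<in>nonzero. plane_wave x (?z n) * \<mu> (?z n)) +
         ((1 / of_real \<bar>det M\<bar>) * (dual_gaussian s x + (\<Sum>\<^sub>\<infinity>n\<in>nonzero. dual_gaussian s (x + lattice_point (dual_matrix M) n))) - k))) nonzero"
      unfolding k_def by (intro has_sum_cmult_right has_sum_add has_sum_infsum up(2) lower_part_lattice_sum[OF M s])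
    also have "?this \<longleftrightarrow> ((\<lambda>n. plane_wave x (?z n) / npow (?z n) (2 * s)) has_sum
       gamma_factor s * ((\<Sum>\<^sub>\<infinity>n\<in>nonzero. plane_wave x (?z n) * \<mu> (?z n)) +
         ((1 / of_real \<bar>det M\<bar>) * (dual_gaussian s x + (\<Sum>\<^sub>\<infinity>n\<in>nonzero. dual_gaussian s (x + lattice_point (dual_matrix M) n))) - k))) nonzero"
    proof (rule has_sum_cong)
      fix n :: "'n \<Rightarrow> int" assume n: "n \<in> nonzero"
      have "plane_wave x (?z n) / npow (?z n) (2 * s) = plane_wave x (?z n) * (1 / npow (?z n) (2 * s))" by simp
      also have "\<dots> = gamma_factor s * (plane_wave x (?z n) * \<mu> (?z n) + plane_wave x (?z n) * lower_part s (?z n))"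
        unfolding npow_eq_parts[OF s0 z0[OF n]] using z0[OF n] by (simp add: \<mu>_def algebra_simps)
      finally show "gamma_factor s * (plane_wave x (?z n) * \<mu> (?z n) + plane_wave x (?z n) * lower_part s (?z n)) = plane_wave x (?z n) / npow (?z n) (2 * s)" by simp
    qed
    finally show "((\<lambda>n. plane_wave x (?z n) / npow (?z n) (2 * s)) has_sum
       (E x + gamma_factor s / of_real \<bar>det M\<bar> *
         (dual_gaussian s x + (\<Sum>\<^sub>\<infinity>n\<in>nonzero. dual_gaussian s (x + lattice_point (dual_matrix M) n))))) nonzero"
      by (simp add: E_def algebra_simps)
  qed
qed

text \<open>Both terms contain the Gaussian integral of the zero frequency, which is singular at the
  origin; it cancels in the difference.\<close>

lemma zeta_difference_analytic:
  fixes M :: "real ^ 'n ^ 'n"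
  assumes M: "invertible M" and s: "Re s \<ge> CARD('n)" and l: "real l + 1 - 2 * Re s + CARD('n) > 0"
  shows "real_analytic_on (\<lambda>x. (\<Sum>\<^sub>\<infinity>n\<in>nonzero. plane_wave x (lattice_point M n) / npow (lattice_point M n) (2 * s)) -
     (\<integral>z. wave_remainder l x z / npow z (2 * s) \<partial>lborel) / of_real \<bar>det M\<bar>) (regular_set M)"
proof -
  have d1: "real CARD('n) \<ge> 1" by (simp add: Suc_leI)
  have s2: "Re s > CARD('n) / 2" using s d1 by linarith
  obtain E1 where E1: "entire_pser E1"
    "\<And>x. ((\<lambda>n. plane_wave x (lattice_point M n) / npow (lattice_point M n) (2 * s)) has_sum
       (E1 x + gamma_factor s / of_real \<bar>det M\<bar> *
         (dual_gaussian s x + (\<Sum>\<^sub>\<infinity>n\<in>nonzero. dual_gaussian s (x + lattice_point (dual_matrix M) n))))) nonzero"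
    by (rule lattice_wave_sum[OF M s]) (rule that, assumption, simp only:)
  obtain E2 where E2: "entire_pser E2"
    "\<And>x::real ^ 'n. (\<integral>z. wave_remainder l x z / npow z (2 * s) \<partial>lborel) = E2 x + gamma_factor s * dual_gaussian s x"
    by (rule wave_remainder_integral[OF s2 l]) (rule that, assumption, simp only:)
  have eq: "(\<Sum>\<^sub>\<infinity>n\<in>nonzero. plane_wave x (lattice_point M n) / npow (lattice_point M n) (2 * s)) -
     (\<integral>z. wave_remainder l x z / npow z (2 * s) \<partial>lborel) / of_real \<bar>det M\<bar> =
     (E1 x - (1 / of_real \<bar>det M\<bar>) * E2 x) + gamma_factor s / of_real \<bar>det M\<bar> * (\<Sum>\<^sub>\<infinity>n\<in>nonzero. dual_gaussian s (x + lattice_point (dual_matrix M) n))" for x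
    unfolding infsumI[OF E1(2)] E2(2) by (simp add: add_divide_distrib distrib_left)
  show ?thesis unfolding eq
    by (intro real_analytic_on_add real_analytic_on_cmult dual_gaussian_sum_analytic[OF M s2] entire_pser_analytic entire_pser_diff entire_pser_cmult E1 E2)
qed

section \<open>Hadamard integrals of Fourier transforms\<close>

text \<open>Continuity with bounded support carries the argument up to \<open>HSI_ft\<close>;
  smoothness enters with \<open>bump_on\<close>, for the integrations by parts.\<close>

definition test_fn :: "(real ^ 'n::finite \<Rightarrow> complex) \<Rightarrow> bool" where
  "test_fn \<psi> \<longleftrightarrow> continuous_on UNIV \<psi> \<and> bounded {x. \<psi> x \<noteq> 0}"

definition ft :: "(real ^ 'n::finite \<Rightarrow> complex) \<Rightarrow> real ^ 'n \<Rightarrow> complex" where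
  "ft \<psi> z = (\<integral>x. plane_wave x z * \<psi> x \<partial>lborel)"

text \<open>The term of degree \<open>k\<close> in the Taylor expansion of \<open>ft \<psi>\<close>
  at the origin, as a function of the increment \<open>y\<close>; see
  \<open>dderiv_ft_zero\<close>.\<close>

definition test_moment :: "nat \<Rightarrow> (real ^ 'n::finite \<Rightarrow> complex) \<Rightarrow> real ^ 'n \<Rightarrow> complex" where
  "test_moment k \<psi> y = (\<integral>x. phase y x ^ k / fact k * \<psi> x \<partial>lborel)"

lemma continuous_on_phase [continuous_intros]: "continuous_on S (phase y)"
  unfolding phase_def by (intro continuous_intros)

lemma test_fn_mult: "continuous_on UNIV f \<Longrightarrow> test_fn \<psi> \<Longrightarrow> test_fn (\<lambda>x. f x * \<psi> x)"
  unfolding test_fn_def by (auto intro!: continuous_on_mult elim!: bounded_subset)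

lemma test_fn_measurable: "test_fn \<psi> \<Longrightarrow> \<psi> \<in> borel_measurable borel"
  by (simp add: test_fn_def borel_measurable_continuous_onI)

lemma test_fn_support:
  assumes "test_fn \<psi>"
  obtains R where "R > 0" "\<And>x. \<psi> x \<noteq> 0 \<Longrightarrow> norm x \<le> R"
  using assms bounded_normE_less[of "{x. \<psi> x \<noteq> 0}"] unfolding test_fn_def
  by (metis (mono_tags, lifting) bounded_pos mem_Collect_eq)

lemma test_fn_integrable:
  assumes \<psi>: "test_fn \<psi>"
  shows "integrable lborel \<psi>"
proof -
  obtain R where R: "\<And>x. \<psi> x \<noteq> 0 \<Longrightarrow> norm x \<le> R" using test_fn_support[OF \<psi>] by metis
  have "integrable lborel (\<lambda>x. indicator (cball 0 R) x *\<^sub>R \<psi> x)"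
    by (rule borel_integrable_compact) (use \<psi> in \<open>auto simp: test_fn_def elim: continuous_on_subset\<close>)
  also have "(\<lambda>x. indicator (cball 0 R) x *\<^sub>R \<psi> x) = \<psi>"
    using R by (auto simp: fun_eq_iff indicator_def)
  finally show ?thesis .
qed

lemma norm_phase_power_bound:
  assumes "norm x \<le> R"
  shows "norm (phase y x ^ k) \<le> (2 * pi * R) ^ k * norm y ^ k"
proof -
  have "norm (phase y x) \<le> 2 * pi * (norm y * norm x)" by (rule norm_phase)
  also have "\<dots> \<le> 2 * pi * R * norm y" using mult_right_mono[OF assms norm_ge_zero[of y]] by (simp add: mult_ac)
  finally show ?thesis unfolding norm_power power_mult_distrib[symmetric] by (intro power_mono) auto
qed

lemma plane_wave_has_derivative: "((\<lambda>z. plane_wave x z) has_derivative (\<lambda>v. plane_wave x z * phase v x)) (at z)"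
proof -
  have "((\<lambda>z. complex_of_real (z \<bullet> x)) has_derivative (\<lambda>v. of_real (v \<bullet> x))) (at z)"
    by (intro has_derivative_of_real bounded_linear_imp_has_derivative bounded_linear_inner_left)
  from has_derivative_mult_right[OF this, of "- 2 * of_real pi * \<i>"]
  have "((\<lambda>z. phase z x) has_derivative (\<lambda>v. phase v x)) (at z)" by (simp only: phase_def)
  from has_derivative_compose[OF this DERIV_exp[unfolded has_field_derivative_def]]
  show ?thesis by (simp add: plane_wave_phase)
qed

lemma ft_has_derivative:
  assumes \<psi>: "test_fn \<psi>"
  shows "(ft \<psi> has_derivative (\<lambda>v. ft (\<lambda>x. phase v x * \<psi> x) w)) (at w)"
proof -
  obtain R where R: "R > 0" "\<And>x. \<psi> x \<noteq> 0 \<Longrightarrow> norm x \<le> R" using test_fn_support[OF \<psi>] by metis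
  have [measurable]: "\<psi> \<in> borel_measurable borel" by (rule test_fn_measurable[OF \<psi>])
  have "((\<lambda>z. \<integral>x. plane_wave x z * \<psi> x \<partial>lborel) has_derivative (\<lambda>v. \<integral>x. plane_wave x w * (phase v x * \<psi> x) \<partial>lborel)) (at w)"
  proof (rule has_derivative_integral[OF zero_less_one])
    show "((\<lambda>z. plane_wave x z * \<psi> x) has_derivative (\<lambda>v. plane_wave x z * (phase v x * \<psi> x))) (at z)" for x z
      using has_derivative_mult_left[OF plane_wave_has_derivative[of x z], of "\<psi> x"] by (simp add: mult.assoc)
    show "integrable lborel (\<lambda>x. 2 * pi * R * norm (\<psi> x))" by (intro integrable_mult_right integrable_norm test_fn_integrable \<psi>)
    show "integrable lborel (\<lambda>x. plane_wave x z * \<psi> x)" for z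
      by (intro test_fn_integrable test_fn_mult \<psi> continuous_intros)
    show "norm (plane_wave x z * (phase v x * \<psi> x)) \<le> 2 * pi * R * norm (\<psi> x) * norm v" for x z v
    proof (cases "\<psi> x = 0")
      case False
      then have "norm (phase v x) \<le> 2 * pi * R * norm v"
        using norm_phase_power_bound[OF R(2)[OF False], of v 1] by simp
      then have "norm (phase v x) * norm (\<psi> x) \<le> 2 * pi * R * norm v * norm (\<psi> x)" by (intro mult_right_mono) auto
      then show ?thesis by (simp add: norm_mult norm_plane_wave mult_ac)
    qed simp
  qed measurable
  then show ?thesis by (simp add: ft_def[abs_def])
qed

lemma dderiv_ft: "test_fn \<psi> \<Longrightarrow> dderiv v (ft \<psi>) = ft (\<lambda>x. phase v x * \<psi> x)"
  using frechet_derivative_at[OF ft_has_derivative[of \<psi>]] by (auto simp: dderiv_def fun_eq_iff)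

lemma dderiv_ft_power:
  assumes \<psi>: "test_fn \<psi>"
  shows "(dderiv v ^^ k) (ft \<psi>) = ft (\<lambda>x. phase v x ^ k * \<psi> x)"
proof (induction k)
  case (Suc k)
  have t: "test_fn (\<lambda>x. phase v x ^ k * \<psi> x)" by (intro test_fn_mult \<psi> continuous_intros)
  show ?case by (simp add: Suc.IH dderiv_ft[OF t] mult.assoc)
qed simp

lemma dderiv_ft_zero: "test_fn \<psi> \<Longrightarrow> (dderiv v ^^ k) (ft \<psi>) 0 = fact k * test_moment k \<psi> v"
  by (simp add: dderiv_ft_power ft_def test_moment_def plane_wave_def)

lemma test_moment_measurable [measurable]:
  assumes \<psi>: "test_fn \<psi>"
  shows "test_moment k \<psi> \<in> borel_measurable borel"
proof -
  have [measurable]: "\<psi> \<in> borel_measurable borel" by (rule test_fn_measurable[OF \<psi>])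
  have "(\<lambda>y. \<integral>x. (case (y, x) of (y, x) \<Rightarrow> phase y x ^ k / fact k * \<psi> x) \<partial>lborel) \<in> borel_measurable lborel"
    by (intro lborel.borel_measurable_lebesgue_integral) measurable
  then show ?thesis by (simp add: test_moment_def[abs_def])
qed

lemma test_moment_bound:
  assumes \<psi>: "test_fn \<psi>"
  obtains C where "C \<ge> 0" "\<And>y. norm (test_moment k \<psi> y) \<le> C * norm y ^ k"
proof -
  obtain R where R: "R > 0" "\<And>x. \<psi> x \<noteq> 0 \<Longrightarrow> norm x \<le> R" using test_fn_support[OF \<psi>] by metis
  show ?thesis
  proof
    show "(2 * pi * R) ^ k * (\<integral>x. norm (\<psi> x) \<partial>lborel) \<ge> 0" using R by simp
    fix y
    have "norm (test_moment k \<psi> y) \<le> (\<integral>x. norm (phase y x ^ k / fact k * \<psi> x) \<partial>lborel)"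
      unfolding test_moment_def by (rule integral_norm_bound)
    also have "\<dots> \<le> (\<integral>x. (2 * pi * R) ^ k * norm y ^ k * norm (\<psi> x) \<partial>lborel)"
    proof (rule integral_mono)
      have "test_fn (\<lambda>x. phase y x ^ k / fact k * \<psi> x)" by (intro test_fn_mult \<psi> continuous_intros) simp
      then show "integrable lborel (\<lambda>x. norm (phase y x ^ k / fact k * \<psi> x))" by (intro integrable_norm test_fn_integrable)
      show "integrable lborel (\<lambda>x. (2 * pi * R) ^ k * norm y ^ k * norm (\<psi> x))" by (intro integrable_mult_right integrable_norm test_fn_integrable \<psi>)
      show "norm (phase y x ^ k / fact k * \<psi> x) \<le> (2 * pi * R) ^ k * norm y ^ k * norm (\<psi> x)" for x
      proof (cases "\<psi> x = 0")
        case False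
        have "norm (phase y x ^ k) / fact k \<le> norm (phase y x ^ k) / 1" by (intro divide_left_mono) auto
        then have "norm (phase y x ^ k) / fact k \<le> (2 * pi * R) ^ k * norm y ^ k"
          using norm_phase_power_bound[OF R(2)[OF False], of y k] by simp
        from mult_right_mono[OF this norm_ge_zero[of "\<psi> x"]] show ?thesis by (simp add: norm_mult norm_divide)
      qed simp
    qed
    also have "\<dots> = (2 * pi * R) ^ k * (\<integral>x. norm (\<psi> x) \<partial>lborel) * norm y ^ k" by simp
    finally show "norm (test_moment k \<psi> y) \<le> (2 * pi * R) ^ k * (\<integral>x. norm (\<psi> x) \<partial>lborel) * norm y ^ k" .
  qed
qed

lemma phase_scaleR: "phase (r *\<^sub>R y) x = of_real r * phase y x"
  by (simp add: phase_def)

lemma test_moment_scaleR: "test_moment k \<psi> (r *\<^sub>R y) = of_real r ^ k * test_moment k \<psi> y"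
  by (simp add: test_moment_def phase_scaleR power_mult_distrib mult.assoc flip: integral_mult_right_zero)

text \<open>The compact support of \<psi> is what makes a majorant depending on \<open>z\<close>
  alone available, although plane-wave remainders and phase powers are unbounded in
  \<open>x\<close>.\<close>

lemma test_fn_Fubini:
  fixes K :: "real ^ 'n::finite \<Rightarrow> real ^ 'n \<Rightarrow> complex"
  assumes \<psi>: "test_fn \<psi>" and [measurable]: "case_prod K \<in> borel_measurable (lborel \<Otimes>\<^sub>M lborel)"
    and B: "integrable lborel B" and le: "\<And>x z. \<psi> x \<noteq> 0 \<Longrightarrow> norm (K x z) \<le> B z"
  shows "integrable lborel (\<lambda>z. \<integral>x. K x z * \<psi> x \<partial>lborel)"
    and "integrable lborel (\<lambda>x. \<psi> x * (\<integral>z. K x z \<partial>lborel))"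
    and "(\<integral>x. \<psi> x * (\<integral>z. K x z \<partial>lborel) \<partial>lborel) = (\<integral>z. (\<integral>x. K x z * \<psi> x \<partial>lborel) \<partial>lborel)"
proof -
  have [measurable]: "\<psi> \<in> borel_measurable borel" by (rule test_fn_measurable[OF \<psi>])
  define f where "f x z = K x z * \<psi> x" for x z
  have Km: "K x \<in> borel_measurable lborel" for x
    using measurable_Pair2[OF assms(2), of x] by simp
  have fB: "norm (f x z) \<le> norm (\<psi> x) * B z" for x z
    using mult_left_mono[OF le[of x z], of "norm (\<psi> x)"] by (cases "\<psi> x = 0") (auto simp: f_def norm_mult mult.commute)
  have fi: "integrable lborel (f x)" for x
  proof (rule Bochner_Integration.integrable_bound)
    show "integrable lborel (\<lambda>z. norm (\<psi> x) * B z)" by (intro integrable_mult_right B)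
    show "f x \<in> borel_measurable lborel" unfolding f_def by (intro borel_measurable_times Km borel_measurable_const)
  qed (use fB in \<open>auto intro!: AE_I2 order_trans[OF fB abs_ge_self]\<close>)
  have int: "integrable (lborel \<Otimes>\<^sub>M lborel) (case_prod f)"
  proof (rule lborel_pair.Fubini_integrable)
    show fm: "case_prod f \<in> borel_measurable (lborel \<Otimes>\<^sub>M lborel)"
      unfolding f_def by measurable
    show "integrable lborel (\<lambda>x. \<integral>z. norm (case (x, z) of (x, z) \<Rightarrow> f x z) \<partial>lborel)"
    proof (rule Bochner_Integration.integrable_bound)
      show "integrable lborel (\<lambda>x. norm (\<psi> x) * (\<integral>z. B z \<partial>lborel))" by (intro integrable_mult_left integrable_norm test_fn_integrable \<psi>)
      show "(\<lambda>x. \<integral>z. norm (case (x, z) of (x, z) \<Rightarrow> f x z) \<partial>lborel) \<in> borel_measurable lborel"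
        using fm by measurable
      show "AE x in lborel. norm (\<integral>z. norm (case (x, z) of (x, z) \<Rightarrow> f x z) \<partial>lborel) \<le> norm (norm (\<psi> x) * (\<integral>z. B z \<partial>lborel))"
      proof (rule AE_I2)
        fix x
        have "(\<integral>z. norm (f x z) \<partial>lborel) \<le> (\<integral>z. norm (\<psi> x) * B z \<partial>lborel)"
          by (intro integral_mono integrable_norm fi integrable_mult_right B fB)
        moreover have "0 \<le> (\<integral>z. norm (f x z) \<partial>lborel)" by (intro Bochner_Integration.integral_nonneg) auto
        ultimately show "norm (\<integral>z. norm (case (x, z) of (x, z) \<Rightarrow> f x z) \<partial>lborel) \<le> norm (norm (\<psi> x) * (\<integral>z. B z \<partial>lborel))"
          by simp
      qed
    qed
  qed (simp add: fi)
  have inner: "(\<integral>z. f x z \<partial>lborel) = \<psi> x * (\<integral>z. K x z \<partial>lborel)" for x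
    by (simp add: f_def mult.commute)
  show "integrable lborel (\<lambda>z. \<integral>x. K x z * \<psi> x \<partial>lborel)"
    using lborel_pair.integrable_snd[OF int] by (simp add: f_def)
  show "integrable lborel (\<lambda>x. \<psi> x * (\<integral>z. K x z \<partial>lborel))"
    using lborel_pair.integrable_fst[OF int] by (simp add: inner)
  show "(\<integral>x. \<psi> x * (\<integral>z. K x z \<partial>lborel) \<partial>lborel) = (\<integral>z. (\<integral>x. K x z * \<psi> x \<partial>lborel) \<partial>lborel)"
    using lborel_pair.Fubini_integral[OF int] by (simp add: inner) (simp add: f_def)
qed

section \<open>The counterterms of the Hadamard integral\<close>

lemma norm_npow: "norm (npow y \<nu>) = norm y powr Re \<nu>"
  by (simp add: npow_def norm_powr_of_real)

lemma shell_quotient_integrable: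
  fixes T :: "real ^ 'n::finite \<Rightarrow> complex"
  assumes [measurable]: "T \<in> borel_measurable borel" and T: "\<And>y. norm (T y) \<le> C * norm y ^ k" and C: "C \<ge> 0"
    and e: "\<epsilon> > 0" and \<nu>: "Re \<nu> \<ge> 0"
  shows "integrable lborel (\<lambda>y. indicator (ball 0 R - ball 0 \<epsilon>) y * (T y / npow y \<nu>))"
proof -
  have "integrable lborel (\<lambda>y. indicator (ball 0 R) y * (indicator (- ball 0 \<epsilon>) y * (T y / npow y \<nu>)))"
  proof (rule finite_measure_ball_integrable)
    fix y :: "real ^ 'n" assume y: "y \<in> ball 0 R"
    show "norm (indicator (- ball 0 \<epsilon>) y * (T y / npow y \<nu>)) \<le> C * R ^ k / \<epsilon> powr Re \<nu>"
    proof (cases "y \<in> ball 0 \<epsilon>")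
      case True
      then show ?thesis using y C by (auto intro!: divide_nonneg_nonneg mult_nonneg_nonneg zero_le_power dest: le_less_trans[OF norm_ge_zero])
    next
      case False
      have "norm (T y) / norm y powr Re \<nu> \<le> C * R ^ k / \<epsilon> powr Re \<nu>"
        using y C e False \<nu> by (intro frac_le order_trans[OF T] mult_left_mono power_mono powr_mono2) (auto intro!: mult_nonneg_nonneg dest: le_less_trans[OF norm_ge_zero])
      then show ?thesis using False by (simp add: norm_divide norm_npow)
    qed
  qed measurable
  then show ?thesis
    by (rule Bochner_Integration.integrable_bound) (auto simp: indicator_def intro!: AE_I2)
qed

text \<open>The weight by which the k-th Hadamard counterterm differs from the integral of the k-th Taylor
  term over the punctured unit ball.\<close>

definition hadamard_weight :: "(real ^ 'n::finite) set \<Rightarrow> complex \<Rightarrow> nat \<Rightarrow> real ^ 'n \<Rightarrow> complex" where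
  "hadamard_weight U \<nu> k y =
     (if \<nu> = of_nat (k + CARD('n)) then (if even k then (indicator U y - indicator (ball 0 1) y) / npow y \<nu> else 0)
      else if Re \<nu> = of_nat (k + CARD('n)) then
        indicator (ball 0 1) y * (of_nat CARD('n) / (\<nu> - of_nat (k + CARD('n)))) / of_real (norm y ^ k)
      else indicator (- ball 0 1) y / npow y \<nu>)"

lemma hadamard_weight_measurable [measurable]:
  "U \<in> sets borel \<Longrightarrow> hadamard_weight U \<nu> k \<in> borel_measurable borel"
  unfolding hadamard_weight_def[abs_def] by (cases "\<nu> = of_nat (k + CARD('a))"; cases "Re \<nu> = of_nat (k + CARD('a))"; cases "even k") simp_all

text \<open>In the resonant case the two indicators agree near 0 and far out, so neither the
  singularity nor infinity is seen. On the critical line the factor |y|^k cancels. Otherwise Re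
  \<nu> > k + d, which gives integrability at infinity.\<close>

lemma hadamard_weight_integrable:
  fixes U :: "(real ^ 'n::finite) set"
  assumes U: "open U" "bounded U" "0 \<in> U" and k: "real k + CARD('n) \<le> Re \<nu>"
  shows "integrable lborel (\<lambda>y. norm y ^ k * norm (hadamard_weight U \<nu> k y))"
proof -
  have [measurable]: "U \<in> sets borel" using U by auto
  have ballI: "integrable lborel (\<lambda>y. C * indicator (ball (0 :: real ^ 'n) R) y)" for C R :: real
    using emeasure_lborel_ball_finite[of "0 :: real ^ 'n" R] by (intro integrable_mult_right integrable_real_indicator) auto
  consider (int) "\<nu> = of_nat (k + CARD('n))" | (line) "\<nu> \<noteq> of_nat (k + CARD('n))" "Re \<nu> = of_nat (k + CARD('n))"
    | (gen) "Re \<nu> \<noteq> of_nat (k + CARD('n))" by auto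
  then show ?thesis
  proof cases
    case int
    obtain \<delta> where \<delta>: "\<delta> > 0" "ball 0 \<delta> \<subseteq> U" using U by (meson open_contains_ball)
    obtain R where R: "R > 0" "\<And>y. y \<in> U \<Longrightarrow> norm y < R" using U bounded_normE_less by metis
    define e where "e = min \<delta> 1"
    show ?thesis
    proof (rule Bochner_Integration.integrable_bound[OF ballI])
      show "AE y in lborel. norm (norm y ^ k * norm (hadamard_weight U \<nu> k y)) \<le> norm (max R 1 ^ k * (e powr - Re \<nu>) * indicator (ball (0 :: real ^ 'n) (max R 1)) y)"
      proof (rule AE_I2)
        fix y :: "real ^ 'n"
        show "norm (norm y ^ k * norm (hadamard_weight U \<nu> k y)) \<le> norm (max R 1 ^ k * (e powr - Re \<nu>) * indicator (ball (0 :: real ^ 'n) (max R 1)) y)"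
        proof (cases "indicator U y - indicator (ball 0 1) y = (0 :: complex)")
          case True
          then show ?thesis using int by (simp add: hadamard_weight_def)
        next
          case False
          then have "(y \<in> U) \<noteq> (norm y < 1)" by (auto simp: indicator_def)
          then consider "y \<in> U" "\<not> norm y < 1" | "y \<notin> U" "norm y < 1" by blast
          then have "norm y < max R 1 \<and> e \<le> norm y"
          proof cases
            case 1
            then show ?thesis using R(2)[of y] by (simp add: e_def)
          next
            case 2
            then have "y \<notin> ball 0 \<delta>" using \<delta>(2) by auto
            then show ?thesis using 2 by (simp add: e_def)
          qed
          then have yR: "y \<in> ball 0 (max R 1)" and ye: "e \<le> norm y" by auto
          have e0: "e > 0" using \<delta> by (simp add: e_def)
          have "norm (hadamard_weight U \<nu> k y) \<le> norm (1 / npow y \<nu>)"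
            unfolding hadamard_weight_def if_P[OF int] by (auto simp: indicator_def norm_divide)
          also have "\<dots> = norm y powr - Re \<nu>"
            unfolding norm_divide norm_npow by (simp add: powr_minus divide_inverse)
          also have "\<dots> \<le> e powr - Re \<nu>" using ye e0 k by (intro powr_mono2') auto
          finally have "norm y ^ k * norm (hadamard_weight U \<nu> k y) \<le> max R 1 ^ k * e powr - Re \<nu>"
            using yR by (intro mult_mono power_mono) auto
          then show ?thesis using yR by (simp add: abs_mult)
        qed
      qed
    qed measurable
  next
    case line
    let ?C = "norm (complex_of_nat CARD('n) / (\<nu> - of_nat (k + CARD('n))))"
    show ?thesis
    proof (rule Bochner_Integration.integrable_bound[OF ballI])
      show "AE y in lborel. norm (norm y ^ k * norm (hadamard_weight U \<nu> k y)) \<le> norm (?C * indicator (ball (0 :: real ^ 'n) 1) y)"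
      proof (rule AE_I2)
        fix y :: "real ^ 'n"
        have "norm (hadamard_weight U \<nu> k y) = indicator (ball 0 1) y * ?C / norm y ^ k"
          using line by (simp add: hadamard_weight_def norm_divide norm_mult norm_power indicator_def)
        then show "norm (norm y ^ k * norm (hadamard_weight U \<nu> k y)) \<le> norm (?C * indicator (ball (0 :: real ^ 'n) 1) y)"
          by (cases "norm y ^ k = 0") (simp_all add: abs_mult)
      qed
    qed measurable
  next
    case gen
    then have a: "(real k - Re \<nu>) + CARD('n) < 0" using k by simp
    show ?thesis
    proof (rule Bochner_Integration.integrable_bound[OF integrable_norm_powr_outside[OF a]])
      show "AE y in lborel. norm (norm y ^ k * norm (hadamard_weight U \<nu> k y)) \<le> norm (indicator (- ball 0 1) y * norm (y :: real ^ 'n) powr (real k - Re \<nu>))"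
      proof (rule AE_I2)
        fix y :: "real ^ 'n"
        show "norm (norm y ^ k * norm (hadamard_weight U \<nu> k y)) \<le> norm (indicator (- ball 0 1) y * norm (y :: real ^ 'n) powr (real k - Re \<nu>))"
        proof (cases "y \<in> ball 0 1")
          case False
          then have "norm y > 0" by auto
          then have "norm y powr (real k - Re \<nu>) = norm y ^ k / norm y powr Re \<nu>" by (simp add: powr_diff powr_realpow)
          then show ?thesis using False gen by (auto simp: hadamard_weight_def norm_divide norm_npow)
        qed (use gen in \<open>auto simp: hadamard_weight_def\<close>)
      qed
    qed measurable
  qed
qed

lemma weighted_integrable:
  fixes T \<mu> :: "real ^ 'n::finite \<Rightarrow> complex"
  assumes [measurable]: "T \<in> borel_measurable borel" "\<mu> \<in> borel_measurable borel"
    and T: "\<And>y. norm (T y) \<le> C * norm y ^ k"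
    and int: "integrable lborel (\<lambda>y. norm y ^ k * norm (\<mu> y))"
  shows "integrable lborel (\<lambda>y. T y * \<mu> y)"
proof (rule Bochner_Integration.integrable_bound)
  show "integrable lborel (\<lambda>y. C * (norm y ^ k * norm (\<mu> y)))" by (intro integrable_mult_right int)
  show "AE y in lborel. norm (T y * \<mu> y) \<le> norm (C * (norm y ^ k * norm (\<mu> y)))"
  proof (rule AE_I2)
    fix y
    have "norm (T y) * norm (\<mu> y) \<le> C * norm y ^ k * norm (\<mu> y)" by (rule mult_right_mono[OF T norm_ge_zero])
    then show "norm (T y * \<mu> y) \<le> norm (C * (norm y ^ k * norm (\<mu> y)))"
      unfolding real_norm_def norm_mult mult.assoc[symmetric] using abs_ge_self order_trans by blast
  qed
qed measurable

text \<open>All dependence on \<epsilon> is collected in the first integral, which has the same form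
  in the three regimes. On the critical line polar coordinates give the shell integral as \<sigma>
  (1 - \<epsilon>^p) / p, with \<sigma> the spherical mean of the Taylor term times the area and p =
  k + d - \<nu>; the counterterm is -\<sigma> \<epsilon>^p / p, so the difference -\<sigma> / p is
  encoded as a weighted integral over the unit ball.\<close>

lemma hadamard_term_split:
  fixes U :: "(real ^ 'n::finite) set"
  assumes U: "open U" "bounded U" "0 \<in> U" and k: "real k + CARD('n) \<le> Re \<nu>" and \<psi>: "test_fn \<psi>"
    and e: "0 < \<epsilon>" "\<epsilon> < 1" "ball 0 \<epsilon> \<subseteq> U"
  shows "hadamard_term U \<nu> \<epsilon> (ft \<psi>) k =
     (\<integral>y. indicator (ball 0 1 - ball 0 \<epsilon>) y * (test_moment k \<psi> y / npow y \<nu>) \<partial>lborel) +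
     (\<integral>y. test_moment k \<psi> y * hadamard_weight U \<nu> k y \<partial>lborel)"
proof -
  define T where "T = test_moment k \<psi>"
  obtain C where C: "C \<ge> 0" "\<And>y. norm (T y) \<le> C * norm y ^ k"
    using test_moment_bound[OF \<psi>, of k] unfolding T_def by metis
  have [measurable]: "T \<in> borel_measurable borel" unfolding T_def by (rule test_moment_measurable[OF \<psi>])
  have [measurable]: "U \<in> sets borel" using U by auto
  have i1: "integrable lborel (\<lambda>y. indicator (ball 0 1 - ball 0 \<epsilon>) y * (T y / npow y \<nu>))"
    by (rule shell_quotient_integrable[OF _ C(2) C(1) e(1)]) (use k in auto)
  have i2: "integrable lborel (\<lambda>y. T y * hadamard_weight U \<nu> k y)"
    by (rule weighted_integrable[OF _ _ C(2) hadamard_weight_integrable[OF U k]]) measurable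
  have D: "(dderiv v ^^ k) (ft \<psi>) 0 = fact k * T v" for v unfolding T_def by (rule dderiv_ft_zero[OF \<psi>])
  have cancel: "(\<integral>y. indicator A y * (fact k * T y / npow y \<nu>) \<partial>lborel) / fact k = (\<integral>y. indicator A y * (T y / npow y \<nu>) \<partial>lborel)" for A
    by (simp flip: integral_divide_zero)
  consider (int) "\<nu> = of_nat (k + CARD('n))" | (line) "\<nu> \<noteq> of_nat (k + CARD('n))" "Re \<nu> = of_nat (k + CARD('n))"
    | (gen) "Re \<nu> \<noteq> of_nat (k + CARD('n))" by auto
  then have "hadamard_term U \<nu> \<epsilon> (ft \<psi>) k =
     (\<integral>y. indicator (ball 0 1 - ball 0 \<epsilon>) y * (T y / npow y \<nu>) \<partial>lborel) + (\<integral>y. T y * hadamard_weight U \<nu> k y \<partial>lborel)"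
  proof cases
    case int
    have "hadamard_term U \<nu> \<epsilon> (ft \<psi>) k = (\<integral>y. indicator ((if even k then U else ball 0 1) - ball 0 \<epsilon>) y * (T y / npow y \<nu>) \<partial>lborel)"
      using int unfolding hadamard_term_def set_lebesgue_integral_def indicator_scaleR_mult D cancel[symmetric] by simp
    also have "\<dots> = (\<integral>y. indicator (ball 0 1 - ball 0 \<epsilon>) y * (T y / npow y \<nu>) + T y * hadamard_weight U \<nu> k y \<partial>lborel)"
      by (intro Bochner_Integration.integral_cong refl)
        (use e int in \<open>auto simp: hadamard_weight_def indicator_def subset_iff\<close>)
    also have "\<dots> = (\<integral>y. indicator (ball 0 1 - ball 0 \<epsilon>) y * (T y / npow y \<nu>) \<partial>lborel) + (\<integral>y. T y * hadamard_weight U \<nu> k y \<partial>lborel)"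
      by (rule Bochner_Integration.integral_add[OF i1 i2])
    finally show ?thesis .
  next
    case line
    \<comment> \<open>\<open>polar_shell\<close> wants a bounded function. The truncation agrees
      with \<open>T\<close> at every \<open>sgn y\<close>, the only points where it is
      evaluated.\<close>
    define G where "G y = (if norm y \<le> 1 then T y else 0)" for y
    have [measurable]: "G \<in> borel_measurable borel" unfolding G_def by measurable
    have Gb: "norm (G y) \<le> C" for y
    proof (cases "norm y \<le> 1")
      case True
      have "norm (T y) \<le> C * norm y ^ k" by (rule C)
      also have "\<dots> \<le> C * 1" using True C(1) by (intro mult_left_mono power_le_one) auto
      finally show ?thesis using True by (simp add: G_def)
    qed (simp add: G_def C)
    have GT: "G (sgn y) = T (sgn y)" for y by (simp add: G_def norm_sgn)
    define a where "a = of_nat k - \<nu>"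
    have ad: "a + of_nat CARD('n) \<noteq> 0" using line by (auto simp: a_def add_eq_0_iff algebra_simps)
    have a0: "a \<noteq> 0" using line by (auto simp: a_def)
    have ad': "\<nu> - of_nat (k + CARD('n)) = - (a + of_nat CARD('n))" by (simp add: a_def)
    have Ts: "T y = of_real (norm y) ^ k * T (sgn y)" for y
    proof (cases "y = 0")
      case False
      then have "norm y *\<^sub>R sgn y = y" by (simp add: sgn_div_norm)
      then show ?thesis using test_moment_scaleR[of k \<psi> "norm y" "sgn y"] by (simp add: T_def)
    next
      case True
      then show ?thesis using C(2)[of 0] by (cases k) auto
    qed
    have "(\<integral>y. indicator (ball 0 1 - ball 0 \<epsilon>) y * (T y / npow y \<nu>) \<partial>lborel) =
        (\<integral>y. indicator (ball 0 1 - ball 0 \<epsilon>) y * (G (sgn y) * of_real (norm y) powr a) \<partial>lborel)"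
    proof (intro Bochner_Integration.integral_cong refl)
      fix y :: "real ^ 'n"
      show "indicator (ball 0 1 - ball 0 \<epsilon>) y * (T y / npow y \<nu>) = indicator (ball 0 1 - ball 0 \<epsilon>) y * (G (sgn y) * of_real (norm y) powr a)"
      proof (cases "y \<in> ball 0 \<epsilon>")
        case False
        then have y: "norm y > 0" using e by auto
        then have "complex_of_real (norm y) powr a = of_real (norm y) ^ k / npow y \<nu>"
          by (simp add: a_def npow_def powr_diff powr_nat')
        then show ?thesis unfolding GT by (subst Ts) (simp add: mult_ac)
      qed simp
    qed
    also have "\<dots> = sphere_integral G * (of_real 1 powr (a + of_nat CARD('n)) - of_real \<epsilon> powr (a + of_nat CARD('n))) / (a + of_nat CARD('n))"
      by (rule polar_shell) (use Gb e a0 ad in auto)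
    finally have 1: "(\<integral>y. indicator (ball 0 1 - ball 0 \<epsilon>) y * (T y / npow y \<nu>) \<partial>lborel) =
      sphere_integral G * (1 - of_real \<epsilon> powr (a + of_nat CARD('n))) / (a + of_nat CARD('n))" by simp
    have sG: "sphere_integral G = of_nat CARD('n) * (\<integral>y. indicator (ball 0 1) y * T (sgn y) \<partial>lborel)"
      unfolding sphere_integral_def set_lebesgue_integral_def indicator_scaleR_mult GT ..
    have "(\<integral>y. T y * hadamard_weight U \<nu> k y \<partial>lborel) = (\<integral>y. (of_nat CARD('n) / (\<nu> - of_nat (k + CARD('n)))) * (indicator (ball 0 1) y * T (sgn y)) \<partial>lborel)"
    proof (intro Bochner_Integration.integral_cong refl)
      fix y :: "real ^ 'n"
      have "T y / of_real (norm y ^ k) = T (sgn y)"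
      proof (cases "norm y ^ k = 0")
        case True
        then have "y = 0" "k > 0" by auto
        then have "T y = 0" using C(2)[of 0] by (cases k) auto
        then show ?thesis using \<open>y = 0\<close> by simp
      qed (use Ts[of y] in simp)
      then have "T y * (I * c / of_real (norm y ^ k)) = c * (I * T (sgn y))" for I c :: complex
        by (metis mult.left_commute times_divide_eq_right mult.commute)
      then show "T y * hadamard_weight U \<nu> k y = (of_nat CARD('n) / (\<nu> - of_nat (k + CARD('n)))) * (indicator (ball 0 1) y * T (sgn y))"
        unfolding hadamard_weight_def if_not_P[OF line(1)] if_P[OF line(2)] .
    qed
    also have "\<dots> = sphere_integral G / (\<nu> - of_nat (k + CARD('n)))"
      unfolding integral_mult_right_zero sG by simp
    finally have 2: "(\<integral>y. T y * hadamard_weight U \<nu> k y \<partial>lborel) = - (sphere_integral G / (a + of_nat CARD('n)))"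
      unfolding ad' minus_divide_right .
    have "sphere_integral (\<lambda>\<theta>. (dderiv \<theta> ^^ k) (ft \<psi>) 0) / fact k = sphere_integral G"
      unfolding sphere_integral_def set_lebesgue_integral_def indicator_scaleR_mult D GT by (simp add: mult.left_commute)
    note sg = this[symmetric]
    have "hadamard_term U \<nu> \<epsilon> (ft \<psi>) k = sphere_integral G * (of_real \<epsilon> powr (of_nat (k + CARD('n)) - \<nu>) / (\<nu> - of_nat (k + CARD('n))))"
      unfolding hadamard_term_def if_not_P[OF line(1)] if_P[OF line(2)] sg by simp
    also have "of_nat (k + CARD('n)) - \<nu> = a + of_nat CARD('n)" by (simp add: a_def)
    finally show ?thesis unfolding 1 2 ad' minus_divide_right[symmetric] by (simp add: right_diff_distrib diff_divide_distrib)
  next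
    case gen
    have "hadamard_term U \<nu> \<epsilon> (ft \<psi>) k = (\<integral>y. indicator (- ball 0 \<epsilon>) y * (T y / npow y \<nu>) \<partial>lborel)"
      using gen unfolding hadamard_term_def set_lebesgue_integral_def indicator_scaleR_mult D cancel[symmetric] by auto
    also have "\<dots> = (\<integral>y. indicator (ball 0 1 - ball 0 \<epsilon>) y * (T y / npow y \<nu>) + T y * hadamard_weight U \<nu> k y \<partial>lborel)"
      by (intro Bochner_Integration.integral_cong refl)
        (use e gen in \<open>auto simp: hadamard_weight_def indicator_def\<close>)
    also have "\<dots> = (\<integral>y. indicator (ball 0 1 - ball 0 \<epsilon>) y * (T y / npow y \<nu>) \<partial>lborel) + (\<integral>y. T y * hadamard_weight U \<nu> k y \<partial>lborel)"
      by (rule Bochner_Integration.integral_add[OF i1 i2])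
    finally show ?thesis .
  qed
  then show ?thesis by (simp add: T_def)
qed

text \<open>The last sum is the polynomial part; the set \<open>U\<close> and the conventions for
  the exceptional exponents enter through it alone.\<close>

definition zeta_density :: "real ^ 'n ^ 'n \<Rightarrow> (real ^ 'n::finite) set \<Rightarrow> complex \<Rightarrow> nat \<Rightarrow> real ^ 'n \<Rightarrow> complex" where
  "zeta_density M U \<nu> l x =
     (\<Sum>\<^sub>\<infinity>n\<in>nonzero. plane_wave x (lattice_point M n) / npow (lattice_point M n) \<nu>) -
     ((\<integral>z. wave_remainder l x z / npow z \<nu> \<partial>lborel) -
      (\<Sum>k\<le>l. \<integral>y. phase y x ^ k / fact k * hadamard_weight U \<nu> k y \<partial>lborel)) / of_real \<bar>det M\<bar>"

text \<open>The phase is purely imaginary, so the Taylor remainder of exp carries no exponential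
  factor. For x in a fixed ball this gives one majorant in \<open>z\<close>, integrable at 0 through
  the extra power l + 1 and at infinity through Re \<nu> > d.\<close>

lemma wave_remainder_bound:
  assumes x: "norm x \<le> R"
  shows "norm (wave_remainder l x z / npow z \<nu>) \<le>
    (2 * pi * R) ^ Suc l * (indicator (ball 0 1) z * norm z powr (real l + 1 - Re \<nu>)) + indicator (- ball 0 1) z * norm z powr - Re \<nu>"
proof (cases "z \<in> ball 0 1")
  case True
  show ?thesis
  proof (cases "z = 0")
    case False
    have "norm (exp (phase z x) - (\<Sum>i\<le>l. phase z x ^ i / fact i)) \<le> exp \<bar>Re (phase z x)\<bar> * norm (phase z x) ^ Suc l / fact l"
      by (rule Taylor_exp)
    also have "Re (phase z x) = 0" by (simp add: phase_def)
    also have "exp \<bar>0\<bar> * norm (phase z x) ^ Suc l / fact l = norm (phase z x ^ Suc l) / fact l" unfolding norm_power by simp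
    also have "\<dots> \<le> norm (phase z x ^ Suc l) / 1" by (intro divide_left_mono) auto
    also have "\<dots> \<le> (2 * pi * R) ^ Suc l * norm z ^ Suc l" using norm_phase_power_bound[OF x, of z "Suc l"] by simp
    finally have "norm (wave_remainder l x z) / norm z powr Re \<nu> \<le> (2 * pi * R) ^ Suc l * norm z ^ Suc l / norm z powr Re \<nu>"
      using True by (intro divide_right_mono) (simp_all add: plane_wave_phase phase_taylor_def)
    also have "norm z ^ Suc l = norm z powr (real l + 1)" using powr_realpow[of "norm z" "Suc l"] False by (simp add: add.commute)
    finally show ?thesis using True by (simp add: norm_divide norm_npow powr_diff)
  qed (simp add: npow_def)
next
  case False
  then show ?thesis by (simp add: norm_mult norm_inverse norm_npow norm_plane_wave powr_minus divide_inverse)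
qed

text \<open>Pairing with \<psi> before removing the small ball: the integral of the remainder
  converges absolutely, the shell integrals of the Taylor terms cancel the counterterms for each
  small \<epsilon>, and Fubini moves \<psi> outside.\<close>

lemma hadamard_integral_ft:
  fixes U :: "(real ^ 'n::finite) set"
  assumes U: "open U" "bounded U" "0 \<in> U" and \<nu>: "Re \<nu> > CARD('n)" and \<psi>: "test_fn \<psi>"
  defines "l \<equiv> nat \<lfloor>Re \<nu> - real CARD('n)\<rfloor>"
  shows "hadamard_integral U \<nu> (ft \<psi>) = (\<integral>x. \<psi> x * ((\<integral>z. wave_remainder l x z / npow z \<nu> \<partial>lborel) -
      (\<Sum>k\<le>l. \<integral>y. phase y x ^ k / fact k * hadamard_weight U \<nu> k y \<partial>lborel)) \<partial>lborel)" (is ?eq)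
    and "integrable lborel (\<lambda>x. \<psi> x * ((\<integral>z. wave_remainder l x z / npow z \<nu> \<partial>lborel) -
      (\<Sum>k\<le>l. \<integral>y. phase y x ^ k / fact k * hadamard_weight U \<nu> k y \<partial>lborel)))" (is ?int)
proof -
  define d where "d = real CARD('n)"
  have d: "d > 0" by (simp add: d_def)
  have fl: "int k \<le> \<lfloor>Re \<nu> - d\<rfloor> \<longleftrightarrow> k \<le> l" for k
    using \<nu> unfolding l_def d_def by (metis int_nat_eq le_less nat_0_iff nat_le_iff of_nat_0_le_iff zero_le_floor diff_ge_0_iff_ge of_nat_le_iff)
  have kl: "real k + d \<le> Re \<nu>" if "k \<le> l" for k
    using that fl[of k] by (simp add: le_floor_iff algebra_simps)
  \<comment> \<open>By the choice of \<open>l\<close> as a floor, l \<le> Re \<nu> - d < l + 1: the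
    left inequality is what the counterterms need, the right one makes the remainder integrable at
    0.\<close>
  have l1: "real l + 1 - Re \<nu> + d > 0"
  proof -
    have "\<not> Suc l \<le> l" by simp
    then have "\<not> int (Suc l) \<le> \<lfloor>Re \<nu> - d\<rfloor>" using fl by blast
    then show ?thesis by (simp add: le_floor_iff algebra_simps)
  qed
  have [measurable]: "U \<in> sets borel" "\<psi> \<in> borel_measurable borel" using U test_fn_measurable[OF \<psi>] by auto
  obtain R where R: "R > 0" "\<And>x. \<psi> x \<noteq> 0 \<Longrightarrow> norm x \<le> R" using test_fn_support[OF \<psi>] by metis
  define B where "B z = (2 * pi * R) ^ Suc l * (indicator (ball 0 1) z * norm z powr (real l + 1 - Re \<nu>)) + indicator (- ball 0 1) z * norm z powr - Re \<nu>" for z :: "real ^ 'n"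
  have B: "integrable lborel B"
    unfolding B_def using l1 \<nu>
    by (intro Bochner_Integration.integrable_add integrable_mult_right integrable_norm_powr_ball integrable_norm_powr_outside) (auto simp: d_def)
  define K where "K x z = wave_remainder l x z / npow z \<nu>" for x z :: "real ^ 'n"
  have Km: "case_prod K \<in> borel_measurable (lborel \<Otimes>\<^sub>M lborel)"
    unfolding K_def by measurable
  have KB: "norm (K x z) \<le> B z" if "\<psi> x \<noteq> 0" for x z
    unfolding K_def B_def by (rule wave_remainder_bound[OF R(2)[OF that]])
  note FK = test_fn_Fubini[OF \<psi> Km B KB]
  \<comment> \<open>The transform of \<psi> with its own Taylor polynomial subtracted in the unit
    ball, divided by the power; \<open>Jeq\<close> makes this explicit.\<close>
  define J where "J z = (\<integral>x. K x z * \<psi> x \<partial>lborel)" for z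
  have Ji: "integrable lborel J" unfolding J_def by (rule FK(1))
  define T where "T k = test_moment k \<psi>" for k
  have tf: "test_fn (\<lambda>x. f x * \<psi> x)" if "continuous_on UNIV f" for f by (rule test_fn_mult[OF that \<psi>])
  have Jeq: "J z = (ft \<psi> z - indicator (ball 0 1) z * (\<Sum>k\<le>l. T k z)) / npow z \<nu>" for z
  proof -
    have i: "integrable lborel (\<lambda>x. phase z x ^ k / fact k * \<psi> x)" for k
      by (intro test_fn_integrable tf continuous_intros) simp
    have j: "integrable lborel (\<lambda>x. plane_wave x z * \<psi> x)" by (intro test_fn_integrable tf continuous_intros)
    have "J z = (\<integral>x. (plane_wave x z * \<psi> x - indicator (ball 0 1) z * (\<Sum>k\<le>l. phase z x ^ k / fact k * \<psi> x)) / npow z \<nu> \<partial>lborel)"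
      unfolding J_def K_def phase_taylor_def sum_distrib_right[symmetric] by (intro Bochner_Integration.integral_cong refl) (simp add: left_diff_distrib mult.assoc)
    also have "\<dots> = ((\<integral>x. plane_wave x z * \<psi> x \<partial>lborel) - indicator (ball 0 1) z * (\<Sum>k\<le>l. \<integral>x. phase z x ^ k / fact k * \<psi> x \<partial>lborel)) / npow z \<nu>"
      unfolding integral_divide_zero
      by (subst Bochner_Integration.integral_diff) (simp_all add: i j Bochner_Integration.integrable_sum Bochner_Integration.integral_sum del: times_divide_eq_left)
    finally show ?thesis by (simp add: ft_def T_def test_moment_def)
  qed
  define w where "w k = hadamard_weight U \<nu> k" for k
  have wm: "w k \<in> borel_measurable borel" for k unfolding w_def by measurable
  have wi: "integrable lborel (\<lambda>y. norm y ^ k * norm (w k y))" if "k \<le> l" for k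
    unfolding w_def by (rule hadamard_weight_integrable[OF U]) (use kl[OF that] in \<open>simp add: d_def\<close>)
  define Q where "Q k x y = phase y x ^ k / fact k * w k y" for k and x y :: "real ^ 'n"
  have Qm: "case_prod (Q k) \<in> borel_measurable (lborel \<Otimes>\<^sub>M lborel)" for k
  proof -
    have [measurable]: "w k \<in> borel_measurable borel" by (rule wm)
    show ?thesis unfolding Q_def by measurable
  qed
  have QB: "norm (Q k x y) \<le> (2 * pi * R) ^ k * (norm y ^ k * norm (w k y))" if "\<psi> x \<noteq> 0" for k x y
  proof -
    have "norm (phase y x ^ k) / fact k \<le> norm (phase y x ^ k) / 1" by (intro divide_left_mono) auto
    then have "norm (phase y x ^ k) / fact k \<le> (2 * pi * R) ^ k * norm y ^ k"
      using norm_phase_power_bound[OF R(2)[OF that], of y k] by simp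
    from mult_right_mono[OF this norm_ge_zero[of "w k y"]] show ?thesis by (simp add: Q_def norm_mult norm_divide mult.assoc)
  qed
  have wi': "integrable lborel (\<lambda>y. (2 * pi * R) ^ k * (norm y ^ k * norm (w k y)))" if "k \<in> {..l}" for k
    using that by (intro integrable_mult_right wi) simp
  note FQ = test_fn_Fubini[OF \<psi> Qm wi' QB]
  have Qeq: "(\<integral>x. Q k x y * \<psi> x \<partial>lborel) = T k y * w k y" for k y
  proof -
    have "(\<integral>x. Q k x y * \<psi> x \<partial>lborel) = (\<integral>x. w k y * (phase y x ^ k / fact k * \<psi> x) \<partial>lborel)"
      by (intro Bochner_Integration.integral_cong refl) (simp add: Q_def)
    then show ?thesis by (simp add: T_def test_moment_def mult.commute del: times_divide_eq_left)
  qed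
  have Qsum: "integrable lborel (\<lambda>x. \<Sum>k\<le>l. \<psi> x * (\<integral>y. Q k x y \<partial>lborel))"
    by (rule Bochner_Integration.integrable_sum) (rule FQ(2))
  define H where "H \<epsilon> = (LINT z:- ball 0 \<epsilon>|lborel. ft \<psi> z / npow z \<nu>) - (\<Sum>k | int k \<le> \<lfloor>Re \<nu> - real CARD('n)\<rfloor>. hadamard_term U \<nu> \<epsilon> (ft \<psi>) k)" for \<epsilon>
  have Hset: "{k. int k \<le> \<lfloor>Re \<nu> - real CARD('n)\<rfloor>} = {..l}" using fl by (auto simp: d_def)
  obtain \<delta> where \<delta>: "\<delta> > 0" "ball 0 \<delta> \<subseteq> U" using U by (meson open_contains_ball)
  have ind: "integrable lborel (\<lambda>z. indicator (- ball 0 \<epsilon>) z * J z)" for \<epsilon>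
  proof (rule Bochner_Integration.integrable_bound[OF Ji])
    have [measurable]: "J \<in> borel_measurable lborel" using Ji by auto
    show "(\<lambda>z. indicator (- ball 0 \<epsilon>) z * J z) \<in> borel_measurable lborel" by measurable
  qed (auto intro!: AE_I2 simp: indicator_def)
  \<comment> \<open>Restoring the Taylor terms in the main integral and splitting each counterterm
    produce the same shell integrals, which drop out.\<close>
  have Heq: "H \<epsilon> = (\<integral>z. indicator (- ball 0 \<epsilon>) z * J z \<partial>lborel) - (\<Sum>k\<le>l. \<integral>y. T k y * w k y \<partial>lborel)"
    if e: "0 < \<epsilon>" "\<epsilon> < min 1 \<delta>" for \<epsilon>
  proof -
    let ?S = "\<lambda>k z. indicator (ball 0 1 - ball 0 \<epsilon>) z * (T k z / npow z \<nu>)"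
    have Si: "integrable lborel (?S k)" for k
    proof -
      obtain C where C: "C \<ge> 0" "\<And>y. norm (T k y) \<le> C * norm y ^ k"
        using test_moment_bound[OF \<psi>, of k] unfolding T_def by metis
      show ?thesis
        by (rule shell_quotient_integrable[OF _ C(2) C(1) e(1)]) (use \<nu> test_moment_measurable[OF \<psi>] in \<open>auto simp: T_def\<close>)
    qed
    have "(LINT z:- ball 0 \<epsilon>|lborel. ft \<psi> z / npow z \<nu>) = (\<integral>z. indicator (- ball 0 \<epsilon>) z * J z + (\<Sum>k\<le>l. ?S k z) \<partial>lborel)"
      unfolding set_lebesgue_integral_def indicator_scaleR_mult
    proof (intro Bochner_Integration.integral_cong refl)
      fix z :: "real ^ 'n"
      show "indicator (- ball 0 \<epsilon>) z * (ft \<psi> z / npow z \<nu>) = indicator (- ball 0 \<epsilon>) z * J z + (\<Sum>k\<le>l. ?S k z)"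
        using e unfolding Jeq
        by (auto simp: indicator_def diff_divide_distrib sum_divide_distrib)
    qed
    also have "\<dots> = (\<integral>z. indicator (- ball 0 \<epsilon>) z * J z \<partial>lborel) + (\<Sum>k\<le>l. \<integral>z. ?S k z \<partial>lborel)"
      by (subst Bochner_Integration.integral_add[OF ind Bochner_Integration.integrable_sum[OF Si]])
         (simp only: Bochner_Integration.integral_sum[OF Si])
    finally have 1: "(LINT z:- ball 0 \<epsilon>|lborel. ft \<psi> z / npow z \<nu>) = (\<integral>z. indicator (- ball 0 \<epsilon>) z * J z \<partial>lborel) + (\<Sum>k\<le>l. \<integral>z. ?S k z \<partial>lborel)" .
    have "ball 0 \<epsilon> \<subseteq> U" using \<delta>(2) e by (auto simp: subset_iff)
    then have "hadamard_term U \<nu> \<epsilon> (ft \<psi>) k = (\<integral>z. ?S k z \<partial>lborel) + (\<integral>y. T k y * w k y \<partial>lborel)" if "k \<le> l" for k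
      unfolding T_def w_def using hadamard_term_split[OF U _ \<psi> e(1), of k \<nu>] e kl[OF that] by (simp add: d_def)
    then have 2: "(\<Sum>k\<le>l. hadamard_term U \<nu> \<epsilon> (ft \<psi>) k) = (\<Sum>k\<le>l. \<integral>z. ?S k z \<partial>lborel) + (\<Sum>k\<le>l. \<integral>y. T k y * w k y \<partial>lborel)"
      by (simp add: sum.distrib)
    show ?thesis unfolding H_def Hset 1 2 by simp
  qed
  have "((\<lambda>\<epsilon>. \<integral>z. indicator (- ball 0 \<epsilon>) z * J z \<partial>lborel) \<longlongrightarrow> (\<integral>z. J z \<partial>lborel)) (at_right 0)"
    unfolding tendsto_at_iff_sequentially o_def
  proof (intro allI impI)
    fix X :: "nat \<Rightarrow> real" assume X: "\<forall>i. X i \<in> {0<..} - {0}" "X \<longlonglongrightarrow> 0"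
    show "(\<lambda>i. \<integral>z. indicator (- ball 0 (X i)) z * J z \<partial>lborel) \<longlonglongrightarrow> (\<integral>z. J z \<partial>lborel)"
    proof (rule integral_dominated_convergence)
      show "J \<in> borel_measurable lborel" using Ji by auto
      show "(\<lambda>z. indicator (- ball 0 (X i)) z * J z) \<in> borel_measurable lborel" for i using ind[of "X i"] by auto
      show "integrable lborel (\<lambda>z. norm (J z))" by (intro integrable_norm Ji)
      show "AE z in lborel. (\<lambda>i. indicator (- ball 0 (X i)) z * J z) \<longlonglongrightarrow> J z"
        using AE_lborel_singleton[of "0 :: real ^ 'n"]
      proof eventually_elim
        case (elim z)
        then have "\<forall>\<^sub>F i in sequentially. X i < norm z" using X(2) by (intro order_tendstoD) auto
        then have "\<forall>\<^sub>F i in sequentially. indicator (- ball 0 (X i)) z * J z = J z" by eventually_elim simp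
        then show ?case by (rule tendsto_eventually)
      qed
    qed (auto intro!: AE_I2 simp: indicator_def)
  qed
  then have "((\<lambda>\<epsilon>. (\<integral>z. indicator (- ball 0 \<epsilon>) z * J z \<partial>lborel) - (\<Sum>k\<le>l. \<integral>y. T k y * w k y \<partial>lborel)) \<longlongrightarrow>
      (\<integral>z. J z \<partial>lborel) - (\<Sum>k\<le>l. \<integral>y. T k y * w k y \<partial>lborel)) (at_right 0)"
    by (intro tendsto_diff tendsto_const)
  then have "(H \<longlongrightarrow> (\<integral>z. J z \<partial>lborel) - (\<Sum>k\<le>l. \<integral>y. T k y * w k y \<partial>lborel)) (at_right 0)"
  proof (rule Lim_transform_eventually)
    show "\<forall>\<^sub>F \<epsilon> in at_right 0. (\<integral>z. indicator (- ball 0 \<epsilon>) z * J z \<partial>lborel) - (\<Sum>k\<le>l. \<integral>y. T k y * w k y \<partial>lborel) = H \<epsilon>"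
      using eventually_at_right_less[of 0] eventually_at_right_field[of "\<lambda>x. x < min 1 \<delta>" 0]
      unfolding eventually_at_right_field using \<delta>(1) Heq by (intro exI[of _ "min 1 \<delta>"]) auto
  qed
  then have "hadamard_integral U \<nu> (ft \<psi>) = (\<integral>z. J z \<partial>lborel) - (\<Sum>k\<le>l. \<integral>y. T k y * w k y \<partial>lborel)"
    unfolding hadamard_integral_def H_def[symmetric] by (intro tendsto_Lim) auto
  also have "\<dots> = (\<integral>x. \<psi> x * (\<integral>z. K x z \<partial>lborel) \<partial>lborel) - (\<Sum>k\<le>l. \<integral>x. \<psi> x * (\<integral>y. Q k x y \<partial>lborel) \<partial>lborel)"
  proof (intro arg_cong2[where f = minus] sum.cong refl)
    show "(\<integral>z. J z \<partial>lborel) = (\<integral>x. \<psi> x * (\<integral>z. K x z \<partial>lborel) \<partial>lborel)" using FK(3) by (simp add: J_def)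
    show "(\<integral>y. T k y * w k y \<partial>lborel) = (\<integral>x. \<psi> x * (\<integral>y. Q k x y \<partial>lborel) \<partial>lborel)" if "k \<in> {..l}" for k
      using FQ(3)[of k] that by (simp add: Qeq)
  qed
  also have "\<dots> = (\<integral>x. \<psi> x * (\<integral>z. K x z \<partial>lborel) \<partial>lborel) - (\<integral>x. (\<Sum>k\<le>l. \<psi> x * (\<integral>y. Q k x y \<partial>lborel)) \<partial>lborel)"
    by (subst Bochner_Integration.integral_sum) (rule FQ(2), auto)
  also have "\<dots> = (\<integral>x. \<psi> x * (\<integral>z. K x z \<partial>lborel) - (\<Sum>k\<le>l. \<psi> x * (\<integral>y. Q k x y \<partial>lborel)) \<partial>lborel)"
    by (rule Bochner_Integration.integral_diff[OF FK(2) Qsum, symmetric])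
  finally show ?eq by (simp add: K_def Q_def w_def sum_distrib_left right_diff_distrib)
  have "integrable lborel (\<lambda>x. \<psi> x * (\<integral>z. K x z \<partial>lborel) - (\<Sum>k\<le>l. \<psi> x * (\<integral>y. Q k x y \<partial>lborel)))"
    by (rule Bochner_Integration.integrable_diff[OF FK(2) Qsum])
  then show ?int by (simp add: K_def Q_def w_def sum_distrib_left right_diff_distrib)
qed

section \<open>The sum-integral as a pairing with the density\<close>

lemma infsum_lattice_nonzero:
  assumes M: "invertible M"
  shows "infsum f (lattice_of M - {0}) = (\<Sum>\<^sub>\<infinity>n\<in>nonzero. f (lattice_point M n))"
proof -
  have inj: "inj (lattice_point M)"
    using inj_compose[OF inj_matrix_vector_mult[OF M] inj_int_vec] by (simp add: o_def)
  have "lattice_of M - {0} = lattice_point M ` nonzero"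
    using image_set_diff[OF inj, of UNIV "{\<lambda>_. 0}"] by (simp add: lattice_of_eq Compl_eq_Diff_UNIV)
  then show ?thesis using infsum_reindex[of "lattice_point M" nonzero f] inj_on_subset[OF inj] by (simp add: o_def)
qed

lemma lattice_sum_ft:
  fixes M :: "real ^ 'n ^ 'n"
  assumes M: "invertible M" and \<nu>: "Re \<nu> \<ge> 2 * CARD('n)" and \<psi>: "test_fn \<psi>"
  shows "integrable lborel (\<lambda>x. \<psi> x * (\<Sum>\<^sub>\<infinity>n\<in>nonzero. plane_wave x (lattice_point M n) / npow (lattice_point M n) \<nu>))"
    and "(\<Sum>\<^sub>\<infinity>z\<in>lattice_of M - {0}. ft \<psi> z / npow z \<nu>) =
      (\<integral>x. \<psi> x * (\<Sum>\<^sub>\<infinity>n\<in>nonzero. plane_wave x (lattice_point M n) / npow (lattice_point M n) \<nu>) \<partial>lborel)"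
proof -
  let ?z = "lattice_point M"
  obtain c where c: "c > 0" "\<And>n. n \<noteq> (\<lambda>_. 0) \<Longrightarrow> c \<le> norm (?z n)" using lattice_point_lower[OF M] by metis
  define f where "f n x = plane_wave x (?z n) / npow (?z n) \<nu> * \<psi> x" for n x
  define zt where "zt x = (\<Sum>\<^sub>\<infinity>n\<in>nonzero. plane_wave x (?z n) / npow (?z n) \<nu>)" for x
  define K where "K = ((1 + c) / c) ^ (2 * CARD('n)) * c powr (real (2 * CARD('n)) - Re \<nu>)"
  have le: "norm (1 / npow (?z n) \<nu>) \<le> K / (1 + norm (?z n)) ^ (2 * CARD('n))" if "n \<in> nonzero" for n
    using powr_decay_bound[OF c(1) c(2), of n "2 * CARD('n)" "Re \<nu>"] that \<nu>
    by (simp add: K_def norm_inverse norm_npow powr_minus divide_inverse)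
  have sK: "(\<lambda>n. K / (1 + norm (?z n)) ^ (2 * CARD('n))) summable_on nonzero"
  proof (rule summable_on_subset_banach)
    show "(\<lambda>n. K / (1 + norm (?z n)) ^ (2 * CARD('n))) summable_on UNIV"
      by (rule summable_on_lattice[OF M, where C = K]) (use c(1) in \<open>auto simp: K_def\<close>)
  qed simp
  have zt: "((\<lambda>n. plane_wave x (?z n) / npow (?z n) \<nu>) has_sum zt x) nonzero" for x
    unfolding zt_def
  proof (intro has_sum_infsum summable_on_bounded[OF sK])
    show "norm (plane_wave x (?z n) / npow (?z n) \<nu>) \<le> K / (1 + norm (?z n)) ^ (2 * CARD('n))" if "n \<in> nonzero" for n
      using le[OF that] by (simp add: norm_divide norm_plane_wave)
  qed
  have fi: "integrable lborel (f n)" for n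
    unfolding f_def divide_inverse by (intro test_fn_integrable test_fn_mult \<psi> continuous_intros)
  have fn: "(\<integral>x. norm (f n x) \<partial>lborel) = norm (1 / npow (?z n) \<nu>) * (\<integral>x. norm (\<psi> x) \<partial>lborel)" for n
    by (simp add: f_def norm_mult norm_divide norm_plane_wave)
  have swap: "integrable lborel (\<lambda>x. zt x * \<psi> x)" "((\<lambda>n. \<integral>x. f n x \<partial>lborel) has_sum (\<integral>x. zt x * \<psi> x \<partial>lborel)) nonzero"
  proof -
    have "(\<lambda>n. \<integral>x. norm (f n x) \<partial>lborel) summable_on nonzero"
    proof (rule summable_on_comparison_test)
      show "(\<lambda>n. K / (1 + norm (?z n)) ^ (2 * CARD('n)) * (\<integral>x. norm (\<psi> x) \<partial>lborel)) summable_on nonzero"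
        by (intro summable_on_cmult_left sK)
      show "(\<integral>x. norm (f n x) \<partial>lborel) \<le> K / (1 + norm (?z n)) ^ (2 * CARD('n)) * (\<integral>x. norm (\<psi> x) \<partial>lborel)" if "n \<in> nonzero" for n
        unfolding fn by (intro mult_right_mono le that) simp
    qed auto
    moreover have "((\<lambda>n. f n x) has_sum zt x * \<psi> x) nonzero" for x
      unfolding f_def by (rule has_sum_cmult_left[OF zt])
    moreover have "countable (nonzero :: ('n \<Rightarrow> int) set)" by (rule countable_subset[OF _ countable_int_vec]) simp
    ultimately show "integrable lborel (\<lambda>x. zt x * \<psi> x)" "((\<lambda>n. \<integral>x. f n x \<partial>lborel) has_sum (\<integral>x. zt x * \<psi> x \<partial>lborel)) nonzero"
      using has_sum_integral[of nonzero lborel f "\<lambda>x. zt x * \<psi> x"] fi by auto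
  qed
  have ff: "(\<integral>x. f n x \<partial>lborel) = ft \<psi> (?z n) / npow (?z n) \<nu>" for n
    by (simp add: f_def ft_def flip: integral_divide_zero)
  show "integrable lborel (\<lambda>x. \<psi> x * (\<Sum>\<^sub>\<infinity>n\<in>nonzero. plane_wave x (?z n) / npow (?z n) \<nu>))"
    using swap(1) by (simp add: zt_def mult.commute)
  show "(\<Sum>\<^sub>\<infinity>z\<in>lattice_of M - {0}. ft \<psi> z / npow z \<nu>) =
      (\<integral>x. \<psi> x * (\<Sum>\<^sub>\<infinity>n\<in>nonzero. plane_wave x (?z n) / npow (?z n) \<nu>) \<partial>lborel)"
    using infsumI[OF swap(2)] unfolding infsum_lattice_nonzero[OF M] ff by (simp add: zt_def mult.commute)
qed

lemma HSI_ft: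
  fixes M :: "real ^ 'n ^ 'n"
  assumes M: "invertible M" and U: "open U" "bounded U" "0 \<in> U" and \<nu>: "Re \<nu> \<ge> 2 * CARD('n)" and \<psi>: "test_fn \<psi>"
  defines "l \<equiv> nat \<lfloor>Re \<nu> - real CARD('n)\<rfloor>"
  shows "HSI M U \<nu> (ft \<psi>) = (\<integral>x. \<psi> x * zeta_density M U \<nu> l x \<partial>lborel)"
proof -
  have "real CARD('n) \<ge> 1" by (simp add: Suc_leI)
  then have \<nu>': "Re \<nu> > CARD('n)" using \<nu> by linarith
  note h = hadamard_integral_ft[OF U \<nu>' \<psi>, folded l_def] and s = lattice_sum_ft[OF M \<nu> \<psi>]
  show ?thesis
    unfolding HSI_def h(1) s(2) integral_divide_zero[symmetric]
      Bochner_Integration.integral_diff[OF s(1) integrable_divide_zero[OF h(2)], symmetric]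
    by (simp add: zeta_density_def right_diff_distrib)
qed

lemma zeta_density_analytic:
  fixes M :: "real ^ 'n ^ 'n"
  assumes M: "invertible M" and U: "open U" "bounded U" "0 \<in> U" and \<nu>: "Re \<nu> \<ge> 2 * CARD('n)"
  shows "real_analytic_on (zeta_density M U \<nu> (nat \<lfloor>Re \<nu> - real CARD('n)\<rfloor>)) (regular_set M)"
proof -
  define l where "l = nat \<lfloor>Re \<nu> - real CARD('n)\<rfloor>"
  have [measurable]: "U \<in> sets borel" using U by auto
  have d1: "real CARD('n) \<ge> 1" by (simp add: Suc_leI)
  have n0: "Re \<nu> - CARD('n) \<ge> 0" using \<nu> d1 by linarith
  have l1: "real l \<le> Re \<nu> - CARD('n)" "real l + 1 - Re \<nu> + CARD('n) > 0"
    using n0 unfolding l_def by linarith+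
  have q: "entire_pser (\<lambda>x. \<integral>y. phase y x ^ k / fact k * hadamard_weight U \<nu> k y \<partial>lborel)" if "k \<le> l" for k
  proof (intro entire_pser_moment hadamard_weight_integrable U hadamard_weight_measurable)
    show "real k + CARD('n) \<le> Re \<nu>" using that l1(1) by linarith
  qed simp
  have eq: "zeta_density M U \<nu> l x = ((\<Sum>\<^sub>\<infinity>n\<in>nonzero. plane_wave x (lattice_point M n) / npow (lattice_point M n) \<nu>) -
     (\<integral>z. wave_remainder l x z / npow z \<nu> \<partial>lborel) / of_real \<bar>det M\<bar>) +
     (1 / of_real \<bar>det M\<bar>) * (\<Sum>k\<le>l. \<integral>y. phase y x ^ k / fact k * hadamard_weight U \<nu> k y \<partial>lborel)" for x
    by (simp add: zeta_density_def diff_divide_distrib)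
  have "real_analytic_on (\<lambda>x. (\<Sum>\<^sub>\<infinity>n\<in>nonzero. plane_wave x (lattice_point M n) / npow (lattice_point M n) \<nu>) -
     (\<integral>z. wave_remainder l x z / npow z \<nu> \<partial>lborel) / of_real \<bar>det M\<bar>) (regular_set M)"
    using zeta_difference_analytic[OF M, of "\<nu> / 2" l] \<nu> l1 by simp
  then show ?thesis unfolding l_def[symmetric] eq[abs_def]
  proof (rule real_analytic_on_add)
    show "real_analytic_on (\<lambda>x. (1 / of_real \<bar>det M\<bar>) * (\<Sum>k\<le>l. \<integral>y. phase y x ^ k / fact k * hadamard_weight U \<nu> k y \<partial>lborel)) (regular_set M)"
      by (intro entire_pser_analytic entire_pser_cmult entire_pser_sum q) simp
  qed
qed

section \<open>Bump functions and integration by parts\<close>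

lemma dderiv_eqI: "(f has_derivative f') (at x) \<Longrightarrow> dderiv v f x = f' v"
  by (auto simp: dderiv_def dest!: frechet_derivative_at)

lemma has_derivative_dderiv: "f differentiable (at x) \<Longrightarrow> (f has_derivative (\<lambda>v. dderiv v f x)) (at x)"
  by (simp add: frechet_derivative_works dderiv_def)

lemma dderiv_scaleR: "f differentiable (at x) \<Longrightarrow> dderiv (r *\<^sub>R v) f x = r *\<^sub>R dderiv v f x"
  using has_derivative_dderiv[THEN has_derivative_bounded_linear, THEN bounded_linear.linear, THEN linear_cmul] .

lemma dderiv_add:
  "f differentiable (at x) \<Longrightarrow> g differentiable (at x) \<Longrightarrow> dderiv v (\<lambda>x. f x + g x) x = dderiv v f x + dderiv v g x"
  by (intro dderiv_eqI has_derivative_add has_derivative_dderiv)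

lemma dderiv_cmult:
  fixes f :: "'a::real_normed_vector \<Rightarrow> complex"
  shows "f differentiable (at x) \<Longrightarrow> dderiv v (\<lambda>x. c * f x) x = c * dderiv v f x"
  by (rule dderiv_eqI[OF has_derivative_mult_right[OF has_derivative_dderiv]])

lemma smooth_differentiable: "smooth f \<Longrightarrow> f differentiable (at x)"
  unfolding smooth_def by (drule spec[of _ "[]"]) simp

lemma smooth_dderiv:
  assumes "smooth f"
  shows "smooth (dderiv v f)"
  unfolding smooth_def
proof (intro allI)
  show "foldr dderiv vs (dderiv v f) differentiable (at x)" for vs x
    using assms[unfolded smooth_def, rule_format, of "vs @ [v]" x] by simp
qed

lemma smooth_continuous_on: "smooth f \<Longrightarrow> continuous_on S f"
  by (intro continuous_at_imp_continuous_on ballI differentiable_imp_continuous_within smooth_differentiable)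

lemma smooth_add:
  assumes "smooth f" "smooth g"
  shows "smooth (\<lambda>x. f x + g x)"
proof -
  have eq: "foldr dderiv vs (\<lambda>x. f x + g x) = (\<lambda>x. foldr dderiv vs f x + foldr dderiv vs g x)" for vs
  proof (induction vs)
    case (Cons v vs)
    show ?case using assms[unfolded smooth_def] by (intro ext) (simp add: Cons dderiv_add)
  qed simp
  show ?thesis using assms unfolding smooth_def eq by (intro allI differentiable_add) auto
qed

lemma smooth_cmult:
  fixes f :: "'a::real_normed_vector \<Rightarrow> complex"
  assumes "smooth f"
  shows "smooth (\<lambda>x. c * f x)"
proof -
  have eq: "foldr dderiv vs (\<lambda>x. c * f x) = (\<lambda>x. c * foldr dderiv vs f x)" for vs
  proof (induction vs)
    case (Cons v vs)
    show ?case using assms[unfolded smooth_def] by (intro ext) (simp add: Cons dderiv_cmult)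
  qed simp
  show ?thesis using assms unfolding smooth_def eq by (intro allI differentiable_mult differentiable_const) auto
qed

lemma smooth_zero: "smooth (\<lambda>_. 0)"
proof -
  have eq: "foldr dderiv vs (\<lambda>_. 0) = (\<lambda>_. 0)" for vs :: "'a list"
  proof (induction vs)
    case (Cons v vs)
    show ?case by (intro ext) (simp add: Cons dderiv_eqI[OF has_derivative_const])
  qed simp
  show ?thesis unfolding smooth_def eq by auto
qed

lemma smooth_sum: "finite I \<Longrightarrow> (\<And>i. i \<in> I \<Longrightarrow> smooth (f i)) \<Longrightarrow> smooth (\<lambda>x. \<Sum>i\<in>I. f i x)"
  by (induction I rule: finite_induct) (auto intro: smooth_add smooth_zero)

text \<open>The closure of the support lies in \<open>S\<close>, so a product with a function known
  on \<open>S\<close> only vanishes near every point outside \<open>S\<close>, whatever values that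
  function takes there.\<close>

definition bump_on :: "(real ^ 'n::finite) set \<Rightarrow> (real ^ 'n \<Rightarrow> complex) \<Rightarrow> bool" where
  "bump_on S \<psi> \<longleftrightarrow> smooth \<psi> \<and> bounded {x. \<psi> x \<noteq> 0} \<and> closure {x. \<psi> x \<noteq> 0} \<subseteq> S"

lemma bump_on_test_fn: "bump_on S \<psi> \<Longrightarrow> test_fn \<psi>"
  by (simp add: bump_on_def test_fn_def smooth_continuous_on)

lemma bump_on_mono: "bump_on S \<psi> \<Longrightarrow> S \<subseteq> T \<Longrightarrow> bump_on T \<psi>"
  by (auto simp: bump_on_def)

lemma dderiv_outside_support:
  assumes "x \<notin> closure {x. \<psi> x \<noteq> 0}"
  shows "(\<psi> has_derivative (\<lambda>_. 0)) (at x)" "dderiv v \<psi> x = 0"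
proof -
  show "(\<psi> has_derivative (\<lambda>_. 0)) (at x)"
  proof (rule has_derivative_transform_within_open[where f = "\<lambda>_. 0" and s = "- closure {x. \<psi> x \<noteq> 0}"])
    show "0 = \<psi> y" if "y \<in> - closure {x. \<psi> x \<noteq> 0}" for y using that closure_subset[of "{x. \<psi> x \<noteq> 0}"] by auto
  qed (use assms in auto)
  then show "dderiv v \<psi> x = 0" by (rule dderiv_eqI)
qed

lemma support_subset_bump:
  assumes "bump_on S \<psi>" "{x. f x \<noteq> 0} \<subseteq> closure {x. \<psi> x \<noteq> 0}"
  shows "bounded {x. f x \<noteq> 0}" "closure {x. f x \<noteq> 0} \<subseteq> S"
  using assms closure_minimal[OF assms(2) closed_closure] bounded_subset[OF bounded_closure assms(2)] by (auto simp: bump_on_def)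

lemma bump_on_dderiv: "bump_on S \<psi> \<Longrightarrow> bump_on S (dderiv v \<psi>)"
  using support_subset_bump[of S \<psi> "dderiv v \<psi>"] dderiv_outside_support(2)[of _ \<psi> v] by (auto simp: bump_on_def intro: smooth_dderiv)

lemma bump_on_cmult: "bump_on S \<psi> \<Longrightarrow> bump_on S (\<lambda>x. c * \<psi> x)"
  using support_subset_bump[of S \<psi> "\<lambda>x. c * \<psi> x"] closure_subset[of "{x. \<psi> x \<noteq> 0}"] by (auto simp: bump_on_def intro: smooth_cmult)

lemma bump_on_dderiv_power: "bump_on S \<psi> \<Longrightarrow> bump_on S ((dderiv v ^^ k) \<psi>)"
  by (induction k) (auto intro: bump_on_dderiv)

lemma test_fn_add:
  assumes "test_fn f" "test_fn g"
  shows "test_fn (\<lambda>x. f x + g x)"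
proof -
  have "bounded ({x. f x \<noteq> 0} \<union> {x. g x \<noteq> 0})" using assms by (simp add: test_fn_def)
  then have "bounded {x. f x + g x \<noteq> 0}" by (rule bounded_subset) auto
  then show ?thesis using assms by (simp add: test_fn_def continuous_on_add)
qed

lemma test_fn_bounded:
  assumes "test_fn \<psi>"
  obtains C where "\<And>x. norm (\<psi> x) \<le> C"
proof -
  obtain R where R: "R > 0" "\<And>x. \<psi> x \<noteq> 0 \<Longrightarrow> norm x \<le> R" using test_fn_support[OF assms] by metis
  have "compact (\<psi> ` cball 0 R)"
    by (intro compact_continuous_image) (use assms in \<open>auto simp: test_fn_def elim: continuous_on_subset\<close>)
  then obtain C where C: "\<And>y. y \<in> \<psi> ` cball 0 R \<Longrightarrow> norm y \<le> C" using compact_imp_bounded bounded_iff by metis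
  have "norm (\<psi> x) \<le> max C 0" for x
    using C[of "\<psi> x"] R(2)[of x] by (cases "\<psi> x = 0") auto
  then show ?thesis using that by blast
qed

text \<open>By translation invariance the integral of G (x + t v) over x does not depend on
  \<open>t\<close>; differentiating under the integral at t = 0 gives the claim.\<close>

lemma integral_dderiv_eq_0:
  fixes G :: "real ^ 'n::finite \<Rightarrow> complex"
  assumes diff: "\<And>x. G differentiable (at x)" and G: "test_fn G" and DG: "test_fn (dderiv v G)"
  shows "(\<integral>x. dderiv v G x \<partial>lborel) = 0"
proof -
  have [measurable]: "G \<in> borel_measurable borel" "dderiv v G \<in> borel_measurable borel" using G DG test_fn_measurable by blast+
  obtain R where R: "R > 0" "\<And>x. dderiv v G x \<noteq> 0 \<Longrightarrow> norm x \<le> R" using test_fn_support[OF DG] by metis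
  obtain C where C: "\<And>x. norm (dderiv v G x) \<le> C" using test_fn_bounded[OF DG] by metis
  have C0: "C \<ge> 0" using C[of 0] norm_ge_zero order_trans by blast
  have "((\<lambda>t::real. \<integral>x. G (x + t *\<^sub>R v) \<partial>lborel) has_derivative (\<lambda>s. \<integral>x. s *\<^sub>R dderiv v G (x + 0 *\<^sub>R v) \<partial>lborel)) (at 0)"
  proof (rule has_derivative_integral[OF zero_less_one])
    show "integrable lborel (\<lambda>x. C * indicator (ball (0 :: real ^ 'n) (R + norm v + 1)) x)"
      using emeasure_lborel_ball_finite[of "0 :: real ^ 'n"] by (intro integrable_mult_right integrable_real_indicator) auto
    fix t :: real and x :: "real ^ 'n" assume t: "t \<in> ball 0 1"
    have "((\<lambda>t. x + t *\<^sub>R v) has_derivative (\<lambda>s. s *\<^sub>R v)) (at t)" by (auto intro!: derivative_eq_intros)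
    from has_derivative_compose[OF this has_derivative_dderiv[OF diff]]
    show "((\<lambda>t. G (x + t *\<^sub>R v)) has_derivative (\<lambda>s. s *\<^sub>R dderiv v G (x + t *\<^sub>R v))) (at t)"
      by (simp add: dderiv_scaleR diff)
    show "norm (s *\<^sub>R dderiv v G (x + t *\<^sub>R v)) \<le> C * indicator (ball 0 (R + norm v + 1)) x * norm s" for s
    proof (cases "dderiv v G (x + t *\<^sub>R v) = 0")
      case False
      have "norm (t *\<^sub>R v) \<le> norm v" using t by (simp add: mult_left_le_one_le)
      moreover have "norm (x + t *\<^sub>R v) \<le> R" by (rule R(2)[OF False])
      moreover have "norm x \<le> norm (x + t *\<^sub>R v) + norm (t *\<^sub>R v)" by (metis add_diff_cancel_right' norm_triangle_ineq4)
      ultimately have "x \<in> ball 0 (R + norm v + 1)" by simp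
      then show ?thesis using mult_left_mono[OF C[of "x + t *\<^sub>R v"] abs_ge_zero[of s]] by (simp add: mult.commute)
    qed (simp add: C0)
  next
    fix t :: real assume "t \<in> ball 0 1"
    show "integrable lborel (\<lambda>x. G (x + t *\<^sub>R v))"
    proof (rule test_fn_integrable)
      obtain R where R: "R > 0" "\<And>x. G x \<noteq> 0 \<Longrightarrow> norm x \<le> R" using test_fn_support[OF G] by metis
      have "norm x \<le> R + norm (t *\<^sub>R v)" if "G (x + t *\<^sub>R v) \<noteq> 0" for x
        using R(2)[OF that] by (metis (no_types, opaque_lifting) add_diff_cancel_right' add_right_mono norm_triangle_ineq4 order_trans)
      moreover have "continuous_on UNIV (\<lambda>x. G (x + t *\<^sub>R v))"
        using G unfolding test_fn_def by (auto intro!: continuous_on_compose2[of UNIV G] continuous_intros)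
      ultimately show "test_fn (\<lambda>x. G (x + t *\<^sub>R v))" unfolding test_fn_def bounded_iff by blast
    qed
  next
    show "(\<lambda>w. s *\<^sub>R dderiv v G (w + 0 *\<^sub>R v)) \<in> borel_measurable lborel" for s by simp
  qed
  moreover have "(\<lambda>t::real. \<integral>x. G (x + t *\<^sub>R v) \<partial>lborel) = (\<lambda>_. \<integral>x. G x \<partial>lborel)"
    by (intro ext integral_lborel_translation) measurable
  ultimately have "((\<lambda>_::real. \<integral>x. G x \<partial>lborel) has_derivative (\<lambda>s. s *\<^sub>R (\<integral>x. dderiv v G x \<partial>lborel))) (at 0)" by simp
  from has_derivative_unique[OF this has_derivative_const]
  have "1 *\<^sub>R (\<integral>x. dderiv v G x \<partial>lborel) = 0" by metis
  then show ?thesis by simp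
qed

lemma real_analytic_on_continuous_on: "real_analytic_on F S \<Longrightarrow> continuous_on S F"
  using continuous_at_imp_continuous_on differentiable_imp_continuous_within real_analytic_on_differentiable by blast

text \<open>Continuity is glued over two open sets covering the space: \<open>S\<close>, where both
  factors are continuous, and the complement of the closed support, where the product is 0.\<close>

lemma test_fn_bump_mult:
  assumes \<psi>: "bump_on S \<psi>" and S: "open S" and F: "continuous_on S F"
  shows "test_fn (\<lambda>x. \<psi> x * F x)"
proof -
  have "continuous_on (- closure {x. \<psi> x \<noteq> 0}) (\<lambda>x. \<psi> x * F x)"
  proof (rule continuous_on_eq[OF continuous_on_const])
    show "0 = \<psi> x * F x" if "x \<in> - closure {x. \<psi> x \<noteq> 0}" for x
      using that closure_subset[of "{x. \<psi> x \<noteq> 0}"] by auto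
  qed
  moreover have "continuous_on S (\<lambda>x. \<psi> x * F x)"
    by (rule continuous_on_mult[OF smooth_continuous_on F]) (use \<psi> in \<open>simp add: bump_on_def\<close>)
  ultimately have "continuous_on (- closure {x. \<psi> x \<noteq> 0} \<union> S) (\<lambda>x. \<psi> x * F x)"
    using S by (intro continuous_on_open_Un) auto
  moreover have "- closure {x. \<psi> x \<noteq> 0} \<union> S = UNIV" using \<psi> by (auto simp: bump_on_def)
  ultimately have "continuous_on UNIV (\<lambda>x. \<psi> x * F x)" by simp
  moreover have "bounded {x. \<psi> x * F x \<noteq> 0}"
    by (rule bounded_subset[of "{x. \<psi> x \<noteq> 0}"]) (use \<psi> in \<open>auto simp: bump_on_def\<close>)
  ultimately show ?thesis by (simp add: test_fn_def)
qed

lemma integration_by_parts: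
  fixes F :: "real ^ 'n::finite \<Rightarrow> complex"
  assumes S: "open S" and \<psi>: "bump_on S \<psi>" and F: "real_analytic_on F S"
  shows "(\<integral>x. dderiv (axis i 1) \<psi> x * F x \<partial>lborel) = - (\<integral>x. \<psi> x * dderiv (axis i 1) F x \<partial>lborel)"
proof -
  let ?v = "axis i 1 :: real ^ 'n"
  define G where "G x = \<psi> x * F x" for x
  have d: "(G has_derivative (\<lambda>v. \<psi> x * dderiv v F x + dderiv v \<psi> x * F x)) (at x)" for x
  proof (cases "x \<in> S")
    case True
    have "\<psi> differentiable (at x)" using \<psi> by (simp add: bump_on_def smooth_differentiable)
    from has_derivative_mult[OF has_derivative_dderiv[OF this] has_derivative_dderiv[OF real_analytic_on_differentiable[OF F True]]]
    show ?thesis by (simp add: G_def[abs_def])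
  next
    case False
    \<comment> \<open>Nothing is known about \<open>F\<close> here; the product vanishes in a
      neighbourhood, and both terms of the product rule are 0 because \<psi> and its derivative
      vanish.\<close>
    then have x: "x \<notin> closure {x. \<psi> x \<noteq> 0}" using \<psi> by (auto simp: bump_on_def)
    then have "x \<notin> closure {x. G x \<noteq> 0}"
      using closure_mono[of "{x. G x \<noteq> 0}" "{x. \<psi> x \<noteq> 0}"] by (auto simp: G_def)
    note G0 = dderiv_outside_support(1)[OF this]
    have "\<psi> x = 0" using x closure_subset[of "{x. \<psi> x \<noteq> 0}"] by blast
    with G0 show ?thesis by (simp add: dderiv_outside_support(2)[OF x])
  qed
  have Gd: "dderiv ?v G x = \<psi> x * dderiv ?v F x + dderiv ?v \<psi> x * F x" for x
    by (rule dderiv_eqI[OF d])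
  have t1: "test_fn (\<lambda>x. \<psi> x * dderiv ?v F x)"
    by (intro test_fn_bump_mult[OF \<psi> S] real_analytic_on_continuous_on real_analytic_on_dderiv F)
  have t2: "test_fn (\<lambda>x. dderiv ?v \<psi> x * F x)"
    by (intro test_fn_bump_mult[OF bump_on_dderiv[OF \<psi>] S] real_analytic_on_continuous_on F)
  have "(\<integral>x. dderiv ?v G x \<partial>lborel) = 0"
  proof (rule integral_dderiv_eq_0)
    show "G differentiable (at x)" for x using d by (auto simp: differentiable_def)
    show "test_fn G" unfolding G_def by (intro test_fn_bump_mult[OF \<psi> S] real_analytic_on_continuous_on F)
    show "test_fn (dderiv ?v G)" unfolding Gd[abs_def] by (rule test_fn_add[OF t1 t2])
  qed
  then have "(\<integral>x. \<psi> x * dderiv ?v F x \<partial>lborel) + (\<integral>x. dderiv ?v \<psi> x * F x \<partial>lborel) = 0"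
    unfolding Gd using Bochner_Integration.integral_add[OF test_fn_integrable[OF t1] test_fn_integrable[OF t2]] by simp
  then show ?thesis by (simp add: add_eq_0_iff)
qed

text \<open>Normalised so that on the side of the transform it is multiplication by |z|^2, see
  \<open>ft_laplacian\<close>.\<close>

definition laplacian :: "(real ^ 'n::finite \<Rightarrow> complex) \<Rightarrow> real ^ 'n \<Rightarrow> complex" where
  "laplacian f x = of_real (- 1 / (4 * pi ^ 2)) * (\<Sum>i\<in>UNIV. dderiv (axis i 1) (dderiv (axis i 1) f) x)"

lemma bump_on_laplacian: "bump_on S \<psi> \<Longrightarrow> bump_on S (laplacian \<psi>)"
proof -
  assume \<psi>: "bump_on S \<psi>"
  have "{x. laplacian \<psi> x \<noteq> 0} \<subseteq> closure {x. \<psi> x \<noteq> 0}"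
  proof (rule subsetI, rule ccontr)
    fix x assume x: "x \<in> {x. laplacian \<psi> x \<noteq> 0}" "x \<notin> closure {x. \<psi> x \<noteq> 0}"
    have "closure {x. dderiv v \<psi> x \<noteq> 0} \<subseteq> closure {x. \<psi> x \<noteq> 0}" for v
      using dderiv_outside_support(2)[of _ \<psi> v] by (intro closure_minimal) auto
    then have "dderiv v (dderiv v \<psi>) x = 0" for v using x(2) by (intro dderiv_outside_support(2)) blast
    then show False using x(1) by (simp add: laplacian_def)
  qed
  moreover have "smooth (laplacian \<psi>)"
    using \<psi> unfolding laplacian_def[abs_def] bump_on_def by (intro smooth_cmult smooth_sum smooth_dderiv) auto
  ultimately show ?thesis using support_subset_bump[OF \<psi>, of "laplacian \<psi>"] by (simp add: bump_on_def)
qed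

lemma real_analytic_on_laplacian: "real_analytic_on F S \<Longrightarrow> real_analytic_on (laplacian F) S"
  unfolding laplacian_def[abs_def] by (intro real_analytic_on_cmult real_analytic_on_sum real_analytic_on_dderiv)

lemma integral_laplacian:
  fixes F :: "real ^ 'n::finite \<Rightarrow> complex"
  assumes S: "open S" and \<psi>: "bump_on S \<psi>" and F: "real_analytic_on F S"
  shows "(\<integral>x. laplacian \<psi> x * F x \<partial>lborel) = (\<integral>x. \<psi> x * laplacian F x \<partial>lborel)"
proof -
  let ?D = "\<lambda>i::'n. dderiv (axis i 1)" and ?c = "complex_of_real (- 1 / (4 * pi ^ 2))"
  have i1: "integrable lborel (\<lambda>x. ?D i (?D i \<psi>) x * F x)" for i
    by (intro test_fn_integrable test_fn_bump_mult[OF _ S] bump_on_dderiv \<psi> real_analytic_on_continuous_on F)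
  have i2: "integrable lborel (\<lambda>x. \<psi> x * ?D i (?D i F) x)" for i
    by (intro test_fn_integrable test_fn_bump_mult[OF \<psi> S] real_analytic_on_continuous_on real_analytic_on_dderiv F)
  have ibp: "(\<integral>x. ?D i (?D i \<psi>) x * F x \<partial>lborel) = (\<integral>x. \<psi> x * ?D i (?D i F) x \<partial>lborel)" for i
    by (simp add: integration_by_parts[OF S bump_on_dderiv[OF \<psi>] F] integration_by_parts[OF S \<psi> real_analytic_on_dderiv[OF F]])
  have "(\<integral>x. laplacian \<psi> x * F x \<partial>lborel) = (\<integral>x. ?c * (\<Sum>i\<in>UNIV. ?D i (?D i \<psi>) x * F x) \<partial>lborel)"
    by (simp only: laplacian_def sum_distrib_right mult.assoc)
  also have "\<dots> = ?c * (\<Sum>i\<in>UNIV. \<integral>x. ?D i (?D i \<psi>) x * F x \<partial>lborel)"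
    unfolding integral_mult_right_zero by (subst Bochner_Integration.integral_sum) (auto intro: i1)
  also have "\<dots> = ?c * (\<Sum>i\<in>UNIV. \<integral>x. \<psi> x * ?D i (?D i F) x \<partial>lborel)"
    unfolding ibp by (rule refl)
  also have "?c * (\<Sum>i\<in>UNIV. \<integral>x. \<psi> x * ?D i (?D i F) x \<partial>lborel) = (\<integral>x. ?c * (\<Sum>i\<in>UNIV. \<psi> x * ?D i (?D i F) x) \<partial>lborel)"
    unfolding integral_mult_right_zero by (subst Bochner_Integration.integral_sum) (auto intro: i2)
  also have "\<dots> = (\<integral>x. \<psi> x * laplacian F x \<partial>lborel)"
    by (simp only: laplacian_def sum_distrib_left mult.left_commute)
  finally show ?thesis .
qed

section \<open>Shifting the exponent\<close>

lemma dderiv_plane_wave: "dderiv v (\<lambda>x. plane_wave x z) x = phase z v * plane_wave x z"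
proof -
  have "((\<lambda>x. plane_wave x z) has_derivative (\<lambda>v. plane_wave z x * phase v z)) (at x)"
    using plane_wave_has_derivative[of z x] by (simp only: plane_wave_sym[of z])
  from dderiv_eqI[OF this] show ?thesis by (simp add: plane_wave_sym[of z x] phase_commute[of v z] mult.commute)
qed

lemma phase_axis: "phase z (axis i 1) = - (2 * of_real pi * \<i> * of_real (z $ i))"
  by (simp add: phase_def inner_axis)

lemma plane_wave_analytic: "real_analytic_on (\<lambda>x. plane_wave x z) S"
  using has_pser_plane_wave[of z] unfolding entire_pser_def by (intro entire_pser_analytic) (auto simp: entire_pser_def)

lemma ft_dderiv:
  assumes \<psi>: "bump_on UNIV \<psi>"
  shows "ft (dderiv (axis i 1) \<psi>) z = 2 * of_real pi * \<i> * of_real (z $ i) * ft \<psi> z"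
proof -
  have "ft (dderiv (axis i 1) \<psi>) z = (\<integral>x. dderiv (axis i 1) \<psi> x * plane_wave x z \<partial>lborel)"
    by (simp add: ft_def mult.commute)
  also have "\<dots> = - (\<integral>x. \<psi> x * (phase z (axis i 1) * plane_wave x z) \<partial>lborel)"
    by (subst integration_by_parts[OF open_UNIV \<psi> plane_wave_analytic]) (simp add: dderiv_plane_wave)
  also have "(\<lambda>x. \<psi> x * (phase z (axis i 1) * plane_wave x z)) = (\<lambda>x. phase z (axis i 1) * (plane_wave x z * \<psi> x))"
    by (simp add: mult_ac)
  finally show ?thesis by (simp add: phase_axis ft_def)
qed

lemma sum_phase_axis_squares: "(\<Sum>i\<in>UNIV. phase z (axis i 1) ^ 2) = - of_real (4 * pi ^ 2 * norm z ^ 2)"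
proof -
  have "phase z (axis i 1) ^ 2 = - of_real (4 * pi ^ 2) * of_real ((z $ i) ^ 2)" for i
    by (simp add: phase_axis power2_eq_square mult_ac)
  then show ?thesis by (simp add: norm_vec_sum_squares sum_distrib_left sum_negf)
qed

text \<open>A common pattern: differentiation multiplies by the phase of the direction and passes
  from \<open>f\<close> to \<open>g\<close> to \<open>h\<close>. Plane waves have f = g = h; for
  phase monomials the degree drops by one in each step.\<close>

lemma laplacian_eq:
  assumes "\<And>i x. dderiv (axis i 1) f x = phase z (axis i 1) * g x" "\<And>i x. dderiv (axis i 1) g x = phase z (axis i 1) * h x"
    and "\<And>x. g differentiable (at x)"
  shows "laplacian f x = of_real (norm z ^ 2) * h x"
proof -
  have "dderiv (axis i 1) (dderiv (axis i 1) f) x = phase z (axis i 1) ^ 2 * h x" for i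
    using assms(2) by (simp add: assms(1)[abs_def] dderiv_cmult assms(3) power2_eq_square)
  then have "laplacian f x = of_real (- 1 / (4 * pi ^ 2)) * ((\<Sum>i\<in>UNIV. phase z (axis i 1) ^ 2) * h x)"
    by (simp add: laplacian_def sum_distrib_right)
  then show ?thesis unfolding sum_phase_axis_squares by (simp add: power2_eq_square)
qed

lemma ft_laplacian:
  assumes \<psi>: "bump_on UNIV \<psi>"
  shows "ft (laplacian \<psi>) z = of_real (norm z ^ 2) * ft \<psi> z"
proof -
  have l: "laplacian (\<lambda>x. plane_wave x z) x = of_real (norm z ^ 2) * plane_wave x z" for x
    by (rule laplacian_eq) (auto simp: dderiv_plane_wave intro: real_analytic_on_differentiable[OF plane_wave_analytic])
  have "ft (laplacian \<psi>) z = (\<integral>x. laplacian \<psi> x * plane_wave x z \<partial>lborel)" by (simp add: ft_def mult.commute)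
  also have "\<dots> = (\<integral>x. of_real (norm z ^ 2) * (plane_wave x z * \<psi> x) \<partial>lborel)"
    by (subst integral_laplacian[OF open_UNIV \<psi> plane_wave_analytic]) (simp add: l mult_ac)
  finally show ?thesis by (simp add: ft_def)
qed

abbreviation phase_monomial :: "nat \<Rightarrow> real ^ 'n::finite \<Rightarrow> real ^ 'n \<Rightarrow> complex" where
  "phase_monomial k y x \<equiv> phase y x ^ k / fact k"

lemma phase_monomial_analytic: "real_analytic_on (phase_monomial k y) S"
  using has_pser_phase_power[of y k] by (intro entire_pser_analytic) (auto simp: entire_pser_def)

lemma dderiv_phase_monomial:
  "dderiv v (phase_monomial 0 y) x = 0"
  "dderiv v (phase_monomial (Suc k) y) x = phase y v * phase_monomial k y x"
proof -
  show "dderiv v (phase_monomial 0 y) x = 0" by (simp add: dderiv_eqI[OF has_derivative_const])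
  have 1: "((\<lambda>x. phase y x) has_derivative (\<lambda>v. phase y v)) (at x)"
    unfolding phase_def by (intro has_derivative_mult_right has_derivative_of_real bounded_linear_imp_has_derivative bounded_linear_inner_right)
  have "((\<lambda>w. w ^ Suc k / fact (Suc k)) has_field_derivative of_nat (Suc k) * w ^ k / fact (Suc k)) (at w)" for w :: complex
    using DERIV_cdivide[OF DERIV_power[OF DERIV_ident[of "at w"], of "Suc k"], of "fact (Suc k)"] by (simp del: fact_Suc of_nat_Suc)
  moreover have "of_nat (Suc k) * w ^ k / fact (Suc k) = w ^ k / fact k" for w :: complex
    by (simp del: of_nat_Suc)
  ultimately have 2: "((\<lambda>w. w ^ Suc k / fact (Suc k)) has_field_derivative w ^ k / fact k) (at w)" for w :: complex by simp
  from has_derivative_compose[OF 1 2[unfolded has_field_derivative_def]]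
  have "((\<lambda>x. phase_monomial (Suc k) y x) has_derivative (\<lambda>v. phase_monomial k y x * phase y v)) (at x)" .
  from dderiv_eqI[OF this] show "dderiv v (phase_monomial (Suc k) y) x = phase y v * phase_monomial k y x" by (simp only: mult.commute)
qed

text \<open>The Laplacian is moved from \<psi> to the monomial in \<open>x\<close>, where it lowers
  the degree by two and kills the degrees 0 and 1.\<close>

lemma test_moment_laplacian:
  assumes \<psi>: "bump_on UNIV \<psi>"
  shows "test_moment 0 (laplacian \<psi>) y = 0" "test_moment (Suc 0) (laplacian \<psi>) y = 0"
    and "test_moment (k + 2) (laplacian \<psi>) y = of_real (norm y ^ 2) * test_moment k \<psi> y"
proof -
  have eq: "test_moment m (laplacian \<psi>) y = (\<integral>x. \<psi> x * laplacian (phase_monomial m y) x \<partial>lborel)" for m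
    using integral_laplacian[OF open_UNIV \<psi> phase_monomial_analytic[where k = m and y = y]] by (simp add: test_moment_def mult.commute)
  have l0: "laplacian (phase_monomial 0 y) x = of_real (norm y ^ 2) * 0" for x
    by (rule laplacian_eq[where g = "\<lambda>_. 0" and h = "\<lambda>_. 0"])
       (simp_all only: dderiv_phase_monomial mult_zero_right dderiv_eqI[OF has_derivative_const] differentiable_const)
  have l1: "laplacian (phase_monomial (Suc 0) y) x = of_real (norm y ^ 2) * 0" for x
    by (rule laplacian_eq[where g = "phase_monomial 0 y" and h = "\<lambda>_. 0"])
       (simp_all only: dderiv_phase_monomial mult_zero_right real_analytic_on_differentiable[OF phase_monomial_analytic UNIV_I])
  have l2: "laplacian (phase_monomial (Suc (Suc k)) y) x = of_real (norm y ^ 2) * phase_monomial k y x" for x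
    by (rule laplacian_eq[where g = "phase_monomial (Suc k) y"])
       (simp_all only: dderiv_phase_monomial real_analytic_on_differentiable[OF phase_monomial_analytic UNIV_I])
  show "test_moment 0 (laplacian \<psi>) y = 0" "test_moment (Suc 0) (laplacian \<psi>) y = 0"
    unfolding eq l0 l1 by simp_all
  have "test_moment (Suc (Suc k)) (laplacian \<psi>) y = (\<integral>x. of_real (norm y ^ 2) * (phase_monomial k y x * \<psi> x) \<partial>lborel)"
    unfolding eq l2 by (intro Bochner_Integration.integral_cong refl) simp
  then show "test_moment (k + 2) (laplacian \<psi>) y = of_real (norm y ^ 2) * test_moment k \<psi> y"
    unfolding integral_mult_right_zero test_moment_def by simp
qed

lemma hadamard_term_ft:
  fixes \<psi> :: "real ^ 'n::finite \<Rightarrow> complex"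
  assumes \<psi>: "test_fn \<psi>"
  shows "hadamard_term U \<nu> \<epsilon> (ft \<psi>) k =
     (if \<nu> = of_nat (k + CARD('n)) then
        (\<integral>y. indicator ((if even k then U else ball 0 1) - ball 0 \<epsilon>) y * (test_moment k \<psi> y / npow y \<nu>) \<partial>lborel)
      else if Re \<nu> = of_nat (k + CARD('n)) then
        sphere_integral (test_moment k \<psi>) * (of_real \<epsilon> powr (of_nat (k + CARD('n)) - \<nu>) / (\<nu> - of_nat (k + CARD('n))))
      else (\<integral>y. indicator (- ball 0 \<epsilon>) y * (test_moment k \<psi> y / npow y \<nu>) \<partial>lborel))"
proof -
  have s: "sphere_integral (\<lambda>\<theta>. fact k * test_moment k \<psi> \<theta>) = fact k * sphere_integral (test_moment k \<psi>)"
    unfolding sphere_integral_def set_lebesgue_integral_def indicator_scaleR_mult by (simp add: mult.left_commute)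
  have c: "(\<integral>y. indicator A y * (fact k * test_moment k \<psi> y / npow y \<nu>) \<partial>lborel) = fact k * (\<integral>y. indicator A y * (test_moment k \<psi> y / npow y \<nu>) \<partial>lborel)" for A
    by (simp add: mult.left_commute flip: integral_mult_right_zero)
  show ?thesis
    unfolding hadamard_term_def set_lebesgue_integral_def indicator_scaleR_mult dderiv_ft_zero[OF \<psi>] s c by simp
qed

lemma npow_add_2: "y \<noteq> 0 \<Longrightarrow> npow y (\<nu> + 2) = npow y \<nu> * of_real (norm y ^ 2)"
  using powr_nat'[of "complex_of_real (norm y)" 2] by (simp add: npow_def powr_add)

text \<open>Raising \<nu> and k by 2 together preserves both exceptional conditions, and the parity
  of k that selects between \<open>U\<close> and the unit ball. The factor |y|^2 gained by the
  moment cancels the one in the denominator, and is 1 on the sphere.\<close>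

lemma hadamard_term_shift:
  fixes \<psi> :: "real ^ 'n::finite \<Rightarrow> complex"
  assumes \<psi>: "bump_on UNIV \<psi>" and e: "\<epsilon> > 0"
  shows "hadamard_term U (\<nu> + 2) \<epsilon> (ft (laplacian \<psi>)) (k + 2) = hadamard_term U \<nu> \<epsilon> (ft \<psi>) k"
    and "hadamard_term U (\<nu> + 2) \<epsilon> (ft (laplacian \<psi>)) 0 = 0"
    and "hadamard_term U (\<nu> + 2) \<epsilon> (ft (laplacian \<psi>)) (Suc 0) = 0"
proof -
  have t: "test_fn \<psi>" "test_fn (laplacian \<psi>)" using \<psi> bump_on_laplacian[OF \<psi>] bump_on_test_fn by auto
  note L = test_moment_laplacian[OF \<psi>]
  have "test_moment 0 (laplacian \<psi>) = (\<lambda>_. 0)" "test_moment (Suc 0) (laplacian \<psi>) = (\<lambda>_. 0)" using L(1,2) by auto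
  then show "hadamard_term U (\<nu> + 2) \<epsilon> (ft (laplacian \<psi>)) 0 = 0" "hadamard_term U (\<nu> + 2) \<epsilon> (ft (laplacian \<psi>)) (Suc 0) = 0"
    unfolding hadamard_term_ft[OF t(2)] by (simp_all add: sphere_integral_def set_lebesgue_integral_def)
  have q: "test_moment (k + 2) (laplacian \<psi>) y / npow y (\<nu> + 2) = test_moment k \<psi> y / npow y \<nu>" if "y \<noteq> 0" for y
    unfolding L(3) npow_add_2[OF that] using that by simp
  have r: "(\<integral>y. indicator (A - ball 0 \<epsilon>) y * (test_moment (k + 2) (laplacian \<psi>) y / npow y (\<nu> + 2)) \<partial>lborel) =
     (\<integral>y. indicator (A - ball 0 \<epsilon>) y * (test_moment k \<psi> y / npow y \<nu>) \<partial>lborel)" for A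
  proof (intro Bochner_Integration.integral_cong refl)
    show "indicator (A - ball 0 \<epsilon>) y * (test_moment (k + 2) (laplacian \<psi>) y / npow y (\<nu> + 2)) =
      indicator (A - ball 0 \<epsilon>) y * (test_moment k \<psi> y / npow y \<nu>)" for y
      using q[of y] e by (cases "y = 0") auto
  qed
  have [measurable]: "test_moment (k + 2) (laplacian \<psi>) \<in> borel_measurable borel" "test_moment k \<psi> \<in> borel_measurable borel"
    using test_moment_measurable t by blast+
  have s: "sphere_integral (test_moment (k + 2) (laplacian \<psi>)) = sphere_integral (test_moment k \<psi>)"
    unfolding sphere_integral_def set_lebesgue_integral_def indicator_scaleR_mult
  proof (intro arg_cong2[where f = times] refl integral_cong_AE)
    show "AE y in lborel. indicator (ball 0 1) y * test_moment (k + 2) (laplacian \<psi>) (sgn y) = indicator (ball 0 1) y * test_moment k \<psi> (sgn y)"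
      using AE_lborel_singleton[of "0 :: real ^ 'n"] by eventually_elim (simp only: L(3), simp add: norm_sgn)
  qed measurable
  have n: "of_nat (k + 2 + CARD('n)) = of_nat (k + CARD('n)) + (2 :: complex)" "of_nat (k + 2 + CARD('n)) = of_nat (k + CARD('n)) + (2 :: real)" by simp_all
  show "hadamard_term U (\<nu> + 2) \<epsilon> (ft (laplacian \<psi>)) (k + 2) = hadamard_term U \<nu> \<epsilon> (ft \<psi>) k"
    unfolding hadamard_term_ft[OF t(1)] hadamard_term_ft[OF t(2)] n s r r[of UNIV, unfolded Compl_eq_Diff_UNIV[symmetric]]
    by simp
qed

text \<open>The expressions under the limit coincide for every \<epsilon> > 0, so the values of
  \<open>Lim\<close> agree without any appeal to convergence. In particular exponents are covered
  for which no counterterm occurs.\<close>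

lemma hadamard_integral_shift:
  fixes \<psi> :: "real ^ 'n::finite \<Rightarrow> complex"
  assumes \<psi>: "bump_on UNIV \<psi>"
  shows "hadamard_integral U \<nu> (ft \<psi>) = hadamard_integral U (\<nu> + 2) (ft (laplacian \<psi>))"
proof -
  define f where "f = \<lfloor>Re \<nu> - real CARD('n)\<rfloor>"
  have f2: "\<lfloor>Re (\<nu> + 2) - real CARD('n)\<rfloor> = f + 2" unfolding f_def by simp linarith
  have "(LINT z:- ball 0 \<epsilon>|lborel. ft \<psi> z / npow z \<nu>) - (\<Sum>k | int k \<le> f. hadamard_term U \<nu> \<epsilon> (ft \<psi>) k) =
     (LINT z:- ball 0 \<epsilon>|lborel. ft (laplacian \<psi>) z / npow z (\<nu> + 2)) - (\<Sum>k | int k \<le> f + 2. hadamard_term U (\<nu> + 2) \<epsilon> (ft (laplacian \<psi>)) k)"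
    if e: "\<epsilon> > 0" for \<epsilon>
  proof (rule arg_cong2[where f = minus])
    show "(LINT z:- ball 0 \<epsilon>|lborel. ft \<psi> z / npow z \<nu>) = (LINT z:- ball 0 \<epsilon>|lborel. ft (laplacian \<psi>) z / npow z (\<nu> + 2))"
      unfolding set_lebesgue_integral_def indicator_scaleR_mult
    proof (intro Bochner_Integration.integral_cong refl)
      show "indicator (- ball 0 \<epsilon>) z * (ft \<psi> z / npow z \<nu>) = indicator (- ball 0 \<epsilon>) z * (ft (laplacian \<psi>) z / npow z (\<nu> + 2))" for z
        using e by (cases "z = 0") (simp_all add: ft_laplacian[OF \<psi>] npow_add_2)
    qed
    \<comment> \<open>For the raised exponent the indices 0 and 1 have no counterpart, and their
      counterterms are 0. This also covers f < 0, where the other sum is empty.\<close>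
    have "(\<Sum>k | int k \<le> f + 2. hadamard_term U (\<nu> + 2) \<epsilon> (ft (laplacian \<psi>)) k) =
      (\<Sum>k \<in> (\<lambda>k. k + 2) ` {k. int k \<le> f}. hadamard_term U (\<nu> + 2) \<epsilon> (ft (laplacian \<psi>)) k)"
    proof (rule sum.mono_neutral_right)
      show "finite {k. int k \<le> f + 2}" by (rule finite_subset[of _ "{..nat (f + 2)}"]) auto
      show "\<forall>k\<in>{k. int k \<le> f + 2} - (\<lambda>k. k + 2) ` {k. int k \<le> f}. hadamard_term U (\<nu> + 2) \<epsilon> (ft (laplacian \<psi>)) k = 0"
      proof
        fix k assume k: "k \<in> {k. int k \<le> f + 2} - (\<lambda>k. k + 2) ` {k. int k \<le> f}"
        have "\<not> k \<ge> 2"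
        proof
          assume "k \<ge> 2"
          then have "k = (k - 2) + 2" "int (k - 2) \<le> f" using k by auto
          then show False using k by blast
        qed
        then have "k = 0 \<or> k = Suc 0" by auto
        then show "hadamard_term U (\<nu> + 2) \<epsilon> (ft (laplacian \<psi>)) k = 0" using hadamard_term_shift(2,3)[OF \<psi> e] by metis
      qed
    qed auto
    also have "\<dots> = (\<Sum>k | int k \<le> f. hadamard_term U (\<nu> + 2) \<epsilon> (ft (laplacian \<psi>)) (k + 2))"
      by (subst sum.reindex) (auto simp: inj_on_def)
    finally show "(\<Sum>k | int k \<le> f. hadamard_term U \<nu> \<epsilon> (ft \<psi>) k) = (\<Sum>k | int k \<le> f + 2. hadamard_term U (\<nu> + 2) \<epsilon> (ft (laplacian \<psi>)) k)"
      by (simp only: hadamard_term_shift(1)[OF \<psi> e])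
  qed
  then have "\<forall>\<^sub>F \<epsilon> in at_right 0. (LINT z:- ball 0 \<epsilon>|lborel. ft \<psi> z / npow z \<nu>) - (\<Sum>k | int k \<le> f. hadamard_term U \<nu> \<epsilon> (ft \<psi>) k) =
     (LINT z:- ball 0 \<epsilon>|lborel. ft (laplacian \<psi>) z / npow z (\<nu> + 2)) - (\<Sum>k | int k \<le> f + 2. hadamard_term U (\<nu> + 2) \<epsilon> (ft (laplacian \<psi>)) k)"
    by (auto simp: eventually_at_right_field intro: exI[of _ 1])
  from tendsto_cong[OF this] show ?thesis
    unfolding hadamard_integral_def f2 f_def[symmetric] t2_space_class.Lim_def by simp
qed

lemma HSI_shift:
  fixes M :: "real ^ 'n ^ 'n"
  assumes \<psi>: "bump_on UNIV \<psi>"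
  shows "HSI M U \<nu> (ft \<psi>) = HSI M U (\<nu> + 2) (ft (laplacian \<psi>))"
proof -
  have "(\<Sum>\<^sub>\<infinity>z\<in>lattice_of M - {0}. ft \<psi> z / npow z \<nu>) = (\<Sum>\<^sub>\<infinity>z\<in>lattice_of M - {0}. ft (laplacian \<psi>) z / npow z (\<nu> + 2))"
    by (intro infsum_cong) (simp add: ft_laplacian[OF \<psi>] npow_add_2)
  then show ?thesis unfolding HSI_def hadamard_integral_shift[OF \<psi>] by simp
qed

lemma bump_on_laplacian_power: "bump_on S \<psi> \<Longrightarrow> bump_on S ((laplacian ^^ m) \<psi>)"
  by (induction m) (auto intro: bump_on_laplacian)

lemma HSI_shift_power:
  assumes \<psi>: "bump_on UNIV \<psi>"
  shows "HSI M U \<nu> (ft \<psi>) = HSI M U (\<nu> + 2 * of_nat m) (ft ((laplacian ^^ m) \<psi>))"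
proof (induction m)
  case (Suc m)
  then show ?case using HSI_shift[OF bump_on_laplacian_power[OF \<psi>], of M U "\<nu> + 2 * of_nat m" m] by (simp add: algebra_simps)
qed simp

lemma real_analytic_on_laplacian_power: "real_analytic_on F S \<Longrightarrow> real_analytic_on ((laplacian ^^ m) F) S"
  by (induction m) (auto intro: real_analytic_on_laplacian)

lemma integral_laplacian_power:
  assumes S: "open S" and \<psi>: "bump_on S \<psi>" and F: "real_analytic_on F S"
  shows "(\<integral>x. (laplacian ^^ m) \<psi> x * F x \<partial>lborel) = (\<integral>x. \<psi> x * (laplacian ^^ m) F x \<partial>lborel)"
  using F
proof (induction m arbitrary: F)
  case (Suc m)
  show ?case
    using integral_laplacian[OF S bump_on_laplacian_power[OF \<psi>] Suc.prems, of m] Suc.IH[OF real_analytic_on_laplacian[OF Suc.prems]]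
    by (simp add: funpow_swap1)
qed simp

section \<open>Parity and higher derivatives\<close>

lemma integral_lborel_uminus:
  fixes f :: "'a::euclidean_space \<Rightarrow> complex"
  assumes [measurable]: "f \<in> borel_measurable borel"
  shows "(\<integral>x. f (- x) \<partial>lborel) = (\<integral>x. f x \<partial>lborel)"
proof -
  have "distr lborel borel uminus = (lborel :: 'a measure)"
    using lborel_affine[of "-1" "0 :: 'a"] by (simp add: density_1)
  then have "(\<integral>x. f x \<partial>lborel) = (\<integral>x. f x \<partial>distr lborel borel uminus)" by simp
  also have "\<dots> = (\<integral>x. f (- x) \<partial>lborel)" by (rule integral_distr) auto
  finally show ?thesis by simp
qed

lemma phase_minus: "phase (- z) x = - phase z x" "phase z (- x) = - phase z x"
  by (simp_all add: phase_def)

lemma plane_wave_minus: "plane_wave (- x) z = plane_wave x (- z)"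
  by (simp add: plane_wave_def)

text \<open>The set \<open>U\<close> may be asymmetric. It can occur only for even k, where the
  phase power is already even in \<open>x\<close>; for odd k the weight is even in \<open>y\<close>,
  and reflecting the variable of integration replaces \<open>x\<close> by \<open>-x\<close>.\<close>

lemma zeta_density_even:
  fixes M :: "real ^ 'n ^ 'n"
  assumes U: "open U"
  shows "zeta_density M U \<nu> l (- x) = zeta_density M U \<nu> l x"
proof -
  have [measurable]: "U \<in> sets borel" using U by auto
  have np: "npow (- z) \<nu> = npow z \<nu>" for z :: "real ^ 'n" by (simp add: npow_def)
  have "(\<Sum>\<^sub>\<infinity>n\<in>nonzero. plane_wave (- x) (lattice_point M n) / npow (lattice_point M n) \<nu>) =
     (\<Sum>\<^sub>\<infinity>n\<in>nonzero. (\<lambda>n. plane_wave x (lattice_point M n) / npow (lattice_point M n) \<nu>) (\<lambda>i. - n i))"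
    by (intro infsum_cong) (simp add: plane_wave_minus int_vec_minus linear_neg[OF matrix_vector_mul_linear] np)
  also have "\<dots> = (\<Sum>\<^sub>\<infinity>n\<in>nonzero. plane_wave x (lattice_point M n) / npow (lattice_point M n) \<nu>)"
  proof (rule infsum_reindex_bij_betw)
    show "bij_betw (\<lambda>n i. - n i) (nonzero :: ('n \<Rightarrow> int) set) nonzero"
      by (rule bij_betwI[where g = "\<lambda>n i. - n i"]) (auto simp: fun_eq_iff)
  qed
  finally have 1: "(\<Sum>\<^sub>\<infinity>n\<in>nonzero. plane_wave (- x) (lattice_point M n) / npow (lattice_point M n) \<nu>) =
     (\<Sum>\<^sub>\<infinity>n\<in>nonzero. plane_wave x (lattice_point M n) / npow (lattice_point M n) \<nu>)" .
  have "wave_remainder l (- x) z = wave_remainder l x (- z)" for z :: "real ^ 'n"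
    by (simp add: plane_wave_minus phase_taylor_def phase_minus indicator_def)
  then have 2: "(\<integral>z. wave_remainder l (- x) z / npow z \<nu> \<partial>lborel) = (\<integral>z. wave_remainder l x z / npow z \<nu> \<partial>lborel)"
    using integral_lborel_uminus[of "\<lambda>z. wave_remainder l x z / npow z \<nu>"] by (simp add: np)
  have 3: "(\<integral>y. phase y (- x) ^ k / fact k * hadamard_weight U \<nu> k y \<partial>lborel) = (\<integral>y. phase y x ^ k / fact k * hadamard_weight U \<nu> k y \<partial>lborel)" for k
  proof (cases "even k")
    case False
    have "hadamard_weight U \<nu> k (- y) = hadamard_weight U \<nu> k y" for y
      using False by (simp add: hadamard_weight_def np indicator_def)
    then have "(\<lambda>y. phase y (- x) ^ k / fact k * hadamard_weight U \<nu> k y) = (\<lambda>y. phase (- y) x ^ k / fact k * hadamard_weight U \<nu> k (- y))"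
      by (simp add: phase_minus)
    then show ?thesis
      using integral_lborel_uminus[of "\<lambda>y. phase y x ^ k / fact k * hadamard_weight U \<nu> k y"] by simp
  qed (simp add: phase_minus)
  show ?thesis unfolding zeta_density_def 1 2 3 ..
qed

lemma dderiv_parity:
  fixes f :: "real ^ 'n::finite \<Rightarrow> complex"
  assumes S: "open S" "\<And>x. x \<in> S \<Longrightarrow> - x \<in> S" and f: "real_analytic_on f S"
    and par: "\<And>x. x \<in> S \<Longrightarrow> f (- x) = \<sigma> * f x" and x: "x \<in> S"
  shows "dderiv v f (- x) = - \<sigma> * dderiv v f x"
proof -
  have d: "(f has_derivative (\<lambda>v. dderiv v f y)) (at y)" if "y \<in> S" for y
    by (intro has_derivative_dderiv real_analytic_on_differentiable[OF f that])
  have "((\<lambda>y. - y) has_derivative (\<lambda>v. - v)) (at x)" by (auto intro!: derivative_eq_intros)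
  from has_derivative_compose[OF this d[OF S(2)[OF x]]]
  have "((\<lambda>y. f (- y)) has_derivative (\<lambda>v. dderiv (- v) f (- x))) (at x)" .
  then have "((\<lambda>y. \<sigma> * f y) has_derivative (\<lambda>v. dderiv (- v) f (- x))) (at x)"
    by (rule has_derivative_transform_within_open[OF _ S(1) x]) (rule par)
  from has_derivative_unique[OF this has_derivative_mult_right[OF d[OF x]]]
  have "dderiv (- v) f (- x) = \<sigma> * dderiv v f x" by metis
  moreover have "dderiv (- v) f (- x) = - dderiv v f (- x)"
    using dderiv_scaleR[OF real_analytic_on_differentiable[OF f S(2)[OF x]], of "-1" v] by simp
  ultimately have "- (- dderiv v f (- x)) = - (\<sigma> * dderiv v f x)" by simp
  then show ?thesis by simp
qed

lemma laplacian_even: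
  fixes f :: "real ^ 'n::finite \<Rightarrow> complex"
  assumes S: "open S" "\<And>x. x \<in> S \<Longrightarrow> - x \<in> S" and f: "real_analytic_on f S"
    and par: "\<And>x. x \<in> S \<Longrightarrow> f (- x) = f x" and x: "x \<in> S"
  shows "laplacian f (- x) = laplacian f x"
proof -
  have "dderiv (axis i 1) f (- x) = - 1 * dderiv (axis i 1) f x" if "x \<in> S" for i x
    using dderiv_parity[OF S f, of 1] par that by simp
  from dderiv_parity[OF S real_analytic_on_dderiv[OF f] this x]
  have "dderiv (axis i 1) (dderiv (axis i 1) f) (- x) = dderiv (axis i 1) (dderiv (axis i 1) f) x" for i by simp
  then show ?thesis by (simp add: laplacian_def)
qed

lemma laplacian_power_even:
  fixes f :: "real ^ 'n::finite \<Rightarrow> complex"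
  assumes S: "open S" "\<And>x. x \<in> S \<Longrightarrow> - x \<in> S" and f: "real_analytic_on f S"
    and par: "\<And>x. x \<in> S \<Longrightarrow> f (- x) = f x" and x: "x \<in> S"
  shows "(laplacian ^^ m) f (- x) = (laplacian ^^ m) f x"
  using x
proof (induction m arbitrary: x)
  case (Suc m)
  show ?case using laplacian_even[OF S real_analytic_on_laplacian_power[OF f] Suc.IH Suc.prems] by simp
qed (use par in simp)

lemma regular_set_minus: "x \<in> regular_set M \<Longrightarrow> - x \<in> regular_set M"
proof -
  have "- x \<in> dual_lattice_of M \<Longrightarrow> x \<in> dual_lattice_of M" for x
  proof -
    assume "- x \<in> dual_lattice_of M"
    then obtain n where "- x = lattice_point (dual_matrix M) n" unfolding dual_lattice_of_eq by auto
    from arg_cong[OF this, of uminus] have "x = - lattice_point (dual_matrix M) n" by simp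
    then have "x = lattice_point (dual_matrix M) (\<lambda>i. - n i)" by (simp add: int_vec_minus linear_neg[OF matrix_vector_mul_linear])
    then show "x \<in> dual_lattice_of M" unfolding dual_lattice_of_eq by blast
  qed
  then show "x \<in> regular_set M \<Longrightarrow> - x \<in> regular_set M" by (auto simp: regular_set_def)
qed

text \<open>For a small real part the density is the iterated Laplacian of the one at the raised
  exponent. Moving the Laplacians over by parts is legitimate because the bump is supported where
  that density is analytic, the origin included.\<close>

lemma HSI_density:
  fixes M :: "real ^ 'n ^ 'n"
  assumes M: "invertible M" and U: "open U" "bounded U" "0 \<in> U"
  shows "\<exists>F. real_analytic_on F (regular_set M) \<and> (\<forall>x\<in>regular_set M. F (- x) = F x) \<and>
    (\<forall>\<psi>. bump_on (regular_set M) \<psi> \<longrightarrow> HSI M U \<nu> (ft \<psi>) = (\<integral>x. \<psi> x * F x \<partial>lborel))"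
proof -
  \<comment> \<open>The number of shifts that lifts Re \<nu> to at least 2d.\<close>
  obtain m :: nat where m: "(2 * real CARD('n) - Re \<nu>) / 2 \<le> m" using real_arch_simple by blast
  define N where "N = \<nu> + 2 * of_nat m"
  have N: "Re N \<ge> 2 * CARD('n)" using m by (simp add: N_def)
  define Z where "Z = zeta_density M U N (nat \<lfloor>Re N - real CARD('n)\<rfloor>)"
  have Z: "real_analytic_on Z (regular_set M)" unfolding Z_def by (rule zeta_density_analytic[OF M U N])
  note S = open_regular_set[OF M]
  show ?thesis
  proof (intro exI conjI ballI allI impI)
    show "real_analytic_on ((laplacian ^^ m) Z) (regular_set M)" by (rule real_analytic_on_laplacian_power[OF Z])
    show "(laplacian ^^ m) Z (- x) = (laplacian ^^ m) Z x" if "x \<in> regular_set M" for x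
      using S regular_set_minus Z zeta_density_even[OF U(1)] that unfolding Z_def by (rule laplacian_power_even)
    fix \<psi> :: "real ^ 'n \<Rightarrow> complex" assume \<psi>: "bump_on (regular_set M) \<psi>"
    have "HSI M U \<nu> (ft \<psi>) = HSI M U N (ft ((laplacian ^^ m) \<psi>))"
      unfolding N_def by (rule HSI_shift_power[OF bump_on_mono[OF \<psi>]]) simp
    also have "\<dots> = (\<integral>x. (laplacian ^^ m) \<psi> x * Z x \<partial>lborel)"
      unfolding Z_def by (rule HSI_ft[OF M U N bump_on_test_fn[OF bump_on_laplacian_power[OF \<psi>]]])
    also have "\<dots> = (\<integral>x. \<psi> x * (laplacian ^^ m) Z x \<partial>lborel)" by (rule integral_laplacian_power[OF S \<psi> Z])
    finally show "HSI M U \<nu> (ft \<psi>) = (\<integral>x. \<psi> x * (laplacian ^^ m) Z x \<partial>lborel)" .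
  qed
qed

text \<open>\<open>mderiv\<close> with the list of coordinates as an argument, for inductions over
  the list and because integration by parts reverses its order.\<close>

definition multi_dderiv :: "'n mindex \<Rightarrow> 'n list \<Rightarrow> (real ^ 'n::finite \<Rightarrow> complex) \<Rightarrow> real ^ 'n \<Rightarrow> complex" where
  "multi_dderiv \<alpha> js f = foldr (\<lambda>i. dderiv (axis i 1) ^^ lk \<alpha> i) js f"

lemma multi_dderiv_Nil [simp]: "multi_dderiv \<alpha> [] f = f"
  and multi_dderiv_Cons [simp]: "multi_dderiv \<alpha> (i # js) f = (dderiv (axis i 1) ^^ lk \<alpha> i) (multi_dderiv \<alpha> js f)"
  and multi_dderiv_append [simp]: "multi_dderiv \<alpha> (js @ ks) f = multi_dderiv \<alpha> js (multi_dderiv \<alpha> ks f)"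
  by (simp_all add: multi_dderiv_def)

lemma bump_on_multi_dderiv: "bump_on S \<psi> \<Longrightarrow> bump_on S (multi_dderiv \<alpha> js \<psi>)"
  by (induction js) (auto intro: bump_on_dderiv_power)

lemma real_analytic_on_dderiv_power: "real_analytic_on F S \<Longrightarrow> real_analytic_on ((dderiv (axis i 1) ^^ k) F) S"
  by (induction k) (auto intro: real_analytic_on_dderiv)

lemma real_analytic_on_multi_dderiv: "real_analytic_on F S \<Longrightarrow> real_analytic_on (multi_dderiv \<alpha> js F) S"
  by (induction js) (auto intro: real_analytic_on_dderiv_power)

lemma integration_by_parts_power:
  assumes S: "open S" and \<psi>: "bump_on S \<psi>" and F: "real_analytic_on F S"
  shows "(\<integral>x. (dderiv (axis i 1) ^^ k) \<psi> x * F x \<partial>lborel) = (-1) ^ k * (\<integral>x. \<psi> x * (dderiv (axis i 1) ^^ k) F x \<partial>lborel)"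
  using F
proof (induction k arbitrary: F)
  case (Suc k)
  show ?case
    using integration_by_parts[OF S bump_on_dderiv_power[OF \<psi>, where v = "axis i 1" and k = k] Suc.prems, where i = i] Suc.IH[OF real_analytic_on_dderiv[OF Suc.prems]]
    by (simp add: funpow_swap1)
qed simp

text \<open>Derivatives leave \<psi> from the outside inwards and arrive at \<open>F\<close> in the
  opposite order. Stating it with \<open>rev\<close> makes commuting partial derivatives
  unnecessary.\<close>

lemma integration_by_parts_multi:
  assumes S: "open S" and \<psi>: "bump_on S \<psi>" and F: "real_analytic_on F S"
  shows "(\<integral>x. multi_dderiv \<alpha> (rev js) \<psi> x * F x \<partial>lborel) = (-1) ^ sum_list (map (lk \<alpha>) js) * (\<integral>x. \<psi> x * multi_dderiv \<alpha> js F x \<partial>lborel)"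
  using \<psi>
proof (induction js arbitrary: \<psi>)
  case (Cons i js)
  have "(\<integral>x. multi_dderiv \<alpha> (rev (i # js)) \<psi> x * F x \<partial>lborel) = (\<integral>x. multi_dderiv \<alpha> (rev js) ((dderiv (axis i 1) ^^ lk \<alpha> i) \<psi>) x * F x \<partial>lborel)" by simp
  also have "\<dots> = (-1) ^ sum_list (map (lk \<alpha>) js) * (\<integral>x. (dderiv (axis i 1) ^^ lk \<alpha> i) \<psi> x * multi_dderiv \<alpha> js F x \<partial>lborel)"
    by (rule Cons.IH[OF bump_on_dderiv_power[OF Cons.prems]])
  also have "\<dots> = (-1) ^ sum_list (map (lk \<alpha>) (i # js)) * (\<integral>x. \<psi> x * multi_dderiv \<alpha> (i # js) F x \<partial>lborel)"
    unfolding integration_by_parts_power[OF S Cons.prems real_analytic_on_multi_dderiv[OF F]] by (simp add: power_add)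
  finally show ?case .
qed simp

lemma ft_dderiv_power:
  assumes \<psi>: "bump_on UNIV \<psi>"
  shows "ft ((dderiv (axis i 1) ^^ k) \<psi>) z = (2 * of_real pi * \<i> * of_real (z $ i)) ^ k * ft \<psi> z"
  by (induction k) (simp_all add: ft_dderiv bump_on_dderiv_power[OF \<psi>])

lemma ft_multi_dderiv:
  assumes \<psi>: "bump_on UNIV \<psi>"
  shows "ft (multi_dderiv \<alpha> js \<psi>) z = (2 * of_real pi * \<i>) ^ sum_list (map (lk \<alpha>) js) * of_real (\<Prod>i\<leftarrow>js. (z $ i) ^ lk \<alpha> i) * ft \<psi> z"
proof (induction js)
  case (Cons i js)
  then show ?case
    using ft_dderiv_power[OF bump_on_multi_dderiv[OF \<psi>, where \<alpha> = \<alpha> and js = js], where i = i and k = "lk \<alpha> i" and z = z] by (simp add: power_add power_mult_distrib mult_ac)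
qed simp

lemma coords: "distinct (coords :: 'n::finite list)" "set (coords :: 'n list) = UNIV"
proof -
  have "\<exists>js :: 'n list. distinct js \<and> set js = UNIV" using finite_distinct_list[OF finite] by metis
  from someI_ex[OF this] show "distinct (coords :: 'n list)" "set (coords :: 'n list) = UNIV" by (simp_all add: coords_def)
qed

lemma sum_list_coords: "sum_list (map (lk \<alpha>) coords) = mdeg \<alpha>"
  by (simp add: mdeg_def sum_list_distinct_conv_sum_set coords)

lemma mderiv_eq: "mderiv \<alpha> F = multi_dderiv \<alpha> coords F"
  by (simp add: mderiv_def multi_dderiv_def)

lemma dderiv_power_parity:
  fixes f :: "real ^ 'n::finite \<Rightarrow> complex"
  assumes S: "open S" "\<And>x. x \<in> S \<Longrightarrow> - x \<in> S" and f: "real_analytic_on f S"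
    and par: "\<And>x. x \<in> S \<Longrightarrow> f (- x) = \<sigma> * f x" and x: "x \<in> S"
  shows "(dderiv (axis i 1) ^^ k) f (- x) = (-1) ^ k * \<sigma> * (dderiv (axis i 1) ^^ k) f x"
  using x
proof (induction k arbitrary: x)
  case (Suc k)
  show ?case using dderiv_parity[OF S real_analytic_on_dderiv_power[OF f] Suc.IH Suc.prems] by simp
qed (use par in simp)

lemma multi_dderiv_parity:
  fixes f :: "real ^ 'n::finite \<Rightarrow> complex"
  assumes S: "open S" "\<And>x. x \<in> S \<Longrightarrow> - x \<in> S" and f: "real_analytic_on f S"
    and par: "\<And>x. x \<in> S \<Longrightarrow> f (- x) = f x" and x: "x \<in> S"
  shows "multi_dderiv \<alpha> js f (- x) = (-1) ^ sum_list (map (lk \<alpha>) js) * multi_dderiv \<alpha> js f x"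
  using x
proof (induction js arbitrary: x)
  case (Cons i js)
  show ?case using dderiv_power_parity[OF S real_analytic_on_multi_dderiv[OF f] Cons.IH Cons.prems] by (simp add: power_add)
qed (use par in simp)

lemma mderiv_odd_zero:
  fixes f :: "real ^ 'n::finite \<Rightarrow> complex"
  assumes S: "open S" "\<And>x. x \<in> S \<Longrightarrow> - x \<in> S" "0 \<in> S" and f: "real_analytic_on f S"
    and par: "\<And>x. x \<in> S \<Longrightarrow> f (- x) = f x" and \<alpha>: "odd (mdeg \<alpha>)"
  shows "mderiv \<alpha> f 0 = 0"
proof -
  have "mderiv \<alpha> f (- 0) = (-1) ^ mdeg \<alpha> * mderiv \<alpha> f 0"
    unfolding mderiv_eq sum_list_coords[symmetric] by (rule multi_dderiv_parity[OF S(1,2) f par S(3)])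
  then show ?thesis using \<alpha> by simp
qed

section \<open>Shrinking cutoffs\<close>

definition cutoff_bump :: "(real ^ 'n::finite \<Rightarrow> real) \<Rightarrow> real \<Rightarrow> real ^ 'n \<Rightarrow> real ^ 'n \<Rightarrow> complex" where
  "cutoff_bump \<phi> \<beta> y x = of_real (rescaled \<phi> \<beta> (x - y))"

lemma smooth_affine:
  fixes \<phi> :: "real ^ 'n::finite \<Rightarrow> real"
  assumes \<phi>: "smooth \<phi>"
  shows "smooth (\<lambda>x. complex_of_real (c * \<phi> (r *\<^sub>R (x - y))))"
proof -
  have d: "((\<lambda>x. complex_of_real (b * foldr dderiv vs \<phi> (r *\<^sub>R (x - y)))) has_derivative
      (\<lambda>v. of_real (b * (r * dderiv v (foldr dderiv vs \<phi>) (r *\<^sub>R (x - y)))))) (at x)" for b vs x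
  proof -
    have df: "foldr dderiv vs \<phi> differentiable (at p)" for p using \<phi> by (simp add: smooth_def)
    have "((\<lambda>x. r *\<^sub>R (x - y)) has_derivative (\<lambda>v. r *\<^sub>R v)) (at x)" by (auto intro!: derivative_eq_intros)
    from has_derivative_compose[OF this has_derivative_dderiv[OF df]]
    have "((\<lambda>x. foldr dderiv vs \<phi> (r *\<^sub>R (x - y))) has_derivative (\<lambda>v. r * dderiv v (foldr dderiv vs \<phi>) (r *\<^sub>R (x - y)))) (at x)"
      by (simp add: dderiv_scaleR df)
    then show ?thesis by (intro has_derivative_of_real has_derivative_mult_right)
  qed
  \<comment> \<open>Every directional derivative brings out one factor \<open>r\<close> by the chain
    rule, counted by the length of the list.\<close>
  have eq: "foldr dderiv vs (\<lambda>x. complex_of_real (c * \<phi> (r *\<^sub>R (x - y)))) =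
      (\<lambda>x. of_real (c * r ^ length vs * foldr dderiv vs \<phi> (r *\<^sub>R (x - y))))" for vs
  proof (induction vs)
    case (Cons v vs)
    show ?case unfolding foldr_Cons comp_def Cons
      by (intro ext, subst dderiv_eqI[OF d]) (simp add: mult_ac)
  qed simp
  show ?thesis unfolding smooth_def eq using d by (blast intro: differentiableI)
qed

context
  fixes \<phi> :: "real ^ 'n::finite \<Rightarrow> real"
  assumes \<phi>: "smooth_cutoff \<phi>"
begin

lemma cutoff_bump_support:
  assumes "\<beta> > 0" "cutoff_bump \<phi> \<beta> y x \<noteq> 0"
  shows "x \<in> ball y \<beta>"
proof -
  have "\<phi> ((x - y) /\<^sub>R \<beta>) \<noteq> 0" using assms by (auto simp: cutoff_bump_def rescaled_def)
  then have "(x - y) /\<^sub>R \<beta> \<in> ball 0 1"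
    using \<phi> closure_subset[of "{x. \<phi> x \<noteq> 0}"] unfolding smooth_cutoff_def by blast
  then have "norm (x - y) / \<beta> < 1"
    unfolding mem_ball_0 norm_scaleR using assms(1) by (simp add: divide_inverse mult.commute)
  then show ?thesis using assms(1) by (simp add: dist_norm norm_minus_commute)
qed

lemma bump_on_cutoff:
  assumes \<beta>: "\<beta> > 0" and S: "cball y \<beta> \<subseteq> S"
  shows "bump_on S (cutoff_bump \<phi> \<beta> y)"
proof -
  have eq: "cutoff_bump \<phi> \<beta> y = (\<lambda>x. of_real (1 / \<beta> ^ CARD('n) * \<phi> (inverse \<beta> *\<^sub>R (x - y))))"
    by (simp add: cutoff_bump_def[abs_def] rescaled_def)
  have sub: "{x. cutoff_bump \<phi> \<beta> y x \<noteq> 0} \<subseteq> cball y \<beta>" using cutoff_bump_support[OF \<beta>] by fastforce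
  have "smooth (cutoff_bump \<phi> \<beta> y)" unfolding eq by (rule smooth_affine) (use \<phi> in \<open>simp add: smooth_cutoff_def\<close>)
  then show ?thesis
    using bounded_subset[OF bounded_cball sub] closure_minimal[OF sub closed_cball] S by (auto simp: bump_on_def)
qed

lemma rescaled_measurable: "\<beta> > 0 \<Longrightarrow> (\<lambda>x. complex_of_real (rescaled \<phi> \<beta> x)) \<in> borel_measurable borel"
  using test_fn_measurable[OF bump_on_test_fn[OF bump_on_cutoff[of \<beta> 0 UNIV]]] by (simp add: cutoff_bump_def[abs_def])

lemma ft_cutoff:
  assumes \<beta>: "\<beta> > 0"
  shows "ft (cutoff_bump \<phi> \<beta> y) z = fourier (rescaled \<phi> \<beta>) z * plane_wave y z"
proof -
  have [measurable]: "(\<lambda>x. complex_of_real (rescaled \<phi> \<beta> x)) \<in> borel_measurable borel" by (rule rescaled_measurable[OF \<beta>])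
  have m: "(\<lambda>x. plane_wave x z * cutoff_bump \<phi> \<beta> y x) \<in> borel_measurable borel"
    using test_fn_measurable[OF bump_on_test_fn[OF bump_on_cutoff[OF \<beta> subset_UNIV, of y]]] by measurable
  have "ft (cutoff_bump \<phi> \<beta> y) z = (\<integral>x. plane_wave (x + y) z * cutoff_bump \<phi> \<beta> y (x + y) \<partial>lborel)"
    unfolding ft_def by (rule integral_lborel_translation[OF m, symmetric])
  also have "\<dots> = (\<integral>x. plane_wave y z * (plane_wave x z * of_real (rescaled \<phi> \<beta> x)) \<partial>lborel)"
    by (intro Bochner_Integration.integral_cong refl) (simp add: cutoff_bump_def plane_wave_add mult_ac)
  also have "\<dots> = plane_wave y z * fourier (rescaled \<phi> \<beta>) z"
    by (simp add: fourier_def plane_wave_def)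
  finally show ?thesis by simp
qed

lemma integral_cutoff:
  assumes \<beta>: "\<beta> > 0"
  shows "(\<integral>x. cutoff_bump \<phi> \<beta> y x \<partial>lborel) = 1"
proof -
  have m1: "cutoff_bump \<phi> 1 0 \<in> borel_measurable borel"
    using test_fn_measurable[OF bump_on_test_fn[OF bump_on_cutoff[OF zero_less_one subset_UNIV, of 0]]] .
  have "(\<integral>x. cutoff_bump \<phi> 1 0 x \<partial>lborel) = complex_of_real (\<integral>x. \<phi> x \<partial>lborel)"
    by (simp add: cutoff_bump_def rescaled_def)
  then have 1: "(\<integral>x. cutoff_bump \<phi> 1 0 x \<partial>lborel) = 1" using \<phi> by (simp add: smooth_cutoff_def)
  have "(\<integral>x. cutoff_bump \<phi> \<beta> y x \<partial>lborel) = (\<integral>x. cutoff_bump \<phi> \<beta> y (x + y) \<partial>lborel)"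
    by (rule integral_lborel_translation[symmetric])
       (rule test_fn_measurable[OF bump_on_test_fn[OF bump_on_cutoff[OF \<beta> subset_UNIV]]])
  also have "\<dots> = (\<integral>x. cutoff_bump \<phi> 1 0 (inverse \<beta> *\<^sub>R x) / of_real (\<beta> ^ CARD('n)) \<partial>lborel)"
    by (simp add: cutoff_bump_def rescaled_def)
  also have "\<dots> = (\<integral>x. cutoff_bump \<phi> 1 0 (inverse \<beta> *\<^sub>R x) \<partial>lborel) / of_real (\<beta> ^ CARD('n))"
    by (rule integral_divide_zero)
  also have "\<dots> = 1"
    using integral_lborel_scale[of "inverse \<beta>" "cutoff_bump \<phi> 1 0", OF _ m1] \<beta> 1
    by (simp add: power_inverse divide_inverse mult.commute)
  finally show ?thesis .
qed

text \<open>The bumps are nonnegative with integral 1 and shrink to \<open>y\<close>, so the pairing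
  with a function continuous near \<open>y\<close> is an average of values close to
  \<open>G y\<close>.\<close>

lemma cutoff_limit:
  fixes G :: "real ^ 'n \<Rightarrow> complex"
  assumes S: "open S" "y \<in> S" and G: "continuous_on S G"
  shows "((\<lambda>\<beta>. \<integral>x. cutoff_bump \<phi> \<beta> y x * G x \<partial>lborel) \<longlongrightarrow> G y) (at_right 0)"
proof (rule tendstoI)
  fix e :: real assume e: "e > 0"
  have "continuous (at y) G" using G S continuous_on_eq_continuous_at by blast
  then obtain \<delta>1 where \<delta>1: "\<delta>1 > 0" "\<And>x. dist x y < \<delta>1 \<Longrightarrow> dist (G x) (G y) < e / 2"
    unfolding continuous_at_eps_delta using e by (metis half_gt_zero)
  obtain \<delta>2 where \<delta>2: "\<delta>2 > 0" "cball y \<delta>2 \<subseteq> S" using S open_contains_cball by blast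
  have "dist (\<integral>x. cutoff_bump \<phi> \<beta> y x * G x \<partial>lborel) (G y) < e" if \<beta>: "0 < \<beta>" "\<beta> < min \<delta>1 \<delta>2" for \<beta>
  proof -
    define \<psi> where "\<psi> = cutoff_bump \<phi> \<beta> y"
    have b: "bump_on S \<psi>" unfolding \<psi>_def by (rule bump_on_cutoff[OF \<beta>(1)]) (use \<beta> \<delta>2(2) in auto)
    have i: "integrable lborel \<psi>" by (intro test_fn_integrable bump_on_test_fn[OF b])
    have iG: "integrable lborel (\<lambda>x. \<psi> x * G x)" by (intro test_fn_integrable test_fn_bump_mult[OF b S(1) G])
    have ic: "integrable lborel (\<lambda>x. \<psi> x * G y)" by (intro integrable_mult_left i)
    have eq: "(\<integral>x. \<psi> x * G x \<partial>lborel) - G y = (\<integral>x. \<psi> x * G x - \<psi> x * G y \<partial>lborel)"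
      unfolding Bochner_Integration.integral_diff[OF iG ic] by (simp add: integral_cutoff[OF \<beta>(1), of y, folded \<psi>_def])
    \<comment> \<open>Nonnegativity of the cutoff turns its integral into its L1 norm, which is
      therefore 1.\<close>
    have n: "complex_of_real (norm (\<psi> x)) = \<psi> x" for x
      using \<phi> \<beta> by (simp add: \<psi>_def cutoff_bump_def rescaled_def smooth_cutoff_def norm_divide norm_power)
    have "complex_of_real (\<integral>x. norm (\<psi> x) \<partial>lborel) = 1"
      using integral_cutoff[OF \<beta>(1), of y] by (simp only: integral_complex_of_real[symmetric] n) (simp add: \<psi>_def)
    then have n1: "(\<integral>x. norm (\<psi> x) \<partial>lborel) = 1" by simp
    have "norm (\<integral>x. \<psi> x * G x - \<psi> x * G y \<partial>lborel) \<le> (\<integral>x. norm (\<psi> x * G x - \<psi> x * G y) \<partial>lborel)" by (rule integral_norm_bound)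
    also have "\<dots> \<le> (\<integral>x. (e / 2) * norm (\<psi> x) \<partial>lborel)"
    proof (intro integral_mono integrable_norm Bochner_Integration.integrable_diff iG ic integrable_mult_right i)
      fix x
      show "norm (\<psi> x * G x - \<psi> x * G y) \<le> e / 2 * norm (\<psi> x)"
      proof (cases "\<psi> x = 0")
        case False
        then have "dist x y < \<delta>1" using cutoff_bump_support[OF \<beta>(1), of y x] \<beta> by (simp add: \<psi>_def dist_commute)
        then have "norm (G x - G y) \<le> e / 2" using \<delta>1(2) by (simp add: dist_norm less_imp_le)
        from mult_left_mono[OF this norm_ge_zero[of "\<psi> x"]] show ?thesis
          by (simp add: norm_mult[symmetric] right_diff_distrib mult.commute)
      qed simp
    qed
    also have "\<dots> = e / 2" by (simp add: n1)
    finally show ?thesis using e unfolding dist_norm eq[unfolded \<psi>_def] \<psi>_def by simp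
  qed
  then show "\<forall>\<^sub>F \<beta> in at_right 0. dist (\<integral>x. cutoff_bump \<phi> \<beta> y x * G x \<partial>lborel) (G y) < e"
    unfolding eventually_at_right_field using \<delta>1(1) \<delta>2(1) by (intro exI[of _ "min \<delta>1 \<delta>2"]) auto
qed

text \<open>A derivative of the bump becomes multiplication of its transform by 2 pi i z, so the
  monomial is matched after dividing by (2 pi i)^m. The reversed coordinate order is the one in
  which integration by parts delivers \<open>mderiv\<close>.\<close>

lemma ft_nabla:
  assumes \<beta>: "\<beta> > 0" and \<alpha>: "mdeg \<alpha> = m"
  shows "fourier (rescaled \<phi> \<beta>) z * nabla_coeff m \<alpha> z =
    ft (\<lambda>x. fact m / (of_nat (mfact \<alpha>) * (2 * of_real pi * \<i>) ^ m) * multi_dderiv \<alpha> (rev coords) (cutoff_bump \<phi> \<beta> 0) x) z"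
proof -
  have s: "sum_list (map (lk \<alpha>) (rev coords)) = m" unfolding \<alpha>[symmetric] sum_list_coords[symmetric] rev_map[symmetric] sum_list_rev ..
  have p: "(\<Prod>i\<leftarrow>rev coords. (z $ i) ^ lk \<alpha> i) = mpow z \<alpha>"
    using prod.distinct_set_conv_list[of "rev coords" "\<lambda>i. (z $ i) ^ lk \<alpha> i"] by (simp add: mpow_def coords)
  have c: "ft (\<lambda>x. c * f x) z = c * ft f z" for c f by (simp add: ft_def mult.left_commute)
  show ?thesis
    unfolding c ft_multi_dderiv[OF bump_on_cutoff[OF \<beta> subset_UNIV]] s p ft_cutoff[OF \<beta>]
    using \<alpha> by (simp add: nabla_coeff_eq plane_wave_def)
qed

lemma hsem_representation:
  fixes M :: "real ^ 'n ^ 'n" and \<nu> :: complex and U :: "(real ^ 'n) set"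
  assumes M: "invertible M" and U: "open U" "bounded U" "0 \<in> U"
  defines "c \<equiv> - 1 / (2 * of_real pi * \<i>)"
  shows "\<exists>F. real_analytic_on F (regular_set M) \<and>
     (\<forall>y\<in>regular_set M. (HSI_cutoff \<phi> M U \<nu> (plane_wave y) \<longlongrightarrow> F y) (at_right 0)) \<and>
     (\<forall>\<alpha>. odd (mdeg \<alpha>) \<longrightarrow> taylor_op F c \<alpha> = 0) \<and>
     (\<forall>k \<alpha>. (HSI_cutoff \<phi> M U \<nu> (nabla_coeff (2 * k) \<alpha>) \<longlongrightarrow>
        (if mdeg \<alpha> = 2 * k then fact (2 * k) * taylor_op F c \<alpha> else 0)) (at_right 0))"
proof -
  obtain F where F: "real_analytic_on F (regular_set M)" "\<And>x. x \<in> regular_set M \<Longrightarrow> F (- x) = F x"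
    and H: "\<And>\<psi>. bump_on (regular_set M) \<psi> \<Longrightarrow> HSI M U \<nu> (ft \<psi>) = (\<integral>x. \<psi> x * F x \<partial>lborel)"
    using HSI_density[OF M U, of \<nu>] by blast
  note S = open_regular_set[OF M]
  have 0: "0 \<in> regular_set M" by (simp add: regular_set_def)
  \<comment> \<open>Only small widths are admissible: the support must avoid the nonzero dual
    lattice points.\<close>
  have ev: "\<forall>\<^sub>F \<beta> in at_right 0. \<beta> > 0 \<and> bump_on (regular_set M) (cutoff_bump \<phi> \<beta> y)" if "y \<in> regular_set M" for y
  proof -
    obtain \<delta> where \<delta>: "\<delta> > 0" "cball y \<delta> \<subseteq> regular_set M" using S \<open>y \<in> regular_set M\<close> open_contains_cball by blast
    have "bump_on (regular_set M) (cutoff_bump \<phi> \<beta> y)" if "0 < \<beta>" "\<beta> < \<delta>" for \<beta>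
      by (rule bump_on_cutoff) (use that \<delta>(2) in auto)
    then show ?thesis unfolding eventually_at_right_field using \<delta>(1) by (intro exI[of _ \<delta>]) auto
  qed
  have pw: "(HSI_cutoff \<phi> M U \<nu> (plane_wave y) \<longlongrightarrow> F y) (at_right 0)" if y: "y \<in> regular_set M" for y
  proof (rule Lim_transform_eventually[OF cutoff_limit[OF S y real_analytic_on_continuous_on[OF F(1)]]])
    show "\<forall>\<^sub>F \<beta> in at_right 0. (\<integral>x. cutoff_bump \<phi> \<beta> y x * F x \<partial>lborel) = HSI_cutoff \<phi> M U \<nu> (plane_wave y) \<beta>"
      using ev[OF y]
    proof eventually_elim
      case (elim \<beta>)
      then have "ft (cutoff_bump \<phi> \<beta> y) = (\<lambda>z. fourier (rescaled \<phi> \<beta>) z * plane_wave y z)" by (auto simp: ft_cutoff)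
      then show ?case using H[of "cutoff_bump \<phi> \<beta> y"] elim unfolding HSI_cutoff_def by simp
    qed
  qed
  have nc: "(HSI_cutoff \<phi> M U \<nu> (nabla_coeff (2 * k) \<alpha>) \<longlongrightarrow>
        (if mdeg \<alpha> = 2 * k then fact (2 * k) * taylor_op F c \<alpha> else 0)) (at_right 0)" for k \<alpha>
  proof (cases "mdeg \<alpha> = 2 * k")
    case True
    let ?b = "fact (2 * k) / (of_nat (mfact \<alpha>) * (2 * of_real pi * \<i>) ^ (2 * k)) :: complex"
    have "((\<lambda>\<beta>. ?b * (\<integral>x. cutoff_bump \<phi> \<beta> 0 x * mderiv \<alpha> F x \<partial>lborel)) \<longlongrightarrow> ?b * mderiv \<alpha> F 0) (at_right 0)"
      unfolding mderiv_eq
      by (intro tendsto_mult_left cutoff_limit[OF S 0] real_analytic_on_continuous_on real_analytic_on_multi_dderiv F)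
    \<comment> \<open>Each derivative contributes 1 / (2 pi i) from the transform and -1 from
      integration by parts, together the factor \<open>c\<close>; in even order the signs
      cancel.\<close>
    also have "?b * mderiv \<alpha> F 0 = fact (2 * k) * taylor_op F c \<alpha>"
      by (simp add: taylor_op_def True c_def power_divide power_mult)
    finally have "(HSI_cutoff \<phi> M U \<nu> (nabla_coeff (2 * k) \<alpha>) \<longlongrightarrow> fact (2 * k) * taylor_op F c \<alpha>) (at_right 0)"
    proof (rule Lim_transform_eventually)
      show "\<forall>\<^sub>F \<beta> in at_right 0. ?b * (\<integral>x. cutoff_bump \<phi> \<beta> 0 x * mderiv \<alpha> F x \<partial>lborel) = HSI_cutoff \<phi> M U \<nu> (nabla_coeff (2 * k) \<alpha>) \<beta>"
        using ev[OF 0]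
      proof eventually_elim
        case (elim \<beta>)
        then have b: "bump_on (regular_set M) (cutoff_bump \<phi> \<beta> 0)" and \<beta>: "\<beta> > 0" by auto
        have "HSI_cutoff \<phi> M U \<nu> (nabla_coeff (2 * k) \<alpha>) \<beta> = (\<integral>x. ?b * multi_dderiv \<alpha> (rev coords) (cutoff_bump \<phi> \<beta> 0) x * F x \<partial>lborel)"
          unfolding HSI_cutoff_def ft_nabla[OF \<beta> True]
          by (rule H[OF bump_on_cmult[OF bump_on_multi_dderiv[OF b]]])
        also have "\<dots> = ?b * (\<integral>x. multi_dderiv \<alpha> (rev coords) (cutoff_bump \<phi> \<beta> 0) x * F x \<partial>lborel)"
          by (simp only: mult.assoc integral_mult_right_zero)
        also have "\<dots> = ?b * (\<integral>x. cutoff_bump \<phi> \<beta> 0 x * mderiv \<alpha> F x \<partial>lborel)"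
          unfolding integration_by_parts_multi[OF S b F(1)] sum_list_coords True mderiv_eq by simp
        finally show ?case by simp
      qed
    qed
    then show ?thesis using True by simp
  next
    case False
    \<comment> \<open>If the degree of \<alpha> is not 2k, the coefficient function is 0; that its
      sum-integral is 0 follows by testing the density against the zero bump.\<close>
    have z: "ft (\<lambda>_. 0) = (\<lambda>_. 0)" by (simp add: ft_def[abs_def])
    have "bump_on (regular_set M) (\<lambda>_. 0)" by (simp add: bump_on_def smooth_zero)
    from H[OF this] have "HSI M U \<nu> (\<lambda>_. 0) = 0" by (simp add: z)
    then have "HSI_cutoff \<phi> M U \<nu> (nabla_coeff (2 * k) \<alpha>) = (\<lambda>_. 0)"
      using False by (simp add: HSI_cutoff_def[abs_def] nabla_coeff_eq)
    then show ?thesis using False by simp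
  qed
  have odd: "taylor_op F c \<alpha> = 0" if "odd (mdeg \<alpha>)" for \<alpha>
    using mderiv_odd_zero[OF S regular_set_minus 0 F(1,2) that] by (simp add: taylor_op_def)
  show ?thesis using F(1) pw nc odd by blast
qed

end

text \<open>\<open>Lim\<close> has a value even where no limit exists, so the first two conjuncts
  assert separately that the limits behind \<open>zeta0\<close> and \<open>hsem_term\<close> exist.
  The arbitrary neighbourhood \<open>U\<close> expresses all choices of the regularisation.
  Operators are compared coefficient by coefficient.\<close>

theorem theorem5p5:
  fixes M :: "real ^ 'n ^ 'n" and \<nu> :: complex
    and \<phi> :: "real ^ 'n \<Rightarrow> real" and U :: "(real ^ 'n) set"
  assumes "invertible M"
    and "smooth_cutoff \<phi>"
    and "open U" and "bounded U" and "0 \<in> U"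
  shows
    "(\<forall>y. y \<notin> dual_lattice_of M \<longrightarrow>
        (HSI_cutoff \<phi> M U \<nu> (plane_wave y) \<longlongrightarrow> zeta0 \<phi> M U \<nu> y) (at_right 0)) \<and>
     (\<forall>k \<alpha>. \<exists>c. (HSI_cutoff \<phi> M U \<nu> (nabla_coeff (2 * k) \<alpha>) \<longlongrightarrow> c) (at_right 0)) \<and>
     (\<exists>F. real_analytic_on F (- dual_lattice_of M \<union> {0}) \<and>
        (\<forall>y. y \<notin> dual_lattice_of M \<longrightarrow> F y = zeta0 \<phi> M U \<nu> y) \<and>
        hsem_inf \<phi> M U \<nu> = taylor_op F (- 1 / (2 * of_real pi * \<i>)) \<and>
        (\<forall>l. hsem \<phi> M U \<nu> l =
           truncate_op (2 * l) (taylor_op F (- 1 / (2 * of_real pi * \<i>)))))"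
proof -
  define c where "c = - 1 / (2 * complex_of_real pi * \<i>)"
  obtain F where F: "real_analytic_on F (regular_set M)"
    and pw: "\<And>y. y \<in> regular_set M \<Longrightarrow> (HSI_cutoff \<phi> M U \<nu> (plane_wave y) \<longlongrightarrow> F y) (at_right 0)"
    and odd: "\<And>\<alpha>. odd (mdeg \<alpha>) \<Longrightarrow> taylor_op F c \<alpha> = 0"
    and nc: "\<And>k \<alpha>. (HSI_cutoff \<phi> M U \<nu> (nabla_coeff (2 * k) \<alpha>) \<longlongrightarrow>
        (if mdeg \<alpha> = 2 * k then fact (2 * k) * taylor_op F c \<alpha> else 0)) (at_right 0)"
    using hsem_representation[OF assms(2,1,3,4,5), of \<nu>, folded c_def] by blast
  have reg: "y \<in> regular_set M" if "y \<notin> dual_lattice_of M" for y using that by (simp add: regular_set_def)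
  have z: "zeta0 \<phi> M U \<nu> y = F y" if "y \<notin> dual_lattice_of M" for y
    unfolding zeta0_def by (rule tendsto_Lim[OF _ pw[OF reg[OF that]]]) simp
  have t: "hsem_term \<phi> M U \<nu> k \<alpha> = (if mdeg \<alpha> = 2 * k then taylor_op F c \<alpha> else 0)" for k \<alpha>
    unfolding hsem_term_def by (subst tendsto_Lim[OF _ nc]) auto
  \<comment> \<open>An \<alpha> of even degree is served by a single k; one of odd degree by none,
    which agrees with the vanishing of the odd Taylor coefficients of an even function.\<close>
  have inf: "hsem_inf \<phi> M U \<nu> \<alpha> = taylor_op F c \<alpha>" for \<alpha>
  proof -
    have "(\<lambda>k. hsem_term \<phi> M U \<nu> k \<alpha>) sums taylor_op F c \<alpha>"
    proof (cases "even (mdeg \<alpha>)")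
      case True
      then obtain k0 where k0: "mdeg \<alpha> = 2 * k0" by (auto elim: evenE)
      have "(\<lambda>k. hsem_term \<phi> M U \<nu> k \<alpha>) = (\<lambda>k. if k = k0 then taylor_op F c \<alpha> else 0)"
        by (auto simp: t k0 fun_eq_iff)
      then show ?thesis using sums_single[of k0 "\<lambda>_. taylor_op F c \<alpha>"] by simp
    next
      case False
      then have "(\<lambda>k. hsem_term \<phi> M U \<nu> k \<alpha>) = (\<lambda>_. 0)" by (auto simp: t fun_eq_iff)
      then show ?thesis using odd[OF False] by simp
    qed
    then show ?thesis unfolding hsem_inf_def by (rule sums_unique[symmetric])
  qed
  have fin: "hsem \<phi> M U \<nu> l \<alpha> = truncate_op (2 * l) (taylor_op F c) \<alpha>" for l \<alpha>
  proof (cases "even (mdeg \<alpha>)")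
    case True
    then obtain k0 where k0: "mdeg \<alpha> = 2 * k0" by (auto elim: evenE)
    have "hsem \<phi> M U \<nu> l \<alpha> = (\<Sum>k\<le>l. if k = k0 then taylor_op F c \<alpha> else 0)"
      unfolding hsem_def t k0 by (intro sum.cong) auto
    then show ?thesis by (simp add: truncate_op_def k0)
  next
    case False
    then have "hsem \<phi> M U \<nu> l \<alpha> = 0" unfolding hsem_def by (intro sum.neutral) (auto simp: t)
    then show ?thesis using odd[OF False] by (simp add: truncate_op_def)
  qed
  show ?thesis
  proof (intro conjI allI impI exI[of _ F])
    show "(HSI_cutoff \<phi> M U \<nu> (plane_wave y) \<longlongrightarrow> zeta0 \<phi> M U \<nu> y) (at_right 0)" if "y \<notin> dual_lattice_of M" for y
      unfolding z[OF that] by (rule pw[OF reg[OF that]])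
    show "\<exists>c. (HSI_cutoff \<phi> M U \<nu> (nabla_coeff (2 * k) \<alpha>) \<longlongrightarrow> c) (at_right 0)" for k \<alpha> using nc by blast
    show "real_analytic_on F (- dual_lattice_of M \<union> {0})" using F by (simp add: regular_set_def)
    show "F y = zeta0 \<phi> M U \<nu> y" if "y \<notin> dual_lattice_of M" for y using z[OF that] by simp
    show "hsem_inf \<phi> M U \<nu> = taylor_op F (- 1 / (2 * of_real pi * \<i>))" using inf unfolding c_def by (intro ext)
    show "hsem \<phi> M U \<nu> l = truncate_op (2 * l) (taylor_op F (- 1 / (2 * of_real pi * \<i>)))" for l
      using fin unfolding c_def by (intro ext)
  qed
qed

end
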